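(* Let $K_\rho,H_\rho\in\mathbb{R}_{>0}$. There exists a constant $C\in[1,\infty)$ such that, for every $\rho\in\Theta_{K_\rho,H_\rho}$, every $y_0\in\mathbb{R}$ and every time grid $\pi$ of $[0,T]$ with mesh $|\pi|\le (C(1+K_\rho^4))^{-1}$, writing $\eta=(y_0,\rho)$, it holds that $$\mathcal{E}_{\eta,\pi}\le C\Bigl(\mathrm{e}^{CK_\rho^4}\,\mathbb{E}\bigl[|Y^{\eta,\pi}_T-g(X^{\eta,\pi}_T)|^2\bigr]+\mathrm{e}^{C(K_\rho^2+H_\rho^2)}\bigl(|\pi|+|\pi|^\alpha\bigr)\Bigr).$$
   Context: **Setting.** $|\cdot|$ is the Euclidean norm for row and column vectors and the Frobenius norm for matrices; $(\mathbb{R}^d)^*$ denotes row vectors of length $d$. Fix $T>0$, $d\in\mathbb{N}$, $x_0\in\mathbb{R}^d$, and a complete filtered probability space carrying a $d$-dimensional standard Brownian motion $W$, where $(\mathcal{F}_t)_{t\ge0}$ is the natural filtration of $W$ augmented with all null sets. Let $b\colon[0,T]\times\mathbb{R}^d\times\mathbb{R}\times(\mathbb{R}^d)^*\to\mathbb{R}^d$, $\sigma\colon[0,T]\times\mathbb{R}^d\times\mathbb{R}\to\mathbb{R}^{d\times d}$, $F\colon[0,T]\times\mathbb{R}^d\times\mathbb{R}\times(\mathbb{R}^d)^*\to\mathbb{R}$, $g\colon\mathbb{R}^d\to\mathbb{R}$ be deterministic functions. Consider the FBSDE $$X_t=x_0+\int_0^tb(s,X_s,Y_s,Z_s)\,\mathrm{d}s+\int_0^t\sigma(s,X_s,Y_s)\,\mathrm{d}W_s,\qquad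 Y_t=g(X_T)-\int_t^TF(s,X_s,Y_s,Z_s)\,\mathrm{d}s-\int_t^TZ_s\,\mathrm{d}W_s .$$ A solution is a triple $(X,Y,Z)$ of progressively measurable processes with values in $\mathbb{R}^d\times\mathbb{R}\times(\mathbb{R}^d)^*$ such that $X,Y$ are continuous, $\mathbb{E}[\sup_{t\in[0,T]}|X_t|^2]$, $\mathbb{E}[\sup_{t\in[0,T]}|Y_t|^2]$, $\int_0^T\mathbb{E}[|Z_t|^2]\,\mathrm{d}t<\infty$, and the equations hold a.s. for each $t\in[0,T]$. **Standing assumption on the coefficients.** (i) $\sigma(t,x,y)$ is invertible for all $(t,x,y)$; write $\sigma^{-1}(t,x,y)=\sigma(t,x,y)^{-1}$, $(\sigma\sigma^\top)(t,x,y)=\sigma(t,x,y)\sigma(t,x,y)^\top$. (ii) There are constants $H_b,H_\sigma,H_{\sigma^{-1}},H_{\sigma\sigma^\top},H_F,H_g>0$ such that for all arguments: $|\phi(t,x,y,z)-\phi(t',x',y',z')|\le H_\phi(|t-t'|^{1/2}+|x-x'|+|y-y'|+|z-z'|)$ for $\phi\in\{b,F\}$; $|\phi(t,x,y)-\phi(t',x',y')|\le H_\phi(|t-t'|^{1/2}+|x-x'|+|y-y'|)$ for $\phi\in\{\sigma,\sigma^{-1},\sigma\sigma^\top\}$; $|g(x)-g(x')|\le H_g|x-x'|$. (iii) $b,\sigma,\sigma^{-1},\sigma\sigma^\top$ are bounded by constants $K_b,K_\sigma,K_{\sigma^{-1}},K_{\sigma\sigma^\top}>0$. **Standing assumption on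 the PDE.** (a) The quasi-linear parabolic PDE $$u_t(t,x)=F(t,x,u(t,x),v(t,x))-\tfrac12\mathrm{tr}\bigl[u_{xx}(t,x)(\sigma\sigma^\top)(t,x,u(t,x))\bigr]-u_x(t,x)b(t,x,u(t,x),v(t,x)),\quad u(T,x)=g(x),$$ on $[0,T]\times\mathbb{R}^d$, with $v(t,x):=u_x(t,x)\sigma(t,x,u(t,x))$, admits a classical solution $u\colon[0,T]\times\mathbb{R}^d\to\mathbb{R}$ whose gradient $u_x$ (a row vector) and Hessian $u_{xx}$ are bounded by constants $K_{u_x},K_{u_{xx}}>0$. (b) There are $H_u,H_{u_x},H_{u_{xx}}>0$ and $\alpha\in(0,1]$ with $|u(t,x)-u(t',x')|\le H_u(|t-t'|^{1/2}+|x-x'|)$, $|u_x(t,x)-u_x(t',x')|\le H_{u_x}(|t-t'|^{1/2}+|x-x'|)$, $|u_{xx}(t,x)-u_{xx}(t',x')|\le H_{u_{xx}}(|t-t'|^{\alpha/2}+|x-x'|^\alpha)$ for all $(t,x),(t',x')$. This $\alpha$ is the one in the claim. Under these assumptions the FBSDE has a unique solution $(X,Y,Z)$, and $Y_t=u(t,X_t)$, $Z_t=v(t,X_t)$. **Scheme.** A time grid is $\pi=\{t_0,\dots,t_N\}$ with $0=t_0<\dots<t_N=T$; $\Delta_i=t_{i+1}-t_i$, $\Delta W_i=W_{t_{i+1}}-W_{t_i}$, $|\pi|=\max_i\Delta_i$; $\Pi(t)=t_i$ for $t\in[t_i,t_{i+1})$, $\Pi(T)=T$. For $\eta=(y_0,\rho)$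 with $y_0\in\mathbb{R}$ and $\rho\colon[0,T]\times\mathbb{R}^d\to(\mathbb{R}^d)^*$ define $X^{\eta,\pi}_{t_0}=x_0$, $Y^{\eta,\pi}_{t_0}=y_0$, $Z^{\eta,\pi}_{t_i}=\rho(t_i,X^{\eta,\pi}_{t_i})$ for $i=0,\dots,N$, and for $i=0,\dots,N-1$ $$X^{\eta,\pi}_{t_{i+1}}=X^{\eta,\pi}_{t_i}+b(t_i,X^{\eta,\pi}_{t_i},Y^{\eta,\pi}_{t_i},Z^{\eta,\pi}_{t_i})\Delta_i+\sigma(t_i,X^{\eta,\pi}_{t_i},Y^{\eta,\pi}_{t_i})\Delta W_i,$$ $$Y^{\eta,\pi}_{t_{i+1}}=Y^{\eta,\pi}_{t_i}+F(t_i,X^{\eta,\pi}_{t_i},Y^{\eta,\pi}_{t_i},Z^{\eta,\pi}_{t_i})\Delta_i+Z^{\eta,\pi}_{t_i}\Delta W_i,$$ extended to $t\in[0,T]\setminus\pi$ by $X^{\eta,\pi}_t=X^{\eta,\pi}_{\Pi(t)}$, $Y^{\eta,\pi}_t=Y^{\eta,\pi}_{\Pi(t)}$, $Z^{\eta,\pi}_t=Z^{\eta,\pi}_{\Pi(t)}$. **Function class.** $\Theta_{K_\rho,H_\rho}$ is the set of all $\rho\colon[0,T]\times\mathbb{R}^d\to(\mathbb{R}^d)^*$ bounded by $K_\rho$ with $|\rho(t,x)-\rho(t',x')|\le H_\rho(|t-t'|^{1/2}+|x-x'|)$ for all $(t,x),(t',x')$. **Error.** $$\mathcal{E}_{\eta,\pi}:=\sup_{t\in[0,T]}\mathbb{E}\bigl[|X_t-X^{\eta,\pi}_t|^2\bigr]+\max_{t_i\in\pi}\mathbb{E}\bigl[|Y_{t_i}-Y^{\eta,\pi}_{t_i}|^2\bigr]+\mathbb{E}\Bigl[\int_0^T|Y_t-Y^{\eta,\pi}_t|^2+|Z_t-Z^{\eta,\pi}_t|^2\,\mathrm{d}t\Bigr].$$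 *)

theory Defs
  imports "HOL-Probability.Probability"
begin

text \<open>
  Column vectors and row vectors are both elements of \<open>real ^ 'd\<close>. For a row vector \<open>z\<close>, a column
  vector \<open>w\<close> and a matrix \<open>A\<close>, the scalar \<open>z w\<close> is \<open>z \<bullet> w\<close> and the row vector \<open>z A\<close> is \<open>z v* A\<close>.
  The library norm on \<open>real ^ 'd ^ 'd\<close> is the Frobenius norm.
  Functions and processes on \<open>[0,T]\<close> are total in time; only their values on \<open>{0..T}\<close> are used.
  Expectations of nonnegative quantities are taken in \<open>ennreal\<close>, so that they are never junk values.
\<close>

subsection \<open>Brownian motion and its filtration\<close>

definition brownian_motion :: "'a measure \<Rightarrow> (real \<Rightarrow> 'a \<Rightarrow> real ^ 'd) \<Rightarrow> bool" where
  "brownian_motion M W \<longleftrightarrow>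
     (\<forall>t\<ge>0. W t \<in> borel_measurable M) \<and>
     (AE \<omega> in M. W 0 \<omega> = 0 \<and> continuous_on {0..} (\<lambda>t. W t \<omega>)) \<and>
     (\<forall>s t. 0 \<le> s \<and> s < t \<longrightarrow>
        distributed M lborel (\<lambda>\<omega>. W t \<omega> - W s \<omega>)
          (\<lambda>x. ennreal (\<Prod>i\<in>UNIV. normal_density 0 (sqrt (t - s)) (x $ i)))) \<and>
     (\<forall>(n::nat) r. 0 \<le> r 0 \<and> (\<forall>i<n. r i < r (Suc i)) \<longrightarrow>
        prob_space.indep_vars M (\<lambda>_. borel) (\<lambda>i \<omega>. W (r (Suc i)) \<omega> - W (r i) \<omega>) {..<n})"

definition aug_filtration :: "'a measure \<Rightarrow> (real \<Rightarrow> 'a \<Rightarrow> real ^ 'd) \<Rightarrow> real \<Rightarrow> 'a measure" where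
  "aug_filtration M W t =
     sigma (space M)
       ({W s -` B \<inter> space M | s B. s \<in> {0..t} \<and> B \<in> sets borel} \<union> null_sets M)"

definition progressively_measurable ::
  "(real \<Rightarrow> 'a measure) \<Rightarrow> real \<Rightarrow> (real \<Rightarrow> 'a \<Rightarrow> 'b::topological_space) \<Rightarrow> bool" where
  "progressively_measurable \<F> T H \<longleftrightarrow>
     (\<forall>t\<in>{0..T}. (\<lambda>(s, \<omega>). H s \<omega>) \<in> borel_measurable (restrict_space borel {0..t} \<Otimes>\<^sub>M \<F> t))"

subsection \<open>Ito integral\<close>

text \<open>
  A simple integrand on \<open>[a,b]\<close> is \<open>\<Sum>i<n. \<xi> i\<close> on \<open>(r i, r (i+1)]\<close> with each \<open>\<xi> i\<close> bounded and
  measurable at time \<open>r i\<close>.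
\<close>

definition simple_integrand ::
  "'a measure \<Rightarrow> (real \<Rightarrow> 'a \<Rightarrow> real ^ 'd) \<Rightarrow> real \<Rightarrow> real
   \<Rightarrow> nat \<Rightarrow> (nat \<Rightarrow> real) \<Rightarrow> (nat \<Rightarrow> 'a \<Rightarrow> real ^ 'd) \<Rightarrow> bool" where
  "simple_integrand M W a b n r \<xi> \<longleftrightarrow>
     (\<forall>i\<le>n. r i \<in> {a..b}) \<and> (\<forall>i<n. r i < r (Suc i)) \<and>
     (\<forall>i<n. \<xi> i \<in> borel_measurable (aug_filtration M W (r i)) \<and>
        (\<exists>K. \<forall>\<omega>\<in>space M. norm (\<xi> i \<omega>) \<le> K))"

definition simple_process ::
  "nat \<Rightarrow> (nat \<Rightarrow> real) \<Rightarrow> (nat \<Rightarrow> 'a \<Rightarrow> real ^ 'd) \<Rightarrow> real \<Rightarrow> 'a \<Rightarrow> real ^ 'd" where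
  "simple_process n r \<xi> s \<omega> = (\<Sum>i<n. indicator {r i<..r (Suc i)} s *\<^sub>R \<xi> i \<omega>)"

definition simple_ito_integral ::
  "(real \<Rightarrow> 'a \<Rightarrow> real ^ 'd) \<Rightarrow> nat \<Rightarrow> (nat \<Rightarrow> real) \<Rightarrow> (nat \<Rightarrow> 'a \<Rightarrow> real ^ 'd) \<Rightarrow> 'a \<Rightarrow> real" where
  "simple_ito_integral W n r \<xi> \<omega> = (\<Sum>i<n. \<xi> i \<omega> \<bullet> (W (r (Suc i)) \<omega> - W (r i) \<omega>))"

text \<open>
  \<open>has_ito_integral M W a b H I\<close>: the random variable \<open>I\<close> is a version of \<open>\<integral>\<^sub>a\<^sup>b H dW\<close> for a
  row-vector valued integrand \<open>H\<close>, that is, the \<open>L\<^sup>2\<close> limit of the integrals of simple integrands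
  converging to \<open>H\<close> in \<open>L\<^sup>2([a,b] \<times> \<Omega>)\<close>. Such an \<open>I\<close> is determined only up to null sets.
\<close>

definition has_ito_integral ::
  "'a measure \<Rightarrow> (real \<Rightarrow> 'a \<Rightarrow> real ^ 'd) \<Rightarrow> real \<Rightarrow> real
   \<Rightarrow> (real \<Rightarrow> 'a \<Rightarrow> real ^ 'd) \<Rightarrow> ('a \<Rightarrow> real) \<Rightarrow> bool" where
  "has_ito_integral M W a b H I \<longleftrightarrow>
     I \<in> borel_measurable M \<and>
     (\<exists>n r \<xi>.
        (\<forall>k::nat. simple_integrand M W a b (n k) (r k) (\<xi> k)) \<and>
        (\<lambda>k. \<integral>\<^sup>+\<omega>. (\<integral>\<^sup>+s\<in>{a..b}.
            ennreal ((norm (H s \<omega> - simple_process (n k) (r k) (\<xi> k) s \<omega>))\<^sup>2) \<partial>lborel) \<partial>M)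
          \<longlonglongrightarrow> 0 \<and>
        (\<lambda>k. \<integral>\<^sup>+\<omega>. ennreal ((I \<omega> - simple_ito_integral W (n k) (r k) (\<xi> k) \<omega>)\<^sup>2) \<partial>M)
          \<longlonglongrightarrow> 0)"

text \<open>For a matrix-valued integrand, component \<open>i\<close> of the integral is that of the row \<open>H $ i\<close>.\<close>

definition has_matrix_ito_integral ::
  "'a measure \<Rightarrow> (real \<Rightarrow> 'a \<Rightarrow> real ^ 'd) \<Rightarrow> real \<Rightarrow> real
   \<Rightarrow> (real \<Rightarrow> 'a \<Rightarrow> real ^ 'd ^ 'd) \<Rightarrow> ('a \<Rightarrow> real ^ 'd) \<Rightarrow> bool" where
  "has_matrix_ito_integral M W a b H I \<longleftrightarrow>
     (\<forall>i. has_ito_integral M W a b (\<lambda>s \<omega>. H s \<omega> $ i) (\<lambda>\<omega>. I \<omega> $ i))"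

subsection \<open>The FBSDE\<close>

definition fbsde_solution ::
  "'a measure \<Rightarrow> (real \<Rightarrow> 'a \<Rightarrow> real ^ 'd) \<Rightarrow> real \<Rightarrow> real ^ 'd
   \<Rightarrow> (real \<Rightarrow> real ^ 'd \<Rightarrow> real \<Rightarrow> real ^ 'd \<Rightarrow> real ^ 'd)
   \<Rightarrow> (real \<Rightarrow> real ^ 'd \<Rightarrow> real \<Rightarrow> real ^ 'd ^ 'd)
   \<Rightarrow> (real \<Rightarrow> real ^ 'd \<Rightarrow> real \<Rightarrow> real ^ 'd \<Rightarrow> real)
   \<Rightarrow> (real ^ 'd \<Rightarrow> real)
   \<Rightarrow> (real \<Rightarrow> 'a \<Rightarrow> real ^ 'd) \<Rightarrow> (real \<Rightarrow> 'a \<Rightarrow> real) \<Rightarrow> (real \<Rightarrow> 'a \<Rightarrow> real ^ 'd) \<Rightarrow> bool" where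
  "fbsde_solution M W T x0 b \<sigma> F g X Y Z \<longleftrightarrow>
     progressively_measurable (aug_filtration M W) T X \<and>
     progressively_measurable (aug_filtration M W) T Y \<and>
     progressively_measurable (aug_filtration M W) T Z \<and>
     (AE \<omega> in M. continuous_on {0..T} (\<lambda>t. X t \<omega>) \<and> continuous_on {0..T} (\<lambda>t. Y t \<omega>)) \<and>
     (\<integral>\<^sup>+\<omega>. (SUP t\<in>{0..T}. ennreal ((norm (X t \<omega>))\<^sup>2)) \<partial>M) < \<infinity> \<and>
     (\<integral>\<^sup>+\<omega>. (SUP t\<in>{0..T}. ennreal (\<bar>Y t \<omega>\<bar>\<^sup>2)) \<partial>M) < \<infinity> \<and>
     (\<integral>\<^sup>+t\<in>{0..T}. (\<integral>\<^sup>+\<omega>. ennreal ((norm (Z t \<omega>))\<^sup>2) \<partial>M) \<partial>lborel) < \<infinity> \<and>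
     (\<forall>t\<in>{0..T}. \<exists>I.
        has_matrix_ito_integral M W 0 t (\<lambda>s \<omega>. \<sigma> s (X s \<omega>) (Y s \<omega>)) I \<and>
        (AE \<omega> in M. X t \<omega> =
           x0 + (LINT s:{0..t}|lborel. b s (X s \<omega>) (Y s \<omega>) (Z s \<omega>)) + I \<omega>)) \<and>
     (\<forall>t\<in>{0..T}. \<exists>J.
        has_ito_integral M W t T Z J \<and>
        (AE \<omega> in M. Y t \<omega> =
           g (X T \<omega>) - (LINT s:{t..T}|lborel. F s (X s \<omega>) (Y s \<omega>) (Z s \<omega>)) - J \<omega>))"

subsection \<open>Regularity of the coefficients and of the PDE solution\<close>

definition lipschitz_tx ::
  "real \<Rightarrow> real \<Rightarrow> (real \<Rightarrow> real ^ 'd \<Rightarrow> 'b::real_normed_vector) \<Rightarrow> bool" where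
  "lipschitz_tx T H \<phi> \<longleftrightarrow>
     (\<forall>t\<in>{0..T}. \<forall>t'\<in>{0..T}. \<forall>x x'.
        norm (\<phi> t x - \<phi> t' x') \<le> H * (sqrt \<bar>t - t'\<bar> + norm (x - x')))"

definition lipschitz_txy ::
  "real \<Rightarrow> real \<Rightarrow> (real \<Rightarrow> real ^ 'd \<Rightarrow> real \<Rightarrow> 'b::real_normed_vector) \<Rightarrow> bool" where
  "lipschitz_txy T H \<phi> \<longleftrightarrow>
     (\<forall>t\<in>{0..T}. \<forall>t'\<in>{0..T}. \<forall>x x' y y'.
        norm (\<phi> t x y - \<phi> t' x' y') \<le> H * (sqrt \<bar>t - t'\<bar> + norm (x - x') + \<bar>y - y'\<bar>))"

definition lipschitz_txyz ::
  "real \<Rightarrow> real \<Rightarrow> (real \<Rightarrow> real ^ 'd \<Rightarrow> real \<Rightarrow> real ^ 'd \<Rightarrow> 'b::real_normed_vector) \<Rightarrow> bool" where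
  "lipschitz_txyz T H \<phi> \<longleftrightarrow>
     (\<forall>t\<in>{0..T}. \<forall>t'\<in>{0..T}. \<forall>x x' y y' z z'.
        norm (\<phi> t x y z - \<phi> t' x' y' z')
          \<le> H * (sqrt \<bar>t - t'\<bar> + norm (x - x') + \<bar>y - y'\<bar> + norm (z - z')))"

text \<open>
  \<open>u\<close> is of class \<open>C\<^sup>1\<^sup>,\<^sup>2\<close> on \<open>[0,T] \<times> \<real>\<^sup>d\<close> (time derivative one-sided at \<open>0\<close> and \<open>T\<close>), with time
  derivative \<open>ut\<close>, spatial gradient \<open>ux\<close> and spatial Hessian \<open>uxx\<close>.
\<close>

definition C12_on ::
  "real \<Rightarrow> (real \<Rightarrow> real ^ 'd \<Rightarrow> real) \<Rightarrow> (real \<Rightarrow> real ^ 'd \<Rightarrow> real)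
   \<Rightarrow> (real \<Rightarrow> real ^ 'd \<Rightarrow> real ^ 'd) \<Rightarrow> (real \<Rightarrow> real ^ 'd \<Rightarrow> real ^ 'd ^ 'd) \<Rightarrow> bool" where
  "C12_on T u ut ux uxx \<longleftrightarrow>
     (\<forall>t\<in>{0..T}. \<forall>x.
        ((\<lambda>s. u s x) has_real_derivative ut t x) (at t within {0..T}) \<and>
        ((\<lambda>y. u t y) has_derivative (\<lambda>h. ux t x \<bullet> h)) (at x) \<and>
        ((\<lambda>y. ux t y) has_derivative (\<lambda>h. uxx t x *v h)) (at x)) \<and>
     continuous_on ({0..T} \<times> UNIV) (\<lambda>(t, x). u t x) \<and>
     continuous_on ({0..T} \<times> UNIV) (\<lambda>(t, x). ut t x) \<and>
     continuous_on ({0..T} \<times> UNIV) (\<lambda>(t, x). ux t x) \<and>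
     continuous_on ({0..T} \<times> UNIV) (\<lambda>(t, x). uxx t x)"

definition classical_pde_solution ::
  "real \<Rightarrow> (real \<Rightarrow> real ^ 'd \<Rightarrow> real \<Rightarrow> real ^ 'd \<Rightarrow> real ^ 'd)
   \<Rightarrow> (real \<Rightarrow> real ^ 'd \<Rightarrow> real \<Rightarrow> real ^ 'd ^ 'd)
   \<Rightarrow> (real \<Rightarrow> real ^ 'd \<Rightarrow> real \<Rightarrow> real ^ 'd \<Rightarrow> real)
   \<Rightarrow> (real ^ 'd \<Rightarrow> real)
   \<Rightarrow> (real \<Rightarrow> real ^ 'd \<Rightarrow> real) \<Rightarrow> (real \<Rightarrow> real ^ 'd \<Rightarrow> real)
   \<Rightarrow> (real \<Rightarrow> real ^ 'd \<Rightarrow> real ^ 'd) \<Rightarrow> (real \<Rightarrow> real ^ 'd \<Rightarrow> real ^ 'd ^ 'd) \<Rightarrow> bool" where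
  "classical_pde_solution T b \<sigma> F g u ut ux uxx \<longleftrightarrow>
     C12_on T u ut ux uxx \<and>
     (\<forall>t\<in>{0..T}. \<forall>x.
        let v = ux t x v* \<sigma> t x (u t x) in
        ut t x = F t x (u t x) v
          - 1 / 2 * trace (uxx t x ** (\<sigma> t x (u t x) ** transpose (\<sigma> t x (u t x))))
          - ux t x \<bullet> b t x (u t x) v) \<and>
     (\<forall>x. u T x = g x)"

subsection \<open>Scheme and error\<close>

definition time_grid :: "real \<Rightarrow> nat \<Rightarrow> (nat \<Rightarrow> real) \<Rightarrow> bool" where
  "time_grid T N \<tau> \<longleftrightarrow> \<tau> 0 = 0 \<and> \<tau> N = T \<and> (\<forall>i<N. \<tau> i < \<tau> (Suc i))"

definition mesh :: "nat \<Rightarrow> (nat \<Rightarrow> real) \<Rightarrow> real" where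
  "mesh N \<tau> = Max ((\<lambda>i. \<tau> (Suc i) - \<tau> i) ` {..<N})"

text \<open>\<open>\<Pi>(t)\<close> is \<open>\<tau> (grid_index N \<tau> t)\<close>.\<close>

definition grid_index :: "nat \<Rightarrow> (nat \<Rightarrow> real) \<Rightarrow> real \<Rightarrow> nat" where
  "grid_index N \<tau> t = Max {i. i \<le> N \<and> \<tau> i \<le> t}"

definition bounded_lipschitz_class ::
  "real \<Rightarrow> real \<Rightarrow> real \<Rightarrow> (real \<Rightarrow> real ^ 'd \<Rightarrow> real ^ 'd) set" where
  "bounded_lipschitz_class T K H =
     {\<rho>. (\<forall>t\<in>{0..T}. \<forall>x. norm (\<rho> t x) \<le> K) \<and> lipschitz_tx T H \<rho>}"

context
  fixes W :: "real \<Rightarrow> 'a \<Rightarrow> real ^ 'd"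
    and x0 :: "real ^ 'd"
    and b :: "real \<Rightarrow> real ^ 'd \<Rightarrow> real \<Rightarrow> real ^ 'd \<Rightarrow> real ^ 'd"
    and \<sigma> :: "real \<Rightarrow> real ^ 'd \<Rightarrow> real \<Rightarrow> real ^ 'd ^ 'd"
    and F :: "real \<Rightarrow> real ^ 'd \<Rightarrow> real \<Rightarrow> real ^ 'd \<Rightarrow> real"
    and y0 :: real
    and \<rho> :: "real \<Rightarrow> real ^ 'd \<Rightarrow> real ^ 'd"
    and \<tau> :: "nat \<Rightarrow> real"
begin

primrec scheme_XY :: "nat \<Rightarrow> 'a \<Rightarrow> (real ^ 'd) \<times> real" where
  "scheme_XY 0 \<omega> = (x0, y0)"
| "scheme_XY (Suc i) \<omega> =
     (let x = fst (scheme_XY i \<omega>); y = snd (scheme_XY i \<omega>); z = \<rho> (\<tau> i) x;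
          \<Delta>t = \<tau> (Suc i) - \<tau> i; \<Delta>W = W (\<tau> (Suc i)) \<omega> - W (\<tau> i) \<omega>
      in (x + \<Delta>t *\<^sub>R b (\<tau> i) x y z + \<sigma> (\<tau> i) x y *v \<Delta>W,
          y + F (\<tau> i) x y z * \<Delta>t + z \<bullet> \<Delta>W))"

definition scheme_X :: "nat \<Rightarrow> 'a \<Rightarrow> real ^ 'd" where
  "scheme_X i \<omega> = fst (scheme_XY i \<omega>)"

definition scheme_Y :: "nat \<Rightarrow> 'a \<Rightarrow> real" where
  "scheme_Y i \<omega> = snd (scheme_XY i \<omega>)"

definition scheme_Z :: "nat \<Rightarrow> 'a \<Rightarrow> real ^ 'd" where
  "scheme_Z i \<omega> = \<rho> (\<tau> i) (scheme_X i \<omega>)"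

definition scheme_error ::
  "'a measure \<Rightarrow> real \<Rightarrow> (real \<Rightarrow> 'a \<Rightarrow> real ^ 'd) \<Rightarrow> (real \<Rightarrow> 'a \<Rightarrow> real)
   \<Rightarrow> (real \<Rightarrow> 'a \<Rightarrow> real ^ 'd) \<Rightarrow> nat \<Rightarrow> ennreal" where
  "scheme_error M T X Y Z N =
     (SUP t\<in>{0..T}. \<integral>\<^sup>+\<omega>. ennreal ((norm (X t \<omega> - scheme_X (grid_index N \<tau> t) \<omega>))\<^sup>2) \<partial>M)
     + (MAX i\<in>{..N}. \<integral>\<^sup>+\<omega>. ennreal (\<bar>Y (\<tau> i) \<omega> - scheme_Y i \<omega>\<bar>\<^sup>2) \<partial>M)
     + (\<integral>\<^sup>+\<omega>. (\<integral>\<^sup>+t\<in>{0..T}. ennreal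
           (\<bar>Y t \<omega> - scheme_Y (grid_index N \<tau> t) \<omega>\<bar>\<^sup>2
            + (norm (Z t \<omega> - scheme_Z (grid_index N \<tau> t) \<omega>))\<^sup>2) \<partial>lborel) \<partial>M)"

end

end

theory Submission
  imports Defs
begin

text \<open>
  Write \<open>D\<^sub>i\<close> for \<open>Y\<^sub>i - u t\<^sub>i X\<^sub>i\<close> and \<open>\<zeta>\<^sub>i\<close> for \<open>Z\<^sub>i - ux t\<^sub>i X\<^sub>i v* \<sigma> t\<^sub>i X\<^sub>i Y\<^sub>i\<close> along an Euler scheme \<open>(X, Y, Z)\<close>
  with an arbitrary adapted control \<open>Z\<close>. A second order Taylor expansion of \<open>u\<close> along one Euler step,
  in which the PDE cancels the drift up to \<open>O(\<bar>D\<^sub>i\<bar> + \<bar>\<zeta>\<^sub>i\<bar>)\<close>, bounds \<open>E \<bar>D\<^sub>i\<bar>\<^sup>2 + \<Sum> \<Delta> E \<bar>\<zeta>\<^sub>j\<bar>\<^sup>2\<close> by \<open>E \<bar>D\<^sub>N\<bar>\<^sup>2\<close> plus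
  the mesh to the power \<open>\<alpha>\<close>, through a backward Gronwall argument. A forward Gronwall argument bounds the
  distance of the scheme to the solution of the FBSDE by its distance at time \<open>0\<close>, the mesh, and the
  \<open>L\<^sup>2\<close> distance of the controls.

  These two estimates replace the Ito formula. Applied to the schemes that start at \<open>(x0, Y 0)\<close> and are
  controlled by step approximations of \<open>Z\<close>, they identify \<open>Y 0 = u 0 x0\<close> and \<open>Z = v\<close>: such schemes
  converge to the solution, whose terminal condition forces \<open>E \<bar>D\<^sub>N\<bar>\<^sup>2\<close> to tend to \<open>0\<close>. Applied to the
  scheme controlled by \<open>\<rho>\<close>, the backward estimate then controls the initial distance \<open>\<bar>D\<^sub>0\<bar>\<close> and,
  through \<open>\<zeta>\<close>, the distance of the controls, and the forward estimate yields the claim.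
\<close>

subsection \<open>Brownian increments and the augmented filtration\<close>

text \<open>The obstacle is that a solution is known only through its equations: neither
  \<open>Y = u(t, X)\<close> nor any time regularity of \<open>Z\<close> is available, and
  stochastic integrals are mere L2 limits of simple ones. Three choices answer this. The control of
  an Euler scheme is only required to be adapted and square integrable, so that the same estimates
  serve \<rho> and the step approximations of \<open>Z\<close>. Controls are measured against
  \<open>ux v* \<sigma>\<close> with \<sigma> at the scheme's own \<open>Y\<close>, because this
  difference is exactly the linear coefficient of the Brownian increment in one step of
  \<open>Y - u(t, X)\<close>; accordingly \<open>Z\<close> is identified with
  \<open>ux(t, X) v* \<sigma>(t, X, Y)\<close>, which presupposes nothing about \<open>Y\<close>.
  Mean square increments of \<open>Y\<close> over short intervals are bounded, up to a constant, by
  the time integral of 1 plus the second moments of \<open>X\<close>, \<open>Y\<close>,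
  \<open>Z\<close>; this quantity is additive in time, so weighted by the step lengths it sums to at
  most the mesh times a finite constant. All constants come from the data and the solution alone,
  and the exponential factors of the claim are at least 1.\<close>

lemma space_aug_filtration [simp]: "space (aug_filtration M W t) = space M"
  unfolding aug_filtration_def
  by (rule space_measure_of) (auto dest: sets.sets_into_space)

lemma sets_aug_filtration:
  "sets (aug_filtration M W t) =
     sigma_sets (space M)
       ({W s -` B \<inter> space M | s B. s \<in> {0..t} \<and> B \<in> sets borel} \<union> null_sets M)"
  unfolding aug_filtration_def
  by (rule sets_measure_of) (auto dest: sets.sets_into_space)

lemma aug_filtration_mono:
  assumes "s \<le> t"
  shows "sets (aug_filtration M W s) \<subseteq> sets (aug_filtration M W t)"
  unfolding sets_aug_filtration
proof (intro sigma_sets_mono' Un_mono order_refl subsetI)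
  fix A assume "A \<in> {W r -` B \<inter> space M | r B. r \<in> {0..s} \<and> B \<in> sets borel}"
  then obtain r B where "A = W r -` B \<inter> space M" "r \<in> {0..s}" "B \<in> sets borel" by blast
  then show "A \<in> {W r -` B \<inter> space M | r B. r \<in> {0..t} \<and> B \<in> sets borel}"
    using assms by (intro CollectI exI[of _ r] exI[of _ B]) auto
qed

lemma measurable_aug_filtration_mono:
  assumes "f \<in> measurable (aug_filtration M W s) N" "s \<le> t"
  shows "f \<in> measurable (aug_filtration M W t) N"
  using assms aug_filtration_mono[OF assms(2), of M W] by (auto simp: measurable_def)

lemma measurable_aug_filtration_W:
  assumes "s \<in> {0..t}"
  shows "W s \<in> borel_measurable (aug_filtration M W t)"
  using assms by (intro measurableI) (auto simp: sets_aug_filtration)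

locale brownian = prob_space M for M :: "'a measure" +
  fixes W :: "real \<Rightarrow> 'a \<Rightarrow> real ^ 'd"
  assumes bm: "brownian_motion M W"
begin

abbreviation \<F> :: "real \<Rightarrow> 'a measure" where "\<F> \<equiv> aug_filtration M W"

lemma W_measurable [measurable]: "0 \<le> t \<Longrightarrow> W t \<in> borel_measurable M"
  using bm unfolding brownian_motion_def by blast

lemma W_0: "AE \<omega> in M. W 0 \<omega> = 0"
proof -
  have "AE \<omega> in M. W 0 \<omega> = 0 \<and> continuous_on {0..} (\<lambda>t. W t \<omega>)"
    using bm unfolding brownian_motion_def by blast
  thus ?thesis by eventually_elim blast
qed

lemma indep_vars_increments:
  "0 \<le> r 0 \<Longrightarrow> (\<And>i. i < (n::nat) \<Longrightarrow> r i < r (Suc i)) \<Longrightarrow>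
    indep_vars (\<lambda>_. borel) (\<lambda>i \<omega>. W (r (Suc i)) \<omega> - W (r i) \<omega>) {..<n}"
  using bm unfolding brownian_motion_def by blast

lemma distributed_increment:
  "0 \<le> s \<Longrightarrow> s < t \<Longrightarrow> distributed M lborel (\<lambda>\<omega>. W t \<omega> - W s \<omega>)
          (\<lambda>x. ennreal (\<Prod>i\<in>UNIV. normal_density 0 (sqrt (t - s)) (x $ i)))"
  using bm unfolding brownian_motion_def by blast

lemma sets_filtration_le: "sets (\<F> t) \<subseteq> sets M"
  unfolding sets_aug_filtration
  by (rule sets.sigma_sets_subset) (auto intro: measurable_sets[OF W_measurable])

lemma measurable_filtration:
  assumes "f \<in> measurable (\<F> t) N" shows "f \<in> measurable M N"
  using assms sets_filtration_le[of t] by (auto simp: measurable_def)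

text \<open>\<open>brownian_motion\<close> speaks only of successive increments along a sequence of
  times. So the times in \<open>S\<close> are sorted together with \<open>0\<close>,
  \<open>s\<close>, \<open>t\<close>; since \<open>W 0 = 0\<close> almost surely, every past value
  is a partial sum of the increments up to \<open>s\<close>, and these are jointly independent of
  the last increment.\<close>

lemma indep_past_events:
  fixes B :: "real \<Rightarrow> (real ^ 'd) set"
  assumes st: "0 \<le> s" "s < t" and S: "finite S" "S \<subseteq> {0..s}"
    and B: "\<And>r. r \<in> S \<Longrightarrow> B r \<in> sets borel" and A: "A \<in> sets borel"
  shows "prob ({\<omega>\<in>space M. \<forall>r\<in>S. W r \<omega> \<in> B r} \<inter> ((\<lambda>\<omega>. W t \<omega> - W s \<omega>) -` A \<inter> space M)) =
    prob {\<omega>\<in>space M. \<forall>r\<in>S. W r \<omega> \<in> B r} * prob ((\<lambda>\<omega>. W t \<omega> - W s \<omega>) -` A \<inter> space M)"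
proof -
  define l where "l = sorted_list_of_set (S \<union> {0,s,t})"
  \<comment> \<open>\<open>s\<close> and \<open>t\<close> are the two largest times, so the list
    ends with \<open>l ! m = s\<close> and \<open>l ! Suc m = t\<close>: increments with index below
    \<open>m\<close> are past, the one with index \<open>m\<close> is to be separated.\<close>
  define m where "m = length l - 2"
  let ?P = "S \<union> {0,s,t}"
  have fin: "finite ?P" using S by auto
  have lset: "set l = ?P" unfolding l_def by (rule set_sorted_list_of_set[OF fin])
  have lsorted: "sorted_wrt (<) l" unfolding l_def by simp
  have card2: "2 \<le> length l"
  proof -
    have "card {s,t} \<le> card ?P" by (rule card_mono) (use fin in auto)
    thus ?thesis using st unfolding l_def by simp
  qed
  hence len: "length l = Suc (Suc m)" unfolding m_def by simp
  have inc: "l ! i < l ! j" if "i < j" "j < length l" for i j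
    using lsorted that by (simp add: sorted_wrt_nth_less)
  have le_t: "x \<le> t" if "x \<in> ?P" for x using that st S by auto
  have lt: "l ! Suc m = t"
  proof -
    have "t \<in> set l" using lset by auto
    then obtain j where j: "j < length l" "l ! j = t" by (auto simp: in_set_conv_nth)
    have "\<not> j < Suc m"
    proof
      assume "j < Suc m"
      then have "t < l ! Suc m" using inc[of j "Suc m"] j len by simp
      moreover have "l ! Suc m \<in> ?P" using lset len nth_mem[of "Suc m" l] by simp
      ultimately show False using le_t by fastforce
    qed
    thus ?thesis using j len by (metis less_antisym)
  qed
  have ls: "l ! m = s"
  proof -
    have "s \<in> set l" using lset by auto
    then obtain j where j: "j < length l" "l ! j = s" by (auto simp: in_set_conv_nth)
    have "j \<noteq> Suc m" using lt j st by auto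
    have "\<not> j < m"
    proof
      assume "j < m"
      then have 1: "s < l ! m" using inc[of j "m"] j len by simp
      have 2: "l ! m < t" using inc[of m "Suc m"] len lt by simp
      have "l ! m \<in> ?P" using lset len nth_mem[of "m" l] by simp
      with 1 2 S st show False by auto
    qed
    thus ?thesis using j len \<open>j \<noteq> Suc m\<close> by (metis less_antisym)
  qed
  have l0: "l ! 0 = 0"
  proof -
    have "0 \<in> set l" using lset by auto
    then obtain j where j: "j < length l" "l ! j = 0" by (auto simp: in_set_conv_nth)
    have "j = 0"
    proof (rule ccontr)
      assume "j \<noteq> 0"
      then have "l ! 0 < 0" using inc[of 0 j] j by simp
      moreover have "l ! 0 \<in> ?P" using lset len nth_mem[of "0" l] by simp
      ultimately show False using S st by auto
    qed
    thus ?thesis using j by simp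
  qed
  define r where "r i = l ! i" for i
  have "indep_vars (\<lambda>_. borel) (\<lambda>i \<omega>. W (r (Suc i)) \<omega> - W (r i) \<omega>) {..<Suc m}"
    using inc l0 len unfolding r_def by (intro indep_vars_increments) auto
  hence iv: "indep_var (PiM {..<m} (\<lambda>_. borel)) (\<lambda>\<omega>. \<lambda>i\<in>{..<m}. W (r (Suc i)) \<omega> - W (r i) \<omega>)
     (PiM {m} (\<lambda>_. borel)) (\<lambda>\<omega>. \<lambda>i\<in>{m}. W (r (Suc i)) \<omega> - W (r i) \<omega>)"
    by (rule indep_var_restrict) auto
  \<comment> \<open>The past event in terms of increments: the value at \<open>r j\<close> is the
    sum of the first \<open>j\<close> of them. It agrees with the event about \<open>W\<close> only
    up to the null set where \<open>W 0\<close> is not 0.\<close>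
  define E where "E = {x\<in>space (PiM {..<m} (\<lambda>_. borel)). \<forall>j\<in>{..m}. r j \<in> S \<longrightarrow> (\<Sum>i<j. x i) \<in> B (r j)}"
  define E' where "E' = {x\<in>space (PiM {m} (\<lambda>_. borel)). x m \<in> A}"
  have Em: "E \<in> sets (PiM {..<m} (\<lambda>_. borel))"
  proof -
    have "{x\<in>space (PiM {..<m} (\<lambda>_. borel)). r j \<in> S \<longrightarrow> (\<Sum>i<j. x i :: real^'d) \<in> B (r j)} \<in> sets (PiM {..<m} (\<lambda>_. borel))"
      if "j \<in> {..m}" for j
    proof (cases "r j \<in> S")
      case True
      have "(\<lambda>x. \<Sum>i<j. x i :: real^'d) \<in> borel_measurable (PiM {..<m} (\<lambda>_. borel))"
        using that by (intro borel_measurable_sum measurable_component_singleton) auto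
      from measurable_sets[OF this B[OF True]] True show ?thesis
        by (simp add: vimage_def Int_def conj_commute)
    qed auto
    thus ?thesis unfolding E_def by (intro sets.sets_Collect_finite_All') auto
  qed
  have Em': "E' \<in> sets (PiM {m} (\<lambda>_. borel))"
    unfolding E'_def using A by measurable
  have key: "prob ((\<lambda>\<omega>. \<lambda>i\<in>{..<m}. W (r (Suc i)) \<omega> - W (r i) \<omega>) -` E \<inter>
      ((\<lambda>\<omega>. \<lambda>i\<in>{m}. W (r (Suc i)) \<omega> - W (r i) \<omega>) -` E') \<inter> space M) =
     prob ((\<lambda>\<omega>. \<lambda>i\<in>{..<m}. W (r (Suc i)) \<omega> - W (r i) \<omega>) -` E \<inter> space M) *
     prob ((\<lambda>\<omega>. \<lambda>i\<in>{m}. W (r (Suc i)) \<omega> - W (r i) \<omega>) -` E' \<inter> space M)"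
    using indep_varD[OF iv Em Em'] by (simp add: vimage_def Int_def conj_ac)
  have rng: "S \<subseteq> r ` {..m}"
  proof
    fix x assume "x \<in> S"
    then have "x \<in> set l" "x \<noteq> t" using lset S st by auto
    then obtain j where "j < Suc (Suc m)" "l ! j = x" by (auto simp: in_set_conv_nth len)
    then show "x \<in> r ` {..m}" using \<open>x \<noteq> t\<close> lt unfolding r_def by (metis atMost_iff image_eqI less_Suc_eq_le less_antisym)
  qed
  have eq1: "(\<lambda>\<omega>. \<lambda>i\<in>{m}. W (r (Suc i)) \<omega> - W (r i) \<omega>) -` E' \<inter> space M = (\<lambda>\<omega>. W t \<omega> - W s \<omega>) -` A \<inter> space M"
    unfolding E'_def by (auto simp: space_PiM r_def lt ls)
  have ae: "AE \<omega> in M. \<omega> \<in> (\<lambda>\<omega>. \<lambda>i\<in>{..<m}. W (r (Suc i)) \<omega> - W (r i) \<omega>) -` E \<inter> space M \<longleftrightarrow>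
     \<omega> \<in> {\<omega>\<in>space M. \<forall>r\<in>S. W r \<omega> \<in> B r}"
    using W_0
  proof eventually_elim
    case (elim \<omega>)
    have "(\<Sum>i<j. restrict (\<lambda>i. W (r (Suc i)) \<omega> - W (r i) \<omega>) {..<m} i) = W (r j) \<omega>" if "j \<le> m" for j
    proof -
      have "(\<Sum>i<j. restrict (\<lambda>i. W (r (Suc i)) \<omega> - W (r i) \<omega>) {..<m} i) = (\<Sum>i<j. W (r (Suc i)) \<omega> - W (r i) \<omega>)"
        using that by (intro sum.cong) auto
      also have "\<dots> = W (r j) \<omega> - W (r 0) \<omega>" by (rule sum_lessThan_telescope)
      finally show ?thesis using elim l0 unfolding r_def by simp
    qed
    then show ?case unfolding E_def using rng by (auto simp: space_PiM)
  qed
  have meas1: "(\<lambda>\<omega>. \<lambda>i\<in>{..<m}. W (r (Suc i)) \<omega> - W (r i) \<omega>) -` E \<inter> space M \<in> sets M"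
    by (rule measurable_sets[OF indep_var_rv1[OF iv] Em])
  have meas2: "{\<omega>\<in>space M. \<forall>r\<in>S. W r \<omega> \<in> B r} \<in> sets M"
    using S B by (intro sets.sets_Collect_finite_All) (auto intro!: measurable_sets_Collect[OF W_measurable] simp: subset_iff)
  have meas3: "(\<lambda>\<omega>. W t \<omega> - W s \<omega>) -` A \<inter> space M \<in> sets M"
    using st A by (intro measurable_sets[of _ M borel]) auto
  have "prob ({\<omega>\<in>space M. \<forall>r\<in>S. W r \<omega> \<in> B r} \<inter> ((\<lambda>\<omega>. W t \<omega> - W s \<omega>) -` A \<inter> space M)) =
     prob ((\<lambda>\<omega>. \<lambda>i\<in>{..<m}. W (r (Suc i)) \<omega> - W (r i) \<omega>) -` E \<inter> space M \<inter> ((\<lambda>\<omega>. W t \<omega> - W s \<omega>) -` A \<inter> space M))"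
    using ae meas1 meas2 meas3 by (intro finite_measure_eq_AE) auto
  also have "\<dots> = prob ((\<lambda>\<omega>. \<lambda>i\<in>{..<m}. W (r (Suc i)) \<omega> - W (r i) \<omega>) -` E \<inter>
      ((\<lambda>\<omega>. \<lambda>i\<in>{m}. W (r (Suc i)) \<omega> - W (r i) \<omega>) -` E') \<inter> space M)"
    unfolding eq1[symmetric] by (intro arg_cong[where f=prob]) auto
  also have "\<dots> = prob {\<omega>\<in>space M. \<forall>r\<in>S. W r \<omega> \<in> B r} * prob ((\<lambda>\<omega>. W t \<omega> - W s \<omega>) -` A \<inter> space M)"
  proof -
    have "prob ((\<lambda>\<omega>. \<lambda>i\<in>{..<m}. W (r (Suc i)) \<omega> - W (r i) \<omega>) -` E \<inter> space M) = prob {\<omega>\<in>space M. \<forall>r\<in>S. W r \<omega> \<in> B r}"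
      using ae meas1 meas2 by (intro finite_measure_eq_AE) auto
    thus ?thesis unfolding key eq1 by simp
  qed
  finally show ?thesis .
qed

text \<open>Dynkin's argument. Cylinder events in finitely many times up to \<open>s\<close>,
  together with the null sets, are stable under intersection and generate a sigma-algebra containing
  \<open>\<F> s\<close>. A null set is independent of every event, so the augmentation costs
  nothing.\<close>

lemma indep_filtration_increment:
  assumes st: "0 \<le> s" "s < t" and f: "f \<in> measurable (\<F> s) N" and \<psi>: "\<psi> \<in> measurable borel N'"
  shows "indep_var N f N' (\<lambda>\<omega>. \<psi> (W t \<omega> - W s \<omega>))"
proof -
  let ?C = "{{\<omega>\<in>space M. \<forall>r\<in>S. W r \<omega> \<in> B r} |S B. finite S \<and> S \<subseteq> {0..s} \<and> (\<forall>r\<in>S. B r \<in> sets borel)}"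
  let ?D = "{(\<lambda>\<omega>. W t \<omega> - W s \<omega>) -` A \<inter> space M |A. A \<in> sets borel}"
  have C_meas: "?C \<subseteq> sets M"
    by (auto intro!: sets.sets_Collect_finite_All measurable_sets_Collect[OF W_measurable])
  have D_meas: "?D \<subseteq> sets M"
    using st by (auto intro!: measurable_sets[of _ M borel])
  have "indep_set (?C \<union> null_sets M) ?D"
  proof (rule indep_setI)
    show "?C \<union> null_sets M \<subseteq> events" using C_meas by auto
    show "?D \<subseteq> events" by (fact D_meas)
    fix a b assume a: "a \<in> ?C \<union> null_sets M" and b: "b \<in> ?D"
    show "prob (a \<inter> b) = prob a * prob b"
    proof (cases "a \<in> null_sets M")
      case True
      have "a \<inter> b \<in> null_sets M" using True b D_meas by (intro null_set_Int2) auto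
      then show ?thesis using True by (simp add: measure_eq_0_null_sets)
    next
      case False
      then have "a \<in> ?C" using a by blast
      then show ?thesis using b indep_past_events[OF st] by blast
    qed
  qed
  moreover have "Int_stable (?C \<union> null_sets M)"
  proof (rule Int_stableI)
    fix a b assume a: "a \<in> ?C \<union> null_sets M" and b: "b \<in> ?C \<union> null_sets M"
    show "a \<inter> b \<in> ?C \<union> null_sets M"
    proof (cases "a \<in> null_sets M \<or> b \<in> null_sets M")
      case True
      have "a \<in> sets M" "b \<in> sets M" using a b C_meas by auto
      then have "a \<inter> b \<in> null_sets M" using True by (auto intro: null_set_Int1 null_set_Int2)
      then show ?thesis by blast
    next
      case False
      then obtain S1 B1 S2 B2 where 1: "finite S1" "S1 \<subseteq> {0..s}" "\<forall>r\<in>S1. B1 r \<in> sets borel"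
        "a = {\<omega>\<in>space M. \<forall>r\<in>S1. W r \<omega> \<in> B1 r}"
        and 2: "finite S2" "S2 \<subseteq> {0..s}" "\<forall>r\<in>S2. B2 r \<in> sets borel"
        "b = {\<omega>\<in>space M. \<forall>r\<in>S2. W r \<omega> \<in> B2 r}" using a b by blast
      \<comment> \<open>\<open>UNIV\<close> at the times that only the other cylinder constrains
        allows both to be read over \<open>S1 \<union> S2\<close>.\<close>
      define B where "B r = (if r \<in> S1 then B1 r else UNIV) \<inter> (if r \<in> S2 then B2 r else UNIV)" for r
      have "a \<inter> b = {\<omega>\<in>space M. \<forall>r\<in>S1 \<union> S2. W r \<omega> \<in> B r}"
        unfolding 1(4) 2(4) B_def by auto
      moreover have "\<forall>r\<in>S1 \<union> S2. B r \<in> sets borel" unfolding B_def using 1 2 by auto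
      ultimately have "a \<inter> b \<in> ?C"
        using 1(1,2) 2(1,2) by (intro CollectI exI[of _ "S1 \<union> S2"] exI[of _ B]) auto
      then show ?thesis by blast
    qed
  qed
  moreover have "Int_stable ?D"
  proof (rule Int_stableI)
    fix a b assume "a \<in> ?D" "b \<in> ?D"
    then obtain A B where "A \<in> sets borel" "B \<in> sets borel"
      "a = (\<lambda>\<omega>. W t \<omega> - W s \<omega>) -` A \<inter> space M" "b = (\<lambda>\<omega>. W t \<omega> - W s \<omega>) -` B \<inter> space M" by blast
    then show "a \<inter> b \<in> ?D" by (intro CollectI exI[of _ "A \<inter> B"]) auto
  qed
  ultimately have ind: "indep_set (sigma_sets (space M) (?C \<union> null_sets M)) (sigma_sets (space M) ?D)"
    by (rule indep_set_sigma_sets)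
  have gen: "sets (\<F> s) \<subseteq> sigma_sets (space M) (?C \<union> null_sets M)"
    unfolding sets_aug_filtration
  proof (rule sigma_sets_mono', rule Un_mono[OF _ order_refl], rule subsetI)
    fix x assume "x \<in> {W s' -` B \<inter> space M |s' B. s' \<in> {0..s} \<and> B \<in> sets borel}"
    then obtain s' B where "x = W s' -` B \<inter> space M" "s' \<in> {0..s}" "B \<in> sets borel" by blast
    then show "x \<in> ?C" by (intro CollectI exI[of _ "{s'}"] exI[of _ "\<lambda>_. B"]) auto
  qed
  have sub: "sigma_sets (space M) {f -` A \<inter> space M |A. A \<in> sets N} \<subseteq> sigma_sets (space M) (?C \<union> null_sets M)"
    using gen measurable_sets[OF f] by (intro sigma_sets_mono) auto
  have "\<psi> -` A \<in> sets borel" if "A \<in> sets N'" for A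
    using measurable_sets[OF \<psi> that] by simp
  then have sub': "{(\<lambda>\<omega>. \<psi> (W t \<omega> - W s \<omega>)) -` A \<inter> space M |A. A \<in> sets N'} \<subseteq> ?D"
  proof (safe, goal_cases)
    case (1 _ A)
    then show ?case using \<open>\<And>A. A \<in> sets N' \<Longrightarrow> \<psi> -` A \<in> sets borel\<close>
      by (intro exI[of _ "\<psi> -` A"]) (auto simp: vimage_def)
  qed
  have "indep_set (sigma_sets (space M) {f -` A \<inter> space M |A. A \<in> sets N})
     (sigma_sets (space M) {(\<lambda>\<omega>. \<psi> (W t \<omega> - W s \<omega>)) -` A \<inter> space M |A. A \<in> sets N'})"
    using ind unfolding indep_set_def
    by (rule indep_sets_mono_sets) (use sub sigma_sets_mono'[OF sub'] in \<open>auto split: bool.split\<close>)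
  moreover have "(\<lambda>\<omega>. \<psi> (W t \<omega> - W s \<omega>)) \<in> measurable M N'"
    using st by (intro measurable_compose[OF _ \<psi>]) auto
  ultimately show ?thesis unfolding indep_var_eq
    using measurable_filtration[OF f] by auto
qed

text \<open>The Gaussian density is a product over coordinates, and Lebesgue measure on
  \<open>real ^ 'd\<close> is the image of a product of one-dimensional ones, so expectations of
  products of coordinate functions factor. The moments below are instances in which most factors are
  1.\<close>

lemma increment_component_integral:
  assumes st: "0 \<le> s" "s < t"
    and f: "\<And>i::'d. integrable lborel (\<lambda>x. normal_density 0 (sqrt (t - s)) x * f i x)"
    and fm: "\<And>i. f i \<in> borel_measurable borel"
  shows "integrable M (\<lambda>\<omega>. \<Prod>i\<in>UNIV. f i ((W t \<omega> - W s \<omega>) $ i))"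
    and "expectation (\<lambda>\<omega>. \<Prod>i\<in>UNIV. f i ((W t \<omega> - W s \<omega>) $ i)) =
      (\<Prod>i\<in>UNIV. \<integral>x. normal_density 0 (sqrt (t - s)) x * f i x \<partial>lborel)"
proof -
  let ?n = "normal_density 0 (sqrt (t - s))"
  note dist = distributed_increment[OF st]
  let ?\<phi> = "\<lambda>x::real^'d. \<Prod>i\<in>UNIV. f i (x $ i)"
  let ?h = "\<lambda>x::real^'d. (\<Prod>i\<in>UNIV. ?n (x $ i)) * ?\<phi> x"
  \<comment> \<open>\<open>?e\<close> inverts \<open>i \<mapsto> axis i 1\<close>: the product
    measure is indexed by basis vectors, the integrands by coordinates.\<close>
  let ?e = "\<lambda>b::real^'d. (THE i. b = axis i 1)"
  have e: "?e (axis i 1) = i" for i by (auto simp: axis_eq_axis)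
  interpret product_sigma_finite "\<lambda>_::real^'d. lborel :: real measure" ..
  let ?P = "\<Pi>\<^sub>M b\<in>Basis. lborel :: real measure"
  define g where "g b x = ?n x * f (?e b) x" for b x
  have gint: "integrable lborel (g b)" for b unfolding g_def by (rule f)
  have \<phi>m: "?\<phi> \<in> borel_measurable borel" using fm by measurable
  have prod: "?h (\<Sum>b\<in>Basis. x b *\<^sub>R b) = (\<Prod>b\<in>Basis. g b (x b))" for x
  proof -
    have B: "(Basis :: (real^'d) set) = (\<lambda>i. axis i 1) ` UNIV" by (auto simp: Basis_vec_def)
    have inj: "inj (\<lambda>i::'d. axis i (1::real))" by (auto simp: inj_on_def axis_eq_axis)
    have nth: "(\<Sum>b\<in>Basis. x b *\<^sub>R b) $ i = x (axis i 1)" for i :: 'd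
      unfolding B by (subst sum.reindex[OF inj]) (simp add: axis_def if_distrib cong: if_cong)
    show ?thesis unfolding g_def nth prod.distrib[symmetric]
      unfolding B by (subst prod.reindex[OF inj]) (simp add: e)
  qed
  have hm: "?h \<in> borel_measurable borel" using \<phi>m by measurable
  have lb: "(lborel :: (real^'d) measure) = distr ?P borel (\<lambda>f. \<Sum>b\<in>Basis. f b *\<^sub>R b)"
    by (rule lborel_eq)
  have int: "integrable lborel ?h"
    unfolding lb
  proof (subst integrable_distr_eq[OF _ hm])
    show "integrable ?P (\<lambda>x. ?h (\<Sum>b\<in>Basis. x b *\<^sub>R b))"
      unfolding prod by (rule product_integrable_prod) (auto intro: gint)
  qed simp
  have val: "integral\<^sup>L lborel ?h = (\<Prod>i\<in>UNIV. \<integral>x. ?n x * f i x \<partial>lborel)"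
  proof -
    have "integral\<^sup>L lborel ?h = (\<integral>x. (\<Prod>b\<in>Basis. g b (x b)) \<partial>?P)"
      unfolding lb by (subst integral_distr[OF _ hm], simp) (simp only: prod)
    also have "\<dots> = (\<Prod>b\<in>Basis. integral\<^sup>L lborel (g b))"
      by (rule product_integral_prod) (auto intro: gint)
    also have "\<dots> = (\<Prod>i\<in>UNIV. \<integral>x. ?n x * f i x \<partial>lborel)"
    proof -
      have B: "(Basis :: (real^'d) set) = (\<lambda>i. axis i 1) ` UNIV" by (auto simp: Basis_vec_def)
      have inj: "inj (\<lambda>i::'d. axis i (1::real))" by (auto simp: inj_on_def axis_eq_axis)
      show ?thesis unfolding B by (subst prod.reindex[OF inj]) (simp add: e g_def[abs_def])
    qed
    finally show ?thesis .
  qed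
  show "integrable M (\<lambda>\<omega>. \<Prod>i\<in>UNIV. f i ((W t \<omega> - W s \<omega>) $ i))"
    using distributed_integrable[OF dist, of ?\<phi>] int \<phi>m by (simp add: prod_nonneg)
  show "expectation (\<lambda>\<omega>. \<Prod>i\<in>UNIV. f i ((W t \<omega> - W s \<omega>) $ i)) =
      (\<Prod>i\<in>UNIV. \<integral>x. normal_density 0 (sqrt (t - s)) x * f i x \<partial>lborel)"
    using distributed_integral[OF dist, of ?\<phi>] val \<phi>m by (simp add: prod_nonneg)
qed

text \<open>The power sits in coordinate \<open>k\<close>; the other coordinates carry the constant
  1, whose Gaussian integral is 1.\<close>

lemma
  assumes st: "0 \<le> s" "s < t"
  shows integrable_increment_power: "integrable M (\<lambda>\<omega>. ((W t \<omega> - W s \<omega>) $ k) ^ n)"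
    and expectation_increment_power: "expectation (\<lambda>\<omega>. ((W t \<omega> - W s \<omega>) $ k) ^ n) =
      (\<integral>x. normal_density 0 (sqrt (t - s)) x * x ^ n \<partial>lborel)"
proof -
  define f where "f i x = (if i = k then x ^ n else (1::real))" for i :: 'd and x
  have pos: "0 < sqrt (t - s)" using st by simp
  have n: "integrable lborel (\<lambda>x. normal_density 0 (sqrt (t - s)) x * x ^ n)"
    using integrable_normal_moment[OF pos, of 0 n] by simp
  have fi: "integrable lborel (\<lambda>x. normal_density 0 (sqrt (t - s)) x * f i x)" for i
    using n integrable_normal_density[OF pos] unfolding f_def by (cases "i = k") auto
  have fm: "f i \<in> borel_measurable borel" for i unfolding f_def by (cases "i = k") auto
  have p: "(\<Prod>i\<in>UNIV. f i (x $ i)) = (x $ k) ^ n" for x :: "real^'d"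
    by (simp add: f_def)
  have q: "(\<Prod>i\<in>UNIV. \<integral>x. normal_density 0 (sqrt (t - s)) x * f i x \<partial>lborel) =
     (\<integral>x. normal_density 0 (sqrt (t - s)) x * x ^ n \<partial>lborel)"
  proof -
    have "(\<integral>x. normal_density 0 (sqrt (t - s)) x * f i x \<partial>lborel) =
       (if i = k then (\<integral>x. normal_density 0 (sqrt (t - s)) x * x ^ n \<partial>lborel) else 1)" for i
      using integral_normal_density[OF pos, of 0] unfolding f_def by simp
    thus ?thesis by simp
  qed
  show "integrable M (\<lambda>\<omega>. ((W t \<omega> - W s \<omega>) $ k) ^ n)"
    "expectation (\<lambda>\<omega>. ((W t \<omega> - W s \<omega>) $ k) ^ n) =
      (\<integral>x. normal_density 0 (sqrt (t - s)) x * x ^ n \<partial>lborel)"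
    using increment_component_integral[OF st, of f, OF fi fm] unfolding p q by auto
qed

lemma expectation_increment_component:
  assumes st: "0 \<le> s" "s < t"
  shows "expectation (\<lambda>\<omega>. (W t \<omega> - W s \<omega>) $ k) = 0"
  using expectation_increment_power[OF st, of k 1] normal_moment_odd[of "sqrt (t-s)" 0 0] st
  by (simp add: has_bochner_integral_iff)

lemma expectation_increment_square:
  assumes st: "0 \<le> s" "s < t"
  shows "expectation (\<lambda>\<omega>. ((W t \<omega> - W s \<omega>) $ k)^2) = t - s"
  using expectation_increment_power[OF st, of k 2] normal_moment_even[of "sqrt (t-s)" 0 1] st
  by (simp add: has_bochner_integral_iff)

text \<open>105 = 7 * 5 * 3 * 1. The Taylor remainder of one step is cubic in the normalized
  increment, so its square needs sixth moments; the eighth is the next power that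
  \<open>norm_power_8_le\<close> reaches by repeated squaring.\<close>

lemma expectation_increment_power8:
  assumes st: "0 \<le> s" "s < t"
  shows "expectation (\<lambda>\<omega>. ((W t \<omega> - W s \<omega>) $ k)^8) = 105 * (t - s)^4"
  using expectation_increment_power[OF st, of k 8] normal_moment_even[of "sqrt (t-s)" 0 4] st
  by (simp add: has_bochner_integral_iff fact_numeral field_simps)

text \<open>Coordinate \<open>k\<close> contributes the Gaussian mean of the identity as a factor,
  which is 0.\<close>

lemma expectation_increment_mult:
  assumes st: "0 \<le> s" "s < t" and kl: "k \<noteq> l"
  shows "integrable M (\<lambda>\<omega>. (W t \<omega> - W s \<omega>) $ k * (W t \<omega> - W s \<omega>) $ l)" (is ?A)
    "expectation (\<lambda>\<omega>. (W t \<omega> - W s \<omega>) $ k * (W t \<omega> - W s \<omega>) $ l) = 0" (is ?B)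
proof -
  define f where "f i x = (if i \<in> {k,l} then x else (1::real))" for i :: 'd and x
  have pos: "0 < sqrt (t - s)" using st by simp
  have n: "has_bochner_integral lborel (\<lambda>x. normal_density 0 (sqrt (t - s)) x * x) 0"
    using normal_moment_odd[OF pos, of 0 0] by simp
  have fi: "integrable lborel (\<lambda>x. normal_density 0 (sqrt (t - s)) x * f i x)" for i
    using n integrable_normal_density[OF pos] unfolding f_def by (cases "i \<in> {k,l}") (auto simp: has_bochner_integral_iff)
  have fm: "f i \<in> borel_measurable borel" for i unfolding f_def by (cases "i \<in> {k,l}") auto
  have p: "(\<Prod>i\<in>UNIV. f i (x $ i)) = x $ k * x $ l" for x :: "real^'d"
  proof -
    have "(\<Prod>i\<in>UNIV. f i (x $ i)) = (\<Prod>i\<in>{k,l}. f i (x $ i))"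
      by (rule prod.mono_neutral_right) (auto simp: f_def)
    thus ?thesis using kl by (simp add: f_def)
  qed
  have q: "(\<Prod>i\<in>UNIV. \<integral>x. normal_density 0 (sqrt (t - s)) x * f i x \<partial>lborel) = 0"
    using n by (intro prod_zero bexI[of _ k]) (auto simp: f_def has_bochner_integral_iff)
  show ?A ?B
    using increment_component_integral[OF st, of f, OF fi fm] unfolding p q by auto
qed

lemma indep_mult_increment:
  fixes \<psi> :: "real^'d \<Rightarrow> real"
  assumes st: "0 \<le> s" "s < t" and G: "G \<in> borel_measurable (\<F> s)" "integrable M G"
    and \<psi>: "\<psi> \<in> borel_measurable borel" "integrable M (\<lambda>\<omega>. \<psi> (W t \<omega> - W s \<omega>))"
  shows "integrable M (\<lambda>\<omega>. G \<omega> * \<psi> (W t \<omega> - W s \<omega>))"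
    and "expectation (\<lambda>\<omega>. G \<omega> * \<psi> (W t \<omega> - W s \<omega>)) =
      expectation G * expectation (\<lambda>\<omega>. \<psi> (W t \<omega> - W s \<omega>))"
proof -
  note i = indep_filtration_increment[OF st G(1) \<psi>(1)]
  show "integrable M (\<lambda>\<omega>. G \<omega> * \<psi> (W t \<omega> - W s \<omega>))"
    by (rule indep_var_integrable[OF i G(2) \<psi>(2)])
  show "expectation (\<lambda>\<omega>. G \<omega> * \<psi> (W t \<omega> - W s \<omega>)) =
      expectation G * expectation (\<lambda>\<omega>. \<psi> (W t \<omega> - W s \<omega>))"
    by (rule indep_var_lebesgue_integral[OF i G(2) \<psi>(2)])
qed

end

subsection \<open>Square integrable random variables\<close>

lemma measurable_vec_nth:
  fixes f :: "'a \<Rightarrow> ('b::second_countable_topology) ^ 'n"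
  assumes "f \<in> borel_measurable N" shows "(\<lambda>\<omega>. f \<omega> $ k) \<in> borel_measurable N"
  by (rule measurable_compose[OF assms borel_measurable_continuous_onI]) (intro continuous_intros)

lemma measurable_vecI:
  fixes f :: "'a \<Rightarrow> real ^ 'n"
  assumes "\<And>k. (\<lambda>\<omega>. f \<omega> $ k) \<in> borel_measurable N" shows "f \<in> borel_measurable N"
proof -
  have "(\<lambda>\<omega>. \<Sum>k\<in>UNIV. f \<omega> $ k *\<^sub>R axis k (1::real)) \<in> borel_measurable N"
    by (intro borel_measurable_sum borel_measurable_scaleR assms) simp
  also have "(\<lambda>\<omega>. \<Sum>k\<in>UNIV. f \<omega> $ k *\<^sub>R axis k (1::real)) = f"
    by (simp add: fun_eq_iff basis_expansion scalar_mult_eq_scaleR[symmetric])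
  finally show ?thesis .
qed

definition sq_integrable :: "'a measure \<Rightarrow> ('a \<Rightarrow> 'b::euclidean_space) \<Rightarrow> bool" where
  "sq_integrable M f \<longleftrightarrow> f \<in> borel_measurable M \<and> integrable M (\<lambda>\<omega>. (norm (f \<omega>))\<^sup>2)"

lemma sq_integrable_measurable: "sq_integrable M f \<Longrightarrow> f \<in> borel_measurable M"
  by (simp add: sq_integrable_def)

lemma sq_integrable_iff_nn:
  "sq_integrable M f \<longleftrightarrow> f \<in> borel_measurable M \<and> (\<integral>\<^sup>+\<omega>. ennreal ((norm (f \<omega>))\<^sup>2) \<partial>M) < \<infinity>"
  unfolding sq_integrable_def by (auto simp: integrable_iff_bounded)

lemma nn_integral_sq_integrable:
  "sq_integrable M f \<Longrightarrow> (\<integral>\<^sup>+\<omega>. ennreal ((norm (f \<omega>))\<^sup>2) \<partial>M) = ennreal (\<integral>\<omega>. (norm (f \<omega>))\<^sup>2 \<partial>M)"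
  unfolding sq_integrable_def by (intro nn_integral_eq_integral) auto

lemma sq_integrable_bound:
  assumes "sq_integrable M g" "f \<in> borel_measurable M" "AE \<omega> in M. norm (f \<omega>) \<le> norm (g \<omega>)"
  shows "sq_integrable M f"
  using assms unfolding sq_integrable_def
  by (auto intro!: Bochner_Integration.integrable_bound[of M "\<lambda>\<omega>. (norm (g \<omega>))\<^sup>2"] power_mono elim!: eventually_mono)

lemma norm_add_sq_le:
  fixes a b :: "'b::real_normed_vector"
  shows "(norm (a + b))\<^sup>2 \<le> 2 * (norm a)\<^sup>2 + 2 * (norm b)\<^sup>2"
proof -
  have "(norm (a + b))\<^sup>2 \<le> (norm a + norm b)\<^sup>2" by (intro power_mono norm_triangle_ineq) simp
  also have "\<dots> \<le> 2 * (norm a)\<^sup>2 + 2 * (norm b)\<^sup>2"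
    using sum_squares_bound[of "norm a" "norm b"] by (simp add: power2_sum)
  finally show ?thesis .
qed

lemma sq_integrable_add:
  assumes "sq_integrable M f" "sq_integrable M g"
  shows "sq_integrable M (\<lambda>\<omega>. f \<omega> + g \<omega>)"
proof -
  have [measurable]: "f \<in> borel_measurable M" "g \<in> borel_measurable M" using assms by (auto simp: sq_integrable_def)
  show ?thesis unfolding sq_integrable_def
  proof
    show "integrable M (\<lambda>\<omega>. (norm (f \<omega> + g \<omega>))\<^sup>2)"
      by (rule Bochner_Integration.integrable_bound[of M "\<lambda>\<omega>. 2 * (norm (f \<omega>))\<^sup>2 + 2 * (norm (g \<omega>))\<^sup>2"])
        (use assms norm_add_sq_le in \<open>auto simp: sq_integrable_def\<close>)
  qed simp
qed

lemma sq_integrable_scaleR: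
  assumes "sq_integrable M f" shows "sq_integrable M (\<lambda>\<omega>. c *\<^sub>R f \<omega>)"
  using assms by (auto simp: sq_integrable_def power_mult_distrib)

lemma sq_integrable_mult:
  fixes f :: "'a \<Rightarrow> real"
  assumes "sq_integrable M f" shows "sq_integrable M (\<lambda>\<omega>. c * f \<omega>)"
  using sq_integrable_scaleR[OF assms, of c] by simp

lemma sq_integrable_uminus:
  assumes "sq_integrable M f" shows "sq_integrable M (\<lambda>\<omega>. - f \<omega>)"
  using assms by (auto simp: sq_integrable_def)

lemma sq_integrable_diff:
  assumes "sq_integrable M f" "sq_integrable M g"
  shows "sq_integrable M (\<lambda>\<omega>. f \<omega> - g \<omega>)"
  using sq_integrable_add[OF assms(1) sq_integrable_uminus[OF assms(2)]] by simp

lemma sq_integrable_zero [simp]: "sq_integrable M (\<lambda>_. 0)"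
  by (simp add: sq_integrable_def)

lemma sq_integrable_sum:
  assumes "\<And>i. i \<in> A \<Longrightarrow> sq_integrable M (f i)"
  shows "sq_integrable M (\<lambda>\<omega>. \<Sum>i\<in>A. f i \<omega>)"
  using assms by (induction A rule: infinite_finite_induct) (auto intro: sq_integrable_add)

lemma sq_integrable_norm:
  assumes "sq_integrable M f" shows "sq_integrable M (\<lambda>\<omega>. norm (f \<omega>))"
  using assms by (auto simp: sq_integrable_def intro: borel_measurable_norm)

lemma (in finite_measure) sq_integrable_bounded:
  assumes "f \<in> borel_measurable M" "\<And>\<omega>. \<omega> \<in> space M \<Longrightarrow> norm (f \<omega>) \<le> K"
  shows "sq_integrable M f"
  using assms(1) unfolding sq_integrable_def
  by (auto intro!: integrable_const_bound[of _ "K\<^sup>2"] AE_I2 power_mono assms)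

lemma (in finite_measure) sq_integrable_const [simp]: "sq_integrable M (\<lambda>_. c)"
  by (rule sq_integrable_bounded[of _ "norm c"]) auto

lemma sq_integrable_inner:
  assumes "sq_integrable M f" "sq_integrable M g"
  shows "integrable M (\<lambda>\<omega>. f \<omega> \<bullet> g \<omega>)"
proof (rule Bochner_Integration.integrable_bound[of M "\<lambda>\<omega>. (norm (f \<omega>))\<^sup>2 + (norm (g \<omega>))\<^sup>2"])
  show "AE \<omega> in M. norm (f \<omega> \<bullet> g \<omega>) \<le> norm ((norm (f \<omega>))\<^sup>2 + (norm (g \<omega>))\<^sup>2)"
  proof (rule AE_I2)
    fix \<omega>
    have "\<bar>f \<omega> \<bullet> g \<omega>\<bar> \<le> norm (f \<omega>) * norm (g \<omega>)" by (rule Cauchy_Schwarz_ineq2)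
    also have "\<dots> \<le> (norm (f \<omega>))\<^sup>2 + (norm (g \<omega>))\<^sup>2"
      using sum_squares_bound[of "norm (f \<omega>)" "norm (g \<omega>)"] mult_nonneg_nonneg[of "norm (f \<omega>)" "norm (g \<omega>)"]
      using norm_ge_zero[of "f \<omega>"] norm_ge_zero[of "g \<omega>"] by linarith
    finally show "norm (f \<omega> \<bullet> g \<omega>) \<le> norm ((norm (f \<omega>))\<^sup>2 + (norm (g \<omega>))\<^sup>2)" by simp
  qed
qed (use assms in \<open>auto simp: sq_integrable_def\<close>)

lemma sq_integrable_times:
  fixes f g :: "'a \<Rightarrow> real"
  assumes "sq_integrable M f" "sq_integrable M g"
  shows "integrable M (\<lambda>\<omega>. f \<omega> * g \<omega>)"
  using sq_integrable_inner[OF assms] by simp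

lemma sq_integrable_nth:
  fixes f :: "'a \<Rightarrow> real ^ 'n"
  assumes "sq_integrable M f" shows "sq_integrable M (\<lambda>\<omega>. f \<omega> $ k)"
  by (rule sq_integrable_bound[OF assms])
    (use assms Finite_Cartesian_Product.norm_nth_le in \<open>auto simp: sq_integrable_def intro!: measurable_vec_nth component_le_norm_cart\<close>)

lemma sq_integrable_vec:
  fixes f :: "'a \<Rightarrow> real ^ 'n"
  assumes "\<And>k. sq_integrable M (\<lambda>\<omega>. f \<omega> $ k)" shows "sq_integrable M f"
proof -
  have [measurable]: "f \<in> borel_measurable M"
    using assms by (intro measurable_vecI) (auto simp: sq_integrable_def)
  have "(norm (f \<omega>))\<^sup>2 = (\<Sum>k\<in>UNIV. (f \<omega> $ k)\<^sup>2)" for \<omega>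
    by (simp add: norm_vec_def L2_set_def sum_nonneg)
  then show ?thesis using assms by (auto simp: sq_integrable_def)
qed

lemma integral_mult_sq_le:
  fixes f g :: "'a \<Rightarrow> real"
  assumes "sq_integrable M f" "sq_integrable M g"
  shows "(\<integral>\<omega>. f \<omega> * g \<omega> \<partial>M)\<^sup>2 \<le> (\<integral>\<omega>. (f \<omega>)\<^sup>2 \<partial>M) * (\<integral>\<omega>. (g \<omega>)\<^sup>2 \<partial>M)"
proof -
  have 1: "(\<integral>\<^sup>+\<omega>. ennreal (\<bar>f \<omega>\<bar>) * ennreal (\<bar>g \<omega>\<bar>) \<partial>M)\<^sup>2 \<le>
     (\<integral>\<^sup>+\<omega>. (ennreal \<bar>f \<omega>\<bar>)\<^sup>2 \<partial>M) * (\<integral>\<^sup>+\<omega>. (ennreal \<bar>g \<omega>\<bar>)\<^sup>2 \<partial>M)"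
    using assms by (intro Cauchy_Schwarz_nn_integral) (auto simp: sq_integrable_def)
  have 2: "(\<integral>\<^sup>+\<omega>. (ennreal \<bar>f \<omega>\<bar>)\<^sup>2 \<partial>M) = ennreal (\<integral>\<omega>. (f \<omega>)\<^sup>2 \<partial>M)"
    "(\<integral>\<^sup>+\<omega>. (ennreal \<bar>g \<omega>\<bar>)\<^sup>2 \<partial>M) = ennreal (\<integral>\<omega>. (g \<omega>)\<^sup>2 \<partial>M)"
    using nn_integral_sq_integrable[OF assms(1)] nn_integral_sq_integrable[OF assms(2)] by (simp_all add: ennreal_power)
  have int: "integrable M (\<lambda>\<omega>. f \<omega> * g \<omega>)" by (rule sq_integrable_times[OF assms])
  have 3: "(\<integral>\<^sup>+\<omega>. ennreal (\<bar>f \<omega>\<bar>) * ennreal (\<bar>g \<omega>\<bar>) \<partial>M) = ennreal (\<integral>\<omega>. \<bar>f \<omega> * g \<omega>\<bar> \<partial>M)"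
    using integrable_abs[OF int] by (subst nn_integral_eq_integral[symmetric]) (auto simp: ennreal_mult[symmetric] abs_mult)
  have "ennreal ((\<integral>\<omega>. \<bar>f \<omega> * g \<omega>\<bar> \<partial>M)\<^sup>2) \<le> ennreal ((\<integral>\<omega>. (f \<omega>)\<^sup>2 \<partial>M) * (\<integral>\<omega>. (g \<omega>)\<^sup>2 \<partial>M))"
    using 1 unfolding 2 3 by (simp add: ennreal_power ennreal_mult[symmetric])
  then have "(\<integral>\<omega>. \<bar>f \<omega> * g \<omega>\<bar> \<partial>M)\<^sup>2 \<le> (\<integral>\<omega>. (f \<omega>)\<^sup>2 \<partial>M) * (\<integral>\<omega>. (g \<omega>)\<^sup>2 \<partial>M)"
    by (subst (asm) ennreal_le_iff) auto
  moreover have "(\<integral>\<omega>. f \<omega> * g \<omega> \<partial>M)\<^sup>2 \<le> (\<integral>\<omega>. \<bar>f \<omega> * g \<omega>\<bar> \<partial>M)\<^sup>2"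
    using integral_abs_bound[of M "\<lambda>\<omega>. f \<omega> * g \<omega>"] by (simp add: abs_le_square_iff[symmetric])
  ultimately show ?thesis by simp
qed

lemma nn_integral_sq_add_le:
  fixes f g :: "'a \<Rightarrow> 'b::euclidean_space"
  assumes [measurable]: "f \<in> borel_measurable M" "g \<in> borel_measurable M"
  shows "(\<integral>\<^sup>+\<omega>. ennreal ((norm (f \<omega> + g \<omega>))\<^sup>2) \<partial>M) \<le>
    2 * (\<integral>\<^sup>+\<omega>. ennreal ((norm (f \<omega>))\<^sup>2) \<partial>M) + 2 * (\<integral>\<^sup>+\<omega>. ennreal ((norm (g \<omega>))\<^sup>2) \<partial>M)"
proof -
  have "(\<integral>\<^sup>+\<omega>. ennreal ((norm (f \<omega> + g \<omega>))\<^sup>2) \<partial>M) \<le>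
    (\<integral>\<^sup>+\<omega>. 2 * ennreal ((norm (f \<omega>))\<^sup>2) + 2 * ennreal ((norm (g \<omega>))\<^sup>2) \<partial>M)"
  proof (rule nn_integral_mono)
    fix \<omega>
    have "ennreal ((norm (f \<omega> + g \<omega>))\<^sup>2) \<le> ennreal (2 * (norm (f \<omega>))\<^sup>2 + 2 * (norm (g \<omega>))\<^sup>2)"
      by (rule ennreal_leI[OF norm_add_sq_le])
    also have "\<dots> = 2 * ennreal ((norm (f \<omega>))\<^sup>2) + 2 * ennreal ((norm (g \<omega>))\<^sup>2)"
      by (simp add: ennreal_plus ennreal_mult)
    finally show "ennreal ((norm (f \<omega> + g \<omega>))\<^sup>2) \<le> 2 * ennreal ((norm (f \<omega>))\<^sup>2) + 2 * ennreal ((norm (g \<omega>))\<^sup>2)" .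
  qed
  also have "\<dots> = 2 * (\<integral>\<^sup>+\<omega>. ennreal ((norm (f \<omega>))\<^sup>2) \<partial>M) + 2 * (\<integral>\<^sup>+\<omega>. ennreal ((norm (g \<omega>))\<^sup>2) \<partial>M)"
    by (simp add: nn_integral_add nn_integral_cmult)
  finally show ?thesis .
qed

section \<open>Ito isometry for step integrals\<close>

context brownian begin

lemma measurable_increment_filtration: "0 \<le> s \<Longrightarrow> 0 \<le> t \<Longrightarrow> s \<le> c \<Longrightarrow> t \<le> c \<Longrightarrow> (\<lambda>\<omega>. W t \<omega> - W s \<omega>) \<in> borel_measurable (\<F> c)"
  by (intro borel_measurable_diff measurable_aug_filtration_W) auto

lemma sq_integrable_increment:
  assumes "0 \<le> s" "s \<le> t" shows "sq_integrable M (\<lambda>\<omega>. W t \<omega> - W s \<omega>)"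
proof (cases "s = t")
  case False
  then show ?thesis using assms integrable_increment_power[of s t _ 2]
    by (intro sq_integrable_vec) (auto simp: sq_integrable_def intro!: borel_measurable_diff measurable_vec_nth)
qed simp

text \<open>Given the past up to \<open>s\<close>, the increment has mean 0 and covariance
  \<open>t - s\<close> times the identity; both the isometry and the centring of quadratic terms
  rest on this. The case \<open>s = t\<close>, which the independence statement excludes, is trivial
  because the increment vanishes.\<close>

lemma
  assumes st: "0 \<le> s" "s \<le> t" and G: "G \<in> borel_measurable (\<F> s)" "integrable M G"
  shows integrable_mult_increment: "integrable M (\<lambda>\<omega>. G \<omega> * (W t \<omega> - W s \<omega>) $ k)"
    and expectation_mult_increment: "expectation (\<lambda>\<omega>. G \<omega> * (W t \<omega> - W s \<omega>) $ k) = 0"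
    and integrable_mult_increment2: "integrable M (\<lambda>\<omega>. G \<omega> * ((W t \<omega> - W s \<omega>) $ k * (W t \<omega> - W s \<omega>) $ l))"
    and expectation_mult_increment2: "expectation (\<lambda>\<omega>. G \<omega> * ((W t \<omega> - W s \<omega>) $ k * (W t \<omega> - W s \<omega>) $ l)) =
       (if k = l then t - s else 0) * expectation G"
proof -
  have "integrable M (\<lambda>\<omega>. G \<omega> * (W t \<omega> - W s \<omega>) $ k) \<and>
    expectation (\<lambda>\<omega>. G \<omega> * (W t \<omega> - W s \<omega>) $ k) = 0 \<and>
    integrable M (\<lambda>\<omega>. G \<omega> * ((W t \<omega> - W s \<omega>) $ k * (W t \<omega> - W s \<omega>) $ l)) \<and>
    expectation (\<lambda>\<omega>. G \<omega> * ((W t \<omega> - W s \<omega>) $ k * (W t \<omega> - W s \<omega>) $ l)) =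
       (if k = l then t - s else 0) * expectation G"
  proof (cases "s = t")
    case False
    then have lt: "s < t" using st by simp
    have nth: "(\<lambda>x::real^'d. x $ i) \<in> borel_measurable borel" for i by simp
    have 1: "integrable M (\<lambda>\<omega>. (W t \<omega> - W s \<omega>) $ k)"
      using integrable_increment_power[OF st(1) lt, of k 1] by simp
    have 2: "integrable M (\<lambda>\<omega>. (W t \<omega> - W s \<omega>) $ k * (W t \<omega> - W s \<omega>) $ l) \<and>
      expectation (\<lambda>\<omega>. (W t \<omega> - W s \<omega>) $ k * (W t \<omega> - W s \<omega>) $ l) = (if k = l then t - s else 0)"
    proof (cases "k = l")
      case True
      then show ?thesis using integrable_increment_power[OF st(1) lt, of k 2] expectation_increment_square[OF st(1) lt, of k]
        by (simp add: power2_eq_square)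
    next
      case False
      then show ?thesis using expectation_increment_mult[OF st(1) lt] by auto
    qed
    have m2: "(\<lambda>x::real^'d. x $ k * x $ l) \<in> borel_measurable borel" by simp
    show ?thesis
      using indep_mult_increment[OF st(1) lt G nth, of k, OF 1] indep_mult_increment[OF st(1) lt G m2] 2
        expectation_increment_component[OF st(1) lt, of k] by (auto simp: mult.commute)
  qed simp
  then show "integrable M (\<lambda>\<omega>. G \<omega> * (W t \<omega> - W s \<omega>) $ k)"
    "expectation (\<lambda>\<omega>. G \<omega> * (W t \<omega> - W s \<omega>) $ k) = 0"
    "integrable M (\<lambda>\<omega>. G \<omega> * ((W t \<omega> - W s \<omega>) $ k * (W t \<omega> - W s \<omega>) $ l))"
    "expectation (\<lambda>\<omega>. G \<omega> * ((W t \<omega> - W s \<omega>) $ k * (W t \<omega> - W s \<omega>) $ l)) =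
       (if k = l then t - s else 0) * expectation G" by blast+
qed

lemma
  assumes st: "0 \<le> s" "s \<le> t" and x: "\<xi> \<in> borel_measurable (\<F> s)" "sq_integrable M \<xi>"
    and x': "\<xi>' \<in> borel_measurable (\<F> s)" "sq_integrable M \<xi>'"
  shows integrable_inner_increment_mult:
      "integrable M (\<lambda>\<omega>. (\<xi> \<omega> \<bullet> (W t \<omega> - W s \<omega>)) * (\<xi>' \<omega> \<bullet> (W t \<omega> - W s \<omega>)))"
    and expectation_inner_increment_mult:
      "expectation (\<lambda>\<omega>. (\<xi> \<omega> \<bullet> (W t \<omega> - W s \<omega>)) * (\<xi>' \<omega> \<bullet> (W t \<omega> - W s \<omega>))) =
        (t - s) * expectation (\<lambda>\<omega>. \<xi> \<omega> \<bullet> \<xi>' \<omega>)"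
proof -
  let ?D = "\<lambda>\<omega>. W t \<omega> - W s \<omega>"
  have eq: "(\<xi> \<omega> \<bullet> ?D \<omega>) * (\<xi>' \<omega> \<bullet> ?D \<omega>) =
    (\<Sum>k\<in>UNIV. \<Sum>l\<in>UNIV. (\<xi> \<omega> $ k * \<xi>' \<omega> $ l) * (?D \<omega> $ k * ?D \<omega> $ l))" for \<omega>
    unfolding inner_vec_def sum_product by (simp add: ac_simps)
  have m: "(\<lambda>\<omega>. \<xi> \<omega> $ k * \<xi>' \<omega> $ l) \<in> borel_measurable (\<F> s)" for k l
    using x(1) x'(1) by (intro borel_measurable_times measurable_vec_nth)
  have i: "integrable M (\<lambda>\<omega>. \<xi> \<omega> $ k * \<xi>' \<omega> $ l)" for k l
    by (intro sq_integrable_times sq_integrable_nth x x')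
  note I = integrable_mult_increment2[OF st m i] and E = expectation_mult_increment2[OF st m i]
  show "integrable M (\<lambda>\<omega>. (\<xi> \<omega> \<bullet> ?D \<omega>) * (\<xi>' \<omega> \<bullet> ?D \<omega>))"
    unfolding eq by (intro Bochner_Integration.integrable_sum I)
  have "expectation (\<lambda>\<omega>. (\<xi> \<omega> \<bullet> ?D \<omega>) * (\<xi>' \<omega> \<bullet> ?D \<omega>)) =
    (\<Sum>k\<in>UNIV. \<Sum>l\<in>UNIV. (if k = l then t - s else 0) * expectation (\<lambda>\<omega>. \<xi> \<omega> $ k * \<xi>' \<omega> $ l))"
    unfolding eq by (simp add: Bochner_Integration.integral_sum Bochner_Integration.integrable_sum I E
        del: vector_minus_component)
  also have "\<dots> = (\<Sum>k\<in>UNIV. (t - s) * expectation (\<lambda>\<omega>. \<xi> \<omega> $ k * \<xi>' \<omega> $ k))"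
    by (intro sum.cong refl) (simp add: if_distrib[of "\<lambda>x. x * _"] cong: if_cong)
  also have "\<dots> = (t - s) * expectation (\<lambda>\<omega>. \<xi> \<omega> \<bullet> \<xi>' \<omega>)"
    unfolding inner_vec_def by (simp add: i Bochner_Integration.integral_sum sum_distrib_left)
  finally show "expectation (\<lambda>\<omega>. (\<xi> \<omega> \<bullet> ?D \<omega>) * (\<xi>' \<omega> \<bullet> ?D \<omega>)) =
        (t - s) * expectation (\<lambda>\<omega>. \<xi> \<omega> \<bullet> \<xi>' \<omega>)" .
qed

lemma sq_integrable_inner_increment:
  assumes st: "0 \<le> s" "s \<le> t" and x: "\<xi> \<in> borel_measurable (\<F> s)" "sq_integrable M \<xi>"
  shows "sq_integrable M (\<lambda>\<omega>. \<xi> \<omega> \<bullet> (W t \<omega> - W s \<omega>))"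
  using integrable_inner_increment_mult[OF st x x] st measurable_filtration[OF x(1)]
  by (auto simp: sq_integrable_def power2_eq_square)

lemma expectation_mult_inner_increment:
  assumes st: "0 \<le> s" "s \<le> t" and x: "\<xi> \<in> borel_measurable (\<F> s)" "sq_integrable M \<xi>"
    and G: "G \<in> borel_measurable (\<F> s)" "sq_integrable M G"
  shows "expectation (\<lambda>\<omega>. G \<omega> * (\<xi> \<omega> \<bullet> (W t \<omega> - W s \<omega>))) = 0"
proof -
  have eq: "G \<omega> * (\<xi> \<omega> \<bullet> (W t \<omega> - W s \<omega>)) = (\<Sum>k\<in>UNIV. (G \<omega> * \<xi> \<omega> $ k) * (W t \<omega> - W s \<omega>) $ k)" for \<omega>
    unfolding inner_vec_def by (simp add: sum_distrib_left ac_simps)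
  have m: "(\<lambda>\<omega>. G \<omega> * \<xi> \<omega> $ k) \<in> borel_measurable (\<F> s)" for k
    using x(1) G(1) by (intro borel_measurable_times measurable_vec_nth)
  have i: "integrable M (\<lambda>\<omega>. G \<omega> * \<xi> \<omega> $ k)" for k
    by (intro sq_integrable_times sq_integrable_nth x G)
  show ?thesis unfolding eq
    by (simp add: Bochner_Integration.integral_sum integrable_mult_increment[OF st m i]
        expectation_mult_increment[OF st m i] del: vector_minus_component)
qed

text \<open>If the first interval ends before \<open>p'\<close>, the first integral is known at
  \<open>p'\<close> and the second one is orthogonal to it. Otherwise both are cut at
  \<open>p'\<close> and at the smaller right endpoint \<open>m\<close>, and only the common part
  from \<open>p'\<close> to \<open>m\<close> contributes: the other nonzero products pair an
  increment with a factor that is known when this increment starts.\<close>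

lemma expectation_elementary_mult_aux:
  assumes p: "0 \<le> p" "p \<le> q" "p' \<le> q'" "p \<le> p'"
    and x: "\<xi> \<in> borel_measurable (\<F> p)" "sq_integrable M \<xi>"
    and x': "\<xi>' \<in> borel_measurable (\<F> p')" "sq_integrable M \<xi>'"
  shows "expectation (\<lambda>\<omega>. (\<xi> \<omega> \<bullet> (W q \<omega> - W p \<omega>)) * (\<xi>' \<omega> \<bullet> (W q' \<omega> - W p' \<omega>))) =
     max 0 (min q q' - p') * expectation (\<lambda>\<omega>. \<xi> \<omega> \<bullet> \<xi>' \<omega>)"
proof (cases "q \<le> p'")
  case True
  have "(\<lambda>\<omega>. \<xi> \<omega> \<bullet> (W q \<omega> - W p \<omega>)) \<in> borel_measurable (\<F> p')"
    using p True x(1) by (intro borel_measurable_inner measurable_increment_filtration measurable_aug_filtration_mono[OF x(1)]) auto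
  from expectation_mult_inner_increment[OF _ p(3) x' this sq_integrable_inner_increment[OF p(1,2) x]] True p
  show ?thesis by (simp add: max_def)
next
  case False
  define m where "m = min q q'"
  have m: "p' \<le> m" "m \<le> q" "m \<le> q'" "0 \<le> p'" "0 \<le> m" using False p unfolding m_def by auto
  let ?I = "\<lambda>x a b \<omega>. x \<omega> \<bullet> (W b \<omega> - W a \<omega> :: real^'d)"
  have xm: "\<xi> \<in> borel_measurable (\<F> c)" if "p \<le> c" for c using measurable_aug_filtration_mono[OF x(1)] that .
  have xm': "\<xi>' \<in> borel_measurable (\<F> c)" if "p' \<le> c" for c using measurable_aug_filtration_mono[OF x'(1)] that .
  have sI: "sq_integrable M (?I \<xi> a b)" if "p \<le> a" "a \<le> b" for a b
    using that p by (intro sq_integrable_inner_increment xm x) auto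
  have sI': "sq_integrable M (?I \<xi>' a b)" if "p' \<le> a" "a \<le> b" for a b
    using that p by (intro sq_integrable_inner_increment xm' x') auto
  have mI: "?I \<xi> a b \<in> borel_measurable (\<F> c)" if "p \<le> a" "a \<le> b" "b \<le> c" for a b c
    using that p by (intro borel_measurable_inner measurable_increment_filtration xm) auto
  have mI': "?I \<xi>' a b \<in> borel_measurable (\<F> c)" if "p' \<le> a" "a \<le> b" "b \<le> c" for a b c
    using that p by (intro borel_measurable_inner measurable_increment_filtration xm') auto
  have split: "?I \<xi> p q \<omega> * ?I \<xi>' p' q' \<omega> =
     (?I \<xi> p p' \<omega> * ?I \<xi>' p' q' \<omega> + ?I \<xi> p' m \<omega> * ?I \<xi>' p' m \<omega>) + (?I \<xi> p' m \<omega> * ?I \<xi>' m q' \<omega>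
      + ?I \<xi>' p' m \<omega> * ?I \<xi> m q \<omega>) + ?I \<xi> m q \<omega> * ?I \<xi>' m q' \<omega>" for \<omega>
    by (simp add: inner_diff_right algebra_simps)
  have 1: "expectation (\<lambda>\<omega>. ?I \<xi> p p' \<omega> * ?I \<xi>' p' q' \<omega>) = 0"
    using p m by (intro expectation_mult_inner_increment mI sI xm' x') auto
  have 2: "expectation (\<lambda>\<omega>. ?I \<xi> p' m \<omega> * ?I \<xi>' p' m \<omega>) = (m - p') * expectation (\<lambda>\<omega>. \<xi> \<omega> \<bullet> \<xi>' \<omega>)"
    using p m by (intro expectation_inner_increment_mult xm xm' x x') auto
  have 3: "expectation (\<lambda>\<omega>. ?I \<xi> p' m \<omega> * ?I \<xi>' m q' \<omega>) = 0"
    using p m by (intro expectation_mult_inner_increment mI sI xm' x') auto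
  have 4: "expectation (\<lambda>\<omega>. ?I \<xi>' p' m \<omega> * ?I \<xi> m q \<omega>) = 0"
    using p m by (intro expectation_mult_inner_increment mI' sI' xm x) auto
  \<comment> \<open>\<open>m\<close> is the smaller of the two right endpoints, so one of the two
    intervals starting at \<open>m\<close> is empty.\<close>
  have 5: "?I \<xi> m q \<omega> * ?I \<xi>' m q' \<omega> = 0" for \<omega>
    unfolding m_def by (auto simp: min_def)
  have i: "integrable M (\<lambda>\<omega>. ?I \<xi> p p' \<omega> * ?I \<xi>' p' q' \<omega>)" "integrable M (\<lambda>\<omega>. ?I \<xi> p' m \<omega> * ?I \<xi>' p' m \<omega>)"
    "integrable M (\<lambda>\<omega>. ?I \<xi> p' m \<omega> * ?I \<xi>' m q' \<omega>)" "integrable M (\<lambda>\<omega>. ?I \<xi>' p' m \<omega> * ?I \<xi> m q \<omega>)"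
    using p m by (auto intro!: sq_integrable_times sI sI')
  have "expectation (\<lambda>\<omega>. ?I \<xi> p q \<omega> * ?I \<xi>' p' q' \<omega>) = (m - p') * expectation (\<lambda>\<omega>. \<xi> \<omega> \<bullet> \<xi>' \<omega>)"
    unfolding split 5 using 1 2 3 4 i by (simp add: Bochner_Integration.integral_add)
  then show ?thesis using m unfolding m_def by (simp add: max_def)
qed

lemma expectation_elementary_mult:
  assumes p: "0 \<le> p" "p \<le> q" "0 \<le> p'" "p' \<le> q'"
    and x: "\<xi> \<in> borel_measurable (\<F> p)" "sq_integrable M \<xi>"
    and x': "\<xi>' \<in> borel_measurable (\<F> p')" "sq_integrable M \<xi>'"
  shows "expectation (\<lambda>\<omega>. (\<xi> \<omega> \<bullet> (W q \<omega> - W p \<omega>)) * (\<xi>' \<omega> \<bullet> (W q' \<omega> - W p' \<omega>))) =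
     max 0 (min q q' - max p p') * expectation (\<lambda>\<omega>. \<xi> \<omega> \<bullet> \<xi>' \<omega>)"
proof (cases "p \<le> p'")
  case True
  then show ?thesis using expectation_elementary_mult_aux[OF p(1,2,4) True x x'] by (simp add: max_def)
next
  case False
  then show ?thesis using expectation_elementary_mult_aux[OF p(3,4,2) _ x' x]
    by (simp add: max_def mult.commute inner_commute min.commute)
qed

text \<open>Intervals may overlap and the index type is arbitrary. This makes the class closed under
  differences, through a sum type of indices, and under restriction to a subinterval, without any
  common refinement.\<close>

definition step_family :: "'i set \<Rightarrow> ('i \<Rightarrow> real) \<Rightarrow> ('i \<Rightarrow> real) \<Rightarrow> ('i \<Rightarrow> 'a \<Rightarrow> real ^ 'd) \<Rightarrow> bool" where
  "step_family A p q \<xi> \<longleftrightarrow> finite A \<and>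
     (\<forall>i\<in>A. 0 \<le> p i \<and> p i \<le> q i \<and> \<xi> i \<in> borel_measurable (\<F> (p i)) \<and> sq_integrable M (\<xi> i))"

definition step_process :: "'i set \<Rightarrow> ('i \<Rightarrow> real) \<Rightarrow> ('i \<Rightarrow> real) \<Rightarrow> ('i \<Rightarrow> 'a \<Rightarrow> real ^ 'd) \<Rightarrow> real \<Rightarrow> 'a \<Rightarrow> real ^ 'd" where
  "step_process A p q \<xi> r \<omega> = (\<Sum>i\<in>A. indicator {p i<..q i} r *\<^sub>R \<xi> i \<omega>)"

definition step_integral :: "'i set \<Rightarrow> ('i \<Rightarrow> real) \<Rightarrow> ('i \<Rightarrow> real) \<Rightarrow> ('i \<Rightarrow> 'a \<Rightarrow> real ^ 'd) \<Rightarrow> 'a \<Rightarrow> real" where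
  "step_integral A p q \<xi> \<omega> = (\<Sum>i\<in>A. \<xi> i \<omega> \<bullet> (W (q i) \<omega> - W (p i) \<omega>))"

lemma sq_integrable_step_integral:
  assumes "step_family A p q \<xi>" shows "sq_integrable M (step_integral A p q \<xi>)"
  unfolding step_integral_def[abs_def]
  using assms by (intro sq_integrable_sum sq_integrable_inner_increment) (auto simp: step_family_def)

lemma sq_integrable_step_process:
  assumes "step_family A p q \<xi>" shows "sq_integrable M (step_process A p q \<xi> r)"
  unfolding step_process_def[abs_def]
  using assms by (intro sq_integrable_sum sq_integrable_scaleR) (auto simp: step_family_def)

lemma measurable_step_process:
  assumes "step_family A p q \<xi>"
  shows "(\<lambda>(r, \<omega>). step_process A p q \<xi> r \<omega>) \<in> borel_measurable (lborel \<Otimes>\<^sub>M M)"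
proof -
  have [measurable]: "\<xi> i \<in> borel_measurable M" if "i \<in> A" for i
    using assms that by (auto simp: step_family_def sq_integrable_def)
  show ?thesis unfolding step_process_def by measurable
qed

text \<open>Both sides expand into the same double sum: the pair \<open>i\<close>, \<open>j\<close>
  contributes the expectation of \<open>\<xi> i \<bullet> \<xi> j\<close> times the length
  \<open>o' i j\<close> of the intersection of the two intervals.\<close>

lemma step_isometry:
  assumes F: "step_family A p q \<xi>"
  shows "(\<integral>\<^sup>+\<omega>. ennreal ((norm (step_integral A p q \<xi> \<omega>))\<^sup>2) \<partial>M) =
    (\<integral>\<^sup>+r. (\<integral>\<^sup>+\<omega>. ennreal ((norm (step_process A p q \<xi> r \<omega>))\<^sup>2) \<partial>M) \<partial>lborel)"
proof -
  have fin: "finite A" and pq: "\<And>i. i \<in> A \<Longrightarrow> 0 \<le> p i" "\<And>i. i \<in> A \<Longrightarrow> p i \<le> q i"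
    and x: "\<And>i. i \<in> A \<Longrightarrow> \<xi> i \<in> borel_measurable (\<F> (p i))" "\<And>i. i \<in> A \<Longrightarrow> sq_integrable M (\<xi> i)"
    using F by (auto simp: step_family_def)
  define c where "c i j = expectation (\<lambda>\<omega>. \<xi> i \<omega> \<bullet> \<xi> j \<omega>)" for i j
  define o' where "o' i j = max 0 (min (q i) (q j) - max (p i) (p j))" for i j
  have L: "expectation (\<lambda>\<omega>. (norm (step_integral A p q \<xi> \<omega>))\<^sup>2) = (\<Sum>i\<in>A. \<Sum>j\<in>A. o' i j * c i j)"
  proof -
    have "(norm (step_integral A p q \<xi> \<omega>))\<^sup>2 = (\<Sum>i\<in>A. \<Sum>j\<in>A. (\<xi> i \<omega> \<bullet> (W (q i) \<omega> - W (p i) \<omega>)) * (\<xi> j \<omega> \<bullet> (W (q j) \<omega> - W (p j) \<omega>)))" for \<omega>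
      unfolding step_integral_def by (simp add: power2_eq_square sum_product)
    moreover have "integrable M (\<lambda>\<omega>. (\<xi> i \<omega> \<bullet> (W (q i) \<omega> - W (p i) \<omega>)) * (\<xi> j \<omega> \<bullet> (W (q j) \<omega> - W (p j) \<omega>)))" if "i \<in> A" "j \<in> A" for i j
      using that by (intro sq_integrable_times sq_integrable_inner_increment pq x)
    ultimately show ?thesis unfolding o'_def c_def
      by (simp add: Bochner_Integration.integral_sum expectation_elementary_mult[OF pq(1,2) pq(1,2) x x])
  qed
  have int_c: "integrable M (\<lambda>\<omega>. \<xi> i \<omega> \<bullet> \<xi> j \<omega>)" if "i \<in> A" "j \<in> A" for i j
    using that by (intro sq_integrable_inner x)
  have R: "expectation (\<lambda>\<omega>. (norm (step_process A p q \<xi> r \<omega>))\<^sup>2) =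
     (\<Sum>i\<in>A. \<Sum>j\<in>A. indicator {p i<..q i} r * indicator {p j<..q j} r * c i j)" for r
  proof -
    have "(norm (step_process A p q \<xi> r \<omega>))\<^sup>2 = (\<Sum>i\<in>A. \<Sum>j\<in>A. (indicator {p i<..q i} r * indicator {p j<..q j} r) * (\<xi> i \<omega> \<bullet> \<xi> j \<omega>))" for \<omega>
      unfolding step_process_def power2_norm_eq_inner inner_sum_left inner_sum_right
      by (simp add: ac_simps inner_commute)
    then show ?thesis unfolding c_def using int_c by (simp add: Bochner_Integration.integral_sum)
  qed
  have ind: "has_bochner_integral lborel (\<lambda>r. indicator {p i<..q i} r * indicator {p j<..q j} r * c i j) (o' i j * c i j)" for i j
  proof -
    have eq: "indicator {p i<..q i} r * indicator {p j<..q j} r = (indicator {max (p i) (p j)<..min (q i) (q j)} r :: real)" for r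
      by (auto simp: indicator_def)
    have "has_bochner_integral lborel (indicator {max (p i) (p j)<..min (q i) (q j)} :: real \<Rightarrow> real) (measure lborel {max (p i) (p j)<..min (q i) (q j)})"
    proof (rule has_bochner_integral_real_indicator)
      show "emeasure lborel {max (p i) (p j)<..min (q i) (q j)} < \<infinity>"
        by (cases "max (p i) (p j) \<le> min (q i) (q j)") auto
    qed simp
    also have "measure lborel {max (p i) (p j)<..min (q i) (q j)} = o' i j"
      unfolding o'_def by (cases "max (p i) (p j) \<le> min (q i) (q j)") auto
    finally show ?thesis unfolding eq by (intro has_bochner_integral_mult_left) auto
  qed
  have S: "has_bochner_integral lborel (\<lambda>r. expectation (\<lambda>\<omega>. (norm (step_process A p q \<xi> r \<omega>))\<^sup>2)) (\<Sum>i\<in>A. \<Sum>j\<in>A. o' i j * c i j)"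
    unfolding R by (intro has_bochner_integral_sum ind)
  have "(\<integral>\<^sup>+r. (\<integral>\<^sup>+\<omega>. ennreal ((norm (step_process A p q \<xi> r \<omega>))\<^sup>2) \<partial>M) \<partial>lborel) =
     (\<integral>\<^sup>+r. ennreal (expectation (\<lambda>\<omega>. (norm (step_process A p q \<xi> r \<omega>))\<^sup>2)) \<partial>lborel)"
    by (intro nn_integral_cong nn_integral_sq_integrable sq_integrable_step_process F)
  also have "\<dots> = ennreal (\<Sum>i\<in>A. \<Sum>j\<in>A. o' i j * c i j)"
    using S by (subst nn_integral_eq_integral) (auto simp: has_bochner_integral_iff)
  also have "\<dots> = (\<integral>\<^sup>+\<omega>. ennreal ((norm (step_integral A p q \<xi> \<omega>))\<^sup>2) \<partial>M)"
    unfolding L[symmetric] by (intro nn_integral_sq_integrable[symmetric] sq_integrable_step_integral F)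
  finally show ?thesis by simp
qed

lemma step_family_diff:
  assumes F: "step_family A p q \<xi>" and G: "step_family B p' q' \<xi>'"
  shows "step_family (A <+> B) (case_sum p p') (case_sum q q') (case_sum \<xi> (\<lambda>i \<omega>. - \<xi>' i \<omega>))"
    and "step_process (A <+> B) (case_sum p p') (case_sum q q') (case_sum \<xi> (\<lambda>i \<omega>. - \<xi>' i \<omega>)) r \<omega> =
      step_process A p q \<xi> r \<omega> - step_process B p' q' \<xi>' r \<omega>"
    and "step_integral (A <+> B) (case_sum p p') (case_sum q q') (case_sum \<xi> (\<lambda>i \<omega>. - \<xi>' i \<omega>)) \<omega> =
      step_integral A p q \<xi> \<omega> - step_integral B p' q' \<xi>' \<omega>"
proof -
  have fin: "finite A" "finite B" using assms by (auto simp: step_family_def)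
  show "step_family (A <+> B) (case_sum p p') (case_sum q q') (case_sum \<xi> (\<lambda>i \<omega>. - \<xi>' i \<omega>))"
    using assms sq_integrable_uminus[of M "\<xi>' _"] unfolding step_family_def by auto
  show "step_process (A <+> B) (case_sum p p') (case_sum q q') (case_sum \<xi> (\<lambda>i \<omega>. - \<xi>' i \<omega>)) r \<omega> =
      step_process A p q \<xi> r \<omega> - step_process B p' q' \<xi>' r \<omega>"
    unfolding step_process_def sum.Plus[OF fin] by (simp add: sum_negf del: indicator_simps)
  show "step_integral (A <+> B) (case_sum p p') (case_sum q q') (case_sum \<xi> (\<lambda>i \<omega>. - \<xi>' i \<omega>)) \<omega> =
      step_integral A p q \<xi> \<omega> - step_integral B p' q' \<xi>' \<omega>"
    unfolding step_integral_def sum.Plus[OF fin] by (simp add: sum_negf)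
qed

lemma step_isometry_diff:
  assumes F: "step_family A p q \<xi>" and G: "step_family B p' q' \<xi>'"
  shows "(\<integral>\<^sup>+\<omega>. ennreal ((norm (step_integral A p q \<xi> \<omega> - step_integral B p' q' \<xi>' \<omega>))\<^sup>2) \<partial>M) =
    (\<integral>\<^sup>+r. (\<integral>\<^sup>+\<omega>. ennreal ((norm (step_process A p q \<xi> r \<omega> - step_process B p' q' \<xi>' r \<omega>))\<^sup>2) \<partial>M) \<partial>lborel)"
  using step_isometry[OF step_family_diff(1)[OF F G]] unfolding step_family_diff(2,3)[OF F G] .

lemma step_integral_orthogonal:
  assumes F: "step_family A p q \<xi>" and s: "0 \<le> s" "\<And>i. i \<in> A \<Longrightarrow> s \<le> p i"
    and G: "G \<in> borel_measurable (\<F> s)" "sq_integrable M G"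
  shows "expectation (\<lambda>\<omega>. G \<omega> * step_integral A p q \<xi> \<omega>) = 0"
proof -
  have pq: "\<And>i. i \<in> A \<Longrightarrow> 0 \<le> p i" "\<And>i. i \<in> A \<Longrightarrow> p i \<le> q i"
    and x: "\<And>i. i \<in> A \<Longrightarrow> \<xi> i \<in> borel_measurable (\<F> (p i))" "\<And>i. i \<in> A \<Longrightarrow> sq_integrable M (\<xi> i)"
    using F by (auto simp: step_family_def)
  have "expectation (\<lambda>\<omega>. G \<omega> * step_integral A p q \<xi> \<omega>) = (\<Sum>i\<in>A. expectation (\<lambda>\<omega>. G \<omega> * (\<xi> i \<omega> \<bullet> (W (q i) \<omega> - W (p i) \<omega>))))"
    unfolding step_integral_def sum_distrib_left
    by (intro Bochner_Integration.integral_sum sq_integrable_times G sq_integrable_inner_increment pq x)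
  also have "\<dots> = 0"
    by (intro sum.neutral ballI expectation_mult_inner_increment pq x G measurable_aug_filtration_mono[OF G(1)] s)
  finally show ?thesis .
qed

text \<open>Coefficients that are not yet known at time \<open>b\<close> are dropped, because \<open>p' i\<close> may precede \<open>p i\<close>.\<close>

lemma step_family_truncate:
  assumes F: "step_family A p q \<xi>" and ab: "0 \<le> a" "a \<le> b"
  defines "p' \<equiv> \<lambda>i. min b (max a (p i))" and "q' \<equiv> \<lambda>i. min b (max a (q i))"
    and "\<xi>' \<equiv> \<lambda>i. if p i \<le> b then \<xi> i else (\<lambda>_. 0)"
  shows "step_family A p' q' \<xi>'"
    and "step_process A p' q' \<xi>' r \<omega> = indicator {a<..b} r *\<^sub>R step_process A p q \<xi> r \<omega>"
proof -
  have "\<xi>' i \<in> borel_measurable (\<F> (p' i))" if "i \<in> A" for i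
  proof (cases "p i \<le> b")
    case True
    then have "p i \<le> p' i" unfolding p'_def by auto
    moreover have "\<xi> i \<in> borel_measurable (\<F> (p i))" using F that by (auto simp: step_family_def)
    ultimately show ?thesis using True unfolding \<xi>'_def by (auto intro: measurable_aug_filtration_mono)
  qed (simp add: \<xi>'_def)
  moreover have "0 \<le> p' i \<and> p' i \<le> q' i \<and> sq_integrable M (\<xi>' i)" if "i \<in> A" for i
  proof -
    have "p i \<le> q i" "sq_integrable M (\<xi> i)" using F that by (auto simp: step_family_def)
    then show ?thesis using ab unfolding p'_def q'_def \<xi>'_def by auto
  qed
  moreover have "finite A" using F by (simp add: step_family_def)
  ultimately show "step_family A p' q' \<xi>'" unfolding step_family_def by simp
  show "step_process A p' q' \<xi>' r \<omega> = indicator {a<..b} r *\<^sub>R step_process A p q \<xi> r \<omega>"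
    unfolding step_process_def scaleR_sum_right
    by (intro sum.cong refl) (auto simp: p'_def q'_def \<xi>'_def indicator_def)
qed

lemma simple_integrand_step_family:
  assumes "simple_integrand M W a b n r \<xi>" "0 \<le> a"
  shows "step_family {..<n} r (\<lambda>i. r (Suc i)) \<xi>"
    and "simple_process n r \<xi> = step_process {..<n} r (\<lambda>i. r (Suc i)) \<xi>"
    and "simple_ito_integral W n r \<xi> = step_integral {..<n} r (\<lambda>i. r (Suc i)) \<xi>"
proof -
  have sq: "sq_integrable M (\<xi> i)" if "i < n" for i
  proof -
    have "\<xi> i \<in> borel_measurable M" "\<exists>K. \<forall>\<omega>\<in>space M. norm (\<xi> i \<omega>) \<le> K"
      using assms(1) that measurable_filtration[of "\<xi> i" "r i"] unfolding simple_integrand_def by blast+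
    then show ?thesis using sq_integrable_bounded[of "\<xi> i"] by metis
  qed
  show "step_family {..<n} r (\<lambda>i. r (Suc i)) \<xi>"
  proof -
    have "0 \<le> r i \<and> r i \<le> r (Suc i) \<and> \<xi> i \<in> borel_measurable (\<F> (r i)) \<and> sq_integrable M (\<xi> i)" if "i < n" for i
    proof -
      have "r i \<in> {a..b}" "r i < r (Suc i)" "\<xi> i \<in> borel_measurable (\<F> (r i))"
        using assms(1) that unfolding simple_integrand_def by auto
      then show ?thesis using sq[OF that] assms(2) by auto
    qed
    then show ?thesis unfolding step_family_def by auto
  qed
  show "simple_process n r \<xi> = step_process {..<n} r (\<lambda>i. r (Suc i)) \<xi>"
    "simple_ito_integral W n r \<xi> = step_integral {..<n} r (\<lambda>i. r (Suc i)) \<xi>"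
    by (auto simp: fun_eq_iff simple_process_def step_process_def simple_ito_integral_def step_integral_def)
qed

end

subsection \<open>Increments of Ito integrals\<close>

lemma ennreal_le_of_tendsto_zero:
  fixes x c :: ennreal
  assumes "\<And>k::nat. x \<le> c + y k" "y \<longlonglongrightarrow> 0"
  shows "x \<le> c"
proof (rule LIMSEQ_le_const)
  show "(\<lambda>k. c + y k) \<longlonglongrightarrow> c" using tendsto_add[OF tendsto_const assms(2), of c] by simp
  show "\<exists>N. \<forall>k\<ge>N. x \<le> c + y k" using assms(1) by simp
qed

lemma tendsto_cmult_ennreal_zero:
  fixes y :: "nat \<Rightarrow> ennreal"
  assumes "y \<longlonglongrightarrow> 0" "c < \<infinity>" shows "(\<lambda>k. c * y k) \<longlonglongrightarrow> 0"
  using tendsto_mult_ennreal[OF tendsto_const[of c] assms(1)] assms(2) by simp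

lemma ennreal_tendsto_zero_le:
  fixes x y :: "nat \<Rightarrow> ennreal"
  assumes "\<And>k. x k \<le> y k" "y \<longlonglongrightarrow> 0"
  shows "x \<longlonglongrightarrow> 0"
  by (rule tendsto_sandwich[OF _ _ tendsto_const assms(2)]) (simp_all add: assms(1))

context brownian begin

abbreviation msq :: "('a \<Rightarrow> 'c::real_normed_vector) \<Rightarrow> ennreal" where
  "msq f \<equiv> (\<integral>\<^sup>+\<omega>. ennreal ((norm (f \<omega>))\<^sup>2) \<partial>M)"

definition jointly_measurable :: "(real \<Rightarrow> 'a \<Rightarrow> 'c::euclidean_space) \<Rightarrow> bool" where
  "jointly_measurable H \<longleftrightarrow> (\<lambda>(r, \<omega>). H r \<omega>) \<in> borel_measurable (lborel \<Otimes>\<^sub>M M)"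

sublocale LM: pair_sigma_finite "lborel :: real measure" M
  by (simp add: pair_sigma_finite_def sigma_finite_lborel sigma_finite_measure_axioms)

lemma jointly_measurableD: "jointly_measurable H \<Longrightarrow> (\<lambda>(r, \<omega>). H r \<omega>) \<in> borel_measurable (lborel \<Otimes>\<^sub>M M)"
  by (simp add: jointly_measurable_def)

lemma jointly_measurable_section: "jointly_measurable H \<Longrightarrow> H r \<in> borel_measurable M"
  using measurable_compose[OF measurable_Pair1' jointly_measurableD, of r H] by simp

lemma jointly_measurable_path: "jointly_measurable H \<Longrightarrow> \<omega> \<in> space M \<Longrightarrow> (\<lambda>r. H r \<omega>) \<in> borel_measurable lborel"
  using measurable_compose[OF measurable_Pair2' jointly_measurableD, of \<omega> H] by simp

lemma jointly_measurable_diff: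
  "jointly_measurable H \<Longrightarrow> jointly_measurable K \<Longrightarrow> jointly_measurable (\<lambda>r \<omega>. H r \<omega> - K r \<omega>)"
  unfolding jointly_measurable_def by (simp add: case_prod_beta')

lemma jointly_measurable_const_time:
  "f \<in> borel_measurable M \<Longrightarrow> jointly_measurable (\<lambda>r. f)"
  unfolding jointly_measurable_def by simp

lemma jointly_measurable_indicator:
  "jointly_measurable H \<Longrightarrow> A \<in> sets borel \<Longrightarrow> jointly_measurable (\<lambda>r \<omega>. indicator A r *\<^sub>R H r \<omega>)"
  unfolding jointly_measurable_def by (simp add: case_prod_beta')

lemma jointly_measurable_step_process:
  "step_family A p q \<xi> \<Longrightarrow> jointly_measurable (step_process A p q \<xi>)"
  unfolding jointly_measurable_def by (rule measurable_step_process)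

lemma measurable_msq [measurable]:
  "jointly_measurable H \<Longrightarrow> (\<lambda>r. msq (H r)) \<in> borel_measurable lborel"
proof -
  assume "jointly_measurable H"
  then have [measurable]: "(\<lambda>(r, \<omega>). H r \<omega>) \<in> borel_measurable (lborel \<Otimes>\<^sub>M M)" by (rule jointly_measurableD)
  show ?thesis by measurable
qed

lemma Fubini_msq:
  assumes "jointly_measurable H" "A \<in> sets borel"
  shows "(\<integral>\<^sup>+\<omega>. (\<integral>\<^sup>+r\<in>A. ennreal ((norm (H r \<omega>))\<^sup>2) \<partial>lborel) \<partial>M) = (\<integral>\<^sup>+r\<in>A. msq (H r) \<partial>lborel)"
proof -
  have [measurable]: "(\<lambda>(r, \<omega>). H r \<omega>) \<in> borel_measurable (lborel \<Otimes>\<^sub>M M)" using assms(1) by (rule jointly_measurableD)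
  note jointly_measurable_section[OF assms(1), measurable] assms(2)[measurable]
  have "(\<integral>\<^sup>+\<omega>. (\<integral>\<^sup>+r\<in>A. ennreal ((norm (H r \<omega>))\<^sup>2) \<partial>lborel) \<partial>M) =
     (\<integral>\<^sup>+r. (\<integral>\<^sup>+\<omega>. ennreal ((norm (H r \<omega>))\<^sup>2) * indicator A r \<partial>M) \<partial>lborel)"
    by (rule LM.Fubini') measurable
  also have "\<dots> = (\<integral>\<^sup>+r\<in>A. msq (H r) \<partial>lborel)"
    by (intro nn_integral_cong nn_integral_multc) measurable
  finally show ?thesis .
qed

lemma msq_add_le:
  fixes f g :: "'a \<Rightarrow> 'c::euclidean_space"
  assumes "f \<in> borel_measurable M" "g \<in> borel_measurable M"
  shows "msq (\<lambda>\<omega>. f \<omega> + g \<omega>) \<le> 2 * msq f + 2 * msq g"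
  by (rule nn_integral_sq_add_le[OF assms])

lemma msq_diff_le:
  fixes f g :: "'a \<Rightarrow> 'c::euclidean_space"
  assumes "f \<in> borel_measurable M" "g \<in> borel_measurable M"
  shows "msq (\<lambda>\<omega>. f \<omega> - g \<omega>) \<le> 2 * msq f + 2 * msq g"
  using nn_integral_sq_add_le[OF assms(1) borel_measurable_uminus[OF assms(2)]] by simp

lemma msq_eq_0D:
  fixes f :: "'a \<Rightarrow> 'c::euclidean_space"
  assumes [measurable]: "f \<in> borel_measurable M" and "msq f = 0" shows "AE \<omega> in M. f \<omega> = 0"
proof -
  have "AE \<omega> in M. ennreal ((norm (f \<omega>))\<^sup>2) = 0"
    using assms(2) by (rule nn_integral_0_iff_AE[THEN iffD1, rotated]) measurable
  then show ?thesis by eventually_elim simp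
qed

lemma int_msq_add_le:
  assumes H: "jointly_measurable H" and K: "jointly_measurable K" and A: "A \<in> sets borel"
  shows "(\<integral>\<^sup>+r\<in>A. msq (\<lambda>\<omega>. H r \<omega> + K r \<omega>) \<partial>lborel) \<le>
    2 * (\<integral>\<^sup>+r\<in>A. msq (H r) \<partial>lborel) + 2 * (\<integral>\<^sup>+r\<in>A. msq (K r) \<partial>lborel)"
proof -
  note [measurable] = measurable_msq[OF H] measurable_msq[OF K] A
  have "(\<integral>\<^sup>+r\<in>A. msq (\<lambda>\<omega>. H r \<omega> + K r \<omega>) \<partial>lborel) \<le> (\<integral>\<^sup>+r. 2 * (msq (H r) * indicator A r) + 2 * (msq (K r) * indicator A r) \<partial>lborel)"
  proof (rule nn_integral_mono)
    fix r
    show "msq (\<lambda>\<omega>. H r \<omega> + K r \<omega>) * indicator A r \<le> 2 * (msq (H r) * indicator A r) + 2 * (msq (K r) * indicator A r)"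
      using msq_add_le[OF jointly_measurable_section[OF H] jointly_measurable_section[OF K], of r r]
      by (auto simp: indicator_def)
  qed
  also have "\<dots> = 2 * (\<integral>\<^sup>+r\<in>A. msq (H r) \<partial>lborel) + 2 * (\<integral>\<^sup>+r\<in>A. msq (K r) \<partial>lborel)"
    by (simp add: nn_integral_add nn_integral_cmult)
  finally show ?thesis .
qed

lemma int_msq_diff_le:
  assumes H: "jointly_measurable H" and K: "jointly_measurable K" and A: "A \<in> sets borel"
  shows "(\<integral>\<^sup>+r\<in>A. msq (\<lambda>\<omega>. H r \<omega> - K r \<omega>) \<partial>lborel) \<le>
    2 * (\<integral>\<^sup>+r\<in>A. msq (H r) \<partial>lborel) + 2 * (\<integral>\<^sup>+r\<in>A. msq (K r) \<partial>lborel)"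
proof -
  have "jointly_measurable (\<lambda>r \<omega>. - K r \<omega>)" using K unfolding jointly_measurable_def by (simp add: case_prod_beta')
  from int_msq_add_le[OF H this A] show ?thesis by simp
qed

definition step_approx :: "real \<Rightarrow> real \<Rightarrow> (real \<Rightarrow> 'a \<Rightarrow> real ^ 'd) \<Rightarrow> ('a \<Rightarrow> real) \<Rightarrow> (nat \<Rightarrow> nat)
    \<Rightarrow> (nat \<Rightarrow> nat \<Rightarrow> real) \<Rightarrow> (nat \<Rightarrow> nat \<Rightarrow> real) \<Rightarrow> (nat \<Rightarrow> nat \<Rightarrow> 'a \<Rightarrow> real ^ 'd) \<Rightarrow> bool" where
  "step_approx s t H m n p q \<xi> \<longleftrightarrow> m \<in> borel_measurable M \<and>
    (\<forall>k. step_family {..<n k} (p k) (q k) (\<xi> k)) \<and> (\<forall>k. \<forall>i<n k. s \<le> p k i \<and> q k i \<le> t) \<and>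
    (\<lambda>k. \<integral>\<^sup>+r\<in>{s<..t}. msq (\<lambda>\<omega>. H r \<omega> - step_process {..<n k} (p k) (q k) (\<xi> k) r \<omega>) \<partial>lborel) \<longlonglongrightarrow> 0 \<and>
    (\<lambda>k. msq (\<lambda>\<omega>. m \<omega> - step_integral {..<n k} (p k) (q k) (\<xi> k) \<omega>)) \<longlonglongrightarrow> 0"

text \<open>
  \<open>m\<close> is a version of the integral of \<open>H\<close> over \<open>(s, t]\<close>. Unlike in \<open>has_ito_integral\<close>, the intervals of the
  approximating step families may overlap and the coefficients need only be square integrable.
\<close>

definition ito_increment :: "real \<Rightarrow> real \<Rightarrow> (real \<Rightarrow> 'a \<Rightarrow> real ^ 'd) \<Rightarrow> ('a \<Rightarrow> real) \<Rightarrow> bool" where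
  "ito_increment s t H m \<longleftrightarrow> (\<exists>n p q \<xi>. step_approx s t H m n p q \<xi>)"

lemma step_approxD:
  assumes "step_approx s t H m n p q \<xi>"
  shows "m \<in> borel_measurable M" "\<And>k. step_family {..<n k} (p k) (q k) (\<xi> k)"
    "\<And>k i. i < n k \<Longrightarrow> s \<le> p k i" "\<And>k i. i < n k \<Longrightarrow> q k i \<le> t"
    "(\<lambda>k. \<integral>\<^sup>+r\<in>{s<..t}. msq (\<lambda>\<omega>. H r \<omega> - step_process {..<n k} (p k) (q k) (\<xi> k) r \<omega>) \<partial>lborel) \<longlonglongrightarrow> 0"
    "(\<lambda>k. msq (\<lambda>\<omega>. m \<omega> - step_integral {..<n k} (p k) (q k) (\<xi> k) \<omega>)) \<longlonglongrightarrow> 0"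
  using assms unfolding step_approx_def by blast+

lemma step_approx_outside:
  assumes "step_approx s t H m n p q \<xi>" "r \<notin> {s<..t}"
  shows "step_process {..<n k} (p k) (q k) (\<xi> k) r \<omega> = 0"
proof -
  have "indicator {p k i<..q k i} r = (0::real)" if "i < n k" for i
    using step_approxD(3,4)[OF assms(1) that] assms(2) by (auto simp: indicator_def)
  then show ?thesis unfolding step_process_def by simp
qed

text \<open>A coefficient known at \<open>s\<close> is itself a step family with a single interval,
  so the isometry compares it with the approximations of \<open>H\<close>. The factor 4 is the price
  of two triangle inequalities for squares.\<close>

lemma ito_increment_msq_le:
  assumes I: "ito_increment s t H m" and H: "jointly_measurable H" and st: "0 \<le> s" "s \<le> t"
    and x: "\<xi> \<in> borel_measurable (\<F> s)" "sq_integrable M \<xi>"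
  shows "msq (\<lambda>\<omega>. m \<omega> - \<xi> \<omega> \<bullet> (W t \<omega> - W s \<omega>)) \<le> 4 * (\<integral>\<^sup>+r\<in>{s<..t}. msq (\<lambda>\<omega>. H r \<omega> - \<xi> \<omega>) \<partial>lborel)"
proof -
  obtain n p q e where A: "step_approx s t H m n p q e" using I unfolding ito_increment_def by blast
  note F = step_approxD(2)[OF A] and A1 = step_approxD(5)[OF A] and A2 = step_approxD(6)[OF A]
    and m[measurable] = step_approxD(1)[OF A]
  let ?P = "\<lambda>k. step_process {..<n k} (p k) (q k) (e k)" and ?S = "\<lambda>k. step_integral {..<n k} (p k) (q k) (e k)"
  have X: "step_family {0::nat} (\<lambda>_. s) (\<lambda>_. t) (\<lambda>_. \<xi>)" using st x by (simp add: step_family_def)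
  have X2: "step_process {0::nat} (\<lambda>_. s) (\<lambda>_. t) (\<lambda>_. \<xi>) r \<omega> = indicator {s<..t} r *\<^sub>R \<xi> \<omega>" for r \<omega>
    by (simp add: step_process_def)
  have X3: "step_integral {0::nat} (\<lambda>_. s) (\<lambda>_. t) (\<lambda>_. \<xi>) \<omega> = \<xi> \<omega> \<bullet> (W t \<omega> - W s \<omega>)" for \<omega>
    by (simp add: step_integral_def)
  have xm: "\<xi> \<in> borel_measurable M" using x(2) by (rule sq_integrable_measurable)
  note Xm = sq_integrable_measurable[OF sq_integrable_step_integral[OF X], unfolded X3[abs_def]]
  note Sm = sq_integrable_measurable[OF sq_integrable_step_integral[OF F]]
  note out = step_approx_outside[OF A]
  let ?a = "\<lambda>k. \<integral>\<^sup>+r\<in>{s<..t}. msq (\<lambda>\<omega>. H r \<omega> - ?P k r \<omega>) \<partial>lborel"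
  let ?c = "\<integral>\<^sup>+r\<in>{s<..t}. msq (\<lambda>\<omega>. H r \<omega> - \<xi> \<omega>) \<partial>lborel"
  have "msq (\<lambda>\<omega>. m \<omega> - \<xi> \<omega> \<bullet> (W t \<omega> - W s \<omega>)) \<le> 4 * ?c + (2 * msq (\<lambda>\<omega>. m \<omega> - ?S k \<omega>) + 4 * ?a k)" for k
  proof -
    have "msq (\<lambda>\<omega>. m \<omega> - \<xi> \<omega> \<bullet> (W t \<omega> - W s \<omega>)) = msq (\<lambda>\<omega>. (m \<omega> - ?S k \<omega>) + (?S k \<omega> - \<xi> \<omega> \<bullet> (W t \<omega> - W s \<omega>)))"
      by simp
    also have "\<dots> \<le> 2 * msq (\<lambda>\<omega>. m \<omega> - ?S k \<omega>) + 2 * msq (\<lambda>\<omega>. ?S k \<omega> - \<xi> \<omega> \<bullet> (W t \<omega> - W s \<omega>))"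
      by (intro msq_add_le borel_measurable_diff m Sm Xm)
    also have "msq (\<lambda>\<omega>. ?S k \<omega> - \<xi> \<omega> \<bullet> (W t \<omega> - W s \<omega>)) = (\<integral>\<^sup>+r. msq (\<lambda>\<omega>. ?P k r \<omega> - indicator {s<..t} r *\<^sub>R \<xi> \<omega>) \<partial>lborel)"
      using step_isometry_diff[OF F X, of k] unfolding X2 X3 .
    also have "\<dots> = (\<integral>\<^sup>+r\<in>{s<..t}. msq (\<lambda>\<omega>. ?P k r \<omega> - \<xi> \<omega>) \<partial>lborel)"
      by (rule nn_integral_cong) (auto simp: out indicator_def)
    also have "\<dots> = (\<integral>\<^sup>+r\<in>{s<..t}. msq (\<lambda>\<omega>. (H r \<omega> - \<xi> \<omega>) - (H r \<omega> - ?P k r \<omega>)) \<partial>lborel)"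
      by simp
    also have "\<dots> \<le> 2 * ?c + 2 * ?a k"
      by (intro int_msq_diff_le jointly_measurable_diff H jointly_measurable_const_time xm jointly_measurable_step_process F) simp
    finally have "msq (\<lambda>\<omega>. m \<omega> - \<xi> \<omega> \<bullet> (W t \<omega> - W s \<omega>)) \<le> 2 * msq (\<lambda>\<omega>. m \<omega> - ?S k \<omega>) + 2 * (2 * ?c + 2 * ?a k)"
      by (simp add: add_left_mono mult_left_mono)
    also have "\<dots> = 4 * ?c + (2 * msq (\<lambda>\<omega>. m \<omega> - ?S k \<omega>) + 4 * ?a k)"
      by (simp add: distrib_left mult.assoc[symmetric] ac_simps)
    finally show ?thesis .
  qed
  moreover have "(\<lambda>k. 2 * msq (\<lambda>\<omega>. m \<omega> - ?S k \<omega>) + 4 * ?a k) \<longlonglongrightarrow> 0"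
    using tendsto_add[OF tendsto_cmult_ennreal_zero[OF A2, of 2] tendsto_cmult_ennreal_zero[OF A1, of 4]] by simp
  ultimately show ?thesis by (rule ennreal_le_of_tendsto_zero)
qed

text \<open>One member of the sequence at distance below 1 already forces a finite second
  moment.\<close>

lemma sq_integrable_of_approx:
  fixes m :: "'a \<Rightarrow> real"
  assumes m: "m \<in> borel_measurable M" and S: "\<And>k::nat. sq_integrable M (S k)"
    and A: "(\<lambda>k. msq (\<lambda>\<omega>. m \<omega> - S k \<omega>)) \<longlonglongrightarrow> 0"
  shows "sq_integrable M m"
proof -
  have "eventually (\<lambda>k. msq (\<lambda>\<omega>. m \<omega> - S k \<omega>) < 1) sequentially"
    using A by (rule order_tendstoD) simp
  then obtain k where "msq (\<lambda>\<omega>. m \<omega> - S k \<omega>) < 1" by (auto simp: eventually_sequentially)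
  then have "msq (\<lambda>\<omega>. m \<omega> - S k \<omega>) < \<infinity>" by (rule order_less_trans) simp
  then have "sq_integrable M (\<lambda>\<omega>. m \<omega> - S k \<omega>)"
    using m sq_integrable_measurable[OF S, of k] by (simp add: sq_integrable_iff_nn)
  from sq_integrable_add[OF this S[of k]] show ?thesis by simp
qed

lemma ito_increment_sq_integrable:
  assumes I: "ito_increment s t H m" shows "sq_integrable M m"
proof -
  obtain n p q e where A: "step_approx s t H m n p q e" using I unfolding ito_increment_def by blast
  note F = step_approxD(2)[OF A] and A1 = step_approxD(5)[OF A] and A2 = step_approxD(6)[OF A]
    and m[measurable] = step_approxD(1)[OF A]
  show ?thesis by (rule sq_integrable_of_approx[OF m sq_integrable_step_integral[OF F] A2])
qed

text \<open>Each approximating step integral starts after \<open>s\<close>, so it is orthogonal to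
  \<open>G\<close>. Cauchy-Schwarz carries this to the limit: the expectation is bounded by the norm
  of \<open>G\<close> times the approximation error.\<close>

lemma ito_increment_orthogonal:
  assumes I: "ito_increment s t H m" and st: "0 \<le> s"
    and G: "G \<in> borel_measurable (\<F> s)" "sq_integrable M G"
  shows "expectation (\<lambda>\<omega>. G \<omega> * m \<omega>) = 0"
proof -
  obtain n p q e where A: "step_approx s t H m n p q e" using I unfolding ito_increment_def by blast
  note F = step_approxD(2)[OF A] and A1 = step_approxD(5)[OF A] and A2 = step_approxD(6)[OF A]
    and m[measurable] = step_approxD(1)[OF A]
  let ?S = "\<lambda>k. step_integral {..<n k} (p k) (q k) (e k)"
  note S = sq_integrable_step_integral[OF F]
  note mi = ito_increment_sq_integrable[OF I]
  have d: "sq_integrable M (\<lambda>\<omega>. m \<omega> - ?S k \<omega>)" for k by (intro sq_integrable_diff mi S)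
  have "ennreal ((expectation (\<lambda>\<omega>. G \<omega> * m \<omega>))\<^sup>2) \<le> 0 + ennreal (expectation (\<lambda>\<omega>. (G \<omega>)\<^sup>2)) * msq (\<lambda>\<omega>. m \<omega> - ?S k \<omega>)" for k
  proof -
    have "expectation (\<lambda>\<omega>. G \<omega> * (m \<omega> - ?S k \<omega>)) + expectation (\<lambda>\<omega>. G \<omega> * ?S k \<omega>) =
        expectation (\<lambda>\<omega>. G \<omega> * (m \<omega> - ?S k \<omega>) + G \<omega> * ?S k \<omega>)"
      by (rule Bochner_Integration.integral_add[symmetric]) (intro sq_integrable_times G d S)+
    also have "\<dots> = expectation (\<lambda>\<omega>. G \<omega> * m \<omega>)" by (simp add: right_diff_distrib)
    finally have "expectation (\<lambda>\<omega>. G \<omega> * m \<omega>) = expectation (\<lambda>\<omega>. G \<omega> * (m \<omega> - ?S k \<omega>))"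
      using step_integral_orthogonal[OF F st step_approxD(3)[OF A] G, of k] by simp
    then have "(expectation (\<lambda>\<omega>. G \<omega> * m \<omega>))\<^sup>2 \<le> expectation (\<lambda>\<omega>. (G \<omega>)\<^sup>2) * expectation (\<lambda>\<omega>. (m \<omega> - ?S k \<omega>)\<^sup>2)"
      using integral_mult_sq_le[OF G(2) d] by simp
    then have "ennreal ((expectation (\<lambda>\<omega>. G \<omega> * m \<omega>))\<^sup>2) \<le> ennreal (expectation (\<lambda>\<omega>. (G \<omega>)\<^sup>2) * expectation (\<lambda>\<omega>. (m \<omega> - ?S k \<omega>)\<^sup>2))"
      by (rule ennreal_leI)
    also have "\<dots> = ennreal (expectation (\<lambda>\<omega>. (G \<omega>)\<^sup>2)) * msq (\<lambda>\<omega>. m \<omega> - ?S k \<omega>)"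
      using nn_integral_sq_integrable[OF d, of k] by (simp add: ennreal_mult)
    finally show ?thesis by simp
  qed
  then have "ennreal ((expectation (\<lambda>\<omega>. G \<omega> * m \<omega>))\<^sup>2) \<le> 0"
    by (rule ennreal_le_of_tendsto_zero) (rule tendsto_cmult_ennreal_zero[OF A2], simp)
  then show ?thesis by (simp add: ennreal_eq_0_iff)
qed

lemma nn_integral_lborel_drop_endpoint:
  fixes f :: "real \<Rightarrow> ennreal"
  shows "(\<integral>\<^sup>+r\<in>{a..b}. f r \<partial>lborel) = (\<integral>\<^sup>+r\<in>{a<..b}. f r \<partial>lborel)"
proof (rule nn_integral_cong_AE)
  have "AE r in lborel. r \<noteq> a" by (rule AE_lborel_singleton)
  then show "AE r in lborel. f r * indicator {a..b} r = f r * indicator {a<..b} r"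
    by eventually_elim (auto simp: indicator_def)
qed

text \<open>Fubini turns the expected path integral into an integral of second moments, and the left
  endpoint is a null set.\<close>

lemma has_ito_integral_ito_increment:
  assumes I: "has_ito_integral M W a b H I" and H: "jointly_measurable H" and a: "0 \<le> a"
  shows "ito_increment a b H I"
proof -
  obtain n r \<xi> where S: "\<forall>k::nat. simple_integrand M W a b (n k) (r k) (\<xi> k)"
    and A: "(\<lambda>k. \<integral>\<^sup>+\<omega>. (\<integral>\<^sup>+s\<in>{a..b}. ennreal ((norm (H s \<omega> - simple_process (n k) (r k) (\<xi> k) s \<omega>))\<^sup>2) \<partial>lborel) \<partial>M) \<longlonglongrightarrow> 0"
    and B: "(\<lambda>k. \<integral>\<^sup>+\<omega>. ennreal ((I \<omega> - simple_ito_integral W (n k) (r k) (\<xi> k) \<omega>)\<^sup>2) \<partial>M) \<longlonglongrightarrow> 0"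
    using I unfolding has_ito_integral_def by blast
  note F = simple_integrand_step_family[OF S[rule_format] a]
  have "(\<integral>\<^sup>+\<omega>. (\<integral>\<^sup>+s\<in>{a..b}. ennreal ((norm (H s \<omega> - simple_process (n k) (r k) (\<xi> k) s \<omega>))\<^sup>2) \<partial>lborel) \<partial>M) =
     (\<integral>\<^sup>+s\<in>{a<..b}. msq (\<lambda>\<omega>. H s \<omega> - step_process {..<n k} (r k) (\<lambda>i. r k (Suc i)) (\<xi> k) s \<omega>) \<partial>lborel)" for k
    unfolding nn_integral_lborel_drop_endpoint[symmetric] F(2)
    by (intro Fubini_msq jointly_measurable_diff H jointly_measurable_step_process F) simp
  with A have 1: "(\<lambda>k. \<integral>\<^sup>+s\<in>{a<..b}. msq (\<lambda>\<omega>. H s \<omega> - step_process {..<n k} (r k) (\<lambda>i. r k (Suc i)) (\<xi> k) s \<omega>) \<partial>lborel) \<longlonglongrightarrow> 0"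
    by simp
  have 2: "(\<lambda>k. msq (\<lambda>\<omega>. I \<omega> - step_integral {..<n k} (r k) (\<lambda>i. r k (Suc i)) (\<xi> k) \<omega>)) \<longlonglongrightarrow> 0"
    using B unfolding F(3) by simp
  have 3: "a \<le> r k i \<and> r k (Suc i) \<le> b" if "i < n k" for k i
  proof -
    have "r k i \<in> {a..b}" "r k (Suc i) \<in> {a..b}" using S[rule_format, of k] that unfolding simple_integrand_def by auto
    then show ?thesis by simp
  qed
  have "step_approx a b H I n r (\<lambda>k i. r k (Suc i)) \<xi>"
    unfolding step_approx_def using I[unfolded has_ito_integral_def, THEN conjunct1] F(1) 1 2 3 by simp
  then show ?thesis unfolding ito_increment_def by blast
qed

text \<open>The condition on the intervals covers integrals from \<open>0\<close> as well as
  integrals up to \<open>T\<close>. The approximation of \<open>I\<close>, cut down to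
  \<open>{s<..t}\<close>, approximates the difference: what was cut off and the approximation of
  \<open>I'\<close> both live on \<open>{a'<..b'}\<close> and approximate the same \<open>H\<close>
  there.\<close>

lemma ito_increment_diff:
  assumes I: "ito_increment a b H I" and I': "ito_increment a' b' H I'"
    and H: "jointly_measurable H" and st: "0 \<le> s" "s \<le> t"
    and split: "{a<..b} = {a'<..b'} \<union> {s<..t}" "{a'<..b'} \<inter> {s<..t} = {}"
  shows "ito_increment s t H (\<lambda>\<omega>. I \<omega> - I' \<omega>)"
proof -
  obtain n p q e where U': "step_approx a b H I n p q e" using I unfolding ito_increment_def by blast
  obtain n' p' q' e' where V': "step_approx a' b' H I' n' p' q' e'" using I' unfolding ito_increment_def by blast
  note U = step_approxD(2)[OF U'] step_approx_outside[OF U'] step_approxD(5,6)[OF U']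
  note V = step_approxD(2)[OF V'] step_approx_outside[OF V'] step_approxD(5,6)[OF V']
  note [measurable] = step_approxD(1)[OF U'] step_approxD(1)[OF V']
  let ?U = "\<lambda>k. step_process {..<n k} (p k) (q k) (e k)" and ?IU = "\<lambda>k. step_integral {..<n k} (p k) (q k) (e k)"
  let ?V = "\<lambda>k. step_process {..<n' k} (p' k) (q' k) (e' k)" and ?IV = "\<lambda>k. step_integral {..<n' k} (p' k) (q' k) (e' k)"
  define P where "P k i = min t (max s (p k i))" for k i
  define Q where "Q k i = min t (max s (q k i))" for k i
  define X where "X k i = (if p k i \<le> t then e k i else (\<lambda>_. 0))" for k i
  have T: "step_family {..<n k} (P k) (Q k) (X k)"
    "step_process {..<n k} (P k) (Q k) (X k) r \<omega> = indicator {s<..t} r *\<^sub>R ?U k r \<omega>" for k r \<omega>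
    using step_family_truncate[OF U(1)[of k] st] unfolding P_def[abs_def] Q_def[abs_def] X_def[abs_def] by auto
  let ?E = "\<lambda>k. step_process {..<n k} (P k) (Q k) (X k)" and ?IE = "\<lambda>k. step_integral {..<n k} (P k) (Q k) (X k)"
  note [measurable] = sq_integrable_measurable[OF sq_integrable_step_integral[OF U(1)]]
    sq_integrable_measurable[OF sq_integrable_step_integral[OF V(1)]]
    sq_integrable_measurable[OF sq_integrable_step_integral[OF T(1)]]
  let ?u = "\<lambda>k. \<integral>\<^sup>+r\<in>{a<..b}. msq (\<lambda>\<omega>. H r \<omega> - ?U k r \<omega>) \<partial>lborel"
  let ?v = "\<lambda>k. \<integral>\<^sup>+r\<in>{a'<..b'}. msq (\<lambda>\<omega>. H r \<omega> - ?V k r \<omega>) \<partial>lborel"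
  \<comment> \<open>By the isometry this is the distance of two approximations of \<open>H\<close>
    on \<open>{a'<..b'}\<close>; elsewhere the three step processes cancel or vanish.\<close>
  have rest: "msq (\<lambda>\<omega>. ?IU k \<omega> - ?IE k \<omega> - ?IV k \<omega>) \<le> 2 * ?u k + 2 * ?v k" for k
  proof -
    note D = step_family_diff[OF U(1)[of k] T(1)[of k]]
    have "msq (\<lambda>\<omega>. ?IU k \<omega> - ?IE k \<omega> - ?IV k \<omega>) = (\<integral>\<^sup>+r. msq (\<lambda>\<omega>. ?U k r \<omega> - ?E k r \<omega> - ?V k r \<omega>) \<partial>lborel)"
      using step_isometry_diff[OF D(1) V(1)[of k]] by (simp only: D(2,3))
    also have "\<dots> = (\<integral>\<^sup>+r\<in>{a'<..b'}. msq (\<lambda>\<omega>. (H r \<omega> - ?V k r \<omega>) - (H r \<omega> - ?U k r \<omega>)) \<partial>lborel)"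
    proof (rule nn_integral_cong, goal_cases)
      case (1 r)
      show ?case
      proof (cases "r \<in> {a'<..b'}")
        case True
        then have "r \<notin> {s<..t}" using split by auto
        then show ?thesis using True unfolding T(2) by simp
      next
        case False
        then have "r \<in> {s<..t} \<or> r \<notin> {a<..b}" using split by auto
        then show ?thesis using False V(2)[OF False] U(2)[of r] unfolding T(2) by (auto simp: indicator_def)
      qed
    qed
    also have "\<dots> \<le> 2 * ?v k + 2 * (\<integral>\<^sup>+r\<in>{a'<..b'}. msq (\<lambda>\<omega>. H r \<omega> - ?U k r \<omega>) \<partial>lborel)"
      by (intro int_msq_diff_le jointly_measurable_diff H jointly_measurable_step_process U V) simp
    also have "\<dots> \<le> 2 * ?v k + 2 * ?u k"
      using split by (intro add_left_mono mult_left_mono nn_set_integral_set_mono) auto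
    finally show ?thesis by (simp add: add.commute)
  qed
  have b1: "msq (\<lambda>\<omega>. (I \<omega> - I' \<omega>) - ?IE k \<omega>) \<le>
     4 * msq (\<lambda>\<omega>. I \<omega> - ?IU k \<omega>) + 4 * msq (\<lambda>\<omega>. I' \<omega> - ?IV k \<omega>) + (4 * ?u k + 4 * ?v k)" for k
  proof -
    have eq: "(I \<omega> - I' \<omega>) - ?IE k \<omega> = ((I \<omega> - ?IU k \<omega>) - (I' \<omega> - ?IV k \<omega>)) + (?IU k \<omega> - ?IE k \<omega> - ?IV k \<omega>)" for \<omega>
      by linarith
    have "msq (\<lambda>\<omega>. (I \<omega> - I' \<omega>) - ?IE k \<omega>) =
      msq (\<lambda>\<omega>. ((I \<omega> - ?IU k \<omega>) - (I' \<omega> - ?IV k \<omega>)) + (?IU k \<omega> - ?IE k \<omega> - ?IV k \<omega>))"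
      by (simp only: eq)
    also have "\<dots> \<le> 2 * msq (\<lambda>\<omega>. (I \<omega> - ?IU k \<omega>) - (I' \<omega> - ?IV k \<omega>)) + 2 * msq (\<lambda>\<omega>. ?IU k \<omega> - ?IE k \<omega> - ?IV k \<omega>)"
      by (rule msq_add_le) measurable
    also have "\<dots> \<le> 2 * (2 * msq (\<lambda>\<omega>. I \<omega> - ?IU k \<omega>) + 2 * msq (\<lambda>\<omega>. I' \<omega> - ?IV k \<omega>)) + 2 * (2 * ?u k + 2 * ?v k)"
      by (intro add_mono mult_left_mono rest msq_diff_le) auto
    also have "\<dots> = 4 * msq (\<lambda>\<omega>. I \<omega> - ?IU k \<omega>) + 4 * msq (\<lambda>\<omega>. I' \<omega> - ?IV k \<omega>) + (4 * ?u k + 4 * ?v k)"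
      by (simp add: distrib_left mult.assoc[symmetric])
    finally show ?thesis .
  qed
  have b2: "(\<lambda>k. 4 * msq (\<lambda>\<omega>. I \<omega> - ?IU k \<omega>) + 4 * msq (\<lambda>\<omega>. I' \<omega> - ?IV k \<omega>) + (4 * ?u k + 4 * ?v k)) \<longlonglongrightarrow> 0 + 0 + (0 + 0)"
    by (intro tendsto_add tendsto_cmult_ennreal_zero U V) auto
  have lim1: "(\<lambda>k. msq (\<lambda>\<omega>. (I \<omega> - I' \<omega>) - ?IE k \<omega>)) \<longlonglongrightarrow> 0"
    by (rule ennreal_tendsto_zero_le[OF b1]) (use b2 in simp)
  have "(\<integral>\<^sup>+r\<in>{s<..t}. msq (\<lambda>\<omega>. H r \<omega> - ?E k r \<omega>) \<partial>lborel) \<le> ?u k" for k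
    unfolding T(2) using split by (intro nn_integral_mono) (auto simp: indicator_def)
  then have lim2: "(\<lambda>k. \<integral>\<^sup>+r\<in>{s<..t}. msq (\<lambda>\<omega>. H r \<omega> - ?E k r \<omega>) \<partial>lborel) \<longlonglongrightarrow> 0"
    by (rule ennreal_tendsto_zero_le[OF _ U(3)])
  have PQ: "s \<le> P k i \<and> Q k i \<le> t" for k i using st unfolding P_def Q_def by auto
  have "step_approx s t H (\<lambda>\<omega>. I \<omega> - I' \<omega>) n P Q X"
    unfolding step_approx_def using lim1 lim2 PQ T(1) by simp
  then show ?thesis unfolding ito_increment_def by blast
qed

lemma ito_increment_left:
  assumes "has_ito_integral M W 0 t H I" "has_ito_integral M W 0 s H I'"
    and "jointly_measurable H" "0 \<le> s" "s \<le> t"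
  shows "ito_increment s t H (\<lambda>\<omega>. I \<omega> - I' \<omega>)"
  by (rule ito_increment_diff[OF has_ito_integral_ito_increment has_ito_integral_ito_increment, OF assms(1,3) _ assms(2,3) _ assms(3)])
    (use assms in auto)

lemma ito_increment_right:
  assumes "has_ito_integral M W s T H I" "has_ito_integral M W t T H I'"
    and "jointly_measurable H" "0 \<le> s" "s \<le> t" "t \<le> T"
  shows "ito_increment s t H (\<lambda>\<omega>. I \<omega> - I' \<omega>)"
  by (rule ito_increment_diff[OF has_ito_integral_ito_increment has_ito_integral_ito_increment, OF assms(1,3) _ assms(2,3) _ assms(3)])
    (use assms in auto)

text \<open>The bound of \<open>ito_increment_msq_le\<close> with coefficient 0, over an empty
  interval.\<close>

lemma has_ito_integral_degenerate:
  assumes "has_ito_integral M W a a H I" "jointly_measurable H" "0 \<le> a"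
  shows "AE \<omega> in M. I \<omega> = 0"
proof -
  note I = has_ito_integral_ito_increment[OF assms]
  have "msq (\<lambda>\<omega>. I \<omega> - 0 \<bullet> (W a \<omega> - W a \<omega>)) \<le> 4 * (\<integral>\<^sup>+r\<in>{a<..a}. msq (\<lambda>\<omega>. H r \<omega> - 0) \<partial>lborel)"
    by (rule ito_increment_msq_le[OF I assms(2)]) (use assms(3) in auto)
  then have "msq I = 0" by simp
  from msq_eq_0D[OF sq_integrable_measurable[OF ito_increment_sq_integrable[OF I]] this] show ?thesis .
qed

end

subsection \<open>One Euler step along a classical solution\<close>

lemma norm_vec_sq: "(norm x)\<^sup>2 = (\<Sum>i\<in>UNIV. (norm (x $ i))\<^sup>2)"
  by (simp add: norm_vec_def L2_set_def sum_nonneg)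

lemma norm_matrix_vector_mult_le:
  fixes A :: "real ^ 'n ^ 'm" shows "norm (A *v x) \<le> norm A * norm x"
proof (rule power2_le_imp_le)
  have "(norm (A *v x))\<^sup>2 = (\<Sum>i\<in>UNIV. (A $ i \<bullet> x)\<^sup>2)"
    unfolding norm_vec_sq[of "A *v x"] by (simp add: matrix_vector_mul_component)
  also have "\<dots> \<le> (\<Sum>i\<in>UNIV. (norm (A $ i))\<^sup>2 * (norm x)\<^sup>2)"
    by (intro sum_mono) (simp add: power2_norm_eq_inner Cauchy_Schwarz_ineq)
  also have "\<dots> = (norm A * norm x)\<^sup>2"
    unfolding power_mult_distrib norm_vec_sq[of A] by (simp add: sum_distrib_right)
  finally show "(norm (A *v x))\<^sup>2 \<le> (norm A * norm x)\<^sup>2" .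
qed simp

lemma norm_transpose:
  fixes A :: "real ^ 'n ^ 'm" shows "norm (transpose A) = norm A"
proof -
  have "(norm (transpose A))\<^sup>2 = (\<Sum>i\<in>UNIV. \<Sum>j\<in>UNIV. (A $ j $ i)\<^sup>2)"
    unfolding norm_vec_sq[of "transpose A"] norm_vec_sq by (simp add: transpose_def)
  also have "\<dots> = (\<Sum>j\<in>UNIV. \<Sum>i\<in>UNIV. (A $ j $ i)\<^sup>2)" by (rule sum.swap)
  also have "\<dots> = (norm A)\<^sup>2" unfolding norm_vec_sq[of A] norm_vec_sq by simp
  finally show ?thesis by simp
qed

lemma norm_vector_matrix_mult_le:
  fixes A :: "real ^ 'n ^ 'm" shows "norm (x v* A) \<le> norm x * norm A"
  using norm_matrix_vector_mult_le[of "transpose A" x] by (simp add: norm_transpose mult.commute)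

lemma abs_trace_mult_le:
  fixes A B :: "real ^ 'n ^ 'n" shows "\<bar>trace (A ** B)\<bar> \<le> norm A * norm B"
proof -
  have "trace (A ** B) = A \<bullet> transpose B"
    by (simp add: trace_def matrix_matrix_mult_def inner_vec_def transpose_def)
  then show ?thesis using Cauchy_Schwarz_ineq2[of A "transpose B"] by (simp add: norm_transpose)
qed

lemma trace_diff_mult:
  fixes A B A' B' :: "real ^ 'n ^ 'n"
  shows "trace (A ** B) - trace (A' ** B') = trace ((A - A') ** B) + trace (A' ** (B - B'))"
  by (simp add: trace_def matrix_matrix_mult_def sum_subtractf[symmetric] sum.distrib[symmetric] algebra_simps)

lemma trace_mult_diff_right:
  fixes A B B' :: "real ^ 'n ^ 'n"
  shows "trace (A ** (B - B')) = trace (A ** B) - trace (A ** B')"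
  by (simp add: trace_def matrix_matrix_mult_def sum_subtractf[symmetric] algebra_simps)

text \<open>A single \<open>L \<ge> 1\<close> majorizes all Lipschitz and Hoelder constants and all
  suprema, so that constants become powers of \<open>L\<close>, which \<open>L_power_mono\<close>
  compares.\<close>

locale pde_data =
  fixes T L \<alpha> :: real
    and b :: "real \<Rightarrow> real ^ 'd \<Rightarrow> real \<Rightarrow> real ^ 'd \<Rightarrow> real ^ 'd"
    and \<sigma> :: "real \<Rightarrow> real ^ 'd \<Rightarrow> real \<Rightarrow> real ^ 'd ^ 'd"
    and F :: "real \<Rightarrow> real ^ 'd \<Rightarrow> real \<Rightarrow> real ^ 'd \<Rightarrow> real"
    and g :: "real ^ 'd \<Rightarrow> real"
    and u ut :: "real \<Rightarrow> real ^ 'd \<Rightarrow> real"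
    and ux :: "real \<Rightarrow> real ^ 'd \<Rightarrow> real ^ 'd"
    and uxx :: "real \<Rightarrow> real ^ 'd \<Rightarrow> real ^ 'd ^ 'd"
  assumes T: "0 < T" and L: "1 \<le> L" and \<alpha>: "0 < \<alpha>" "\<alpha> \<le> 1"
    and b_lip: "lipschitz_txyz T L b"
    and F_lip: "lipschitz_txyz T L F"
    and \<sigma>_lip: "lipschitz_txy T L \<sigma>"
    and \<sigma>\<sigma>_lip: "lipschitz_txy T L (\<lambda>t x y. \<sigma> t x y ** transpose (\<sigma> t x y))"
    and g_lip: "\<bar>g x - g x'\<bar> \<le> L * norm (x - x')"
    and b_bound: "t \<in> {0..T} \<Longrightarrow> norm (b t x y z) \<le> L"
    and \<sigma>_bound: "t \<in> {0..T} \<Longrightarrow> norm (\<sigma> t x y) \<le> L"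
    and \<sigma>\<sigma>_bound: "t \<in> {0..T} \<Longrightarrow> norm (\<sigma> t x y ** transpose (\<sigma> t x y)) \<le> L"
    and pde: "classical_pde_solution T b \<sigma> F g u ut ux uxx"
    and ux_bound: "t \<in> {0..T} \<Longrightarrow> norm (ux t x) \<le> L"
    and uxx_bound: "t \<in> {0..T} \<Longrightarrow> norm (uxx t x) \<le> L"
    and u_lip: "lipschitz_tx T L u"
    and ux_lip: "lipschitz_tx T L ux"
    and uxx_hoelder: "t \<in> {0..T} \<Longrightarrow> t' \<in> {0..T} \<Longrightarrow>
      norm (uxx t x - uxx t' x') \<le> L * (\<bar>t - t'\<bar> powr (\<alpha> / 2) + norm (x - x') powr \<alpha>)"
begin

abbreviation "a t x y \<equiv> \<sigma> t x y ** transpose (\<sigma> t x y)"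

definition v :: "real \<Rightarrow> real ^ 'd \<Rightarrow> real ^ 'd" where "v t x = ux t x v* \<sigma> t x (u t x)"

lemma L0 [simp]: "0 \<le> L" "0 < L" using L by auto

lemma ut_eq:
  assumes "t \<in> {0..T}"
  shows "ut t x = F t x (u t x) (v t x) - 1 / 2 * trace (uxx t x ** a t x (u t x)) - ux t x \<bullet> b t x (u t x) (v t x)"
  using pde assms unfolding classical_pde_solution_def Let_def v_def by blast

lemma uT_eq: "u T x = g x"
  using pde unfolding classical_pde_solution_def by blast

lemma F_le: "t \<in> {0..T} \<Longrightarrow> t' \<in> {0..T} \<Longrightarrow>
    \<bar>F t x y z - F t' x' y' z'\<bar> \<le> L * (sqrt \<bar>t - t'\<bar> + norm (x - x') + \<bar>y - y'\<bar> + norm (z - z'))"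
  using F_lip unfolding lipschitz_txyz_def real_norm_def by blast

lemma b_le: "t \<in> {0..T} \<Longrightarrow> t' \<in> {0..T} \<Longrightarrow>
    norm (b t x y z - b t' x' y' z') \<le> L * (sqrt \<bar>t - t'\<bar> + norm (x - x') + \<bar>y - y'\<bar> + norm (z - z'))"
  using b_lip unfolding lipschitz_txyz_def by blast

lemma \<sigma>_le: "t \<in> {0..T} \<Longrightarrow> t' \<in> {0..T} \<Longrightarrow>
    norm (\<sigma> t x y - \<sigma> t' x' y') \<le> L * (sqrt \<bar>t - t'\<bar> + norm (x - x') + \<bar>y - y'\<bar>)"
  using \<sigma>_lip unfolding lipschitz_txy_def by blast

lemma a_le: "t \<in> {0..T} \<Longrightarrow> t' \<in> {0..T} \<Longrightarrow>
    norm (a t x y - a t' x' y') \<le> L * (sqrt \<bar>t - t'\<bar> + norm (x - x') + \<bar>y - y'\<bar>)"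
  using \<sigma>\<sigma>_lip unfolding lipschitz_txy_def by blast

lemma u_le: "t \<in> {0..T} \<Longrightarrow> t' \<in> {0..T} \<Longrightarrow> \<bar>u t x - u t' x'\<bar> \<le> L * (sqrt \<bar>t - t'\<bar> + norm (x - x'))"
  using u_lip unfolding lipschitz_tx_def real_norm_def by blast

lemma ux_le: "t \<in> {0..T} \<Longrightarrow> t' \<in> {0..T} \<Longrightarrow> norm (ux t x - ux t' x') \<le> L * (sqrt \<bar>t - t'\<bar> + norm (x - x'))"
  using ux_lip unfolding lipschitz_tx_def by blast

lemma ux\<sigma>_le:
  assumes t: "t \<in> {0..T}" "t' \<in> {0..T}"
  shows "norm (ux t x v* \<sigma> t x y - ux t' x' v* \<sigma> t' x' y') \<le> 2 * L\<^sup>2 * (sqrt \<bar>t - t'\<bar> + norm (x - x') + \<bar>y - y'\<bar>)"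
proof -
  let ?\<tau> = "sqrt \<bar>t - t'\<bar> + norm (x - x')"
  have eq: "ux t x v* \<sigma> t x y - ux t' x' v* \<sigma> t' x' y' = (ux t x - ux t' x') v* \<sigma> t x y + ux t' x' v* (\<sigma> t x y - \<sigma> t' x' y')"
    by (simp add: vector_matrix_mult_def vec_eq_iff sum_subtractf[symmetric] sum.distrib[symmetric] algebra_simps)
  have "norm ((ux t x - ux t' x') v* \<sigma> t x y) \<le> (L * ?\<tau>) * L"
    by (rule order_trans[OF norm_vector_matrix_mult_le]) (intro mult_mono ux_le t \<sigma>_bound, auto)
  moreover have "norm (ux t' x' v* (\<sigma> t x y - \<sigma> t' x' y')) \<le> L * (L * (?\<tau> + \<bar>y - y'\<bar>))"
    by (rule order_trans[OF norm_vector_matrix_mult_le]) (intro mult_mono \<sigma>_le t ux_bound, auto)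
  ultimately have "norm (ux t x v* \<sigma> t x y - ux t' x' v* \<sigma> t' x' y') \<le> (L * ?\<tau>) * L + L * (L * (?\<tau> + \<bar>y - y'\<bar>))"
    unfolding eq by (intro order_trans[OF norm_triangle_ineq]) auto
  also have "\<dots> \<le> 2 * L\<^sup>2 * (?\<tau> + \<bar>y - y'\<bar>)"
    by (simp add: power2_eq_square algebra_simps)
  finally show ?thesis .
qed

lemma v_le:
  assumes t: "t \<in> {0..T}" "t' \<in> {0..T}"
  shows "norm (v t x - v t' x') \<le> 4 * L^3 * (sqrt \<bar>t - t'\<bar> + norm (x - x'))"
proof -
  let ?\<tau> = "sqrt \<bar>t - t'\<bar> + norm (x - x')"
  have \<tau>: "0 \<le> ?\<tau>" by simp
  have "norm (v t x - v t' x') \<le> 2 * L\<^sup>2 * (?\<tau> + \<bar>u t x - u t' x'\<bar>)"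
    unfolding v_def by (rule ux\<sigma>_le[OF t])
  also have "\<dots> \<le> 2 * L\<^sup>2 * (L * ?\<tau> + L * ?\<tau>)"
    using mult_right_mono[OF L \<tau>] u_le[OF t] by (intro mult_left_mono add_mono) auto
  also have "\<dots> = 4 * L^3 * ?\<tau>" by (simp add: power_numeral_reduce algebra_simps)
  finally show ?thesis .
qed

lemma L_power_mono: "i \<le> j \<Longrightarrow> L ^ i \<le> L ^ j"
  using L by (rule power_increasing[rotated])

text \<open>Only continuity of \<open>ut\<close> is given, but the PDE expresses it through the
  coefficients, \<open>u\<close>, \<open>ux\<close> and \<open>uxx\<close>. The Hessian contributes
  the \<alpha>-Hoelder terms; all the rest is Lipschitz in \<open>x\<close> and in the square root
  of time.\<close>

lemma ut_le:
  assumes t: "t \<in> {0..T}" "t' \<in> {0..T}"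
  shows "\<bar>ut t x - ut t' x'\<bar> \<le> 16 * L^5 * (sqrt \<bar>t - t'\<bar> + norm (x - x') + \<bar>t - t'\<bar> powr (\<alpha> / 2) + norm (x - x') powr \<alpha>)"
proof -
  let ?\<tau> = "sqrt \<bar>t - t'\<bar> + norm (x - x')" and ?h = "\<bar>t - t'\<bar> powr (\<alpha> / 2) + norm (x - x') powr \<alpha>"
  have \<tau>: "0 \<le> ?\<tau>" and h: "0 \<le> ?h" by auto
  have LL: "L \<le> L^3" "1 \<le> L^3" using L_power_mono[of 1 3] L_power_mono[of 0 3] by auto
  \<comment> \<open>The arguments \<open>u\<close> and \<open>v\<close> of the coefficients vary
    with constants \<open>L\<close> and \<open>4 * L^3\<close>; with the direct dependence this
    makes at most \<open>6 * L^3\<close>.\<close>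
  have arg: "?\<tau> + \<bar>u t x - u t' x'\<bar> + norm (v t x - v t' x') \<le> 6 * L^3 * ?\<tau>"
  proof -
    have "c + p + q \<le> 6 * K * c" if "p \<le> L * c" "q \<le> 4 * K * c" "L * c \<le> K * c" "1 * c \<le> K * c" for c p q K :: real
      using that by linarith
    from this[OF u_le[OF t] v_le[OF t] mult_right_mono[OF LL(1) \<tau>] mult_right_mono[OF LL(2) \<tau>]] show ?thesis .
  qed
  have L6: "L * (6 * L^3 * ?\<tau>) = 6 * L^4 * ?\<tau>" by (simp add: power_numeral_reduce)
  have 1: "\<bar>F t x (u t x) (v t x) - F t' x' (u t' x') (v t' x')\<bar> \<le> 6 * L^4 * ?\<tau>"
    using order_trans[OF F_le[OF t] mult_left_mono[OF arg L0(1)]] unfolding L6 .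
  have 2: "norm (b t x (u t x) (v t x) - b t' x' (u t' x') (v t' x')) \<le> 6 * L^4 * ?\<tau>"
    using order_trans[OF b_le[OF t] mult_left_mono[OF arg L0(1)]] unfolding L6 .
  have 3: "\<bar>ux t x \<bullet> b t x (u t x) (v t x) - ux t' x' \<bullet> b t' x' (u t' x') (v t' x')\<bar> \<le> L * ?\<tau> * L + L * (6 * L^4 * ?\<tau>)"
  proof -
    have "ux t x \<bullet> b t x (u t x) (v t x) - ux t' x' \<bullet> b t' x' (u t' x') (v t' x') =
      (ux t x - ux t' x') \<bullet> b t x (u t x) (v t x) + ux t' x' \<bullet> (b t x (u t x) (v t x) - b t' x' (u t' x') (v t' x'))"
      by (simp add: inner_diff_left inner_diff_right)
    moreover have "\<bar>(ux t x - ux t' x') \<bullet> b t x (u t x) (v t x)\<bar> \<le> L * ?\<tau> * L"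
      by (rule order_trans[OF Cauchy_Schwarz_ineq2]) (intro mult_mono ux_le t b_bound, auto)
    moreover have "\<bar>ux t' x' \<bullet> (b t x (u t x) (v t x) - b t' x' (u t' x') (v t' x'))\<bar> \<le> L * (6 * L^4 * ?\<tau>)"
      by (rule order_trans[OF Cauchy_Schwarz_ineq2]) (intro mult_mono 2 ux_bound t, auto)
    ultimately show ?thesis by linarith
  qed
  have 4: "\<bar>trace (uxx t x ** a t x (u t x)) - trace (uxx t' x' ** a t' x' (u t' x'))\<bar> \<le> L * ?h * L + L * (L * (L * ?\<tau> + L * ?\<tau>))"
  proof -
    have "\<bar>trace ((uxx t x - uxx t' x') ** a t x (u t x))\<bar> \<le> L * ?h * L"
      by (rule order_trans[OF abs_trace_mult_le]) (intro mult_mono uxx_hoelder t \<sigma>\<sigma>_bound, auto)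
    moreover have "\<bar>trace (uxx t' x' ** (a t x (u t x) - a t' x' (u t' x')))\<bar> \<le> L * (L * (L * ?\<tau> + L * ?\<tau>))"
    proof (rule order_trans[OF abs_trace_mult_le], rule mult_mono)
      show "norm (a t x (u t x) - a t' x' (u t' x')) \<le> L * (L * ?\<tau> + L * ?\<tau>)"
        using mult_right_mono[OF L \<tau>] u_le[OF t, of x x']
        by (intro order_trans[OF a_le[OF t]] mult_left_mono add_mono) auto
    qed (use t uxx_bound in auto)
    ultimately show ?thesis unfolding trace_diff_mult by linarith
  qed
  have P: "L^4 \<le> L^5" "L^2 \<le> L^5" "L^3 \<le> L^5" using L_power_mono by auto
  have "\<bar>ut t x - ut t' x'\<bar> \<le> 6 * L^4 * ?\<tau> + (L^2 * ?h + 2 * L^3 * ?\<tau>) + (L^2 * ?\<tau> + 6 * L^5 * ?\<tau>)"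
  proof -
    have e: "L * ?\<tau> * L + L * (6 * L^4 * ?\<tau>) = L^2 * ?\<tau> + 6 * L^5 * ?\<tau>"
      "L * ?h * L + L * (L * (L * ?\<tau> + L * ?\<tau>)) = L^2 * ?h + 2 * L^3 * ?\<tau>"
      by (simp_all add: power_numeral_reduce algebra_simps)
    show ?thesis
      unfolding ut_eq[OF t(1)] ut_eq[OF t(2)] using 1 3[unfolded e] 4[unfolded e] by linarith
  qed
  also have "\<dots> \<le> 6 * (L^5 * ?\<tau>) + (L^5 * ?h + 2 * (L^5 * ?\<tau>)) + (L^5 * ?\<tau> + 6 * (L^5 * ?\<tau>))"
    using P mult_right_mono[OF P(1) \<tau>] mult_right_mono[OF P(2) \<tau>] mult_right_mono[OF P(3) \<tau>] mult_right_mono[OF P(2) h] by linarith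
  also have "\<dots> \<le> 16 * (L^5 * ?\<tau>) + 16 * (L^5 * ?h)"
    using mult_nonneg_nonneg[of "L^5" ?\<tau>] mult_nonneg_nonneg[of "L^5" ?h] \<tau> h by (simp del: mult_nonneg_nonneg)
  also have "\<dots> = 16 * L^5 * (?\<tau> + ?h)" by (simp add: algebra_simps)
  finally show ?thesis by (simp add: add.assoc)
qed

lemma taylor_time:
  assumes t: "0 \<le> t" "t < t'" "t' \<le> T"
  shows "\<exists>\<theta>\<in>{t<..<t'}. u t' x - u t x = (t' - t) * ut \<theta> x"
proof -
  have d: "((\<lambda>s. u s x) has_real_derivative ut s x) (at s within {0..T})" if "s \<in> {0..T}" for s
    using pde that unfolding classical_pde_solution_def C12_on_def by blast
  have d2: "((\<lambda>s. u s x) has_real_derivative ut s x) (at s within {t..t'})" if "t \<le> s" "s \<le> t'" for s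
    using DERIV_subset[OF d[of s]] that t by auto
  have "\<exists>\<theta>\<in>{t<..<t'}. u t' x - u t x = (\<lambda>h. h * ut \<theta> x) (t' - t)"
  proof (rule mvt_simple[OF t(2)])
    show "((\<lambda>s. u s x) has_derivative (\<lambda>h. h * ut s x)) (at s within {t..t'})" if "t \<le> s" "s \<le> t'" for s
      using d2[OF that] by (simp add: has_field_derivative_def mult_commute_abs)
  qed
  then show ?thesis by simp
qed

text \<open>Maclaurin's formula of order 2 along the segment from \<open>x\<close> to
  \<open>x + \<delta>\<close>. The Hessian appears at an intermediate point, and this is where its
  Hoelder continuity enters in \<open>taylor_step\<close>.\<close>

lemma taylor_space:
  assumes t: "t \<in> {0..T}"
  shows "\<exists>r\<in>{0<..<1}. u t (x + \<delta>) = u t x + ux t x \<bullet> \<delta> + 1 / 2 * (\<delta> \<bullet> (uxx t (x + r *\<^sub>R \<delta>) *v \<delta>))"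
proof -
  have dx: "(u t has_derivative (\<lambda>h. ux t y \<bullet> h)) (at y)" and dxx: "(ux t has_derivative (\<lambda>h. uxx t y *v h)) (at y)" for y
    using pde t unfolding classical_pde_solution_def C12_on_def by blast+
  \<comment> \<open>The function on the segment with its first two derivatives, in the indexed form
    that \<open>Maclaurin\<close> expects.\<close>
  define diff where "diff m r = (if m = 0 then u t (x + r *\<^sub>R \<delta>) else if m = 1 then ux t (x + r *\<^sub>R \<delta>) \<bullet> \<delta>
     else (uxx t (x + r *\<^sub>R \<delta>) *v \<delta>) \<bullet> \<delta>)" for m :: nat and r :: real
  have line: "((\<lambda>r. x + r *\<^sub>R \<delta>) has_derivative (\<lambda>h. h *\<^sub>R \<delta>)) (at r)" for r
    by (auto intro!: derivative_eq_intros)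
  have D0: "DERIV (diff 0) r :> diff 1 r" for r
    using diff_chain_at[OF line[of r] dx] unfolding diff_def has_field_derivative_def
    by (simp add: o_def mult_commute_abs)
  have D1: "DERIV (diff 1) r :> diff 2 r" for r
    using has_derivative_inner_left[OF diff_chain_at[OF line[of r] dxx], of \<delta>] unfolding diff_def has_field_derivative_def
    by (simp add: o_def mult_commute_abs matrix_vector_mult_scaleR)
  have "\<exists>r>0. r < 1 \<and> diff 0 1 = (\<Sum>m<2. diff m 0 / fact m * 1 ^ m) + diff 2 r / fact 2 * 1 ^ 2"
  proof (rule Maclaurin)
    show "\<forall>m r. m < 2 \<and> 0 \<le> r \<and> r \<le> 1 \<longrightarrow> DERIV (diff m) r :> diff (Suc m) r"
    proof (intro allI impI)
      fix m :: nat and r :: real assume "m < 2 \<and> 0 \<le> r \<and> r \<le> 1"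
      then consider "m = 0" | "m = 1" by linarith
      then show "DERIV (diff m) r :> diff (Suc m) r"
        by cases (use D0 D1 in \<open>auto simp: numeral_2_eq_2\<close>)
    qed
  qed auto
  then obtain r where r: "0 < r" "r < 1" "diff 0 1 = diff 0 0 + diff 1 0 + diff 2 r / 2"
    by (auto simp: numeral_2_eq_2)
  then show ?thesis unfolding diff_def by (intro bexI[of _ r]) (auto simp: inner_commute)
qed

text \<open>Time is expanded first, at the displaced point, and space afterwards. With
  \<open>m = 1 + norm w / sqrt \<Delta>\<close> the displacement is at most
  \<open>L * sqrt \<Delta> * m\<close>, and as \<open>\<Delta> \<le> 1\<close> and
  \<open>\<alpha> \<le> 1\<close>, every modulus of continuity is at most
  \<open>L * m * \<Delta> powr (\<alpha> / 2)\<close>. The quadratic term keeps only the noise part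
  \<eta>.\<close>

lemma taylor_step:
  fixes x w z :: "real ^ 'd" and y :: real
  assumes t: "t \<in> {0..T}" "t' \<in> {0..T}" "t < t'" "t' - t \<le> 1"
  defines "\<Delta> \<equiv> t' - t" and "\<eta> \<equiv> \<sigma> t x y *v w"
  defines "\<delta> \<equiv> \<Delta> *\<^sub>R b t x y z + \<eta>"
  shows "\<bar>u t' (x + \<delta>) - (u t x + \<Delta> * ut t x + ux t x \<bullet> \<delta> + 1 / 2 * (\<eta> \<bullet> (uxx t x *v \<eta>)))\<bar>
    \<le> 66 * L^6 * (\<Delta> * \<Delta> powr (\<alpha> / 2)) * (1 + norm w / sqrt \<Delta>)^3"
proof -
  define q where "q = sqrt \<Delta>"
  define h where "h = \<Delta> powr (\<alpha> / 2)"
  define m where "m = 1 + norm w / q"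
  define \<beta> where "\<beta> = \<Delta> *\<^sub>R b t x y z"
  define H where "H = uxx t x"
  have \<Delta>: "0 < \<Delta>" "\<Delta> \<le> 1" using t unfolding \<Delta>_def by auto
  have q: "0 < q" "q \<le> 1" "q * q = \<Delta>" using \<Delta> unfolding q_def by auto
  have m1: "1 \<le> m" using q unfolding m_def by simp
  have Lm: "1 \<le> L * m" using mult_mono[OF L m1] by simp
  have q_powr: "q powr \<alpha> = h" using \<Delta> unfolding q_def h_def by (simp add: powr_half_sqrt[symmetric] powr_powr)
  have h0: "0 < h" using \<Delta> unfolding h_def by simp
  \<comment> \<open>Here \<open>\<Delta> \<le> 1\<close> enters: the Hoelder modulus then dominates
    the Lipschitz one.\<close>
  have qh: "q \<le> h"
  proof -
    have "\<Delta> powr (1/2) \<le> \<Delta> powr (\<alpha>/2)" using \<Delta> \<alpha> by (intro powr_mono') auto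
    then show ?thesis using \<Delta> unfolding q_def h_def by (simp add: powr_half_sqrt)
  qed
  have \<beta>: "norm \<beta> \<le> L * \<Delta>" using b_bound[OF t(1), of x y z] \<Delta> unfolding \<beta>_def by (simp add: mult.commute)
  have wm: "norm w = q * (m - 1)" unfolding m_def using q by simp
  have \<eta>: "norm \<eta> \<le> L * (q * (m - 1))"
    unfolding \<eta>_def wm[symmetric] by (rule order_trans[OF norm_matrix_vector_mult_le]) (intro mult_right_mono \<sigma>_bound t norm_ge_zero)
  have \<beta>q: "norm \<beta> \<le> L * q"
  proof -
    have "\<Delta> \<le> q" using q mult_left_le[of q q] by simp
    from mult_left_mono[OF this L0(1)] \<beta> show ?thesis by linarith
  qed
  have \<delta>: "norm \<delta> \<le> L * q * m"
    using norm_triangle_ineq[of \<beta> \<eta>] \<beta>q \<eta> unfolding \<delta>_def \<beta>_def[symmetric] by (simp add: algebra_simps)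
  have \<eta>': "norm \<eta> \<le> L * q * m"
    using \<eta> q by (simp add: algebra_simps) (smt (verit) L0(2) mult_pos_pos)
  have \<delta>\<alpha>: "norm \<delta> powr \<alpha> \<le> L * m * h"
  proof -
    have "norm \<delta> powr \<alpha> \<le> ((L * m) * q) powr \<alpha>" using \<delta> \<alpha> by (intro powr_mono2) (auto simp: ac_simps)
    also have "\<dots> = (L * m) powr \<alpha> * h" using q Lm by (simp add: powr_mult q_powr)
    also have "\<dots> \<le> (L * m) powr 1 * h" using Lm \<alpha> h0 by (intro mult_right_mono powr_mono) auto
    finally show ?thesis using Lm by simp
  qed
  have Lqm: "L * q * m \<le> L * m * h" using mult_left_mono[OF qh, of "L * m"] Lm by (simp add: ac_simps)
  have \<delta>h: "norm \<delta> \<le> L * m * h" and \<eta>h: "norm \<eta> \<le> L * m * h" using \<delta> \<eta>' Lqm by linarith+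
  have hLm: "h \<le> L * m * h" using mult_right_mono[OF Lm, of h] h0 by simp
  \<comment> \<open>The time increment. The four moduli in \<open>ut_le\<close> are each at most
    \<open>L * m * h\<close>, whence 64 = 16 * 4.\<close>
  have A: "\<bar>u t' (x + \<delta>) - u t (x + \<delta>) - \<Delta> * ut t x\<bar> \<le> 64 * L^6 * (\<Delta> * h * m)"
  proof -
    obtain \<theta> where \<theta>: "\<theta> \<in> {t<..<t'}" "u t' (x + \<delta>) - u t (x + \<delta>) = \<Delta> * ut \<theta> (x + \<delta>)"
      using taylor_time[of t t' "x + \<delta>"] t unfolding \<Delta>_def by auto
    have \<theta>T: "\<theta> \<in> {0..T}" and \<theta>\<Delta>: "\<bar>\<theta> - t\<bar> \<le> \<Delta>" using \<theta> t unfolding \<Delta>_def by auto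
    have s1: "sqrt \<bar>\<theta> - t\<bar> \<le> L * m * h" using \<theta>\<Delta> qh hLm unfolding q_def by (meson order_trans real_sqrt_le_iff)
    have s2: "\<bar>\<theta> - t\<bar> powr (\<alpha> / 2) \<le> L * m * h"
      using \<theta>\<Delta> \<alpha> hLm order_trans[OF powr_mono2[of "\<alpha>/2" "\<bar>\<theta> - t\<bar>" \<Delta>]] unfolding h_def by simp
    have "\<bar>ut \<theta> (x + \<delta>) - ut t x\<bar> \<le> 16 * L^5 * (sqrt \<bar>\<theta> - t\<bar> + norm \<delta> + \<bar>\<theta> - t\<bar> powr (\<alpha> / 2) + norm \<delta> powr \<alpha>)"
      using ut_le[OF \<theta>T t(1), of "x + \<delta>" x] by simp
    also have "\<dots> \<le> 16 * L^5 * (L * m * h + L * m * h + L * m * h + L * m * h)"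
      using s1 s2 \<delta>h \<delta>\<alpha> by (intro mult_left_mono add_mono) auto
    also have "\<dots> = 64 * L^6 * (h * m)" by (simp add: power_numeral_reduce)
    finally have "\<Delta> * \<bar>ut \<theta> (x + \<delta>) - ut t x\<bar> \<le> \<Delta> * (64 * L^6 * (h * m))"
      using \<Delta> by (intro mult_left_mono) auto
    then show ?thesis unfolding \<theta>(2) right_diff_distrib[symmetric] abs_mult using \<Delta> by (simp add: ac_simps)
  qed
  obtain r where r: "r \<in> {0<..<1}" "u t (x + \<delta>) = u t x + ux t x \<bullet> \<delta> + 1 / 2 * (\<delta> \<bullet> (uxx t (x + r *\<^sub>R \<delta>) *v \<delta>))"
    using taylor_space[OF t(1), of x \<delta>] by blast
  have B: "\<bar>\<delta> \<bullet> ((uxx t (x + r *\<^sub>R \<delta>) - H) *v \<delta>)\<bar> \<le> L^4 * (\<Delta> * h * m^3)"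
  proof -
    have "norm (uxx t (x + r *\<^sub>R \<delta>) - H) \<le> L * (norm (r *\<^sub>R \<delta>) powr \<alpha>)"
      using uxx_hoelder[OF t(1) t(1), of "x + r *\<^sub>R \<delta>" x] unfolding H_def by simp
    also have "\<dots> \<le> L * (norm \<delta> powr \<alpha>)"
      using r \<alpha> by (intro mult_left_mono powr_mono2) (auto intro!: mult_left_le_one_le)
    also have "\<dots> \<le> L * (L * m * h)" using \<delta>\<alpha> by (intro mult_left_mono) auto
    finally have n: "norm (uxx t (x + r *\<^sub>R \<delta>) - H) \<le> L * (L * m * h)" .
    have "\<bar>\<delta> \<bullet> ((uxx t (x + r *\<^sub>R \<delta>) - H) *v \<delta>)\<bar> \<le> norm \<delta> * (norm (uxx t (x + r *\<^sub>R \<delta>) - H) * norm \<delta>)"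
      by (rule order_trans[OF Cauchy_Schwarz_ineq2]) (intro mult_left_mono norm_matrix_vector_mult_le norm_ge_zero)
    also have "\<dots> \<le> (L * q * m) * (L * (L * m * h) * (L * q * m))"
      using \<delta> n h0 m1 q by (intro mult_mono) auto
    also have "\<dots> = L^4 * ((q * q) * h * m^3)" by (simp add: power_numeral_reduce)
    finally show ?thesis unfolding q(3) .
  qed
  \<comment> \<open>The form at \<delta> and at \<eta> differs by terms containing the drift part
    \<beta>, which is of order \<open>\<Delta>\<close> instead of
    \<open>sqrt \<Delta>\<close>.\<close>
  have C: "\<bar>\<delta> \<bullet> (H *v \<delta>) - \<eta> \<bullet> (H *v \<eta>)\<bar> \<le> 2 * L^3 * (\<Delta> * h * m)"
  proof -
    have \<delta>\<beta>: "\<delta> = \<beta> + \<eta>" unfolding \<delta>_def \<beta>_def ..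
    have eq: "\<delta> \<bullet> (H *v \<delta>) - \<eta> \<bullet> (H *v \<eta>) = \<beta> \<bullet> (H *v \<delta>) + \<eta> \<bullet> (H *v \<beta>)"
      unfolding \<delta>\<beta> by (simp add: inner_add_left inner_add_right matrix_vector_right_distrib)
    have bil: "\<bar>c \<bullet> (H *v e)\<bar> \<le> norm c * (L * norm e)" for c e
      unfolding H_def
      by (rule order_trans[OF Cauchy_Schwarz_ineq2], intro mult_left_mono order_trans[OF norm_matrix_vector_mult_le])
        (auto intro!: mult_right_mono uxx_bound t)
    have e: "(L * \<Delta>) * (L * (L * m * h)) = L^3 * (\<Delta> * h * m)" "(L * m * h) * (L * (L * \<Delta>)) = L^3 * (\<Delta> * h * m)"
      by (simp_all add: power_numeral_reduce)
    have "\<bar>\<beta> \<bullet> (H *v \<delta>)\<bar> \<le> (L * \<Delta>) * (L * (L * m * h))"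
      using \<beta> \<delta>h \<Delta> by (intro order_trans[OF bil] mult_mono mult_left_mono) auto
    then have 1: "\<bar>\<beta> \<bullet> (H *v \<delta>)\<bar> \<le> L^3 * (\<Delta> * h * m)" unfolding e .
    have "\<bar>\<eta> \<bullet> (H *v \<beta>)\<bar> \<le> (L * m * h) * (L * (L * \<Delta>))"
      using \<beta> \<eta>h \<Delta> Lm h0 by (intro order_trans[OF bil] mult_mono mult_left_mono) auto
    then have 2: "\<bar>\<eta> \<bullet> (H *v \<beta>)\<bar> \<le> L^3 * (\<Delta> * h * m)" unfolding e .
    show ?thesis unfolding eq
      by (rule order_trans[OF abs_triangle_ineq]) (use add_mono[OF 1 2] in \<open>simp only: mult_2[symmetric] mult.assoc\<close>)
  qed
  have m3: "\<Delta> * h * m \<le> \<Delta> * h * m^3"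
    using power_increasing[of 1 3 m] m1 \<Delta> h0 by (intro mult_left_mono) auto
  let ?S = "\<Delta> * h * m^3"
  have S0: "0 \<le> ?S" using \<Delta> h0 m1 by auto
  have LL: "L^3 \<le> L^6" "L^4 \<le> L^6" using L_power_mono by auto
  have "\<bar>u t' (x + \<delta>) - (u t x + \<Delta> * ut t x + ux t x \<bullet> \<delta> + 1 / 2 * (\<eta> \<bullet> (uxx t x *v \<eta>)))\<bar> \<le>
     64 * L^6 * (\<Delta> * h * m) + L^4 * ?S / 2 + L^3 * (\<Delta> * h * m)"
    using A B C unfolding r(2) H_def[symmetric] by (simp add: matrix_vector_mult_diff_rdistrib inner_diff_right)
  also have "\<dots> \<le> 64 * L^6 * ?S + L^6 * ?S + L^6 * ?S"
  proof (intro add_mono)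
    show "64 * L^6 * (\<Delta> * h * m) \<le> 64 * L^6 * ?S" by (intro mult_left_mono m3) auto
    have "L^4 * ?S \<le> L^6 * ?S" by (intro mult_right_mono LL S0)
    moreover have "0 \<le> L^6 * ?S" using S0 by simp
    ultimately show "L^4 * ?S / 2 \<le> L^6 * ?S" by linarith
    show "L^3 * (\<Delta> * h * m) \<le> L^6 * ?S" by (intro mult_mono m3 LL) (use S0 \<Delta> h0 m1 in auto)
  qed
  also have "\<dots> = 66 * L^6 * (\<Delta> * h) * m^3" by simp
  finally show ?thesis unfolding m_def q_def h_def .
qed

text \<open>The drift rate of \<open>Y - u(t, X)\<close> along an Euler step, with the second order
  term of Ito's formula in trace form. By \<open>ut_eq\<close> it vanishes at
  \<open>y = u t x\<close>, \<open>z = v t x\<close>.\<close>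

definition drift_defect :: "real \<Rightarrow> real ^ 'd \<Rightarrow> real \<Rightarrow> real ^ 'd \<Rightarrow> real" where
  "drift_defect t x y z = F t x y z - ut t x - ux t x \<bullet> b t x y z - 1 / 2 * trace (uxx t x ** a t x y)"

text \<open>The Hessian of \<open>w \<mapsto> u t (x + \<sigma> t x y *v w)\<close> at 0; the second
  order term becomes a quadratic form in the Brownian increment.\<close>

definition hess :: "real \<Rightarrow> real ^ 'd \<Rightarrow> real \<Rightarrow> real ^ 'd ^ 'd" where
  "hess t x y = transpose (\<sigma> t x y) ** (uxx t x ** \<sigma> t x y)"

lemma inner_hess: "c \<bullet> (hess t x y *v e) = (\<sigma> t x y *v c) \<bullet> (uxx t x *v (\<sigma> t x y *v e))"
proof -
  have "c \<bullet> (hess t x y *v e) = c \<bullet> (transpose (\<sigma> t x y) *v (uxx t x *v (\<sigma> t x y *v e)))"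
    unfolding hess_def by (simp only: matrix_vector_mul_assoc)
  also have "\<dots> = (\<sigma> t x y *v c) \<bullet> (uxx t x *v (\<sigma> t x y *v e))"
    by (metis dot_lmul_matrix vector_transpose_matrix)
  finally show ?thesis .
qed

lemma abs_inner_hess_le:
  assumes "t \<in> {0..T}" shows "\<bar>c \<bullet> (hess t x y *v e)\<bar> \<le> L^3 * (norm c * norm e)"
proof -
  have n: "norm (\<sigma> t x y *v c) \<le> L * norm c" for c
    by (rule order_trans[OF norm_matrix_vector_mult_le]) (intro mult_right_mono \<sigma>_bound assms norm_ge_zero)
  have n2: "norm (uxx t x *v c) \<le> L * norm c" for c
    by (rule order_trans[OF norm_matrix_vector_mult_le]) (intro mult_right_mono uxx_bound assms norm_ge_zero)
  have "\<bar>c \<bullet> (hess t x y *v e)\<bar> \<le> (L * norm c) * (L * (L * norm e))"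
    unfolding inner_hess
    by (rule order_trans[OF Cauchy_Schwarz_ineq2]) (intro mult_mono n order_trans[OF n2] mult_left_mono, auto)
  then show ?thesis by (simp add: power_numeral_reduce ac_simps)
qed

lemma trace_hess: "trace (hess t x y) = trace (uxx t x ** a t x y)"
  unfolding hess_def by (subst trace_mul_sym) (simp add: matrix_mul_assoc)

lemma abs_trace_hess_le: "t \<in> {0..T} \<Longrightarrow> \<bar>trace (hess t x y)\<bar> \<le> L\<^sup>2"
  unfolding trace_hess power2_eq_square
  by (rule order_trans[OF abs_trace_mult_le]) (intro mult_mono uxx_bound \<sigma>\<sigma>_bound, auto)

text \<open>The mean of the quadratic form is split off as a trace term. This centres the form and
  completes the drift to \<open>drift_defect\<close>, which the PDE controls; what remains is the
  Taylor remainder.\<close>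

lemma scheme_step:
  fixes x w :: "real ^ 'd"
  assumes t: "t \<in> {0..T}" "t' \<in> {0..T}" "t < t'" "t' - t \<le> 1"
  shows "\<exists>R. y + F t x y z * (t' - t) + z \<bullet> w - u t' (x + (t' - t) *\<^sub>R b t x y z + \<sigma> t x y *v w) =
      (y - u t x) + (t' - t) * drift_defect t x y z + (z - ux t x v* \<sigma> t x y) \<bullet> w
      - 1 / 2 * (w \<bullet> (hess t x y *v w) - (t' - t) * trace (hess t x y)) - R \<and>
    \<bar>R\<bar> \<le> 66 * L^6 * ((t' - t) * (t' - t) powr (\<alpha> / 2)) * (1 + norm w / sqrt (t' - t))^3"
proof -
  have d: "ux t x \<bullet> (\<sigma> t x y *v w) = (ux t x v* \<sigma> t x y) \<bullet> w" by (rule dot_lmul_matrix[symmetric])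
  define \<Delta> where "\<Delta> = t' - t"
  define R where "R = u t' (x + (\<Delta> *\<^sub>R b t x y z + \<sigma> t x y *v w)) - (u t x + \<Delta> * ut t x
     + ux t x \<bullet> (\<Delta> *\<^sub>R b t x y z + \<sigma> t x y *v w) + 1 / 2 * ((\<sigma> t x y *v w) \<bullet> (uxx t x *v (\<sigma> t x y *v w))))"
  have "\<bar>R\<bar> \<le> 66 * L^6 * (\<Delta> * \<Delta> powr (\<alpha> / 2)) * (1 + norm w / sqrt \<Delta>)^3"
    using taylor_step[OF t, of x y z w] unfolding R_def \<Delta>_def .
  moreover have "y + F t x y z * \<Delta> + z \<bullet> w - u t' (x + \<Delta> *\<^sub>R b t x y z + \<sigma> t x y *v w) =
      (y - u t x) + \<Delta> * drift_defect t x y z + (z - ux t x v* \<sigma> t x y) \<bullet> w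
      - 1 / 2 * (w \<bullet> (hess t x y *v w) - \<Delta> * trace (hess t x y)) - R"
    unfolding R_def drift_defect_def inner_hess trace_hess inner_add_right inner_diff_left d inner_scaleR_right
    by (simp add: add.assoc algebra_simps)
  ultimately show ?thesis unfolding \<Delta>_def by blast
qed

text \<open>The defect vanishes at \<open>u t x\<close>, \<open>v t x\<close>, so it is a difference
  to which the Lipschitz bounds apply. The distance of \<open>z\<close> to \<open>v t x\<close> is
  split at \<open>ux v* \<sigma>\<close> with \<sigma> at \<open>y\<close>, which costs a further
  multiple of \<open>y - u t x\<close>.\<close>

lemma abs_drift_defect_le:
  assumes t: "t \<in> {0..T}"
  shows "\<bar>drift_defect t x y z\<bar> \<le> 7 * L^4 * (\<bar>y - u t x\<bar> + norm (z - ux t x v* \<sigma> t x y))"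
proof -
  let ?D = "\<bar>y - u t x\<bar>" and ?\<zeta> = "norm (z - ux t x v* \<sigma> t x y)"
  have zv: "norm (z - v t x) \<le> ?\<zeta> + 2 * L\<^sup>2 * ?D"
  proof -
    have "norm (z - v t x) \<le> ?\<zeta> + norm (ux t x v* \<sigma> t x y - v t x)"
      using norm_triangle_ineq[of "z - ux t x v* \<sigma> t x y" "ux t x v* \<sigma> t x y - v t x"] by simp
    then show ?thesis using ux\<sigma>_le[OF t t, of x y x "u t x"] unfolding v_def by simp
  qed
  let ?E = "?D + (?\<zeta> + 2 * L\<^sup>2 * ?D)"
  have 1: "\<bar>F t x y z - F t x (u t x) (v t x)\<bar> \<le> L * ?E"
    using F_le[OF t t, of x y z x "u t x" "v t x"] zv L by (smt (verit) L0(1) diff_self mult_left_mono norm_zero real_sqrt_zero abs_zero)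
  have 2: "norm (b t x (u t x) (v t x) - b t x y z) \<le> L * ?E"
    using b_le[OF t t, of x y z x "u t x" "v t x"] zv L by (smt (verit) L0(1) diff_self mult_left_mono norm_zero real_sqrt_zero abs_zero norm_minus_commute)
  have 3: "\<bar>ux t x \<bullet> (b t x (u t x) (v t x) - b t x y z)\<bar> \<le> L * (L * ?E)"
    by (rule order_trans[OF Cauchy_Schwarz_ineq2]) (intro mult_mono 2 ux_bound t, auto)
  have 4: "\<bar>trace (uxx t x ** (a t x (u t x) - a t x y))\<bar> \<le> L * (L * ?D)"
    using a_le[OF t t, of x "u t x" x y]
    by (intro order_trans[OF abs_trace_mult_le] mult_mono uxx_bound t) (auto simp: abs_minus_commute)
  have eq: "drift_defect t x y z = (F t x y z - F t x (u t x) (v t x)) + ux t x \<bullet> (b t x (u t x) (v t x) - b t x y z)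
     + 1 / 2 * trace (uxx t x ** (a t x (u t x) - a t x y))"
    unfolding drift_defect_def ut_eq[OF t] by (simp add: inner_diff_right trace_mult_diff_right algebra_simps)
  have "\<bar>drift_defect t x y z\<bar> \<le> L * ?E + L * (L * ?E) + L * (L * ?D)"
    using 1 3 4 unfolding eq by linarith
  also have "\<dots> \<le> L^2 * ?E + L^2 * ?E + L^2 * ?D"
    using mult_right_mono[of L "L^2" ?E] L_power_mono[of 1 2] by (simp add: power2_eq_square)
  also have "\<dots> = 3 * (L^2 * ?D) + 2 * (L^2 * ?\<zeta>) + 4 * (L^4 * ?D)"
    by (simp add: power_numeral_reduce algebra_simps)
  also have "\<dots> \<le> 3 * (L^4 * ?D) + 2 * (L^4 * ?\<zeta>) + 4 * (L^4 * ?D)"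
    using L_power_mono[of 2 4] by (intro add_mono mult_left_mono mult_right_mono) auto
  also have "\<dots> \<le> 7 * L^4 * (?D + ?\<zeta>)"
    by (simp add: algebra_simps)
  finally show ?thesis .
qed

end

section \<open>Measurability of the coefficients along processes\<close>

definition clip :: "real \<Rightarrow> real \<Rightarrow> real" where "clip T t = max 0 (min T t)"

lemma clip_mem: "0 \<le> T \<Longrightarrow> clip T t \<in> {0..T}" by (auto simp: clip_def)

lemma clip_eq: "t \<in> {0..T} \<Longrightarrow> clip T t = t" by (auto simp: clip_def)

lemma isCont_of_bound:
  fixes f :: "'b::t2_space \<Rightarrow> 'c::real_normed_vector"
  assumes "\<And>p. norm (f p - f p0) \<le> h p" "isCont h p0" "h p0 = 0"
  shows "isCont f p0"
  unfolding isCont_def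
proof (rule LIM_zero_cancel, rule Lim_null_comparison)
  show "\<forall>\<^sub>F p in at p0. norm (f p - f p0) \<le> h p" using assms(1) by simp
  show "(h \<longlongrightarrow> 0) (at p0)" using assms(2,3) by (simp add: isCont_def)
qed

lemma continuous_clip: "continuous_on UNIV (clip T)"
  unfolding clip_def by (intro continuous_intros)

text \<open>The Lipschitz bound holds for times in \<open>{0..T}\<close> only. Composed with
  \<open>clip T\<close>, the function is continuous on the whole product space, hence Borel.\<close>

lemma measurable_of_lipschitz_txyz:
  fixes f :: "real \<Rightarrow> real ^ 'n \<Rightarrow> real \<Rightarrow> real ^ 'n \<Rightarrow> 'c::euclidean_space"
  assumes f: "lipschitz_txyz T K f" and T: "0 \<le> T"
    and m: "R \<in> borel_measurable M" "X \<in> borel_measurable M" "Y \<in> borel_measurable M" "Z \<in> borel_measurable M"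
  shows "(\<lambda>\<omega>. f (clip T (R \<omega>)) (X \<omega>) (Y \<omega>) (Z \<omega>)) \<in> borel_measurable M"
proof -
  let ?f = "\<lambda>(r, x, y, z). f (clip T r) x y z"
  have "continuous_on UNIV ?f"
  proof (rule continuous_at_imp_continuous_on, rule ballI)
    fix p0 :: "real \<times> (real ^ 'n) \<times> real \<times> (real ^ 'n)"
    obtain r0 x0 y0 z0 where p0: "p0 = (r0, x0, y0, z0)" by (cases p0) auto
    let ?h = "\<lambda>(r, x, y, z). K * (sqrt \<bar>clip T r - clip T r0\<bar> + norm (x - x0) + \<bar>y - y0\<bar> + norm (z - z0))"
    have "continuous_on UNIV ?h"
      unfolding case_prod_beta' by (intro continuous_intros continuous_on_compose2[OF continuous_clip]) auto
    then have "isCont ?h p0" unfolding continuous_on_eq_continuous_at[OF open_UNIV] by blast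
    moreover have "norm (?f p - ?f p0) \<le> ?h p" for p
      using f clip_mem[OF T] unfolding lipschitz_txyz_def p0 by (cases p) auto
    ultimately show "isCont ?f p0" by (intro isCont_of_bound[of ?f p0 ?h]) (auto simp: p0)
  qed
  then have "?f \<in> borel_measurable borel" by (rule borel_measurable_continuous_onI)
  moreover have "(\<lambda>\<omega>. (R \<omega>, X \<omega>, Y \<omega>, Z \<omega>)) \<in> borel_measurable M" using m by (intro borel_measurable_Pair)
  ultimately show ?thesis using measurable_compose[of "\<lambda>\<omega>. (R \<omega>, X \<omega>, Y \<omega>, Z \<omega>)" M borel ?f borel] by simp
qed

lemma measurable_of_lipschitz_txy:
  fixes f :: "real \<Rightarrow> real ^ 'n \<Rightarrow> real \<Rightarrow> 'c::euclidean_space"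
  assumes f: "lipschitz_txy T K f" and T: "0 \<le> T" and K: "0 \<le> K"
    and m: "R \<in> borel_measurable M" "X \<in> borel_measurable M" "Y \<in> borel_measurable M"
  shows "(\<lambda>\<omega>. f (clip T (R \<omega>)) (X \<omega>) (Y \<omega>)) \<in> borel_measurable M"
proof (rule measurable_of_lipschitz_txyz[where f="\<lambda>t x y z. f t x y" and Z=X, OF _ T m m(2)])
  have "K * (s + norm (x - x') + \<bar>y - y'\<bar>) \<le> K * (s + norm (x - x') + \<bar>y - y'\<bar> + norm (z - z'))"
    for s y y' :: real and x x' z z' :: "real ^ 'n"
    using K by (intro mult_left_mono) auto
  then show "lipschitz_txyz T K (\<lambda>t x y z. f t x y)"
    using f unfolding lipschitz_txy_def lipschitz_txyz_def by (meson order_trans)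
qed

lemma measurable_of_lipschitz_tx:
  fixes f :: "real \<Rightarrow> real ^ 'n \<Rightarrow> 'c::euclidean_space"
  assumes f: "lipschitz_tx T K f" and T: "0 \<le> T" and K: "0 \<le> K"
    and m: "R \<in> borel_measurable M" "X \<in> borel_measurable M"
  shows "(\<lambda>\<omega>. f (clip T (R \<omega>)) (X \<omega>)) \<in> borel_measurable M"
proof (rule measurable_of_lipschitz_txy[where f="\<lambda>t x y. f t x" and Y="\<lambda>_. 0", OF _ T K m])
  have "K * (s + norm (x - x')) \<le> K * (s + norm (x - x') + \<bar>y - y'\<bar>)"
    for s y y' :: real and x x' :: "real ^ 'n"
    using K by (intro mult_left_mono) auto
  then show "lipschitz_txy T K (\<lambda>t x y. f t x)"
    using f unfolding lipschitz_tx_def lipschitz_txy_def by (meson order_trans)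
qed simp

lemma measurable_matrix_vector_mult:
  fixes A :: "'a \<Rightarrow> real ^ 'n ^ 'm"
  assumes "A \<in> borel_measurable M" "x \<in> borel_measurable M"
  shows "(\<lambda>\<omega>. A \<omega> *v x \<omega>) \<in> borel_measurable M"
  using assms by (intro measurable_vecI)
    (simp add: matrix_vector_mul_component borel_measurable_inner measurable_vec_nth)

lemma measurable_vector_matrix_mult:
  fixes A :: "'a \<Rightarrow> real ^ 'n ^ 'm"
  assumes "A \<in> borel_measurable M" "x \<in> borel_measurable M"
  shows "(\<lambda>\<omega>. x \<omega> v* A \<omega>) \<in> borel_measurable M"
  using assms by (intro measurable_vecI)
    (simp add: vector_matrix_mult_def borel_measurable_sum borel_measurable_times measurable_vec_nth)

text \<open>Cauchy-Schwarz for a sum of \<open>CARD('n)\<close> terms, applied to the squares and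
  then to the fourth powers of the coordinates.\<close>

lemma norm_power_8_le:
  fixes w :: "real ^ 'n"
  shows "norm w ^ 8 \<le> real CARD('n)^3 * (\<Sum>k\<in>UNIV. (w $ k)^8)"
proof -
  have sq: "(\<Sum>k\<in>UNIV. y k)\<^sup>2 \<le> real CARD('n) * (\<Sum>k\<in>UNIV. (y k)\<^sup>2)" for y :: "'n \<Rightarrow> real"
    using sum_squared_le_sum_of_squares[of y UNIV] by (simp add: mult.commute)
  have "norm w ^ 8 = (((norm w)\<^sup>2)\<^sup>2)\<^sup>2" by simp
  also have "(norm w)\<^sup>2 = (\<Sum>k\<in>UNIV. (w $ k)\<^sup>2)" unfolding norm_vec_sq by simp
  also have "((\<Sum>k\<in>UNIV. (w $ k)\<^sup>2)\<^sup>2)\<^sup>2 \<le> (real CARD('n) * (\<Sum>k\<in>UNIV. (w $ k)^4))\<^sup>2"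
    using sq[of "\<lambda>k. (w $ k)\<^sup>2"] by (intro power_mono) auto
  also have "\<dots> \<le> (real CARD('n))\<^sup>2 * (real CARD('n) * (\<Sum>k\<in>UNIV. (w $ k)^8))"
    unfolding power_mult_distrib using sq[of "\<lambda>k. (w $ k)^4"] by (intro mult_left_mono) auto
  finally show ?thesis by (simp add: power2_eq_square power3_eq_cube)
qed

lemma (in brownian) increment_power_8:
  assumes st: "0 \<le> s" "s < t"
  shows "integrable M (\<lambda>\<omega>. (norm (W t \<omega> - W s \<omega>))^8)"
    and "expectation (\<lambda>\<omega>. (norm (W t \<omega> - W s \<omega>))^8) \<le> 105 * real CARD('d)^4 * (t - s)^4"
proof -
  have i: "integrable M (\<lambda>\<omega>. real CARD('d)^3 * (\<Sum>k\<in>UNIV. ((W t \<omega> - W s \<omega>) $ k)^8))"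
    by (intro integrable_mult_right Bochner_Integration.integrable_sum integrable_increment_power st)
  show i8: "integrable M (\<lambda>\<omega>. (norm (W t \<omega> - W s \<omega>))^8)"
    by (rule Bochner_Integration.integrable_bound[OF i]) (use st norm_power_8_le in \<open>auto intro!: order_trans[OF norm_power_8_le] simp del: vector_minus_component\<close>)
  have "expectation (\<lambda>\<omega>. (norm (W t \<omega> - W s \<omega>))^8) \<le> expectation (\<lambda>\<omega>. real CARD('d)^3 * (\<Sum>k\<in>UNIV. ((W t \<omega> - W s \<omega>) $ k)^8))"
    by (rule integral_mono[OF i8 i norm_power_8_le])
  also have "\<dots> = 105 * real CARD('d)^4 * (t - s)^4"
    using integrable_increment_power[OF st, of _ 8]
    by (simp add: Bochner_Integration.integral_sum expectation_increment_power8[OF st] power3_eq_cube power4_eq_xxxx del: vector_minus_component)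
  finally show "expectation (\<lambda>\<omega>. (norm (W t \<omega> - W s \<omega>))^8) \<le> 105 * real CARD('d)^4 * (t - s)^4" .
qed

context pde_data begin

lemma T0 [simp]: "0 \<le> T" using T by simp

lemma measurable_b:
  assumes "t \<in> {0..T}" "X \<in> borel_measurable M" "Y \<in> borel_measurable M" "Z \<in> borel_measurable M"
  shows "(\<lambda>\<omega>. b t (X \<omega>) (Y \<omega>) (Z \<omega>)) \<in> borel_measurable M"
  using measurable_of_lipschitz_txyz[OF b_lip T0 measurable_const assms(2-4), of t] clip_eq[OF assms(1)] by simp

lemma measurable_F:
  assumes "t \<in> {0..T}" "X \<in> borel_measurable M" "Y \<in> borel_measurable M" "Z \<in> borel_measurable M"
  shows "(\<lambda>\<omega>. F t (X \<omega>) (Y \<omega>) (Z \<omega>)) \<in> borel_measurable M"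
  using measurable_of_lipschitz_txyz[OF F_lip T0 measurable_const assms(2-4), of t] clip_eq[OF assms(1)] by simp

lemma measurable_\<sigma>:
  assumes "t \<in> {0..T}" "X \<in> borel_measurable M" "Y \<in> borel_measurable M"
  shows "(\<lambda>\<omega>. \<sigma> t (X \<omega>) (Y \<omega>)) \<in> borel_measurable M"
  using measurable_of_lipschitz_txy[OF \<sigma>_lip T0 L0(1) measurable_const assms(2-3), of t] clip_eq[OF assms(1)] by simp

lemma measurable_u:
  assumes "t \<in> {0..T}" "X \<in> borel_measurable M"
  shows "(\<lambda>\<omega>. u t (X \<omega>)) \<in> borel_measurable M"
  using measurable_of_lipschitz_tx[OF u_lip T0 L0(1) measurable_const assms(2), of t] clip_eq[OF assms(1)] by simp

lemma measurable_ux: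
  assumes "t \<in> {0..T}" "X \<in> borel_measurable M"
  shows "(\<lambda>\<omega>. ux t (X \<omega>)) \<in> borel_measurable M"
  using measurable_of_lipschitz_tx[OF ux_lip T0 L0(1) measurable_const assms(2), of t] clip_eq[OF assms(1)] by simp

lemma
  assumes t: "t \<in> {0..T}" and X: "X \<in> borel_measurable M"
  shows measurable_ut: "(\<lambda>\<omega>. ut t (X \<omega>)) \<in> borel_measurable M"
    and measurable_uxx: "(\<lambda>\<omega>. uxx t (X \<omega>)) \<in> borel_measurable M"
proof -
  have "continuous_on ({0..T} \<times> UNIV) (\<lambda>(t, x). ut t x)" "continuous_on ({0..T} \<times> UNIV) (\<lambda>(t, x). uxx t x)"
    using pde unfolding classical_pde_solution_def C12_on_def by blast+
  moreover have "continuous_on UNIV (\<lambda>x::real^'d. (t, x))" by (intro continuous_intros)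
  ultimately have "continuous_on UNIV (ut t)" "continuous_on UNIV (uxx t)"
    using t by (auto dest!: continuous_on_compose2[of "{0..T} \<times> UNIV" _ UNIV "\<lambda>x. (t, x)"])
  then show "(\<lambda>\<omega>. ut t (X \<omega>)) \<in> borel_measurable M" "(\<lambda>\<omega>. uxx t (X \<omega>)) \<in> borel_measurable M"
    using X by (auto intro: measurable_compose borel_measurable_continuous_onI)
qed

lemma measurable_drift_defect:
  assumes "t \<in> {0..T}" "X \<in> borel_measurable M" "Y \<in> borel_measurable M" "Z \<in> borel_measurable M"
  shows "(\<lambda>\<omega>. drift_defect t (X \<omega>) (Y \<omega>) (Z \<omega>)) \<in> borel_measurable M"
proof -
  have m: "(\<lambda>\<omega>. trace (uxx t (X \<omega>) ** a t (X \<omega>) (Y \<omega>))) \<in> borel_measurable M"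
    unfolding trace_def matrix_matrix_mult_def transpose_def
    by (simp, intro borel_measurable_sum borel_measurable_times measurable_vec_nth measurable_uxx measurable_\<sigma> assms)
  show ?thesis
    unfolding drift_defect_def
    by (intro borel_measurable_diff borel_measurable_times borel_measurable_inner measurable_F measurable_ut measurable_ux
        measurable_b m borel_measurable_const assms)
qed

lemma measurable_hess:
  assumes "t \<in> {0..T}" "X \<in> borel_measurable M" "Y \<in> borel_measurable M"
  shows "(\<lambda>\<omega>. hess t (X \<omega>) (Y \<omega>) $ k $ l) \<in> borel_measurable M"
  unfolding hess_def matrix_matrix_mult_def transpose_def
  by (simp, intro borel_measurable_sum borel_measurable_times measurable_vec_nth measurable_uxx measurable_\<sigma> assms)

lemma abs_hess_component_le: "t \<in> {0..T} \<Longrightarrow> \<bar>hess t x y $ k $ l\<bar> \<le> L^3"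
  using abs_inner_hess_le[of t "axis k 1" x y "axis l 1"]
  by (simp add: inner_axis' matrix_vector_mul_component inner_axis)

end

subsection \<open>The backward estimate\<close>

lemma time_grid_mono:
  assumes "time_grid T N \<tau>" "i \<le> j" "j \<le> N" shows "\<tau> i \<le> \<tau> j"
  using assms(2,3)
proof (induction rule: dec_induct)
  case (step k)
  have "\<tau> k < \<tau> (Suc k)" using assms(1) step unfolding time_grid_def by simp
  then show ?case using step by simp
qed simp

lemma time_grid_mem:
  assumes "time_grid T N \<tau>" "i \<le> N" shows "\<tau> i \<in> {0..T}"
  using time_grid_mono[OF assms(1), of 0 i] time_grid_mono[OF assms(1), of i N] assms
  unfolding time_grid_def by simp

text \<open>The exponential factors are at least 1, so they may also be put in front of the later
  \<open>z j\<close> and of \<open>c\<close> times the current step; they then multiply to the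
  exponential of the whole remaining time.\<close>

lemma backward_gronwall:
  fixes d z :: "nat \<Rightarrow> real"
  assumes \<tau>: "time_grid T N \<tau>" and k: "0 \<le> k" and c: "0 \<le> c"
    and nn: "\<And>i. i \<le> N \<Longrightarrow> 0 \<le> d i" "\<And>i. i < N \<Longrightarrow> 0 \<le> z i"
    and step: "\<And>i. i < N \<Longrightarrow> d i + z i \<le> exp (k * (\<tau> (Suc i) - \<tau> i)) * (d (Suc i) + c * (\<tau> (Suc i) - \<tau> i))"
    and i: "i \<le> N"
  shows "d i + (\<Sum>j=i..<N. z j) \<le> exp (k * (T - \<tau> i)) * (d N + c * (T - \<tau> i))"
  using i
proof (induction rule: inc_induct)
  case base
  then show ?case using \<tau> by (simp add: time_grid_def)
next
  case (step i)
  let ?\<Delta> = "\<tau> (Suc i) - \<tau> i" and ?S = "\<Sum>j=Suc i..<N. z j"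
  have iN: "i < N" using step by simp
  have \<Delta>: "0 \<le> ?\<Delta>" using \<tau> iN unfolding time_grid_def by (simp add: less_imp_le)
  have r: "0 \<le> T - \<tau> (Suc i)" using time_grid_mem[OF \<tau>, of "Suc i"] iN by simp
  have S: "0 \<le> ?S" using nn(2) by (intro sum_nonneg) auto
  have e1: "1 \<le> exp (k * ?\<Delta>)" "1 \<le> exp (k * (T - \<tau> (Suc i)))" using k \<Delta> r by simp_all
  have "d i + (\<Sum>j=i..<N. z j) = d i + z i + ?S" using iN by (simp add: sum.atLeast_Suc_lessThan)
  also have "\<dots> \<le> exp (k * ?\<Delta>) * (d (Suc i) + c * ?\<Delta>) + exp (k * ?\<Delta>) * ?S"
    using assms(6)[OF iN] mult_right_mono[OF e1(1) S] by simp
  also have "\<dots> = exp (k * ?\<Delta>) * (d (Suc i) + ?S + c * ?\<Delta>)" by (simp add: algebra_simps)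
  also have "\<dots> \<le> exp (k * ?\<Delta>) * (exp (k * (T - \<tau> (Suc i))) * (d N + c * (T - \<tau> (Suc i))) + exp (k * (T - \<tau> (Suc i))) * (c * ?\<Delta>))"
    using step.IH mult_right_mono[OF e1(2), of "c * ?\<Delta>"] c \<Delta> by (intro mult_left_mono add_mono) auto
  also have "\<dots> = exp (k * ?\<Delta>) * exp (k * (T - \<tau> (Suc i))) * (d N + c * (T - \<tau> i))"
    by (simp add: algebra_simps)
  also have "exp (k * ?\<Delta>) * exp (k * (T - \<tau> (Suc i))) = exp (k * (T - \<tau> i))"
    by (simp add: exp_add[symmetric] algebra_simps)
  finally show ?case .
qed

text \<open>Initial values may be random, because \<open>Y 0\<close> is not yet known to be constant
  when a scheme is started in it. Adaptedness of the control is assumed only given that of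
  \<open>xs i\<close>: a feedback control is a function of \<open>xs i\<close>, and adaptedness of
  both comes out of one induction.\<close>

locale euler_scheme = brownian M W + pde_data T L \<alpha> b \<sigma> F g u ut ux uxx
  for M :: "'a measure" and W :: "real \<Rightarrow> 'a \<Rightarrow> real ^ 'd"
    and T L \<alpha> :: real
    and b :: "real \<Rightarrow> real ^ 'd \<Rightarrow> real \<Rightarrow> real ^ 'd \<Rightarrow> real ^ 'd"
    and \<sigma> :: "real \<Rightarrow> real ^ 'd \<Rightarrow> real \<Rightarrow> real ^ 'd ^ 'd"
    and F :: "real \<Rightarrow> real ^ 'd \<Rightarrow> real \<Rightarrow> real ^ 'd \<Rightarrow> real"
    and g :: "real ^ 'd \<Rightarrow> real"
    and u ut :: "real \<Rightarrow> real ^ 'd \<Rightarrow> real"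
    and ux :: "real \<Rightarrow> real ^ 'd \<Rightarrow> real ^ 'd"
    and uxx :: "real \<Rightarrow> real ^ 'd \<Rightarrow> real ^ 'd ^ 'd" +
  fixes N :: nat and \<tau> :: "nat \<Rightarrow> real"
    and xs :: "nat \<Rightarrow> 'a \<Rightarrow> real ^ 'd" and ys :: "nat \<Rightarrow> 'a \<Rightarrow> real" and zs :: "nat \<Rightarrow> 'a \<Rightarrow> real ^ 'd"
  assumes grid: "time_grid T N \<tau>"
    and xs0: "xs 0 \<in> borel_measurable (\<F> 0)" "sq_integrable M (xs 0)"
    and ys0: "ys 0 \<in> borel_measurable (\<F> 0)" "sq_integrable M (ys 0)"
    and zs_feedback: "i < N \<Longrightarrow> xs i \<in> borel_measurable (\<F> (\<tau> i)) \<Longrightarrow> zs i \<in> borel_measurable (\<F> (\<tau> i))"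
      "i < N \<Longrightarrow> xs i \<in> borel_measurable (\<F> (\<tau> i)) \<Longrightarrow> sq_integrable M (zs i)"
    and xs_Suc: "i < N \<Longrightarrow> xs (Suc i) \<omega> = xs i \<omega> + (\<tau> (Suc i) - \<tau> i) *\<^sub>R b (\<tau> i) (xs i \<omega>) (ys i \<omega>) (zs i \<omega>)
        + \<sigma> (\<tau> i) (xs i \<omega>) (ys i \<omega>) *v (W (\<tau> (Suc i)) \<omega> - W (\<tau> i) \<omega>)"
    and ys_Suc: "i < N \<Longrightarrow> ys (Suc i) \<omega> = ys i \<omega> + F (\<tau> i) (xs i \<omega>) (ys i \<omega>) (zs i \<omega>) * (\<tau> (Suc i) - \<tau> i)
        + zs i \<omega> \<bullet> (W (\<tau> (Suc i)) \<omega> - W (\<tau> i) \<omega>)"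
begin

lemma grid_0: "\<tau> 0 = 0" and grid_N: "\<tau> N = T" and grid_less: "i < N \<Longrightarrow> \<tau> i < \<tau> (Suc i)"
  using grid by (auto simp: time_grid_def)

lemma grid_mem: "i \<le> N \<Longrightarrow> \<tau> i \<in> {0..T}" by (rule time_grid_mem[OF grid])

lemma sq_integrable_matrix_vector_mult:
  assumes A: "A \<in> borel_measurable M" "\<And>\<omega>. norm (A \<omega> :: real ^ 'd ^ 'd) \<le> K" and x: "sq_integrable M x"
  shows "sq_integrable M (\<lambda>\<omega>. A \<omega> *v x \<omega>)"
proof (rule sq_integrable_bound[OF sq_integrable_scaleR[OF x, of K]])
  show "(\<lambda>\<omega>. A \<omega> *v x \<omega>) \<in> borel_measurable M"
    by (intro measurable_matrix_vector_mult A sq_integrable_measurable[OF x])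
  have "norm (A \<omega> *v x \<omega>) \<le> norm (K *\<^sub>R x \<omega>)" for \<omega>
    using order_trans[OF norm_matrix_vector_mult_le mult_right_mono[OF A(2) norm_ge_zero]] order_trans[OF norm_ge_zero A(2)[of \<omega>]]
    by simp
  then show "AE \<omega> in M. norm (A \<omega> *v x \<omega>) \<le> norm (K *\<^sub>R x \<omega>)" by simp
qed

lemma sq_integrable_F:
  assumes t: "t \<in> {0..T}" and X: "sq_integrable M X" and Y: "sq_integrable M Y" and Z: "sq_integrable M Z"
  shows "sq_integrable M (\<lambda>\<omega>. F t (X \<omega>) (Y \<omega>) (Z \<omega>))"
proof -
  let ?G = "\<lambda>\<omega>. (\<bar>F t 0 0 0\<bar> + L * norm (X \<omega>)) + (L * norm (Y \<omega>) + L * norm (Z \<omega>))"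
  have G: "sq_integrable M ?G"
    by (intro sq_integrable_add sq_integrable_mult sq_integrable_const sq_integrable_norm X Y Z)
  have le: "\<bar>F t (X \<omega>) (Y \<omega>) (Z \<omega>)\<bar> \<le> ?G \<omega>" for \<omega>
    using F_le[OF t t, of "X \<omega>" "Y \<omega>" "Z \<omega>" 0 0 0] by (simp add: algebra_simps)
  show ?thesis
  proof (rule sq_integrable_bound[OF G])
    show "(\<lambda>\<omega>. F t (X \<omega>) (Y \<omega>) (Z \<omega>)) \<in> borel_measurable M"
      by (intro measurable_F t sq_integrable_measurable X Y Z)
    have "norm (F t (X \<omega>) (Y \<omega>) (Z \<omega>)) \<le> norm (?G \<omega>)" for \<omega>
      using le[of \<omega>] unfolding real_norm_def by linarith
    then show "AE \<omega> in M. norm (F t (X \<omega>) (Y \<omega>) (Z \<omega>)) \<le> norm (?G \<omega>)" by simp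
  qed
qed

lemma sq_integrable_u:
  assumes t: "t \<in> {0..T}" and X: "sq_integrable M X"
  shows "sq_integrable M (\<lambda>\<omega>. u t (X \<omega>))"
proof -
  let ?G = "\<lambda>\<omega>. \<bar>u t 0\<bar> + L * norm (X \<omega>)"
  have G: "sq_integrable M ?G"
    by (intro sq_integrable_add sq_integrable_mult sq_integrable_const sq_integrable_norm X)
  have le: "\<bar>u t (X \<omega>)\<bar> \<le> ?G \<omega>" for \<omega>
    using u_le[OF t t, of "X \<omega>" 0] by simp
  show ?thesis
  proof (rule sq_integrable_bound[OF G])
    show "(\<lambda>\<omega>. u t (X \<omega>)) \<in> borel_measurable M"
      by (intro measurable_u t sq_integrable_measurable X)
    have "norm (u t (X \<omega>)) \<le> norm (?G \<omega>)" for \<omega>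
      using le[of \<omega>] unfolding real_norm_def by linarith
    then show "AE \<omega> in M. norm (u t (X \<omega>)) \<le> norm (?G \<omega>)" by simp
  qed
qed

lemma sq_integrable_ux\<sigma>:
  assumes t: "t \<in> {0..T}" and X: "X \<in> borel_measurable M" and Y: "Y \<in> borel_measurable M"
  shows "sq_integrable M (\<lambda>\<omega>. ux t (X \<omega>) v* \<sigma> t (X \<omega>) (Y \<omega>))"
proof (rule sq_integrable_bounded)
  show "(\<lambda>\<omega>. ux t (X \<omega>) v* \<sigma> t (X \<omega>) (Y \<omega>)) \<in> borel_measurable M"
    by (intro measurable_vector_matrix_mult measurable_\<sigma> measurable_ux t X Y)
  show "norm (ux t (X \<omega>) v* \<sigma> t (X \<omega>) (Y \<omega>)) \<le> L * L" for \<omega>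
    by (rule order_trans[OF norm_vector_matrix_mult_le]) (intro mult_mono ux_bound \<sigma>_bound t, auto)
qed

text \<open>One induction for all four properties, since each component of the next step uses both
  components of the current one and, through the feedback condition, the control.\<close>

lemma scheme_adapted:
  "i \<le> N \<Longrightarrow> xs i \<in> borel_measurable (\<F> (\<tau> i)) \<and> sq_integrable M (xs i) \<and>
     ys i \<in> borel_measurable (\<F> (\<tau> i)) \<and> sq_integrable M (ys i)"
proof (induction i)
  case 0
  then show ?case using xs0 ys0 grid_0 by simp
next
  case (Suc i)
  then have i: "i < N" and X: "xs i \<in> borel_measurable (\<F> (\<tau> i))" "sq_integrable M (xs i)"
    and Y: "ys i \<in> borel_measurable (\<F> (\<tau> i))" "sq_integrable M (ys i)" by auto
  have le: "\<tau> i \<le> \<tau> (Suc i)" "0 \<le> \<tau> i" and t: "\<tau> i \<in> {0..T}" using grid_less[OF i] grid_mem[of i] i by auto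
  note Z = zs_feedback[OF i X(1)]
  note up = measurable_aug_filtration_mono[OF _ le(1)]
  have W1: "(\<lambda>\<omega>. W (\<tau> (Suc i)) \<omega> - W (\<tau> i) \<omega>) \<in> borel_measurable (\<F> (\<tau> (Suc i)))"
    using le by (intro measurable_increment_filtration) auto
  have W2: "sq_integrable M (\<lambda>\<omega>. W (\<tau> (Suc i)) \<omega> - W (\<tau> i) \<omega>)"
    using le by (intro sq_integrable_increment) auto
  have "xs (Suc i) \<in> borel_measurable (\<F> (\<tau> (Suc i)))"
    unfolding xs_Suc[OF i, abs_def]
    by (intro borel_measurable_add borel_measurable_scaleR borel_measurable_const measurable_b measurable_matrix_vector_mult measurable_\<sigma> W1 up X Y Z t)
  moreover have "ys (Suc i) \<in> borel_measurable (\<F> (\<tau> (Suc i)))"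
    unfolding ys_Suc[OF i, abs_def]
    by (intro borel_measurable_add borel_measurable_times borel_measurable_const measurable_F borel_measurable_inner W1 up X Y Z t)
  moreover have "sq_integrable M (xs (Suc i))"
  proof -
    note m = sq_integrable_measurable[OF X(2)] sq_integrable_measurable[OF Y(2)] sq_integrable_measurable[OF Z(2)]
    have "sq_integrable M (\<lambda>\<omega>. b (\<tau> i) (xs i \<omega>) (ys i \<omega>) (zs i \<omega>))"
      by (rule sq_integrable_bounded[of _ L]) (intro measurable_b t m, rule b_bound[OF t])
    moreover have "sq_integrable M (\<lambda>\<omega>. \<sigma> (\<tau> i) (xs i \<omega>) (ys i \<omega>) *v (W (\<tau> (Suc i)) \<omega> - W (\<tau> i) \<omega>))"
      by (rule sq_integrable_matrix_vector_mult[of _ L, OF _ _ W2]) (intro measurable_\<sigma> t m, rule \<sigma>_bound[OF t])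
    ultimately show ?thesis
      unfolding xs_Suc[OF i, abs_def] by (intro sq_integrable_add sq_integrable_scaleR X)
  qed
  moreover have "sq_integrable M (\<lambda>\<omega>. F (\<tau> i) (xs i \<omega>) (ys i \<omega>) (zs i \<omega>) * (\<tau> (Suc i) - \<tau> i))"
    using sq_integrable_mult[OF sq_integrable_F[OF t X(2) Y(2) Z(2)], of "\<tau> (Suc i) - \<tau> i"] by (simp add: mult.commute)
  then have "sq_integrable M (ys (Suc i))"
    unfolding ys_Suc[OF i, abs_def] using le
    by (intro sq_integrable_add sq_integrable_inner_increment Y Z)
  ultimately show ?case by simp
qed

lemma
  assumes "i \<le> N"
  shows xs_adapted: "xs i \<in> borel_measurable (\<F> (\<tau> i))" and xs_sq: "sq_integrable M (xs i)"
    and ys_adapted: "ys i \<in> borel_measurable (\<F> (\<tau> i))" and ys_sq: "sq_integrable M (ys i)"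
  using scheme_adapted[OF assms] by auto

lemma zs: "i < N \<Longrightarrow> zs i \<in> borel_measurable (\<F> (\<tau> i))" "i < N \<Longrightarrow> sq_integrable M (zs i)"
  using zs_feedback[of i] xs_adapted[of i] by simp_all

definition Dev :: "nat \<Rightarrow> 'a \<Rightarrow> real" where "Dev i \<omega> = ys i \<omega> - u (\<tau> i) (xs i \<omega>)"

definition Zdev :: "nat \<Rightarrow> 'a \<Rightarrow> real ^ 'd" where
  "Zdev i \<omega> = zs i \<omega> - ux (\<tau> i) (xs i \<omega>) v* \<sigma> (\<tau> i) (xs i \<omega>) (ys i \<omega>)"

lemma Dev_adapted: "i \<le> N \<Longrightarrow> Dev i \<in> borel_measurable (\<F> (\<tau> i))"
  unfolding Dev_def[abs_def] by (intro borel_measurable_diff measurable_u grid_mem xs_adapted ys_adapted)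

lemma Dev_sq: "i \<le> N \<Longrightarrow> sq_integrable M (Dev i)"
  unfolding Dev_def[abs_def] by (intro sq_integrable_diff sq_integrable_u grid_mem xs_sq ys_sq)

lemma Zdev_adapted: "i < N \<Longrightarrow> Zdev i \<in> borel_measurable (\<F> (\<tau> i))"
  unfolding Zdev_def[abs_def]
  by (intro borel_measurable_diff measurable_vector_matrix_mult measurable_\<sigma> measurable_ux grid_mem xs_adapted ys_adapted zs) auto

lemma Zdev_sq: "i < N \<Longrightarrow> sq_integrable M (Zdev i)"
  unfolding Zdev_def[abs_def]
  by (intro sq_integrable_diff sq_integrable_ux\<sigma> grid_mem sq_integrable_measurable xs_sq ys_sq zs) auto

text \<open>Given the past up to \<open>\<tau> i\<close>, products of increment coordinates have
  mean \<open>\<Delta>\<close> on the diagonal and 0 off it, so the form has conditional mean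
  \<open>\<Delta>\<close> times the trace. The entries of \<open>hess\<close> are bounded, which
  supplies integrability.\<close>

lemma expectation_mult_quadratic:
  assumes i: "i < N" and G: "G \<in> borel_measurable (\<F> (\<tau> i))" "sq_integrable M G"
  defines "w \<equiv> \<lambda>\<omega>. W (\<tau> (Suc i)) \<omega> - W (\<tau> i) \<omega>" and "A \<equiv> \<lambda>\<omega>. hess (\<tau> i) (xs i \<omega>) (ys i \<omega>)"
  shows "expectation (\<lambda>\<omega>. G \<omega> * (w \<omega> \<bullet> (A \<omega> *v w \<omega>) - (\<tau> (Suc i) - \<tau> i) * trace (A \<omega>))) = 0"
proof -
  let ?\<Delta> = "\<tau> (Suc i) - \<tau> i"
  have le: "0 \<le> \<tau> i" "\<tau> i \<le> \<tau> (Suc i)" and t: "\<tau> i \<in> {0..T}" using grid_less[OF i] grid_mem[of i] i by auto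
  have Am: "(\<lambda>\<omega>. A \<omega> $ k $ l) \<in> borel_measurable (\<F> (\<tau> i))" for k l
    unfolding A_def using i by (intro measurable_hess t xs_adapted ys_adapted) auto
  have Hm: "(\<lambda>\<omega>. G \<omega> * A \<omega> $ k $ l) \<in> borel_measurable (\<F> (\<tau> i))" for k l
    by (intro borel_measurable_times G Am)
  have Hi: "integrable M (\<lambda>\<omega>. G \<omega> * A \<omega> $ k $ l)" for k l
  proof (intro sq_integrable_times G sq_integrable_bounded)
    show "(\<lambda>\<omega>. A \<omega> $ k $ l) \<in> borel_measurable M" by (rule measurable_filtration[OF Am])
    show "norm (A \<omega> $ k $ l) \<le> L^3" for \<omega> unfolding A_def real_norm_def by (rule abs_hess_component_le[OF t])
  qed
  note I = integrable_mult_increment2[OF le Hm Hi, folded w_def] and E = expectation_mult_increment2[OF le Hm Hi, folded w_def]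
  have wm: "(\<lambda>\<omega>. W (\<tau> (Suc i)) \<omega> - W (\<tau> i) \<omega>) = w" by (simp add: w_def)
  have eq: "G \<omega> * (w \<omega> \<bullet> (A \<omega> *v w \<omega>) - ?\<Delta> * trace (A \<omega>)) =
     (\<Sum>k\<in>UNIV. \<Sum>l\<in>UNIV. (G \<omega> * A \<omega> $ k $ l) * (w \<omega> $ k * w \<omega> $ l)) - (\<Sum>k\<in>UNIV. ?\<Delta> * (G \<omega> * A \<omega> $ k $ k))" for \<omega>
    by (simp add: inner_vec_def matrix_vector_mult_def trace_def sum_distrib_left right_diff_distrib ac_simps)
  have "expectation (\<lambda>\<omega>. G \<omega> * (w \<omega> \<bullet> (A \<omega> *v w \<omega>) - ?\<Delta> * trace (A \<omega>))) =
     expectation (\<lambda>\<omega>. \<Sum>k\<in>UNIV. \<Sum>l\<in>UNIV. (G \<omega> * A \<omega> $ k $ l) * (w \<omega> $ k * w \<omega> $ l)) - expectation (\<lambda>\<omega>. \<Sum>k\<in>UNIV. ?\<Delta> * (G \<omega> * A \<omega> $ k $ k))"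
    unfolding eq using I by (intro Bochner_Integration.integral_diff Bochner_Integration.integrable_sum integrable_mult_right Hi) (simp_all add: w_def)
  also have "expectation (\<lambda>\<omega>. \<Sum>k\<in>UNIV. ?\<Delta> * (G \<omega> * A \<omega> $ k $ k)) = (\<Sum>k\<in>UNIV. ?\<Delta> * expectation (\<lambda>\<omega>. G \<omega> * A \<omega> $ k $ k))"
    using Hi by (subst Bochner_Integration.integral_sum) auto
  also have "expectation (\<lambda>\<omega>. \<Sum>k\<in>UNIV. \<Sum>l\<in>UNIV. (G \<omega> * A \<omega> $ k $ l) * (w \<omega> $ k * w \<omega> $ l)) =
     (\<Sum>k\<in>UNIV. \<Sum>l\<in>UNIV. (if k = l then ?\<Delta> else 0) * expectation (\<lambda>\<omega>. G \<omega> * A \<omega> $ k $ l))"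
    unfolding w_def
    by (simp add: Bochner_Integration.integral_sum Bochner_Integration.integrable_sum
       integrable_mult_increment2[OF le Hm Hi] expectation_mult_increment2[OF le Hm Hi] del: vector_minus_component)
  also have "\<dots> = (\<Sum>k\<in>UNIV. ?\<Delta> * expectation (\<lambda>\<omega>. G \<omega> * A \<omega> $ k $ k))"
    by (intro sum.cong refl) (simp add: if_distrib[of "\<lambda>x. x * _"] cong: if_cong)
  finally show ?thesis by simp
qed

text \<open>Write \<open>Dev (Suc i) = e + n - R\<close> with \<open>e\<close> known at
  \<open>\<tau> i\<close> and \<open>n\<close> centred given that time, so that \<open>e * n\<close>
  has mean 0. The mean of \<open>(e + n)\<^sup>2\<close> is bounded below by the deviations at
  \<open>i\<close> and above by the one at \<open>Suc i\<close> and the Taylor remainder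
  \<open>R\<close>. Of the full \<open>\<Delta>\<close> in front of the second moment of
  \<open>Zdev i\<close>, one half is lost in separating \<open>Q\<close>, one quarter goes to the
  drift defect, and one quarter remains.\<close>

lemma backward_step:
  assumes i: "i < N" and \<Delta>1: "\<tau> (Suc i) - \<tau> i \<le> 1"
  defines "\<Delta> \<equiv> \<tau> (Suc i) - \<tau> i" and "c \<equiv> 1 + 105 * real CARD('d)^4"
  shows "(1 - (2 * (7 * L^4) + 4 * (7 * L^4)\<^sup>2) * \<Delta>) * expectation (\<lambda>\<omega>. (Dev i \<omega>)\<^sup>2) + \<Delta> / 4 * expectation (\<lambda>\<omega>. (norm (Zdev i \<omega>))\<^sup>2) \<le>
    (1 + \<Delta>) * expectation (\<lambda>\<omega>. (Dev (Suc i) \<omega>)\<^sup>2) + (L^6 + 128 * (66 * L^6)\<^sup>2) * c * (\<Delta> * \<Delta> powr \<alpha>)"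
proof -
  have le: "0 \<le> \<tau> i" "\<tau> i < \<tau> (Suc i)" and t: "\<tau> i \<in> {0..T}" "\<tau> (Suc i) \<in> {0..T}"
    using grid_less[OF i] grid_mem[of i] grid_mem[of "Suc i"] i by auto
  have \<Delta>: "0 < \<Delta>" "\<Delta> \<le> 1" using le \<Delta>1 unfolding \<Delta>_def by auto
  define h where "h = \<Delta> powr (\<alpha> / 2)"
  define K where "K = 7 * L^4"
  have K0: "0 \<le> K" unfolding K_def by simp
  define w where "w \<omega> = W (\<tau> (Suc i)) \<omega> - W (\<tau> i) \<omega>" for \<omega>
  define A where "A \<omega> = drift_defect (\<tau> i) (xs i \<omega>) (ys i \<omega>) (zs i \<omega>)" for \<omega>
  define Q where "Q \<omega> = 1 / 2 * (w \<omega> \<bullet> (hess (\<tau> i) (xs i \<omega>) (ys i \<omega>) *v w \<omega>) - \<Delta> * trace (hess (\<tau> i) (xs i \<omega>) (ys i \<omega>)))" for \<omega>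
  define n where "n \<omega> = Zdev i \<omega> \<bullet> w \<omega> - Q \<omega>" for \<omega>
  define e where "e \<omega> = Dev i \<omega> + \<Delta> * A \<omega>" for \<omega>
  define R where "R \<omega> = e \<omega> + n \<omega> - Dev (Suc i) \<omega>" for \<omega>
  \<comment> \<open>The increment in units of its standard deviation, so that its moments are
    bounded independently of the step.\<close>
  define \<rho> where "\<rho> \<omega> = norm (w \<omega>) / sqrt \<Delta>" for \<omega>
  note D = Dev_adapted[OF less_imp_le[OF i]] Dev_sq[OF less_imp_le[OF i]]
  note Zd = Zdev_adapted[OF i] Zdev_sq[OF i]
  note X = xs_adapted[OF less_imp_le[OF i]] and Y = ys_adapted[OF less_imp_le[OF i]]
  have R_le: "\<bar>R \<omega>\<bar> \<le> 66 * L^6 * (\<Delta> * h) * (1 + \<rho> \<omega>)^3" for \<omega>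
  proof -
    have id: "Dev (Suc i) \<omega> = ys i \<omega> + F (\<tau> i) (xs i \<omega>) (ys i \<omega>) (zs i \<omega>) * \<Delta> + zs i \<omega> \<bullet> w \<omega>
      - u (\<tau> (Suc i)) (xs i \<omega> + \<Delta> *\<^sub>R b (\<tau> i) (xs i \<omega>) (ys i \<omega>) (zs i \<omega>) + \<sigma> (\<tau> i) (xs i \<omega>) (ys i \<omega>) *v w \<omega>)"
      unfolding Dev_def xs_Suc[OF i] ys_Suc[OF i] \<Delta>_def w_def ..
    obtain r where r: "Dev (Suc i) \<omega> = e \<omega> + n \<omega> - r" "\<bar>r\<bar> \<le> 66 * L^6 * (\<Delta> * h) * (1 + \<rho> \<omega>)^3"
      using scheme_step[OF t le(2) \<Delta>1, of "ys i \<omega>" "xs i \<omega>" "zs i \<omega>" "w \<omega>"]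
      unfolding id[unfolded \<Delta>_def, symmetric] unfolding \<Delta>_def[symmetric] h_def[symmetric] \<rho>_def[symmetric]
      by (auto simp: e_def n_def Q_def A_def Dev_def Zdev_def algebra_simps)
    then show ?thesis unfolding R_def by simp
  qed
  have A_le: "\<bar>A \<omega>\<bar> \<le> K * (\<bar>Dev i \<omega>\<bar> + norm (Zdev i \<omega>))" for \<omega>
    unfolding A_def K_def Dev_def Zdev_def by (rule abs_drift_defect_le[OF t(1)])
  have \<rho>0: "0 \<le> \<rho> \<omega>" and \<rho>w: "norm (w \<omega>) = sqrt \<Delta> * \<rho> \<omega>" for \<omega> unfolding \<rho>_def using \<Delta> by auto
  have \<rho>8: "integrable M (\<lambda>\<omega>. 1 + \<rho> \<omega> ^ 8)" "expectation (\<lambda>\<omega>. 1 + \<rho> \<omega> ^ 8) \<le> c"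
  proof -
    have s8: "sqrt \<Delta> ^ 8 = \<Delta>^4" using \<Delta> power_mult[of "sqrt \<Delta>" 2 4] by simp
    have eq: "\<rho> \<omega> ^ 8 = norm (w \<omega>) ^ 8 / \<Delta>^4" for \<omega> unfolding \<rho>_def by (simp add: power_divide s8)
    note I = increment_power_8[OF le, folded w_def, folded \<Delta>_def]
    show "integrable M (\<lambda>\<omega>. 1 + \<rho> \<omega> ^ 8)" unfolding eq using I(1) by simp
    have "expectation (\<lambda>\<omega>. 1 + \<rho> \<omega> ^ 8) = 1 + expectation (\<lambda>\<omega>. norm (w \<omega>) ^ 8) / \<Delta>^4"
      unfolding eq using I(1) by (simp add: prob_space)
    also have "\<dots> \<le> c" using I(2) \<Delta> unfolding c_def by (simp add: divide_le_eq)
    finally show "expectation (\<lambda>\<omega>. 1 + \<rho> \<omega> ^ 8) \<le> c" .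
  qed
  \<comment> \<open>Both compare with \<open>max 1 r\<close>, whose eighth power is at most
    \<open>1 + r^8\<close>; one moment then serves the remainder and the quadratic term.\<close>
  have pow: "(1 + r)^6 \<le> 64 * (1 + r^8)" "(1 + r\<^sup>2)\<^sup>2 \<le> 4 * (1 + r^8)" if "0 \<le> r" for r :: real
  proof -
    define m where "m = max 1 r"
    have m: "1 \<le> m" "r \<le> m" "m^8 \<le> 1 + r^8" using that unfolding m_def by (auto simp: max_def)
    have "(1 + r)^6 \<le> (2 * m)^6" using m that by (intro power_mono) auto
    also have "\<dots> = 64 * m^6" by (simp add: power_mult_distrib)
    also have "m^6 \<le> m^8" using m by (intro power_increasing) auto
    finally show "(1 + r)^6 \<le> 64 * (1 + r^8)" using m by simp
    have "r\<^sup>2 \<le> m\<^sup>2" "1 \<le> m\<^sup>2" using m that by (auto intro!: power_mono)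
    then have "(1 + r\<^sup>2)\<^sup>2 \<le> (2 * m\<^sup>2)\<^sup>2" by (intro power_mono) auto
    also have "\<dots> = 4 * m^4" by (simp add: power_mult_distrib)
    also have "m^4 \<le> m^8" using m by (intro power_increasing) auto
    finally show "(1 + r\<^sup>2)\<^sup>2 \<le> 4 * (1 + r^8)" using m by simp
  qed
  have hh: "h * h = \<Delta> powr \<alpha>" unfolding h_def by (simp add: powr_add[symmetric])
  have R2: "(R \<omega>)\<^sup>2 \<le> (66 * L^6)\<^sup>2 * 64 * (\<Delta>\<^sup>2 * \<Delta> powr \<alpha>) * (1 + \<rho> \<omega> ^ 8)" for \<omega>
  proof -
    have "(R \<omega>)\<^sup>2 \<le> (66 * L^6 * (\<Delta> * h) * (1 + \<rho> \<omega>)^3)\<^sup>2"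
      by (rule power2_le_iff_abs_le[THEN iffD2, OF order_trans[OF abs_ge_zero R_le] R_le])
    also have "\<dots> = (66 * L^6)\<^sup>2 * (\<Delta>\<^sup>2 * (h * h)) * (1 + \<rho> \<omega>)^6"
      by (simp only: power_mult_distrib power_mult[symmetric] power2_eq_square[of h]) simp
    also have "\<dots> \<le> (66 * L^6)\<^sup>2 * (\<Delta>\<^sup>2 * (h * h)) * (64 * (1 + \<rho> \<omega> ^ 8))"
      by (intro mult_left_mono pow \<rho>0) (auto simp: hh)
    finally show ?thesis unfolding hh by (simp add: ac_simps)
  qed
  have Q2: "(Q \<omega>)\<^sup>2 \<le> L^6 * \<Delta>\<^sup>2 * (1 + \<rho> \<omega> ^ 8)" for \<omega>
  proof -
    have n2: "norm (w \<omega>) * norm (w \<omega>) = \<Delta> * (\<rho> \<omega>)\<^sup>2" unfolding \<rho>w using \<Delta> by (simp add: power2_eq_square)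
    have "\<bar>w \<omega> \<bullet> (hess (\<tau> i) (xs i \<omega>) (ys i \<omega>) *v w \<omega>)\<bar> \<le> L^3 * (\<Delta> * (\<rho> \<omega>)\<^sup>2)"
      using abs_inner_hess_le[OF t(1), of "w \<omega>" "xs i \<omega>" "ys i \<omega>" "w \<omega>"] unfolding n2 .
    moreover have "\<bar>\<Delta> * trace (hess (\<tau> i) (xs i \<omega>) (ys i \<omega>))\<bar> \<le> L^3 * \<Delta>"
      unfolding abs_mult using mult_left_mono[OF order_trans[OF abs_trace_hess_le[OF t(1), of "xs i \<omega>" "ys i \<omega>"] L_power_mono[of 2 3]], of \<Delta>] \<Delta> by (simp add: mult.commute)
    ultimately have "\<bar>Q \<omega>\<bar> \<le> 1 / 2 * (L^3 * (\<Delta> * (\<rho> \<omega>)\<^sup>2) + L^3 * \<Delta>)"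
      unfolding Q_def by simp
    also have "\<dots> = L^3 * \<Delta> * (1 + (\<rho> \<omega>)\<^sup>2) / 2" by (simp add: algebra_simps)
    finally have "(Q \<omega>)\<^sup>2 \<le> (L^3 * \<Delta> * (1 + (\<rho> \<omega>)\<^sup>2) / 2)\<^sup>2"
      using \<Delta> by (intro power2_le_iff_abs_le[THEN iffD2]) auto
    also have "\<dots> = L^6 * \<Delta>\<^sup>2 * (1 + (\<rho> \<omega>)\<^sup>2)\<^sup>2 / 4" by (simp add: power_mult_distrib power_divide)
    also have "\<dots> \<le> L^6 * \<Delta>\<^sup>2 * (4 * (1 + \<rho> \<omega> ^ 8)) / 4"
      by (intro divide_right_mono mult_left_mono pow \<rho>0) auto
    finally show ?thesis by (simp add: algebra_simps)
  qed
  have wm: "w \<in> borel_measurable M" unfolding w_def[abs_def]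
    using sq_integrable_increment[of "\<tau> i" "\<tau> (Suc i)"] le sq_integrable_measurable by auto
  have Am: "A \<in> borel_measurable (\<F> (\<tau> i))" unfolding A_def[abs_def] by (intro measurable_drift_defect t X Y zs i)
  have Ai: "sq_integrable M A"
  proof (rule sq_integrable_bound)
    show "sq_integrable M (\<lambda>\<omega>. K * (norm (Dev i \<omega>) + norm (Zdev i \<omega>)))"
      by (intro sq_integrable_mult sq_integrable_add sq_integrable_norm D Zd)
    show "AE \<omega> in M. norm (A \<omega>) \<le> norm (K * (norm (Dev i \<omega>) + norm (Zdev i \<omega>)))"
      using A_le K0 by (simp add: abs_mult)
  qed (rule measurable_filtration[OF Am])
  have em: "e \<in> borel_measurable (\<F> (\<tau> i))" unfolding e_def[abs_def] by (intro borel_measurable_add borel_measurable_times borel_measurable_const D Am)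
  have ei: "sq_integrable M e" unfolding e_def[abs_def] by (intro sq_integrable_add sq_integrable_mult D Ai)
  have Qm: "Q \<in> borel_measurable M"
  proof -
    have hm: "(\<lambda>\<omega>. hess (\<tau> i) (xs i \<omega>) (ys i \<omega>) $ k $ l) \<in> borel_measurable M" for k l
      by (intro measurable_hess t measurable_filtration[OF X] measurable_filtration[OF Y])
    have "Q \<omega> = 1 / 2 * ((\<Sum>k\<in>UNIV. w \<omega> $ k * (\<Sum>l\<in>UNIV. hess (\<tau> i) (xs i \<omega>) (ys i \<omega>) $ k $ l * w \<omega> $ l))
        - \<Delta> * (\<Sum>k\<in>UNIV. hess (\<tau> i) (xs i \<omega>) (ys i \<omega>) $ k $ k))" for \<omega>
      unfolding Q_def by (simp add: inner_vec_def trace_def matrix_vector_mult_def)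
    then have "Q = (\<lambda>\<omega>. 1 / 2 * ((\<Sum>k\<in>UNIV. w \<omega> $ k * (\<Sum>l\<in>UNIV. hess (\<tau> i) (xs i \<omega>) (ys i \<omega>) $ k $ l * w \<omega> $ l))
        - \<Delta> * (\<Sum>k\<in>UNIV. hess (\<tau> i) (xs i \<omega>) (ys i \<omega>) $ k $ k)))" by blast
    then show ?thesis
      by (simp only:) (intro borel_measurable_diff borel_measurable_times borel_measurable_const borel_measurable_sum measurable_vec_nth[OF wm] hm)
  qed
  have sq_of_bound: "sq_integrable M f" if "f \<in> borel_measurable M" "\<And>\<omega>. (f \<omega>)\<^sup>2 \<le> k * (1 + \<rho> \<omega> ^ 8)" for f :: "'a \<Rightarrow> real" and k
    unfolding sq_integrable_def
    by (intro conjI that(1) Bochner_Integration.integrable_bound[OF integrable_mult_right[OF \<rho>8(1), of k]])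
      (use that in \<open>auto intro: order_trans[OF _ abs_ge_self]\<close>)
  have Qi: "sq_integrable M Q" by (rule sq_of_bound[OF Qm Q2])
  have Zwi: "sq_integrable M (\<lambda>\<omega>. Zdev i \<omega> \<bullet> w \<omega>)" unfolding w_def using le by (intro sq_integrable_inner_increment Zd) auto
  have ni: "sq_integrable M n" unfolding n_def[abs_def] by (intro sq_integrable_diff Zwi Qi)
  note D' = Dev_sq[of "Suc i"]
  have D'i: "sq_integrable M (Dev (Suc i))" using i by (intro D') auto
  have Ri: "sq_integrable M R" unfolding R_def[abs_def] by (intro sq_integrable_diff sq_integrable_add ei ni D'i)
  have ER: "expectation (\<lambda>\<omega>. (R \<omega>)\<^sup>2) \<le> (66 * L^6)\<^sup>2 * 64 * (\<Delta>\<^sup>2 * \<Delta> powr \<alpha>) * c"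
  proof -
    have "expectation (\<lambda>\<omega>. (R \<omega>)\<^sup>2) \<le> expectation (\<lambda>\<omega>. (66 * L^6)\<^sup>2 * 64 * (\<Delta>\<^sup>2 * \<Delta> powr \<alpha>) * (1 + \<rho> \<omega> ^ 8))"
      using Ri by (intro integral_mono R2 integrable_mult_right \<rho>8) (simp add: sq_integrable_def)
    also have "\<dots> = (66 * L^6)\<^sup>2 * 64 * (\<Delta>\<^sup>2 * \<Delta> powr \<alpha>) * expectation (\<lambda>\<omega>. 1 + \<rho> \<omega> ^ 8)" by simp
    also have "\<dots> \<le> (66 * L^6)\<^sup>2 * 64 * (\<Delta>\<^sup>2 * \<Delta> powr \<alpha>) * c" by (intro mult_left_mono \<rho>8) auto
    finally show ?thesis .
  qed
  have EQ: "expectation (\<lambda>\<omega>. (Q \<omega>)\<^sup>2) \<le> L^6 * \<Delta>\<^sup>2 * c"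
  proof -
    have "expectation (\<lambda>\<omega>. (Q \<omega>)\<^sup>2) \<le> expectation (\<lambda>\<omega>. L^6 * \<Delta>\<^sup>2 * (1 + \<rho> \<omega> ^ 8))"
      using Qi by (intro integral_mono Q2 integrable_mult_right \<rho>8) (simp add: sq_integrable_def)
    also have "\<dots> = L^6 * \<Delta>\<^sup>2 * expectation (\<lambda>\<omega>. 1 + \<rho> \<omega> ^ 8)" by simp
    also have "\<dots> \<le> L^6 * \<Delta>\<^sup>2 * c" by (intro mult_left_mono \<rho>8) auto
    finally show ?thesis .
  qed
  have Een: "expectation (\<lambda>\<omega>. e \<omega> * n \<omega>) = 0"
  proof -
    have "expectation (\<lambda>\<omega>. e \<omega> * (Zdev i \<omega> \<bullet> w \<omega>)) = 0"
      unfolding w_def using le by (intro expectation_mult_inner_increment em ei Zd) auto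
    moreover have "expectation (\<lambda>\<omega>. e \<omega> * Q \<omega>) = 0"
    proof -
      have "expectation (\<lambda>\<omega>. e \<omega> * Q \<omega>) = expectation (\<lambda>\<omega>. 1 / 2 * (e \<omega> * (w \<omega> \<bullet> (hess (\<tau> i) (xs i \<omega>) (ys i \<omega>) *v w \<omega>) - \<Delta> * trace (hess (\<tau> i) (xs i \<omega>) (ys i \<omega>)))))"
        unfolding Q_def by (simp add: mult.left_commute)
      also have "\<dots> = 1 / 2 * 0" unfolding integral_mult_right_zero
        using expectation_mult_quadratic[OF i em ei, folded w_def, folded \<Delta>_def] by simp
      finally show ?thesis by simp
    qed
    ultimately show ?thesis unfolding n_def right_diff_distrib
      by (subst Bochner_Integration.integral_diff) (auto intro!: sq_integrable_times ei Zwi Qi)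
  qed
  have EZ: "expectation (\<lambda>\<omega>. (Zdev i \<omega> \<bullet> w \<omega>)\<^sup>2) = \<Delta> * expectation (\<lambda>\<omega>. (norm (Zdev i \<omega>))\<^sup>2)"
    using expectation_inner_increment_mult[OF le(1) less_imp_le[OF le(2)] Zd Zd] unfolding w_def \<Delta>_def
    by (simp add: power2_eq_square[of "_ \<bullet> _"] power2_norm_eq_inner)
  \<comment> \<open>A pointwise inequality whose expectation is the claim; the product
    \<open>e * n\<close> is carried along because only its mean vanishes.\<close>
  have point: "(1 - (2 * K + 4 * K\<^sup>2) * \<Delta>) * (Dev i \<omega>)\<^sup>2 - \<Delta> / 4 * (norm (Zdev i \<omega>))\<^sup>2 + 2 * (e \<omega> * n \<omega>) + 1 / 2 * (Zdev i \<omega> \<bullet> w \<omega>)\<^sup>2 - (Q \<omega>)\<^sup>2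
     \<le> (1 + \<Delta>) * (Dev (Suc i) \<omega>)\<^sup>2 + 2 / \<Delta> * (R \<omega>)\<^sup>2" for \<omega>
  proof -
    let ?D = "Dev i \<omega>" and ?z = "norm (Zdev i \<omega>)" and ?D' = "Dev (Suc i) \<omega>"
    \<comment> \<open>Young's inequality, weighted so that the squared norm of \<open>Zdev i\<close>
      gets the coefficient 1/4; the price is \<open>4 * K\<^sup>2\<close> in front of the squared
      deviation.\<close>
    have 1: "(e \<omega>)\<^sup>2 \<ge> ?D\<^sup>2 - \<Delta> * ((2 * K + 4 * K\<^sup>2) * ?D\<^sup>2 + 1 / 4 * ?z\<^sup>2)"
    proof -
      have "- (?D * A \<omega>) \<le> \<bar>?D\<bar> * (K * (\<bar>?D\<bar> + ?z))"
        using mult_left_mono[OF A_le[of \<omega>], of "\<bar>?D\<bar>"] abs_ge_minus_self[of "?D * A \<omega>"] by (simp add: abs_mult)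
      also have "\<dots> = K * ?D\<^sup>2 + (2 * K * \<bar>?D\<bar>) * ?z / 2" by (simp add: power2_eq_square algebra_simps)
      also have "2 * (2 * K * \<bar>?D\<bar>) * (?z / 2) \<le> (2 * K * \<bar>?D\<bar>)\<^sup>2 + (?z / 2)\<^sup>2" by (rule sum_squares_bound)
      then have "(2 * K * \<bar>?D\<bar>) * ?z / 2 \<le> 1 / 2 * (4 * K\<^sup>2 * ?D\<^sup>2 + 1 / 4 * ?z\<^sup>2)"
        by (simp add: power_mult_distrib power_divide)
      finally have "- (?D * A \<omega>) \<le> 1 / 2 * ((2 * K + 4 * K\<^sup>2) * ?D\<^sup>2 + 1 / 4 * ?z\<^sup>2)" by (simp add: algebra_simps)
      from mult_left_mono[OF this, of "2 * \<Delta>"] \<Delta>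
      have "- (2 * \<Delta> * (?D * A \<omega>)) \<le> \<Delta> * ((2 * K + 4 * K\<^sup>2) * ?D\<^sup>2 + 1 / 4 * ?z\<^sup>2)" by simp
      moreover have "(e \<omega>)\<^sup>2 = ?D\<^sup>2 + 2 * \<Delta> * (?D * A \<omega>) + (\<Delta> * A \<omega>)\<^sup>2" unfolding e_def by (simp add: power2_sum)
      ultimately show ?thesis using zero_le_power2[of "\<Delta> * A \<omega>"] by linarith
    qed
    have 2: "(n \<omega>)\<^sup>2 \<ge> 1 / 2 * (Zdev i \<omega> \<bullet> w \<omega>)\<^sup>2 - (Q \<omega>)\<^sup>2"
      using norm_add_sq_le[of "n \<omega>" "Q \<omega>"] unfolding n_def by simp
    \<comment> \<open>Young's inequality with weight \<open>\<Delta>\<close>: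
      \<open>Dev (Suc i)\<close> gains only the factor \<open>1 + \<Delta>\<close>, while
      \<open>2 / \<Delta>\<close> in front of \<open>R\<^sup>2\<close> is affordable because
      \<open>R\<close> is of order \<open>\<Delta> * \<Delta> powr (\<alpha> / 2)\<close>.\<close>
    have 3: "(e \<omega> + n \<omega>)\<^sup>2 \<le> (1 + \<Delta>) * ?D'\<^sup>2 + 2 / \<Delta> * (R \<omega>)\<^sup>2"
    proof -
      have "2 * (sqrt \<Delta> * ?D') * (R \<omega> / sqrt \<Delta>) \<le> (sqrt \<Delta> * ?D')\<^sup>2 + (R \<omega> / sqrt \<Delta>)\<^sup>2" by (rule sum_squares_bound)
      then have "2 * ?D' * R \<omega> \<le> \<Delta> * ?D'\<^sup>2 + (R \<omega>)\<^sup>2 / \<Delta>" using \<Delta> by (simp add: power_mult_distrib power_divide)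
      moreover have "(R \<omega>)\<^sup>2 \<le> (R \<omega>)\<^sup>2 / \<Delta>" using \<Delta> by (simp add: le_divide_eq mult_left_le)
      moreover have "e \<omega> + n \<omega> = ?D' + R \<omega>" unfolding R_def by simp
      then have "(e \<omega> + n \<omega>)\<^sup>2 = ?D'\<^sup>2 + (R \<omega>)\<^sup>2 + 2 * ?D' * R \<omega>" by (simp add: power2_sum)
      ultimately show ?thesis by (simp add: algebra_simps)
    qed
    have "(e \<omega> + n \<omega>)\<^sup>2 = (e \<omega>)\<^sup>2 + (n \<omega>)\<^sup>2 + 2 * (e \<omega> * n \<omega>)" by (simp add: power2_sum)
    then show ?thesis using 1 2 3 by (simp add: algebra_simps)
  qed
  note sqi = D(2)[unfolded sq_integrable_def, THEN conjunct2] Zd(2)[unfolded sq_integrable_def, THEN conjunct2]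
    D'i[unfolded sq_integrable_def, THEN conjunct2] Ri[unfolded sq_integrable_def, THEN conjunct2]
    Qi[unfolded sq_integrable_def, THEN conjunct2] Zwi[unfolded sq_integrable_def, THEN conjunct2]
  have eni: "integrable M (\<lambda>\<omega>. e \<omega> * n \<omega>)" by (intro sq_integrable_times ei ni)
  have "expectation (\<lambda>\<omega>. (1 - (2 * K + 4 * K\<^sup>2) * \<Delta>) * (Dev i \<omega>)\<^sup>2 - \<Delta> / 4 * (norm (Zdev i \<omega>))\<^sup>2 + 2 * (e \<omega> * n \<omega>) + 1 / 2 * (Zdev i \<omega> \<bullet> w \<omega>)\<^sup>2 - (Q \<omega>)\<^sup>2)
    \<le> expectation (\<lambda>\<omega>. (1 + \<Delta>) * (Dev (Suc i) \<omega>)\<^sup>2 + 2 / \<Delta> * (R \<omega>)\<^sup>2)"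
    using sqi eni by (intro integral_mono point) auto
  also have "\<dots> = (1 + \<Delta>) * expectation (\<lambda>\<omega>. (Dev (Suc i) \<omega>)\<^sup>2) + 2 / \<Delta> * expectation (\<lambda>\<omega>. (R \<omega>)\<^sup>2)"
    using sqi by simp
  also have "expectation (\<lambda>\<omega>. (1 - (2 * K + 4 * K\<^sup>2) * \<Delta>) * (Dev i \<omega>)\<^sup>2 - \<Delta> / 4 * (norm (Zdev i \<omega>))\<^sup>2 + 2 * (e \<omega> * n \<omega>) + 1 / 2 * (Zdev i \<omega> \<bullet> w \<omega>)\<^sup>2 - (Q \<omega>)\<^sup>2)
    = (1 - (2 * K + 4 * K\<^sup>2) * \<Delta>) * expectation (\<lambda>\<omega>. (Dev i \<omega>)\<^sup>2) - \<Delta> / 4 * expectation (\<lambda>\<omega>. (norm (Zdev i \<omega>))\<^sup>2)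
      + 2 * expectation (\<lambda>\<omega>. e \<omega> * n \<omega>) + 1 / 2 * expectation (\<lambda>\<omega>. (Zdev i \<omega> \<bullet> w \<omega>)\<^sup>2) - expectation (\<lambda>\<omega>. (Q \<omega>)\<^sup>2)"
    using sqi eni by simp
  finally have main: "(1 - (2 * K + 4 * K\<^sup>2) * \<Delta>) * expectation (\<lambda>\<omega>. (Dev i \<omega>)\<^sup>2) + \<Delta> / 4 * expectation (\<lambda>\<omega>. (norm (Zdev i \<omega>))\<^sup>2)
    \<le> (1 + \<Delta>) * expectation (\<lambda>\<omega>. (Dev (Suc i) \<omega>)\<^sup>2) + 2 / \<Delta> * expectation (\<lambda>\<omega>. (R \<omega>)\<^sup>2) + expectation (\<lambda>\<omega>. (Q \<omega>)\<^sup>2)"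
    unfolding Een EZ by simp
  have c0: "0 \<le> c" unfolding c_def by simp
  have "2 / \<Delta> * expectation (\<lambda>\<omega>. (R \<omega>)\<^sup>2) \<le> 2 / \<Delta> * ((66 * L^6)\<^sup>2 * 64 * (\<Delta>\<^sup>2 * \<Delta> powr \<alpha>) * c)"
    using \<Delta> by (intro mult_left_mono ER) auto
  also have "\<dots> = 128 * (66 * L^6)\<^sup>2 * c * (\<Delta> * \<Delta> powr \<alpha>)" using \<Delta> by (simp add: power2_eq_square)
  finally have fin1: "2 / \<Delta> * expectation (\<lambda>\<omega>. (R \<omega>)\<^sup>2) \<le> 128 * (66 * L^6)\<^sup>2 * c * (\<Delta> * \<Delta> powr \<alpha>)" .
  \<comment> \<open>The centred quadratic term has second moment of order
    \<open>\<Delta>\<^sup>2\<close>, which is absorbed because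
    \<open>\<alpha> \<le> 1\<close>.\<close>
  have "\<Delta> powr 1 \<le> \<Delta> powr \<alpha>" using \<Delta> \<alpha> by (intro powr_mono') auto
  then have "L^6 * c * (\<Delta> * \<Delta>) \<le> L^6 * c * (\<Delta> * \<Delta> powr \<alpha>)" using \<Delta> c0 by (intro mult_left_mono) auto
  then have fin2: "expectation (\<lambda>\<omega>. (Q \<omega>)\<^sup>2) \<le> L^6 * c * (\<Delta> * \<Delta> powr \<alpha>)" using EQ by (simp add: power2_eq_square ac_simps)
  show ?thesis using main fin1 fin2 unfolding K_def[symmetric] by (simp add: algebra_simps)
qed

text \<open>For \<open>0 \<le> x \<le> 1 / 2\<close> one has
  \<open>1 \<le> (1 + 2 * x) * (1 - x)\<close>. With \<open>x = k * \<Delta>\<close> this removes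
  the factor \<open>1 - k * \<Delta>\<close> of \<open>backward_step\<close> and explains the
  condition \<open>k * h \<le> 1 / 2\<close>; the exponent \<open>2 * k + 1\<close> collects the
  factors \<open>1 + 2 * k * \<Delta>\<close> and \<open>1 + \<Delta>\<close>.\<close>

lemma backward_estimate:
  defines "k \<equiv> 2 * (7 * L^4) + 4 * (7 * L^4)\<^sup>2" and "c \<equiv> (L^6 + 128 * (66 * L^6)\<^sup>2) * (1 + 105 * real CARD('d)^4)"
  assumes h: "\<And>i. i < N \<Longrightarrow> \<tau> (Suc i) - \<tau> i \<le> h" "h \<le> 1" "k * h \<le> 1 / 2" and i: "i \<le> N"
  shows "expectation (\<lambda>\<omega>. (Dev i \<omega>)\<^sup>2) + (\<Sum>j=i..<N. (\<tau> (Suc j) - \<tau> j) / 4 * expectation (\<lambda>\<omega>. (norm (Zdev j \<omega>))\<^sup>2)) \<le>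
     exp ((2 * k + 1) * T) * (expectation (\<lambda>\<omega>. (Dev N \<omega>)\<^sup>2) + c * T * h powr \<alpha>)"
proof -
  have k0: "0 \<le> k" and c0: "0 \<le> c" unfolding k_def c_def by simp_all
  define d where "d i = expectation (\<lambda>\<omega>. (Dev i \<omega>)\<^sup>2)" for i
  define z where "z j = (\<tau> (Suc j) - \<tau> j) / 4 * expectation (\<lambda>\<omega>. (norm (Zdev j \<omega>))\<^sup>2)" for j
  have d0: "0 \<le> d i" for i unfolding d_def by simp
  have z0: "0 \<le> z i" if "i < N" for i using grid_less[OF that] unfolding z_def by simp
  have step: "d i + z i \<le> exp ((2 * k + 1) * (\<tau> (Suc i) - \<tau> i)) * (d (Suc i) + (c * h powr \<alpha>) * (\<tau> (Suc i) - \<tau> i))" if i: "i < N" for i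
  proof -
    define \<Delta> where "\<Delta> = \<tau> (Suc i) - \<tau> i"
    have \<Delta>: "0 < \<Delta>" "\<Delta> \<le> h" "\<Delta> \<le> 1" using grid_less[OF i] h(1)[OF i] h(2) unfolding \<Delta>_def by auto
    have k\<Delta>: "k * \<Delta> \<le> 1 / 2" using mult_left_mono[OF \<Delta>(2) k0] h(3) by linarith
    have k\<Delta>0: "0 \<le> k * \<Delta>" using k0 \<Delta> by simp
    have \<Delta>h: "\<Delta> powr \<alpha> \<le> h powr \<alpha>" using \<Delta> \<alpha> by (intro powr_mono2) auto
    have bs: "(1 - k * \<Delta>) * d i + z i \<le> (1 + \<Delta>) * d (Suc i) + c * (\<Delta> * \<Delta> powr \<alpha>)"
      using backward_step[OF i, folded \<Delta>_def] \<Delta> unfolding d_def z_def k_def c_def \<Delta>_def by simp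
    also have "\<dots> \<le> exp \<Delta> * d (Suc i) + exp \<Delta> * (c * h powr \<alpha> * \<Delta>)"
    proof (intro add_mono mult_right_mono exp_ge_add_one_self d0)
      have "c * (\<Delta> * \<Delta> powr \<alpha>) \<le> c * (\<Delta> * h powr \<alpha>)" using \<Delta> c0 \<Delta>h by (intro mult_left_mono) auto
      also have "\<dots> \<le> exp \<Delta> * (c * (\<Delta> * h powr \<alpha>))" using \<Delta> c0 mult_right_mono[of 1 "exp \<Delta>" "c * (\<Delta> * h powr \<alpha>)"] by simp
      finally show "c * (\<Delta> * \<Delta> powr \<alpha>) \<le> exp \<Delta> * (c * h powr \<alpha> * \<Delta>)" by (simp add: ac_simps)
    qed
    also have "\<dots> = exp \<Delta> * (d (Suc i) + c * h powr \<alpha> * \<Delta>)" by (simp add: algebra_simps)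
    finally have A: "(1 - k * \<Delta>) * d i + z i \<le> exp \<Delta> * (d (Suc i) + c * h powr \<alpha> * \<Delta>)" .
    let ?f = "1 + 2 * (k * \<Delta>)"
    have f: "1 \<le> ?f * (1 - k * \<Delta>)"
    proof -
      have "k * \<Delta> * (k * \<Delta>) \<le> 1 / 2 * (k * \<Delta>)" using k\<Delta> k\<Delta>0 by (rule mult_right_mono)
      then show ?thesis by (simp add: algebra_simps)
    qed
    have "d i + z i \<le> (?f * (1 - k * \<Delta>)) * d i + ?f * z i"
      using mult_right_mono[OF f d0[of i]] mult_right_mono[of 1 ?f "z i"] k\<Delta>0 z0[OF i] by simp
    also have "\<dots> = ?f * ((1 - k * \<Delta>) * d i + z i)" by (simp add: algebra_simps)
    also have "\<dots> \<le> exp (2 * (k * \<Delta>)) * (exp \<Delta> * (d (Suc i) + c * h powr \<alpha> * \<Delta>))"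
      using A k\<Delta>0 k\<Delta> d0[of i] z0[OF i]
      by (intro mult_mono exp_ge_add_one_self) (auto intro!: add_nonneg_nonneg mult_nonneg_nonneg)
    also have "\<dots> = exp ((2 * k + 1) * \<Delta>) * (d (Suc i) + c * h powr \<alpha> * \<Delta>)"
    proof -
      have e: "(2 * k + 1) * \<Delta> = 2 * (k * \<Delta>) + \<Delta>" by (simp add: algebra_simps)
      show ?thesis unfolding e exp_add by (simp only: mult.assoc)
    qed
    finally show ?thesis unfolding \<Delta>_def .
  qed
  have "d i + (\<Sum>j=i..<N. z j) \<le> exp ((2 * k + 1) * (T - \<tau> i)) * (d N + (c * h powr \<alpha>) * (T - \<tau> i))"
    using k0 c0 by (intro backward_gronwall[OF grid _ _ d0 z0 step i]) auto
  also have "\<dots> \<le> exp ((2 * k + 1) * T) * (d N + (c * h powr \<alpha>) * T)"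
  proof (rule mult_mono)
    have r: "0 \<le> T - \<tau> i" "T - \<tau> i \<le> T" using grid_mem[OF i] by auto
    have c': "0 \<le> c * h powr \<alpha>" using c0 by simp
    show "exp ((2 * k + 1) * (T - \<tau> i)) \<le> exp ((2 * k + 1) * T)" using mult_left_mono[OF r(2), of "2 * k + 1"] k0 by simp
    show "d N + c * h powr \<alpha> * (T - \<tau> i) \<le> d N + c * h powr \<alpha> * T" using mult_left_mono[OF r(2) c'] by simp
    show "0 \<le> d N + c * h powr \<alpha> * (T - \<tau> i)" using mult_nonneg_nonneg[OF c' r(1)] d0[of N] by simp
  qed simp
  finally show ?thesis unfolding d_def z_def by (simp add: ac_simps)
qed

end

subsection \<open>Increments of the solution of the FBSDE\<close>

lemma set_lebesgue_integral_split:
  fixes f :: "real \<Rightarrow> 'b::euclidean_space"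
  assumes "set_integrable lborel {a..c} f" "a \<le> b" "b \<le> c"
  shows "(LINT r:{a..c}|lborel. f r) = (LINT r:{a..b}|lborel. f r) + (LINT r:{b..c}|lborel. f r)"
proof -
  have "{a..c} = {a..b} \<union> {b..c}" using assms(2,3) by auto
  moreover have "(LINT r:{a..b} \<union> {b..c}|lborel. f r) = (LINT r:{a..b}|lborel. f r) + (LINT r:{b..c}|lborel. f r)"
  proof (rule set_integral_Un_AE)
    have "AE r in lborel. r \<noteq> b" by (rule AE_lborel_singleton)
    then show "AE r in lborel. \<not> (r \<in> {a..b} \<and> r \<in> {b..c})" by eventually_elim auto
  qed (use assms in \<open>auto intro!: set_integrable_subset[OF assms(1)]\<close>)
  ultimately show ?thesis by simp
qed

lemma set_lebesgue_integral_degenerate: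
  fixes f :: "real \<Rightarrow> 'b::euclidean_space"
  shows "(LINT r:{a}|lborel. f r) = 0"
  unfolding set_lebesgue_integral_def
proof (rule integral_eq_zero_AE)
  have "AE r in lborel. r \<noteq> a" by (rule AE_lborel_singleton)
  then show "AE r in lborel. indicator {a} r *\<^sub>R f r = 0" by eventually_elim simp
qed

lemma sq_set_lebesgue_integral_le:
  fixes f :: "real \<Rightarrow> 'b::euclidean_space"
  assumes [measurable]: "f \<in> borel_measurable lborel" and st: "s \<le> t"
  shows "ennreal ((norm (LINT r:{s..t}|lborel. f r))\<^sup>2) \<le> ennreal (t - s) * (\<integral>\<^sup>+r\<in>{s<..t}. ennreal ((norm (f r))\<^sup>2) \<partial>lborel)"
proof (cases "set_integrable lborel {s..t} f")
  case True
  let ?I = "indicator {s..t} :: real \<Rightarrow> ennreal"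
  have "ennreal (norm (LINT r:{s..t}|lborel. f r)) \<le> (\<integral>\<^sup>+r. ennreal (norm (indicator {s..t} r *\<^sub>R f r)) \<partial>lborel)"
    unfolding set_lebesgue_integral_def using True unfolding set_integrable_def by (rule integral_norm_bound_ennreal)
  also have "\<dots> = (\<integral>\<^sup>+r. (ennreal (norm (f r)) * ?I r) * ?I r \<partial>lborel)"
    by (intro nn_integral_cong) (auto simp: indicator_def)
  finally have "(ennreal (norm (LINT r:{s..t}|lborel. f r)))\<^sup>2 \<le> (\<integral>\<^sup>+r. (ennreal (norm (f r)) * ?I r) * ?I r \<partial>lborel)\<^sup>2"
    by (rule power_mono) simp
  also have "\<dots> \<le> (\<integral>\<^sup>+r. (ennreal (norm (f r)) * ?I r)\<^sup>2 \<partial>lborel) * (\<integral>\<^sup>+r. (?I r)\<^sup>2 \<partial>lborel)"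
    by (rule Cauchy_Schwarz_nn_integral) measurable
  also have "(\<integral>\<^sup>+r. (?I r)\<^sup>2 \<partial>lborel) = (\<integral>\<^sup>+r. ?I r \<partial>lborel)"
    by (intro nn_integral_cong) (auto simp: indicator_def)
  also have "(\<integral>\<^sup>+r. ?I r \<partial>lborel) = ennreal (t - s)" using st by simp
  also have "(\<integral>\<^sup>+r. (ennreal (norm (f r)) * ?I r)\<^sup>2 \<partial>lborel) = (\<integral>\<^sup>+r\<in>{s..t}. ennreal ((norm (f r))\<^sup>2) \<partial>lborel)"
    by (intro nn_integral_cong) (auto simp: indicator_def ennreal_power)
  also have "\<dots> = (\<integral>\<^sup>+r\<in>{s<..t}. ennreal ((norm (f r))\<^sup>2) \<partial>lborel)"
    by (intro nn_integral_cong_AE, rule AE_mp[OF AE_lborel_singleton[of s]]) (auto simp: indicator_def)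
  finally show ?thesis by (simp add: ennreal_power mult.commute)
next
  \<comment> \<open>A Bochner integral that does not exist has the value 0.\<close>
  case False
  then show ?thesis unfolding set_integrable_def set_lebesgue_integral_def by (simp add: not_integrable_integral_eq)
qed

context brownian begin

lemma measurable_lint:
  assumes H: "jointly_measurable H"
  shows "(\<lambda>\<omega>. LINT r:{s..t}|lborel. H r \<omega>) \<in> borel_measurable M"
proof -
  have "(\<lambda>(r, \<omega>). indicator {s..t} r *\<^sub>R H r \<omega>) \<in> borel_measurable (lborel \<Otimes>\<^sub>M M)"
    using jointly_measurable_indicator[OF H, of "{s..t}"] unfolding jointly_measurable_def by simp
  from measurable_compose[OF measurable_pair_swap' this]
  have "case_prod (\<lambda>\<omega> r. indicator {s..t} r *\<^sub>R H r \<omega>) \<in> borel_measurable (M \<Otimes>\<^sub>M lborel)"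
    by (simp add: case_prod_beta')
  then show ?thesis unfolding set_lebesgue_integral_def by (rule lborel.borel_measurable_lebesgue_integral)
qed

lemma msq_lint_le:
  assumes H: "jointly_measurable H" and st: "s \<le> t"
  shows "msq (\<lambda>\<omega>. LINT r:{s..t}|lborel. H r \<omega>) \<le> ennreal (t - s) * (\<integral>\<^sup>+r\<in>{s<..t}. msq (H r) \<partial>lborel)"
proof -
  have [measurable]: "(\<lambda>(r, \<omega>). H r \<omega>) \<in> borel_measurable (lborel \<Otimes>\<^sub>M M)" using H by (rule jointly_measurableD)
  have m: "(\<lambda>\<omega>. \<integral>\<^sup>+r\<in>{s<..t}. ennreal ((norm (H r \<omega>))\<^sup>2) \<partial>lborel) \<in> borel_measurable M" by measurable
  have "msq (\<lambda>\<omega>. LINT r:{s..t}|lborel. H r \<omega>) \<le> (\<integral>\<^sup>+\<omega>. ennreal (t - s) * (\<integral>\<^sup>+r\<in>{s<..t}. ennreal ((norm (H r \<omega>))\<^sup>2) \<partial>lborel) \<partial>M)"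
    by (intro nn_integral_mono sq_set_lebesgue_integral_le jointly_measurable_path[OF H] st)
  also have "\<dots> = ennreal (t - s) * (\<integral>\<^sup>+r\<in>{s<..t}. msq (H r) \<partial>lborel)"
    using m by (simp add: nn_integral_cmult Fubini_msq[OF H])
  finally show ?thesis .
qed

text \<open>Fubini makes the path integral of the square finite almost surely, and
  \<open>norm x \<le> 1 + (norm x)\<^sup>2\<close> on an interval of finite length.\<close>

lemma AE_set_integrable_path:
  assumes H: "jointly_measurable H" and fin: "(\<integral>\<^sup>+r\<in>{a..c}. msq (H r) \<partial>lborel) < \<infinity>"
  shows "AE \<omega> in M. set_integrable lborel {a..c} (\<lambda>r. H r \<omega>)"
proof -
  have [measurable]: "(\<lambda>(r, \<omega>). H r \<omega>) \<in> borel_measurable (lborel \<Otimes>\<^sub>M M)" using H by (rule jointly_measurableD)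
  have "(\<integral>\<^sup>+\<omega>. (\<integral>\<^sup>+r\<in>{a..c}. ennreal ((norm (H r \<omega>))\<^sup>2) \<partial>lborel) \<partial>M) \<noteq> \<infinity>"
    using fin Fubini_msq[OF H, of "{a..c}"] by simp
  then have "AE \<omega> in M. (\<integral>\<^sup>+r\<in>{a..c}. ennreal ((norm (H r \<omega>))\<^sup>2) \<partial>lborel) \<noteq> \<infinity>"
    by (intro nn_integral_PInf_AE) measurable
  then show ?thesis
  proof (rule AE_mp, intro AE_I2 impI)
    fix \<omega> assume \<omega>: "\<omega> \<in> space M" and f: "(\<integral>\<^sup>+r\<in>{a..c}. ennreal ((norm (H r \<omega>))\<^sup>2) \<partial>lborel) \<noteq> \<infinity>"
    have [measurable]: "(\<lambda>r. H r \<omega>) \<in> borel_measurable lborel" by (rule jointly_measurable_path[OF H \<omega>])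
    have "(\<integral>\<^sup>+r. ennreal (norm (indicator {a..c} r *\<^sub>R H r \<omega>)) \<partial>lborel) \<le>
       (\<integral>\<^sup>+r. indicator {a..c} r + ennreal ((norm (H r \<omega>))\<^sup>2) * indicator {a..c} r \<partial>lborel)"
    proof (rule nn_integral_mono)
      fix r
      have "norm (H r \<omega>) \<le> 1 + (norm (H r \<omega>))\<^sup>2"
      proof -
        have "2 * norm (H r \<omega>) \<le> (norm (H r \<omega>))\<^sup>2 + 1" using sum_squares_bound[of "norm (H r \<omega>)" 1] by simp
        then show ?thesis using norm_ge_zero[of "H r \<omega>"] by linarith
      qed
      then have "ennreal (norm (H r \<omega>)) \<le> 1 + ennreal ((norm (H r \<omega>))\<^sup>2)"
        using ennreal_leI ennreal_plus[of 1 "(norm (H r \<omega>))\<^sup>2"] by fastforce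
      then show "ennreal (norm (indicator {a..c} r *\<^sub>R H r \<omega>)) \<le> indicator {a..c} r + ennreal ((norm (H r \<omega>))\<^sup>2) * indicator {a..c} r"
        by (auto simp: indicator_def)
    qed
    also have "\<dots> = emeasure lborel {a..c} + (\<integral>\<^sup>+r\<in>{a..c}. ennreal ((norm (H r \<omega>))\<^sup>2) \<partial>lborel)"
      by (subst nn_integral_add) auto
    also have "\<dots> < \<infinity>" using f by (simp add: top.not_eq_extremum[symmetric] ennreal_add_eq_top emeasure_lborel_Icc_eq)
    finally show "set_integrable lborel {a..c} (\<lambda>r. H r \<omega>)"
      unfolding set_integrable_def by (intro integrableI_bounded) measurable
  qed
qed

lemma msq_components:
  fixes f :: "'a \<Rightarrow> ('c::euclidean_space) ^ 'n"
  assumes "f \<in> borel_measurable M"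
  shows "msq f = (\<Sum>k\<in>UNIV. msq (\<lambda>\<omega>. f \<omega> $ k))"
proof -
  have "msq f = (\<integral>\<^sup>+\<omega>. (\<Sum>k\<in>UNIV. ennreal ((norm (f \<omega> $ k))\<^sup>2)) \<partial>M)"
    unfolding norm_vec_sq by (intro nn_integral_cong) (simp add: sum_ennreal)
  also have "\<dots> = (\<Sum>k\<in>UNIV. msq (\<lambda>\<omega>. f \<omega> $ k))"
    using measurable_vec_nth[OF assms] by (intro nn_integral_sum) auto
  finally show ?thesis .
qed

lemma msq_add_orthogonal_real:
  fixes f g :: "'a \<Rightarrow> real"
  assumes f: "sq_integrable M f" and g: "sq_integrable M g" and o: "expectation (\<lambda>\<omega>. f \<omega> * g \<omega>) = 0"
  shows "msq (\<lambda>\<omega>. f \<omega> + g \<omega>) = msq f + msq g"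
proof -
  have i: "integrable M (\<lambda>\<omega>. (f \<omega>)\<^sup>2)" "integrable M (\<lambda>\<omega>. (g \<omega>)\<^sup>2)" "integrable M (\<lambda>\<omega>. f \<omega> * g \<omega>)"
    using f g sq_integrable_times[OF f g] by (auto simp: sq_integrable_def)
  have "expectation (\<lambda>\<omega>. (norm (f \<omega> + g \<omega>))\<^sup>2) = expectation (\<lambda>\<omega>. ((f \<omega>)\<^sup>2 + (g \<omega>)\<^sup>2) + 2 * (f \<omega> * g \<omega>))"
    by (simp add: power2_sum mult.assoc)
  also have "\<dots> = expectation (\<lambda>\<omega>. (norm (f \<omega>))\<^sup>2) + expectation (\<lambda>\<omega>. (norm (g \<omega>))\<^sup>2)"
    using i o by simp
  finally show ?thesis
    using nn_integral_sq_integrable[OF f] nn_integral_sq_integrable[OF g] nn_integral_sq_integrable[OF sq_integrable_add[OF f g]]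
    by (simp add: ennreal_plus)
qed

text \<open>Orthogonality is asked for coordinatewise because \<open>ito_increment_matrix\<close>
  yields it in this form.\<close>

lemma msq_add_orthogonal:
  fixes f g :: "'a \<Rightarrow> real ^ 'n"
  assumes f: "sq_integrable M f" and g: "sq_integrable M g" and o: "\<And>k. expectation (\<lambda>\<omega>. f \<omega> $ k * g \<omega> $ k) = 0"
  shows "msq (\<lambda>\<omega>. f \<omega> + g \<omega>) = msq f + msq g"
proof -
  note fm = sq_integrable_measurable[OF f] and gm = sq_integrable_measurable[OF g]
  show ?thesis
    unfolding msq_components[OF fm] msq_components[OF gm] msq_components[OF borel_measurable_add[OF fm gm]] sum.distrib[symmetric]
      vector_add_component
    by (intro sum.cong refl msq_add_orthogonal_real sq_integrable_nth f g o)
qed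

text \<open>Young's inequality with a free weight. With \<open>d\<close> the step length, the
  product of the factors \<open>1 + d\<close> over all steps stays bounded, whereas
  \<open>msq_add_le\<close> would accumulate a factor 2 at every step.\<close>

lemma msq_add_weighted:
  fixes f g :: "'a \<Rightarrow> 'c::euclidean_space"
  assumes [measurable]: "f \<in> borel_measurable M" "g \<in> borel_measurable M" and d: "0 < d"
  shows "msq (\<lambda>\<omega>. f \<omega> + g \<omega>) \<le> ennreal (1 + d) * msq f + ennreal (1 + 1 / d) * msq g"
proof -
  have le: "(norm (x + y))\<^sup>2 \<le> (1 + d) * (norm x)\<^sup>2 + (1 + 1 / d) * (norm y)\<^sup>2" for x y :: 'c
  proof -
    have "(norm (x + y))\<^sup>2 \<le> (norm x + norm y)\<^sup>2" by (intro power_mono norm_triangle_ineq) simp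
    moreover have "2 * (sqrt d * norm x) * (norm y / sqrt d) \<le> (sqrt d * norm x)\<^sup>2 + (norm y / sqrt d)\<^sup>2"
      by (rule sum_squares_bound)
    then have "2 * norm x * norm y \<le> d * (norm x)\<^sup>2 + (norm y)\<^sup>2 / d" using d by (simp add: power_mult_distrib power_divide)
    ultimately show ?thesis by (simp add: power2_sum algebra_simps)
  qed
  have "msq (\<lambda>\<omega>. f \<omega> + g \<omega>) \<le> (\<integral>\<^sup>+\<omega>. ennreal (1 + d) * ennreal ((norm (f \<omega>))\<^sup>2) + ennreal (1 + 1 / d) * ennreal ((norm (g \<omega>))\<^sup>2) \<partial>M)"
    using le d by (intro nn_integral_mono) (simp add: ennreal_mult[symmetric] ennreal_plus[symmetric] del: ennreal_plus)
  also have "\<dots> = ennreal (1 + d) * msq f + ennreal (1 + 1 / d) * msq g"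
    by (subst nn_integral_add) (auto simp: nn_integral_cmult)
  finally show ?thesis .
qed

text \<open>The factor 4 comes from squaring a sum of four terms.\<close>

lemma msq_le_lipschitz:
  fixes f :: "'a \<Rightarrow> 'c::euclidean_space" and A :: "'a \<Rightarrow> 'e::euclidean_space" and B :: "'a \<Rightarrow> 'f::euclidean_space" and Z :: "'a \<Rightarrow> 'g::euclidean_space"
  assumes [measurable]: "A \<in> borel_measurable M" "B \<in> borel_measurable M" "Z \<in> borel_measurable M"
    and le: "\<And>\<omega>. norm (f \<omega>) \<le> K * (sqrt s + norm (A \<omega>) + norm (B \<omega>) + norm (Z \<omega>))" and K: "0 \<le> K" and s: "0 \<le> s"
  shows "msq f \<le> ennreal (4 * K\<^sup>2) * (ennreal s + msq A + msq B + msq Z)"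
proof -
  have le4: "(norm (f \<omega>))\<^sup>2 \<le> 4 * K\<^sup>2 * (s + (norm (A \<omega>))\<^sup>2 + (norm (B \<omega>))\<^sup>2 + (norm (Z \<omega>))\<^sup>2)" for \<omega>
  proof -
    have "(norm (f \<omega>))\<^sup>2 \<le> (K * (sqrt s + norm (A \<omega>) + norm (B \<omega>) + norm (Z \<omega>)))\<^sup>2" by (intro power_mono le) simp
    also have "\<dots> = K\<^sup>2 * ((sqrt s + norm (A \<omega>)) + (norm (B \<omega>) + norm (Z \<omega>)))\<^sup>2" by (simp add: power_mult_distrib add.assoc)
    also have "\<dots> \<le> K\<^sup>2 * (2 * (2 * (sqrt s)\<^sup>2 + 2 * (norm (A \<omega>))\<^sup>2) + 2 * (2 * (norm (B \<omega>))\<^sup>2 + 2 * (norm (Z \<omega>))\<^sup>2))"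
    proof (rule mult_left_mono)
      have sq: "(x + y)\<^sup>2 \<le> 2 * x\<^sup>2 + 2 * y\<^sup>2" for x y :: real using sum_squares_bound[of x y] by (simp add: power2_sum)
      show "((sqrt s + norm (A \<omega>)) + (norm (B \<omega>) + norm (Z \<omega>)))\<^sup>2 \<le> 2 * (2 * (sqrt s)\<^sup>2 + 2 * (norm (A \<omega>))\<^sup>2) + 2 * (2 * (norm (B \<omega>))\<^sup>2 + 2 * (norm (Z \<omega>))\<^sup>2)"
        by (rule order_trans[OF sq add_mono[OF mult_left_mono[OF sq] mult_left_mono[OF sq]]]) simp_all
    qed simp
    also have "\<dots> = 4 * K\<^sup>2 * (s + (norm (A \<omega>))\<^sup>2 + (norm (B \<omega>))\<^sup>2 + (norm (Z \<omega>))\<^sup>2)" using s by (simp add: algebra_simps)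
    finally show ?thesis .
  qed
  have "msq f \<le> (\<integral>\<^sup>+\<omega>. ennreal (4 * K\<^sup>2) * (ennreal s + ennreal ((norm (A \<omega>))\<^sup>2) + ennreal ((norm (B \<omega>))\<^sup>2) + ennreal ((norm (Z \<omega>))\<^sup>2)) \<partial>M)"
    using le4 s by (intro nn_integral_mono) (simp add: ennreal_mult[symmetric] ennreal_plus[symmetric] del: ennreal_plus)
  also have "\<dots> = ennreal (4 * K\<^sup>2) * (ennreal s + msq A + msq B + msq Z)"
    by (simp add: nn_integral_cmult nn_integral_add emeasure_space_1)
  finally show ?thesis .
qed

end

locale fbsde = brownian M W + pde_data T L \<alpha> b \<sigma> F g u ut ux uxx
  for M :: "'a measure" and W :: "real \<Rightarrow> 'a \<Rightarrow> real ^ 'd"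
    and T L \<alpha> :: real
    and b :: "real \<Rightarrow> real ^ 'd \<Rightarrow> real \<Rightarrow> real ^ 'd \<Rightarrow> real ^ 'd"
    and \<sigma> :: "real \<Rightarrow> real ^ 'd \<Rightarrow> real \<Rightarrow> real ^ 'd ^ 'd"
    and F :: "real \<Rightarrow> real ^ 'd \<Rightarrow> real \<Rightarrow> real ^ 'd \<Rightarrow> real"
    and g :: "real ^ 'd \<Rightarrow> real"
    and u ut :: "real \<Rightarrow> real ^ 'd \<Rightarrow> real"
    and ux :: "real \<Rightarrow> real ^ 'd \<Rightarrow> real ^ 'd"
    and uxx :: "real \<Rightarrow> real ^ 'd \<Rightarrow> real ^ 'd ^ 'd" +
  fixes x0 :: "real ^ 'd" and X :: "real \<Rightarrow> 'a \<Rightarrow> real ^ 'd" and Y :: "real \<Rightarrow> 'a \<Rightarrow> real"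
    and Z :: "real \<Rightarrow> 'a \<Rightarrow> real ^ 'd"
  assumes sol: "fbsde_solution M W T x0 b \<sigma> F g X Y Z"
begin

text \<open>Constant extension in time beyond \<open>{0..T}\<close> gives processes that are jointly
  measurable on the whole line, to which Fubini applies.\<close>

definition Xc where "Xc r = X (clip T r)"
definition Yc where "Yc r = Y (clip T r)"
definition Zc where "Zc r = Z (clip T r)"
definition bc where "bc r \<omega> = b (clip T r) (Xc r \<omega>) (Yc r \<omega>) (Zc r \<omega>)"
definition Fc where "Fc r \<omega> = F (clip T r) (Xc r \<omega>) (Yc r \<omega>) (Zc r \<omega>)"
definition \<sigma>c where "\<sigma>c r \<omega> = \<sigma> (clip T r) (Xc r \<omega>) (Yc r \<omega>)"
definition Vc where "Vc r \<omega> = ux (clip T r) (Xc r \<omega>) v* \<sigma>c r \<omega>"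

lemma clip_T_mem: "clip T r \<in> {0..T}" by (rule clip_mem[OF T0])

lemmas prog_X = sol[unfolded fbsde_solution_def, THEN conjunct1]
lemmas prog_Y = sol[unfolded fbsde_solution_def, THEN conjunct2, THEN conjunct1]
lemmas prog_Z = sol[unfolded fbsde_solution_def, THEN conjunct2, THEN conjunct2, THEN conjunct1]
lemmas sup_X = sol[unfolded fbsde_solution_def, THEN conjunct2, THEN conjunct2, THEN conjunct2, THEN conjunct2, THEN conjunct1]
lemmas sup_Y = sol[unfolded fbsde_solution_def, THEN conjunct2, THEN conjunct2, THEN conjunct2, THEN conjunct2, THEN conjunct2, THEN conjunct1]
lemmas int_Z = sol[unfolded fbsde_solution_def, THEN conjunct2, THEN conjunct2, THEN conjunct2, THEN conjunct2, THEN conjunct2, THEN conjunct2, THEN conjunct1]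
lemmas X_eq = sol[unfolded fbsde_solution_def, THEN conjunct2, THEN conjunct2, THEN conjunct2, THEN conjunct2, THEN conjunct2, THEN conjunct2, THEN conjunct2, THEN conjunct1]
lemmas Y_eq = sol[unfolded fbsde_solution_def, THEN conjunct2, THEN conjunct2, THEN conjunct2, THEN conjunct2, THEN conjunct2, THEN conjunct2, THEN conjunct2, THEN conjunct2]

lemma progressive_section:
  assumes "progressively_measurable \<F> T H" "r \<in> {0..T}" shows "H r \<in> borel_measurable (\<F> r)"
proof -
  have "(\<lambda>(s, \<omega>). H s \<omega>) \<in> borel_measurable (restrict_space borel {0..r} \<Otimes>\<^sub>M \<F> r)"
    using assms unfolding progressively_measurable_def by blast
  moreover have "Pair r \<in> measurable (\<F> r) (restrict_space borel {0..r} \<Otimes>\<^sub>M \<F> r)"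
    using assms(2) by (intro measurable_Pair1') (simp add: space_restrict_space)
  ultimately have "(\<lambda>\<omega>. (\<lambda>(s, \<omega>). H s \<omega>) (r, \<omega>)) \<in> borel_measurable (\<F> r)" by (rule measurable_compose[rotated])
  then show ?thesis by simp
qed

text \<open>Progressive measurability at the single time \<open>T\<close> suffices, as
  \<open>clip T\<close> maps into \<open>{0..T}\<close> and \<open>\<F> T\<close> is contained in
  the sigma-algebra of \<open>M\<close>.\<close>

lemma progressive_joint:
  assumes "progressively_measurable \<F> T H" shows "jointly_measurable (\<lambda>r. H (clip T r))"
proof -
  have "(\<lambda>(s, \<omega>). H s \<omega>) \<in> borel_measurable (restrict_space borel {0..T} \<Otimes>\<^sub>M \<F> T)"
    using assms T0 unfolding progressively_measurable_def by auto
  moreover have "(\<lambda>p. (clip T (fst p), snd p)) \<in> measurable (lborel \<Otimes>\<^sub>M M) (restrict_space borel {0..T} \<Otimes>\<^sub>M \<F> T)"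
  proof (rule measurable_Pair)
    have "clip T \<in> borel_measurable borel" by (rule borel_measurable_continuous_onI[OF continuous_clip])
    then have "clip T \<in> measurable lborel (restrict_space borel {0..T})"
      using clip_T_mem by (intro measurable_restrict_space2) auto
    from measurable_compose[OF measurable_fst this]
    show "(\<lambda>p. clip T (fst p)) \<in> measurable (lborel \<Otimes>\<^sub>M M) (restrict_space borel {0..T})" .
    have "(\<lambda>\<omega>. \<omega>) \<in> measurable M (\<F> T)" using sets_filtration_le[of T] by (auto simp: measurable_def sets.Int_space_eq2)
    then have "(\<lambda>p. (\<lambda>\<omega>. \<omega>) (snd p)) \<in> measurable ((lborel :: real measure) \<Otimes>\<^sub>M M) (\<F> T)"
      by (rule measurable_compose[OF measurable_snd])
    then show "snd \<in> measurable ((lborel :: real measure) \<Otimes>\<^sub>M M) (\<F> T)" by simp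
  qed
  ultimately have "(\<lambda>p. (\<lambda>(s, \<omega>). H s \<omega>) (clip T (fst p), snd p)) \<in> borel_measurable (lborel \<Otimes>\<^sub>M M)"
    by (rule measurable_compose[rotated])
  then show ?thesis unfolding jointly_measurable_def by (simp add: case_prod_beta')
qed

lemma joint_X: "jointly_measurable Xc" and joint_Y: "jointly_measurable Yc" and joint_Z: "jointly_measurable Zc"
  unfolding Xc_def[abs_def] Yc_def[abs_def] Zc_def[abs_def]
  by (intro progressive_joint prog_X prog_Y prog_Z)+

lemma joint_b: "jointly_measurable bc"
  using joint_X joint_Y joint_Z unfolding jointly_measurable_def bc_def case_prod_beta'
  by (intro measurable_of_lipschitz_txyz[OF b_lip T0]) simp_all

lemma joint_F: "jointly_measurable Fc"
  using joint_X joint_Y joint_Z unfolding jointly_measurable_def Fc_def case_prod_beta'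
  by (intro measurable_of_lipschitz_txyz[OF F_lip T0]) simp_all

lemma measurable_\<sigma>c: "(\<lambda>(r, \<omega>). \<sigma>c r \<omega>) \<in> borel_measurable (lborel \<Otimes>\<^sub>M M)"
  using joint_X joint_Y unfolding jointly_measurable_def \<sigma>c_def case_prod_beta'
  by (intro measurable_of_lipschitz_txy[OF \<sigma>_lip T0 L0(1)]) simp_all

lemma joint_\<sigma>: "jointly_measurable \<sigma>c"
  unfolding jointly_measurable_def by (rule measurable_\<sigma>c)

lemma joint_\<sigma>_row: "jointly_measurable (\<lambda>r \<omega>. \<sigma>c r \<omega> $ k)"
  using measurable_\<sigma>c unfolding jointly_measurable_def case_prod_beta' by (rule measurable_vec_nth)

lemma joint_V: "jointly_measurable Vc"
  using joint_X measurable_\<sigma>c unfolding jointly_measurable_def Vc_def case_prod_beta'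
  by (intro measurable_vector_matrix_mult measurable_of_lipschitz_tx[OF ux_lip T0 L0(1)]) simp_all

lemma Xc_eq: "r \<in> {0..T} \<Longrightarrow> Xc r = X r" and Yc_eq: "r \<in> {0..T} \<Longrightarrow> Yc r = Y r" and Zc_eq: "r \<in> {0..T} \<Longrightarrow> Zc r = Z r"
  unfolding Xc_def Yc_def Zc_def by (simp_all add: clip_eq)

definition SX :: ennreal where "SX = (\<integral>\<^sup>+\<omega>. (SUP t\<in>{0..T}. ennreal ((norm (X t \<omega>))\<^sup>2)) \<partial>M)"
definition SY :: ennreal where "SY = (\<integral>\<^sup>+\<omega>. (SUP t\<in>{0..T}. ennreal (\<bar>Y t \<omega>\<bar>\<^sup>2)) \<partial>M)"

lemma msq_X_le: "msq (Xc r) \<le> SX" and msq_Y_le: "msq (Yc r) \<le> SY"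
  unfolding SX_def SY_def Xc_def Yc_def using clip_T_mem[of r] by (auto intro!: nn_integral_mono SUP_upper2)

lemma adapted_X: "r \<in> {0..T} \<Longrightarrow> X r \<in> borel_measurable (\<F> r)" and adapted_Y: "r \<in> {0..T} \<Longrightarrow> Y r \<in> borel_measurable (\<F> r)"
  by (intro progressive_section prog_X prog_Y; assumption)+

lemma sq_Xc: "sq_integrable M (Xc r)" and sq_Yc: "sq_integrable M (Yc r)"
  using msq_X_le[of r] msq_Y_le[of r] sup_X sup_Y jointly_measurable_section[OF joint_X] jointly_measurable_section[OF joint_Y]
  unfolding sq_integrable_iff_nn SX_def[symmetric] SY_def[symmetric] by (auto intro: le_less_trans)

lemma sq_X: "r \<in> {0..T} \<Longrightarrow> sq_integrable M (X r)" and sq_Y: "r \<in> {0..T} \<Longrightarrow> sq_integrable M (Y r)"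
  using sq_Xc[of r] sq_Yc[of r] by (simp_all add: Xc_eq Yc_eq)

text \<open>The density of the additive interval function \<open>Q\<close>, which bounds mean square
  increments of \<open>Y\<close>. The summand 1 lets \<open>Q\<close> dominate the interval length,
  so that terms in the step length can be merged into it.\<close>

definition dens :: "real \<Rightarrow> ennreal" where "dens r = 1 + msq (Xc r) + msq (Yc r) + msq (Zc r)"

definition Q :: "real \<Rightarrow> real \<Rightarrow> ennreal" where "Q s t = (\<integral>\<^sup>+r\<in>{s<..t}. dens r \<partial>lborel)"

lemma measurable_dens [measurable]: "dens \<in> borel_measurable lborel"
  unfolding dens_def[abs_def]
  by (intro borel_measurable_add borel_measurable_const measurable_msq joint_X joint_Y joint_Z)

lemma Q_finite: "Q 0 T < \<infinity>"
proof -
  note [measurable] = measurable_msq[OF joint_Z]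
  have "Q 0 T \<le> (\<integral>\<^sup>+r. (1 + SX + SY) * indicator {0..T} r + msq (Z r) * indicator {0..T} r \<partial>lborel)"
    unfolding Q_def
  proof (rule nn_integral_mono)
    fix r
    show "dens r * indicator {0<..T} r \<le> (1 + SX + SY) * indicator {0..T} r + msq (Z r) * indicator {0..T} r"
      using msq_X_le[of r] msq_Y_le[of r] unfolding dens_def by (auto simp: indicator_def Zc_eq intro!: add_mono)
  qed
  also have "\<dots> = (\<integral>\<^sup>+r. (1 + SX + SY) * indicator {0..T} r + msq (Zc r) * indicator {0..T} r \<partial>lborel)"
    by (intro nn_integral_cong) (auto simp: indicator_def Zc_eq)
  also have "\<dots> = (1 + SX + SY) * ennreal T + (\<integral>\<^sup>+r\<in>{0..T}. msq (Zc r) \<partial>lborel)"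
    by (subst nn_integral_add) (auto simp: nn_integral_cmult)
  also have "(\<integral>\<^sup>+r\<in>{0..T}. msq (Zc r) \<partial>lborel) = (\<integral>\<^sup>+t\<in>{0..T}. (\<integral>\<^sup>+\<omega>. ennreal ((norm (Z t \<omega>))\<^sup>2) \<partial>M) \<partial>lborel)"
    by (intro nn_integral_cong) (auto simp: indicator_def Zc_eq)
  also have "(1 + SX + SY) * ennreal T + \<dots> < \<infinity>"
    using int_Z sup_X sup_Y unfolding SX_def[symmetric] SY_def[symmetric] by (simp add: ennreal_mult_less_top)
  finally show ?thesis .
qed

lemma Q_mono: "s \<le> s' \<Longrightarrow> t' \<le> t \<Longrightarrow> Q s' t' \<le> Q s t"
  unfolding Q_def by (intro nn_set_integral_set_mono) auto

lemma Q_fin: "0 \<le> s \<Longrightarrow> t \<le> T \<Longrightarrow> Q s t < \<infinity>"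
  using Q_mono[of 0 s t T] Q_finite by (rule le_less_trans)

lemma Q_ge: "s \<le> t \<Longrightarrow> ennreal (t - s) \<le> Q s t"
proof -
  assume st: "s \<le> t"
  have "ennreal (t - s) = (\<integral>\<^sup>+r\<in>{s<..t}. 1 \<partial>lborel)" using st by simp
  also have "\<dots> \<le> Q s t" unfolding Q_def dens_def
    by (intro nn_integral_mono mult_right_mono) (auto simp: add.assoc)
  finally show ?thesis .
qed

lemma int_msq_Z_le: "(\<integral>\<^sup>+r\<in>{s<..t}. msq (Zc r) \<partial>lborel) \<le> Q s t"
  unfolding Q_def dens_def by (intro nn_integral_mono mult_right_mono) (auto simp: add.commute intro: add_increasing2)

text \<open>A bound for \<open>F t 0 0 0\<close> over \<open>{0..T}\<close>: regularity in time
  costs \<open>L * sqrt T\<close>.\<close>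

definition f0 :: real where "f0 = \<bar>F 0 0 0 0\<bar> + L * sqrt T"

lemma msq_F_le: "msq (Fc r) \<le> ennreal (4 * (1 + f0 + L)\<^sup>2) * dens r"
proof -
  have f0: "0 \<le> f0" unfolding f0_def using T by simp
  have "msq (Fc r) \<le> ennreal (4 * (1 + f0 + L)\<^sup>2) * (ennreal 1 + msq (Xc r) + msq (Yc r) + msq (Zc r))"
  proof (rule msq_le_lipschitz)
    show "norm (Fc r \<omega>) \<le> (1 + f0 + L) * (sqrt 1 + norm (Xc r \<omega>) + norm (Yc r \<omega>) + norm (Zc r \<omega>))" for \<omega>
    proof -
      let ?n = "norm (Xc r \<omega>) + norm (Yc r \<omega>) + norm (Zc r \<omega>)"
      have "\<bar>Fc r \<omega> - F 0 0 0 0\<bar> \<le> L * (sqrt \<bar>clip T r - 0\<bar> + norm (Xc r \<omega> - 0) + \<bar>Yc r \<omega> - 0\<bar> + norm (Zc r \<omega> - 0))"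
        unfolding Fc_def by (rule F_le[OF clip_T_mem]) simp
      also have "\<dots> \<le> L * (sqrt T + ?n)"
        using clip_T_mem[of r] by (intro mult_left_mono) auto
      finally have "\<bar>Fc r \<omega>\<bar> \<le> f0 + L * ?n" unfolding f0_def by (simp add: algebra_simps)
      also have "\<dots> \<le> (1 + f0 + L) * (1 + ?n)" using f0 by (simp add: algebra_simps)
      finally show ?thesis by (simp add: add.assoc)
    qed
  qed (use f0 in \<open>auto intro: jointly_measurable_section joint_X joint_Y joint_Z\<close>)
  then show ?thesis unfolding dens_def by simp
qed

lemma int_msq_F_le: "(\<integral>\<^sup>+r\<in>{s<..t}. msq (Fc r) \<partial>lborel) \<le> ennreal (4 * (1 + f0 + L)\<^sup>2) * Q s t"
proof -
  have "(\<integral>\<^sup>+r\<in>{s<..t}. msq (Fc r) \<partial>lborel) \<le> (\<integral>\<^sup>+r. ennreal (4 * (1 + f0 + L)\<^sup>2) * (dens r * indicator {s<..t} r) \<partial>lborel)"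
    using msq_F_le by (intro nn_integral_mono) (auto simp: indicator_def)
  also have "\<dots> = ennreal (4 * (1 + f0 + L)\<^sup>2) * Q s t"
    unfolding Q_def by (intro nn_integral_cmult) measurable
  finally show ?thesis .
qed

lemma msq_b_le: "msq (bc r) \<le> ennreal (L\<^sup>2)"
proof -
  have "msq (bc r) \<le> (\<integral>\<^sup>+\<omega>. ennreal (L\<^sup>2) \<partial>M)"
    unfolding bc_def using b_bound[OF clip_T_mem] by (intro nn_integral_mono ennreal_leI power_mono) auto
  then show ?thesis by (simp add: emeasure_space_1)
qed

lemma msq_\<sigma>_le: "msq (\<sigma>c r) \<le> ennreal (L\<^sup>2)"
proof -
  have "msq (\<sigma>c r) \<le> (\<integral>\<^sup>+\<omega>. ennreal (L\<^sup>2) \<partial>M)"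
    unfolding \<sigma>c_def using \<sigma>_bound[OF clip_T_mem] by (intro nn_integral_mono ennreal_leI power_mono) auto
  then show ?thesis by (simp add: emeasure_space_1)
qed

lemma int_le_const:
  assumes "\<And>r. f r \<le> c" "s \<le> t" shows "(\<integral>\<^sup>+r\<in>{s<..t}. f r \<partial>lborel) \<le> c * ennreal (t - s)"
proof -
  have "(\<integral>\<^sup>+r\<in>{s<..t}. f r \<partial>lborel) \<le> (\<integral>\<^sup>+r\<in>{s<..t}. c \<partial>lborel)"
    by (intro nn_integral_mono mult_right_mono assms) simp
  then show ?thesis using assms(2) by (simp add: nn_integral_cmult)
qed

lemma b_paths: "AE \<omega> in M. set_integrable lborel {0..T} (\<lambda>r. bc r \<omega>)"
proof (rule AE_set_integrable_path[OF joint_b])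
  have "(\<integral>\<^sup>+r\<in>{0..T}. msq (bc r) \<partial>lborel) \<le> ennreal (L\<^sup>2) * ennreal (T - 0)"
    unfolding nn_integral_lborel_drop_endpoint by (intro int_le_const msq_b_le T0)
  also have "\<dots> < \<infinity>" by (simp add: ennreal_mult_less_top)
  finally show "(\<integral>\<^sup>+r\<in>{0..T}. msq (bc r) \<partial>lborel) < \<infinity>" .
qed

lemma F_paths: "AE \<omega> in M. set_integrable lborel {0..T} (\<lambda>r. Fc r \<omega>)"
proof (rule AE_set_integrable_path[OF joint_F])
  have "(\<integral>\<^sup>+r\<in>{0..T}. msq (Fc r) \<partial>lborel) \<le> ennreal (4 * (1 + f0 + L)\<^sup>2) * Q 0 T"
    unfolding nn_integral_lborel_drop_endpoint by (rule int_msq_F_le)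
  also have "\<dots> < \<infinity>" using Q_finite by (simp add: ennreal_mult_less_top)
  finally show "(\<integral>\<^sup>+r\<in>{0..T}. msq (Fc r) \<partial>lborel) < \<infinity>" .
qed

lemma has_ito_integral_cong:
  assumes "has_ito_integral M W p q H I" "\<And>r \<omega>. r \<in> {p..q} \<Longrightarrow> H r \<omega> = H' r \<omega>"
  shows "has_ito_integral M W p q H' I"
proof -
  have "(\<integral>\<^sup>+s\<in>{p..q}. ennreal ((norm (H s \<omega> - P s \<omega>))\<^sup>2) \<partial>lborel) = (\<integral>\<^sup>+s\<in>{p..q}. ennreal ((norm (H' s \<omega> - P s \<omega>))\<^sup>2) \<partial>lborel)" for P \<omega>
    using assms(2) by (intro nn_integral_cong) (auto simp: indicator_def)
  then show ?thesis using assms(1) unfolding has_ito_integral_def by simp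
qed

text \<open>Both equations start from \<open>0\<close>, so their difference is the increment from
  \<open>s\<close> to \<open>t\<close>. The drift integrals may be subtracted for almost every path
  because almost every path of \<open>bc\<close> is integrable.\<close>

lemma X_increment:
  assumes st: "0 \<le> s" "s \<le> t" "t \<le> T"
  shows "\<exists>m. (\<forall>k. ito_increment s t (\<lambda>r \<omega>. \<sigma>c r \<omega> $ k) (\<lambda>\<omega>. m \<omega> $ k)) \<and>
    (AE \<omega> in M. X t \<omega> = X s \<omega> + (LINT r:{s..t}|lborel. bc r \<omega>) + m \<omega>)"
proof -
  have ex: "\<exists>I. (\<forall>k. has_ito_integral M W 0 t (\<lambda>r \<omega>. \<sigma>c r \<omega> $ k) (\<lambda>\<omega>. I \<omega> $ k)) \<and>
     (AE \<omega> in M. X t \<omega> = x0 + (LINT s:{0..t}|lborel. bc s \<omega>) + I \<omega>)" if t': "t \<in> {0..T}" for t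
  proof -
    have eq: "(LINT s:{0..t}|lborel. b s (X s \<omega>) (Y s \<omega>) (Z s \<omega>)) = (LINT s:{0..t}|lborel. bc s \<omega>)" for \<omega>
      using t' by (intro set_lebesgue_integral_cong) (auto simp: bc_def Xc_eq Yc_eq Zc_eq clip_eq)
    obtain I where "has_matrix_ito_integral M W 0 t (\<lambda>s \<omega>. \<sigma> s (X s \<omega>) (Y s \<omega>)) I \<and>
      (AE \<omega> in M. X t \<omega> = x0 + (LINT s:{0..t}|lborel. b s (X s \<omega>) (Y s \<omega>) (Z s \<omega>)) + I \<omega>)"
      using bspec[OF X_eq t'] ..
    note I = this[THEN conjunct1] this[THEN conjunct2]
    have "has_ito_integral M W 0 t (\<lambda>r \<omega>. \<sigma>c r \<omega> $ k) (\<lambda>\<omega>. I \<omega> $ k)" for k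
      using t' by (intro has_ito_integral_cong[OF I(1)[unfolded has_matrix_ito_integral_def, rule_format]])
        (auto simp: \<sigma>c_def Xc_eq Yc_eq clip_eq)
    then show ?thesis using I(2) unfolding eq by blast
  qed
  obtain I where I: "\<forall>k. has_ito_integral M W 0 t (\<lambda>r \<omega>. \<sigma>c r \<omega> $ k) (\<lambda>\<omega>. I \<omega> $ k)"
     "AE \<omega> in M. X t \<omega> = x0 + (LINT s:{0..t}|lborel. bc s \<omega>) + I \<omega>" using ex[of t] st by auto
  obtain J where J: "\<forall>k. has_ito_integral M W 0 s (\<lambda>r \<omega>. \<sigma>c r \<omega> $ k) (\<lambda>\<omega>. J \<omega> $ k)"
     "AE \<omega> in M. X s \<omega> = x0 + (LINT s:{0..s}|lborel. bc s \<omega>) + J \<omega>" using ex[of s] st by auto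
  show ?thesis
  proof (intro exI[of _ "\<lambda>\<omega>. I \<omega> - J \<omega>"] conjI allI)
    show "ito_increment s t (\<lambda>r \<omega>. \<sigma>c r \<omega> $ k) (\<lambda>\<omega>. (I \<omega> - J \<omega>) $ k)" for k
      using ito_increment_left[OF I(1)[rule_format] J(1)[rule_format] joint_\<sigma>_row st(1,2), of k] by simp
    show "AE \<omega> in M. X t \<omega> = X s \<omega> + (LINT r:{s..t}|lborel. bc r \<omega>) + (I \<omega> - J \<omega>)"
      using I(2) J(2) b_paths
    proof eventually_elim
      case (elim \<omega>)
      have "set_integrable lborel {0..t} (\<lambda>r. bc r \<omega>)" using st by (intro set_integrable_subset[OF elim(3)]) auto
      from set_lebesgue_integral_split[OF this st(1,2)] show ?case unfolding elim(1,2) by simp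
    qed
  qed
qed

text \<open>Subtracting the backward equations at \<open>s\<close> and \<open>t\<close> cancels the
  terminal value and leaves a forward equation, so that \<open>Y\<close> can be treated like
  \<open>X\<close>.\<close>

lemma Y_increment:
  assumes st: "0 \<le> s" "s \<le> t" "t \<le> T"
  shows "\<exists>m. ito_increment s t Zc m \<and>
    (AE \<omega> in M. Y t \<omega> = Y s \<omega> + (LINT r:{s..t}|lborel. Fc r \<omega>) + m \<omega>)"
proof -
  have ex: "\<exists>J. has_ito_integral M W t T Zc J \<and>
     (AE \<omega> in M. Y t \<omega> = g (X T \<omega>) - (LINT s:{t..T}|lborel. Fc s \<omega>) - J \<omega>)" if t': "t \<in> {0..T}" for t
  proof -
    have eq: "(LINT s:{t..T}|lborel. F s (X s \<omega>) (Y s \<omega>) (Z s \<omega>)) = (LINT s:{t..T}|lborel. Fc s \<omega>)" for \<omega>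
      using t' by (intro set_lebesgue_integral_cong) (auto simp: Fc_def Xc_eq Yc_eq Zc_eq clip_eq)
    obtain J where "has_ito_integral M W t T Z J \<and>
      (AE \<omega> in M. Y t \<omega> = g (X T \<omega>) - (LINT s:{t..T}|lborel. F s (X s \<omega>) (Y s \<omega>) (Z s \<omega>)) - J \<omega>)"
      using bspec[OF Y_eq t'] ..
    note J = this[THEN conjunct1] this[THEN conjunct2]
    have "has_ito_integral M W t T Zc J"
      using t' by (intro has_ito_integral_cong[OF J(1)]) (auto simp: Zc_eq)
    then show ?thesis using J(2) unfolding eq by blast
  qed
  obtain I where I: "has_ito_integral M W t T Zc I"
     "AE \<omega> in M. Y t \<omega> = g (X T \<omega>) - (LINT s:{t..T}|lborel. Fc s \<omega>) - I \<omega>" using ex[of t] st by auto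
  obtain J where J: "has_ito_integral M W s T Zc J"
     "AE \<omega> in M. Y s \<omega> = g (X T \<omega>) - (LINT s:{s..T}|lborel. Fc s \<omega>) - J \<omega>" using ex[of s] st by auto
  show ?thesis
  proof (intro exI[of _ "\<lambda>\<omega>. J \<omega> - I \<omega>"] conjI)
    show "ito_increment s t Zc (\<lambda>\<omega>. J \<omega> - I \<omega>)"
      by (rule ito_increment_right[OF J(1) I(1) joint_Z st])
    show "AE \<omega> in M. Y t \<omega> = Y s \<omega> + (LINT r:{s..t}|lborel. Fc r \<omega>) + (J \<omega> - I \<omega>)"
      using I(2) J(2) F_paths
    proof eventually_elim
      case (elim \<omega>)
      have "set_integrable lborel {s..T} (\<lambda>r. Fc r \<omega>)" using st by (intro set_integrable_subset[OF elim(3)]) auto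
      from set_lebesgue_integral_split[OF this st(2,3)] show ?case unfolding elim(1,2) by simp
    qed
  qed
qed

text \<open>At time 0 both integrals of the forward equation run over a single point.\<close>

lemma X_0: "AE \<omega> in M. X 0 \<omega> = x0"
proof -
  obtain I where I: "has_matrix_ito_integral M W 0 0 (\<lambda>s \<omega>. \<sigma> s (X s \<omega>) (Y s \<omega>)) I"
    "AE \<omega> in M. X 0 \<omega> = x0 + (LINT s:{0..0}|lborel. b s (X s \<omega>) (Y s \<omega>) (Z s \<omega>)) + I \<omega>" using X_eq T0 by (meson atLeastAtMost_iff order_refl)
  have "AE \<omega> in M. I \<omega> $ k = 0" for k
  proof (rule has_ito_integral_degenerate[OF _ joint_\<sigma>_row])
    show "has_ito_integral M W 0 0 (\<lambda>r \<omega>. \<sigma>c r \<omega> $ k) (\<lambda>\<omega>. I \<omega> $ k)"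
      using T0 by (intro has_ito_integral_cong[OF I(1)[unfolded has_matrix_ito_integral_def, rule_format]])
        (auto simp: \<sigma>c_def Xc_eq Yc_eq clip_eq)
  qed simp
  then have "AE \<omega> in M. \<forall>k. I \<omega> $ k = 0" by (simp add: AE_all_countable)
  with I(2) show ?thesis
    by eventually_elim (simp add: vec_eq_iff set_lebesgue_integral_degenerate)
qed

lemma Y_T: "AE \<omega> in M. Y T \<omega> = g (X T \<omega>)"
proof -
  obtain J where J: "has_ito_integral M W T T Z J"
    "AE \<omega> in M. Y T \<omega> = g (X T \<omega>) - (LINT s:{T..T}|lborel. F s (X s \<omega>) (Y s \<omega>) (Z s \<omega>)) - J \<omega>" using Y_eq T0 by (meson atLeastAtMost_iff order_refl)
  have "AE \<omega> in M. J \<omega> = 0"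
    using T0 by (intro has_ito_integral_degenerate[OF has_ito_integral_cong[OF J(1)] joint_Z]) (auto simp: Zc_eq)
  with J(2) show ?thesis
    by eventually_elim (simp add: set_lebesgue_integral_degenerate)
qed

end

subsection \<open>The forward estimate\<close>

lemma numeral_ennreal_mult: "0 \<le> x \<Longrightarrow> numeral n * ennreal x = ennreal (numeral n * x)"
  by (simp add: ennreal_mult)

lemma forward_gronwall:
  fixes e k :: "nat \<Rightarrow> real"
  assumes \<tau>: "time_grid T N \<tau>" and c: "0 \<le> c" and e0: "0 \<le> e 0" and k: "\<And>i. i < N \<Longrightarrow> 0 \<le> k i"
    and step: "\<And>i. i < N \<Longrightarrow> e (Suc i) \<le> (1 + c * (\<tau> (Suc i) - \<tau> i)) * e i + k i"
    and i: "i \<le> N"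
  shows "e i \<le> exp (c * \<tau> i) * (e 0 + (\<Sum>j<i. k j))"
  using i
proof (induction i)
  case 0
  then show ?case using \<tau> by (simp add: time_grid_def)
next
  case (Suc i)
  let ?\<Delta> = "\<tau> (Suc i) - \<tau> i"
  have i: "i < N" using Suc.prems by simp
  have \<Delta>: "0 < ?\<Delta>" and \<tau>0: "0 \<le> \<tau> (Suc i)" using \<tau> i time_grid_mem[OF \<tau> Suc.prems] unfolding time_grid_def by auto
  have S: "0 \<le> e 0 + (\<Sum>j<i. k j)" using e0 k i by (intro add_nonneg_nonneg sum_nonneg) auto
  have "e (Suc i) \<le> (1 + c * ?\<Delta>) * e i + k i" by (rule step[OF i])
  also have "\<dots> \<le> (1 + c * ?\<Delta>) * (exp (c * \<tau> i) * (e 0 + (\<Sum>j<i. k j))) + exp (c * \<tau> (Suc i)) * k i"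
    using Suc.IH i c \<Delta> \<tau>0 mult_right_mono[of 1 "exp (c * \<tau> (Suc i))" "k i"] k[OF i] by (intro add_mono mult_left_mono) auto
  also have "(1 + c * ?\<Delta>) * (exp (c * \<tau> i) * (e 0 + (\<Sum>j<i. k j))) \<le> exp (c * ?\<Delta>) * (exp (c * \<tau> i) * (e 0 + (\<Sum>j<i. k j)))"
    using S by (intro mult_right_mono exp_ge_add_one_self) auto
  also have "exp (c * ?\<Delta>) * (exp (c * \<tau> i) * (e 0 + (\<Sum>j<i. k j))) = exp (c * \<tau> (Suc i)) * (e 0 + (\<Sum>j<i. k j))"
    by (simp add: mult.assoc[symmetric] exp_add[symmetric] right_diff_distrib)
  finally show ?case by (simp add: distrib_left add.assoc)
qed

context brownian begin

text \<open>The rows of \<open>m\<close> are scalar increments and squared norms add over rows, so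
  the scalar bound is inherited without a dimensional constant.\<close>

lemma ito_increment_matrix:
  fixes m :: "'a \<Rightarrow> real ^ 'd" and H :: "real \<Rightarrow> 'a \<Rightarrow> real ^ 'd ^ 'd"
  assumes m: "\<And>k. ito_increment s t (\<lambda>r \<omega>. H r \<omega> $ k) (\<lambda>\<omega>. m \<omega> $ k)" and H: "jointly_measurable H" and st: "0 \<le> s" "s \<le> t"
    and x: "\<Xi> \<in> borel_measurable (\<F> s)" "sq_integrable M \<Xi>"
  defines "n \<equiv> \<lambda>\<omega>. m \<omega> - \<Xi> \<omega> *v (W t \<omega> - W s \<omega>)"
  shows "sq_integrable M n"
    and "msq n \<le> 4 * (\<integral>\<^sup>+r\<in>{s<..t}. msq (\<lambda>\<omega>. H r \<omega> - \<Xi> \<omega>) \<partial>lborel)"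
    and "\<And>G k. G \<in> borel_measurable (\<F> s) \<Longrightarrow> sq_integrable M G \<Longrightarrow> expectation (\<lambda>\<omega>. G \<omega> * n \<omega> $ k) = 0"
proof -
  have nk: "n \<omega> $ k = m \<omega> $ k - \<Xi> \<omega> $ k \<bullet> (W t \<omega> - W s \<omega>)" for \<omega> k
    unfolding n_def by (simp add: matrix_vector_mul_component)
  have xk: "(\<lambda>\<omega>. \<Xi> \<omega> $ k) \<in> borel_measurable (\<F> s)" for k by (rule measurable_vec_nth[OF x(1)])
  have xk2: "sq_integrable M (\<lambda>\<omega>. \<Xi> \<omega> $ k)" for k
    by (rule sq_integrable_bound[OF x(2) measurable_filtration[OF xk]]) (auto intro: Finite_Cartesian_Product.norm_nth_le)
  have mk: "sq_integrable M (\<lambda>\<omega>. m \<omega> $ k)" for k by (rule ito_increment_sq_integrable[OF m])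
  have nk2: "sq_integrable M (\<lambda>\<omega>. n \<omega> $ k)" for k
    unfolding nk by (intro sq_integrable_diff mk sq_integrable_inner_increment st xk xk2)
  show n: "sq_integrable M n" by (rule sq_integrable_vec[OF nk2])
  have Hk: "jointly_measurable (\<lambda>r \<omega>. H r \<omega> $ k)" for k
    using H unfolding jointly_measurable_def case_prod_beta' by (rule measurable_vec_nth)
  have D: "jointly_measurable (\<lambda>r \<omega>. H r \<omega> $ k - \<Xi> \<omega> $ k)" for k
    by (intro jointly_measurable_diff Hk jointly_measurable_const_time measurable_filtration[OF xk])
  have "msq n = (\<Sum>k\<in>UNIV. msq (\<lambda>\<omega>. n \<omega> $ k))" by (rule msq_components[OF sq_integrable_measurable[OF n]])
  also have "\<dots> \<le> (\<Sum>k\<in>UNIV. 4 * (\<integral>\<^sup>+r\<in>{s<..t}. msq (\<lambda>\<omega>. H r \<omega> $ k - \<Xi> \<omega> $ k) \<partial>lborel))"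
    unfolding nk by (intro sum_mono ito_increment_msq_le m Hk st xk xk2)
  also have "\<dots> = 4 * (\<integral>\<^sup>+r. (\<Sum>k\<in>UNIV. msq (\<lambda>\<omega>. H r \<omega> $ k - \<Xi> \<omega> $ k) * indicator {s<..t} r) \<partial>lborel)"
    using measurable_msq[OF D] by (subst nn_integral_sum) (auto simp: sum_distrib_left)
  also have "\<dots> = 4 * (\<integral>\<^sup>+r\<in>{s<..t}. msq (\<lambda>\<omega>. H r \<omega> - \<Xi> \<omega>) \<partial>lborel)"
  proof -
    have "msq (\<lambda>\<omega>. H r \<omega> - \<Xi> \<omega>) = (\<Sum>k\<in>UNIV. msq (\<lambda>\<omega>. H r \<omega> $ k - \<Xi> \<omega> $ k))" for r
      using msq_components[of "\<lambda>\<omega>. H r \<omega> - \<Xi> \<omega>"] jointly_measurable_section[OF H] sq_integrable_measurable[OF x(2)] by simp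
    then show ?thesis by (simp add: sum_distrib_right)
  qed
  finally show "msq n \<le> 4 * (\<integral>\<^sup>+r\<in>{s<..t}. msq (\<lambda>\<omega>. H r \<omega> - \<Xi> \<omega>) \<partial>lborel)" .
  show "expectation (\<lambda>\<omega>. G \<omega> * n \<omega> $ k) = 0" if G: "G \<in> borel_measurable (\<F> s)" "sq_integrable M G" for G k
  proof -
    have "expectation (\<lambda>\<omega>. G \<omega> * n \<omega> $ k) = expectation (\<lambda>\<omega>. G \<omega> * m \<omega> $ k) - expectation (\<lambda>\<omega>. G \<omega> * (\<Xi> \<omega> $ k \<bullet> (W t \<omega> - W s \<omega>)))"
      unfolding nk right_diff_distrib
      by (intro Bochner_Integration.integral_diff sq_integrable_times G mk sq_integrable_inner_increment st xk xk2)
    also have "\<dots> = 0"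
      using ito_increment_orthogonal[OF m st(1) G] expectation_mult_inner_increment[OF st xk xk2 G] by simp
    finally show ?thesis .
  qed
qed

end

context fbsde begin

text \<open>Twice the constant of \<open>msq_F_le\<close> for the drift, plus 2 * 4 for the Ito
  integral in \<open>Y_regularity\<close>.\<close>

definition CY :: real where "CY = 8 * (1 + f0 + L)\<^sup>2 + 8"

lemma CY_pos: "0 \<le> CY" unfolding CY_def by simp

lemma msq_cong_AE: "AE \<omega> in M. f \<omega> = h \<omega> \<Longrightarrow> msq f = msq h"
  by (intro nn_integral_cong_AE) auto

text \<open>Comparison of the noise with the coefficient 0. In units of
  \<open>L\<^sup>2 * (t - s)\<close> the drift gives 2, by \<open>t - s \<le> 1\<close>, and the
  noise gives 2 * 4.\<close>

lemma X_regularity: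
  assumes st: "0 \<le> s" "s \<le> t" "t \<le> T" "t - s \<le> 1"
  shows "msq (\<lambda>\<omega>. X t \<omega> - X s \<omega>) \<le> ennreal (10 * L\<^sup>2 * (t - s))"
proof -
  obtain m where "(\<forall>k. ito_increment s t (\<lambda>r \<omega>. \<sigma>c r \<omega> $ k) (\<lambda>\<omega>. m \<omega> $ k)) \<and>
    (AE \<omega> in M. X t \<omega> = X s \<omega> + (LINT r:{s..t}|lborel. bc r \<omega>) + m \<omega>)" using X_increment[OF st(1-3)] ..
  note m = this[THEN conjunct1, rule_format] this[THEN conjunct2]
  have z: "(\<lambda>_. 0 :: real^'d^'d) \<in> borel_measurable (\<F> s)" "sq_integrable M (\<lambda>_. 0 :: real^'d^'d)" by auto
  note im = ito_increment_matrix[OF m(1) joint_\<sigma> st(1,2) z]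
  have mm: "m \<in> borel_measurable M" using sq_integrable_measurable[OF im(1)] by simp
  have "msq (\<lambda>\<omega>. X t \<omega> - X s \<omega>) = msq (\<lambda>\<omega>. (LINT r:{s..t}|lborel. bc r \<omega>) + m \<omega>)"
    using m(2) by (intro msq_cong_AE) auto
  also have "\<dots> \<le> 2 * msq (\<lambda>\<omega>. LINT r:{s..t}|lborel. bc r \<omega>) + 2 * msq m"
    by (intro msq_add_le measurable_lint joint_b mm)
  also have "\<dots> \<le> 2 * (ennreal (t - s) * (ennreal (L\<^sup>2) * ennreal (t - s))) + 2 * (4 * (ennreal (L\<^sup>2) * ennreal (t - s)))"
  proof (intro add_mono mult_left_mono)
    show "msq (\<lambda>\<omega>. LINT r:{s..t}|lborel. bc r \<omega>) \<le> ennreal (t - s) * (ennreal (L\<^sup>2) * ennreal (t - s))"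
      by (rule order_trans[OF msq_lint_le[OF joint_b st(2)]]) (intro mult_left_mono int_le_const msq_b_le st, simp)
    have "msq m \<le> 4 * (\<integral>\<^sup>+r\<in>{s<..t}. msq (\<sigma>c r) \<partial>lborel)" using im(2) by simp
    also have "\<dots> \<le> 4 * (ennreal (L\<^sup>2) * ennreal (t - s))" by (intro mult_left_mono int_le_const msq_\<sigma>_le st) simp
    finally show "msq m \<le> 4 * (ennreal (L\<^sup>2) * ennreal (t - s))" .
  qed simp_all
  also have "\<dots> = ennreal (2 * ((t - s) * (L\<^sup>2 * (t - s))) + 2 * (4 * (L\<^sup>2 * (t - s))))"
    using st by (simp add: ennreal_mult ennreal_plus)
  also have "\<dots> \<le> ennreal (10 * L\<^sup>2 * (t - s))"
  proof (rule ennreal_leI)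
    have "(t - s) * (L\<^sup>2 * (t - s)) \<le> 1 * (L\<^sup>2 * (t - s))" using st by (intro mult_right_mono) auto
    then show "2 * ((t - s) * (L\<^sup>2 * (t - s))) + 2 * (4 * (L\<^sup>2 * (t - s))) \<le> 10 * L\<^sup>2 * (t - s)"
      unfolding mult.assoc[of 10] by linarith
  qed
  finally show ?thesis .
qed

lemma Y_regularity:
  assumes st: "0 \<le> s" "s \<le> t" "t \<le> T" "t - s \<le> 1"
  shows "msq (\<lambda>\<omega>. Y t \<omega> - Y s \<omega>) \<le> ennreal CY * Q s t"
proof -
  obtain m where "ito_increment s t Zc m \<and>
    (AE \<omega> in M. Y t \<omega> = Y s \<omega> + (LINT r:{s..t}|lborel. Fc r \<omega>) + m \<omega>)" using Y_increment[OF st(1-3)] ..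
  note m = this[THEN conjunct1] this[THEN conjunct2]
  have mm: "m \<in> borel_measurable M" by (rule sq_integrable_measurable[OF ito_increment_sq_integrable[OF m(1)]])
  let ?k = "ennreal (4 * (1 + f0 + L)\<^sup>2)"
  have "msq (\<lambda>\<omega>. Y t \<omega> - Y s \<omega>) = msq (\<lambda>\<omega>. (LINT r:{s..t}|lborel. Fc r \<omega>) + m \<omega>)"
    using m(2) by (intro msq_cong_AE) auto
  also have "\<dots> \<le> 2 * msq (\<lambda>\<omega>. LINT r:{s..t}|lborel. Fc r \<omega>) + 2 * msq m"
    by (intro msq_add_le measurable_lint joint_F mm)
  also have "\<dots> \<le> 2 * (1 * (?k * Q s t)) + 2 * (4 * Q s t)"
  proof (intro add_mono mult_left_mono)
    show "msq (\<lambda>\<omega>. LINT r:{s..t}|lborel. Fc r \<omega>) \<le> 1 * (?k * Q s t)"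
      by (rule order_trans[OF msq_lint_le[OF joint_F st(2)]]) (intro mult_mono int_msq_F_le, use st in auto)
    have "msq m \<le> 4 * (\<integral>\<^sup>+r\<in>{s<..t}. msq (Zc r) \<partial>lborel)"
      using ito_increment_msq_le[OF m(1) joint_Z st(1,2), of "\<lambda>_. 0"] by simp
    also have "\<dots> \<le> 4 * Q s t" by (intro mult_left_mono int_msq_Z_le) simp
    finally show "msq m \<le> 4 * Q s t" .
  qed simp_all
  also have "\<dots> = (2 * ?k + 8) * Q s t" by (simp add: distrib_right mult.assoc[symmetric])
  also have "2 * ?k + 8 = ennreal CY"
    unfolding CY_def by (subst numeral_ennreal_mult) (simp_all add: ennreal_plus)
  finally show ?thesis .
qed

end

locale fbsde_scheme =
  fbsde M W T L \<alpha> b \<sigma> F g u ut ux uxx x0 X Y Z + euler_scheme M W T L \<alpha> b \<sigma> F g u ut ux uxx N \<tau> xs ys zs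
  for M :: "'a measure" and W :: "real \<Rightarrow> 'a \<Rightarrow> real ^ 'd"
    and T L \<alpha> :: real
    and b :: "real \<Rightarrow> real ^ 'd \<Rightarrow> real \<Rightarrow> real ^ 'd \<Rightarrow> real ^ 'd"
    and \<sigma> :: "real \<Rightarrow> real ^ 'd \<Rightarrow> real \<Rightarrow> real ^ 'd ^ 'd"
    and F :: "real \<Rightarrow> real ^ 'd \<Rightarrow> real \<Rightarrow> real ^ 'd \<Rightarrow> real"
    and g :: "real ^ 'd \<Rightarrow> real"
    and u ut :: "real \<Rightarrow> real ^ 'd \<Rightarrow> real"
    and ux :: "real \<Rightarrow> real ^ 'd \<Rightarrow> real ^ 'd"
    and uxx :: "real \<Rightarrow> real ^ 'd \<Rightarrow> real ^ 'd ^ 'd"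
    and x0 :: "real ^ 'd" and X :: "real \<Rightarrow> 'a \<Rightarrow> real ^ 'd" and Y :: "real \<Rightarrow> 'a \<Rightarrow> real"
    and Z :: "real \<Rightarrow> 'a \<Rightarrow> real ^ 'd"
    and N :: nat and \<tau> :: "nat \<Rightarrow> real"
    and xs :: "nat \<Rightarrow> 'a \<Rightarrow> real ^ 'd" and ys :: "nat \<Rightarrow> 'a \<Rightarrow> real" and zs :: "nat \<Rightarrow> 'a \<Rightarrow> real ^ 'd" +
  assumes mesh_le_1: "i < N \<Longrightarrow> \<tau> (Suc i) - \<tau> i \<le> 1"
begin

definition step where "step i = \<tau> (Suc i) - \<tau> i"

definition err :: "nat \<Rightarrow> real" where
  "err i = expectation (\<lambda>\<omega>. (norm (X (\<tau> i) \<omega> - xs i \<omega>))\<^sup>2) + expectation (\<lambda>\<omega>. (Y (\<tau> i) \<omega> - ys i \<omega>)\<^sup>2)"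

definition q :: "nat \<Rightarrow> real" where "q i = enn2real (Q (\<tau> i) (\<tau> (Suc i)))"

definition zint :: "nat \<Rightarrow> real" where
  "zint i = enn2real (\<integral>\<^sup>+r\<in>{\<tau> i<..\<tau> (Suc i)}. msq (\<lambda>\<omega>. Zc r \<omega> - zs i \<omega>) \<partial>lborel)"

text \<open>Bounds the mean square distance of the solution at any time of step \<open>i\<close> to
  the scheme at its start: twice the regularity of \<open>X\<close> and \<open>Y\<close>, plus twice
  the error at \<open>\<tau> i\<close>.\<close>

definition near :: "nat \<Rightarrow> real" where "near i = 20 * L\<^sup>2 * step i + 2 * CY * q i + 2 * err i"

lemma step_pos: "i < N \<Longrightarrow> 0 < step i" and step_le_1: "i < N \<Longrightarrow> step i \<le> 1"
  unfolding step_def using grid_less mesh_le_1 by auto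

lemma sq_X_dev: "i \<le> N \<Longrightarrow> sq_integrable M (\<lambda>\<omega>. X (\<tau> i) \<omega> - xs i \<omega>)"
  and sq_Y_dev: "i \<le> N \<Longrightarrow> sq_integrable M (\<lambda>\<omega>. Y (\<tau> i) \<omega> - ys i \<omega>)"
  by (intro sq_integrable_diff sq_X sq_Y xs_sq ys_sq grid_mem; assumption)+

lemma err_nonneg: "0 \<le> err i" unfolding err_def by simp

lemma err_eq: "i \<le> N \<Longrightarrow> msq (\<lambda>\<omega>. X (\<tau> i) \<omega> - xs i \<omega>) + msq (\<lambda>\<omega>. Y (\<tau> i) \<omega> - ys i \<omega>) = ennreal (err i)"
  unfolding err_def nn_integral_sq_integrable[OF sq_X_dev] nn_integral_sq_integrable[OF sq_Y_dev] by (simp add: ennreal_plus)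

lemma q_eq: "i < N \<Longrightarrow> Q (\<tau> i) (\<tau> (Suc i)) = ennreal (q i)"
  unfolding q_def using Q_fin[of "\<tau> i" "\<tau> (Suc i)"] grid_mem[of i] grid_mem[of "Suc i"] by simp

lemma q_nonneg: "0 \<le> q i" unfolding q_def by simp

lemma step_le_q:
  assumes i: "i < N" shows "step i \<le> q i"
  using Q_ge[of "\<tau> i" "\<tau> (Suc i)"] grid_less[OF i] q_nonneg[of i] unfolding q_eq[OF i] step_def by (simp add: ennreal_le_iff)

lemma near_nonneg: "i < N \<Longrightarrow> 0 \<le> near i"
  unfolding near_def using step_pos[of i] CY_pos q_nonneg[of i] err_nonneg[of i] by simp

lemma joint_Z_dev: "i < N \<Longrightarrow> jointly_measurable (\<lambda>r \<omega>. Zc r \<omega> - zs i \<omega>)"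
  by (intro jointly_measurable_diff joint_Z jointly_measurable_const_time sq_integrable_measurable zs)

text \<open>The integral is finite, so \<open>enn2real\<close> in the definition of
  \<open>zint\<close> loses nothing.\<close>

lemma zint_eq:
  assumes i: "i < N"
  shows "(\<integral>\<^sup>+r\<in>{\<tau> i<..\<tau> (Suc i)}. msq (\<lambda>\<omega>. Zc r \<omega> - zs i \<omega>) \<partial>lborel) = ennreal (zint i)"
proof -
  let ?A = "{\<tau> i<..\<tau> (Suc i)}"
  have "(\<integral>\<^sup>+r\<in>?A. msq (\<lambda>\<omega>. Zc r \<omega> - zs i \<omega>) \<partial>lborel) \<le> 2 * (\<integral>\<^sup>+r\<in>?A. msq (Zc r) \<partial>lborel) + 2 * (\<integral>\<^sup>+r\<in>?A. msq (zs i) \<partial>lborel)"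
    by (intro int_msq_diff_le joint_Z jointly_measurable_const_time sq_integrable_measurable zs i) simp
  also have "\<dots> \<le> 2 * ennreal (q i) + 2 * (msq (zs i) * ennreal (step i))"
    unfolding q_eq[OF i, symmetric] step_def using grid_less[OF i]
    by (intro add_mono mult_left_mono int_msq_Z_le int_le_const) auto
  also have "\<dots> < \<infinity>" using zs(2)[OF i] by (simp add: sq_integrable_iff_nn ennreal_mult_less_top)
  finally show ?thesis unfolding zint_def by simp
qed

lemma zint_nonneg: "0 \<le> zint i" unfolding zint_def by simp

text \<open>The separate bound for \<open>X\<close> avoids \<open>q i\<close>, which becomes small
  only after weighting by the step lengths and summing. The supremum over \<open>t\<close> in the
  error needs a bound of the order of the step at each single time.\<close>

lemma
  assumes i: "i < N" and r: "r \<in> {\<tau> i..\<tau> (Suc i)}"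
  shows near_bound: "msq (\<lambda>\<omega>. Xc r \<omega> - xs i \<omega>) + msq (\<lambda>\<omega>. Yc r \<omega> - ys i \<omega>) \<le> ennreal (near i)"
    and near_bound_X: "msq (\<lambda>\<omega>. Xc r \<omega> - xs i \<omega>) \<le> ennreal (20 * L\<^sup>2 * step i + 2 * err i)"
proof -
  have m: "\<tau> i \<in> {0..T}" "\<tau> (Suc i) \<in> {0..T}" using grid_mem i by auto
  have rT: "r \<in> {0..T}" and r1: "0 \<le> \<tau> i" "\<tau> i \<le> r" "r \<le> T" "r - \<tau> i \<le> 1" "r - \<tau> i \<le> step i"
    using m r mesh_le_1[OF i] unfolding step_def by auto
  note [measurable] = sq_integrable_measurable[OF sq_X[OF rT]] sq_integrable_measurable[OF sq_Y[OF rT]]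
    sq_integrable_measurable[OF sq_X[OF m(1)]] sq_integrable_measurable[OF sq_Y[OF m(1)]]
    sq_integrable_measurable[OF xs_sq[OF less_imp_le[OF i]]] sq_integrable_measurable[OF ys_sq[OF less_imp_le[OF i]]]
  have "msq (\<lambda>\<omega>. Xc r \<omega> - xs i \<omega>) = msq (\<lambda>\<omega>. (X r \<omega> - X (\<tau> i) \<omega>) + (X (\<tau> i) \<omega> - xs i \<omega>))" by (simp add: Xc_eq[OF rT])
  also have "\<dots> \<le> 2 * msq (\<lambda>\<omega>. X r \<omega> - X (\<tau> i) \<omega>) + 2 * msq (\<lambda>\<omega>. X (\<tau> i) \<omega> - xs i \<omega>)"
    by (rule msq_add_le) measurable
  also have "\<dots> \<le> 2 * ennreal (10 * L\<^sup>2 * step i) + 2 * msq (\<lambda>\<omega>. X (\<tau> i) \<omega> - xs i \<omega>)"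
  proof (intro add_mono mult_left_mono order_refl)
    have "msq (\<lambda>\<omega>. X r \<omega> - X (\<tau> i) \<omega>) \<le> ennreal (10 * L\<^sup>2 * (r - \<tau> i))" by (rule X_regularity[OF r1(1-4)])
    also have "\<dots> \<le> ennreal (10 * L\<^sup>2 * step i)" using r1(5) by (intro ennreal_leI mult_left_mono) auto
    finally show "msq (\<lambda>\<omega>. X r \<omega> - X (\<tau> i) \<omega>) \<le> ennreal (10 * L\<^sup>2 * step i)" .
  qed simp_all
  finally have 1: "msq (\<lambda>\<omega>. Xc r \<omega> - xs i \<omega>) \<le> 2 * ennreal (10 * L\<^sup>2 * step i) + 2 * msq (\<lambda>\<omega>. X (\<tau> i) \<omega> - xs i \<omega>)" .
  have "msq (\<lambda>\<omega>. Yc r \<omega> - ys i \<omega>) = msq (\<lambda>\<omega>. (Y r \<omega> - Y (\<tau> i) \<omega>) + (Y (\<tau> i) \<omega> - ys i \<omega>))" by (simp add: Yc_eq[OF rT])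
  also have "\<dots> \<le> 2 * msq (\<lambda>\<omega>. Y r \<omega> - Y (\<tau> i) \<omega>) + 2 * msq (\<lambda>\<omega>. Y (\<tau> i) \<omega> - ys i \<omega>)"
    by (rule msq_add_le) measurable
  also have "\<dots> \<le> 2 * (ennreal CY * ennreal (q i)) + 2 * msq (\<lambda>\<omega>. Y (\<tau> i) \<omega> - ys i \<omega>)"
  proof (intro add_mono mult_left_mono order_refl)
    have "msq (\<lambda>\<omega>. Y r \<omega> - Y (\<tau> i) \<omega>) \<le> ennreal CY * Q (\<tau> i) r" by (rule Y_regularity[OF r1(1-4)])
    also have "\<dots> \<le> ennreal CY * ennreal (q i)" using r unfolding q_eq[OF i, symmetric] by (intro mult_left_mono Q_mono) auto
    finally show "msq (\<lambda>\<omega>. Y r \<omega> - Y (\<tau> i) \<omega>) \<le> ennreal CY * ennreal (q i)" .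
  qed simp_all
  finally have 2: "msq (\<lambda>\<omega>. Yc r \<omega> - ys i \<omega>) \<le> 2 * (ennreal CY * ennreal (q i)) + 2 * msq (\<lambda>\<omega>. Y (\<tau> i) \<omega> - ys i \<omega>)" .
  have "msq (\<lambda>\<omega>. Xc r \<omega> - xs i \<omega>) + msq (\<lambda>\<omega>. Yc r \<omega> - ys i \<omega>) \<le>
     (2 * ennreal (10 * L\<^sup>2 * step i) + 2 * msq (\<lambda>\<omega>. X (\<tau> i) \<omega> - xs i \<omega>)) + (2 * (ennreal CY * ennreal (q i)) + 2 * msq (\<lambda>\<omega>. Y (\<tau> i) \<omega> - ys i \<omega>))"
    by (rule add_mono[OF 1 2])
  also have "\<dots> = 2 * ennreal (10 * L\<^sup>2 * step i) + 2 * (ennreal CY * ennreal (q i)) + 2 * ennreal (err i)"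
    unfolding err_eq[OF less_imp_le[OF i], symmetric] distrib_left by (simp only: ac_simps)
  also have "\<dots> = ennreal (near i)"
    unfolding near_def using step_pos[OF i] CY_pos q_nonneg[of i] err_nonneg[of i]
    by (simp add: numeral_ennreal_mult ennreal_mult[symmetric] ennreal_plus[symmetric] mult.assoc del: ennreal_plus)
  finally show "msq (\<lambda>\<omega>. Xc r \<omega> - xs i \<omega>) + msq (\<lambda>\<omega>. Yc r \<omega> - ys i \<omega>) \<le> ennreal (near i)" .
  have "msq (\<lambda>\<omega>. Xc r \<omega> - xs i \<omega>) \<le> 2 * ennreal (10 * L\<^sup>2 * step i) + 2 * ennreal (err i)"
    by (rule order_trans[OF 1]) (use err_eq[OF less_imp_le[OF i]] in \<open>auto intro!: add_left_mono mult_left_mono simp: add_increasing2 simp flip: err_eq[OF less_imp_le[OF i]]\<close>)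
  also have "\<dots> = ennreal (20 * L\<^sup>2 * step i + 2 * err i)"
    using step_pos[OF i] err_nonneg[of i]
    by (simp add: numeral_ennreal_mult ennreal_plus[symmetric] del: ennreal_plus)
  finally show "msq (\<lambda>\<omega>. Xc r \<omega> - xs i \<omega>) \<le> ennreal (20 * L\<^sup>2 * step i + 2 * err i)" .
qed

end

context fbsde begin

text \<open>Dominates the three constants of \<open>forward_step\<close>:
  \<open>1 + 96 * L\<^sup>2\<close> at \<open>err\<close>,
  \<open>48 * L\<^sup>2 * (1 + 20 * L\<^sup>2 + 2 * CY)\<close> at \<open>q\<close>, and
  \<open>48 * L\<^sup>2 + 8\<close> at \<open>zint\<close>.\<close>

definition CF :: real where "CF = 48 * L\<^sup>2 * (3 + 20 * L\<^sup>2 + 2 * CY) + 9"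

definition Qtot :: real where "Qtot = enn2real (Q 0 T)"

end

context fbsde_scheme begin

lemma grid_sub: "i < N \<Longrightarrow> r \<in> {\<tau> i<..\<tau> (Suc i)} \<Longrightarrow> r \<in> {0..T} \<and> \<bar>r - \<tau> i\<bar> \<le> step i"
  using grid_mem[of i] grid_mem[of "Suc i"] unfolding step_def by auto

text \<open>\<open>G\<close> stands for the deviation of the control: it is \<open>Zc - zs i\<close>
  when coefficients are compared, and \<open>Zdev i\<close> when \<open>Vc\<close> is compared with
  the control.\<close>

lemma int_msq_le_near:
  fixes \<Psi> :: "real \<Rightarrow> 'a \<Rightarrow> 'e::euclidean_space" and G :: "real \<Rightarrow> 'a \<Rightarrow> 'f::euclidean_space"
  assumes i: "i < N" and K: "0 \<le> K" and G: "jointly_measurable G"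
    and le: "\<And>r \<omega>. r \<in> {\<tau> i<..\<tau> (Suc i)} \<Longrightarrow>
      norm (\<Psi> r \<omega>) \<le> K * (sqrt (step i) + norm (Xc r \<omega> - xs i \<omega>) + norm (Yc r \<omega> - ys i \<omega>) + norm (G r \<omega>))"
  shows "(\<integral>\<^sup>+r\<in>{\<tau> i<..\<tau> (Suc i)}. msq (\<Psi> r) \<partial>lborel) \<le>
    ennreal (4 * K\<^sup>2) * (ennreal ((step i + near i) * step i) + (\<integral>\<^sup>+r\<in>{\<tau> i<..\<tau> (Suc i)}. msq (G r) \<partial>lborel))"
proof -
  let ?A = "{\<tau> i<..\<tau> (Suc i)}"
  have s0: "0 \<le> step i" using step_pos[OF i] by simp
  note [measurable] = measurable_msq[OF G]
  have "(\<integral>\<^sup>+r\<in>?A. msq (\<Psi> r) \<partial>lborel) \<le> (\<integral>\<^sup>+r. ennreal (4 * K\<^sup>2) * (ennreal (step i + near i) * indicator ?A r + msq (G r) * indicator ?A r) \<partial>lborel)"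
  proof (rule nn_integral_mono)
    fix r
    show "msq (\<Psi> r) * indicator ?A r \<le> ennreal (4 * K\<^sup>2) * (ennreal (step i + near i) * indicator ?A r + msq (G r) * indicator ?A r)"
    proof (cases "r \<in> ?A")
      case True
      have "msq (\<Psi> r) \<le> ennreal (4 * K\<^sup>2) * (ennreal (step i) + msq (\<lambda>\<omega>. Xc r \<omega> - xs i \<omega>) + msq (\<lambda>\<omega>. Yc r \<omega> - ys i \<omega>) + msq (G r))"
        using i by (intro msq_le_lipschitz le True K s0 borel_measurable_diff jointly_measurable_section[OF joint_X] jointly_measurable_section[OF joint_Y]
          jointly_measurable_section[OF G] sq_integrable_measurable[OF xs_sq] sq_integrable_measurable[OF ys_sq]) auto
      also have "\<dots> \<le> ennreal (4 * K\<^sup>2) * (ennreal (step i) + ennreal (near i) + msq (G r))"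
        unfolding add.assoc[of "ennreal (step i)"] using near_bound[OF i, of r] True
        by (intro mult_left_mono add_mono order_refl) auto
      also have "\<dots> = ennreal (4 * K\<^sup>2) * (ennreal (step i + near i) + msq (G r))"
        using s0 near_nonneg[OF i] by (simp add: ennreal_plus)
      finally show ?thesis using True by simp
    qed simp
  qed
  also have "\<dots> = ennreal (4 * K\<^sup>2) * (ennreal (step i + near i) * ennreal (step i) + (\<integral>\<^sup>+r\<in>?A. msq (G r) \<partial>lborel))"
    using s0 unfolding step_def by (simp add: nn_integral_cmult nn_integral_add)
  also have "ennreal (step i + near i) * ennreal (step i) = ennreal ((step i + near i) * step i)"
    using s0 near_nonneg[OF i] by (simp add: ennreal_mult)
  finally show ?thesis .
qed

definition b_i where "b_i i \<omega> = b (\<tau> i) (xs i \<omega>) (ys i \<omega>) (zs i \<omega>)"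
definition F_i where "F_i i \<omega> = F (\<tau> i) (xs i \<omega>) (ys i \<omega>) (zs i \<omega>)"
definition \<sigma>_i where "\<sigma>_i i \<omega> = \<sigma> (\<tau> i) (xs i \<omega>) (ys i \<omega>)"

text \<open>A common bound for the mean square distances of \<open>b\<close>, \<open>F\<close> and
  \<sigma> along the solution to their values frozen at the start of the step, integrated over the
  step.\<close>

definition cint :: "nat \<Rightarrow> real" where "cint i = 4 * L\<^sup>2 * ((step i + near i) * step i + zint i)"

lemma cint_nonneg: "i < N \<Longrightarrow> 0 \<le> cint i"
  unfolding cint_def using step_pos[of i] near_nonneg[of i] zint_nonneg[of i] by simp

lemma
  assumes i: "i < N"
  shows int_b_le: "(\<integral>\<^sup>+r\<in>{\<tau> i<..\<tau> (Suc i)}. msq (\<lambda>\<omega>. bc r \<omega> - b_i i \<omega>) \<partial>lborel) \<le> ennreal (cint i)"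
    and int_F_le: "(\<integral>\<^sup>+r\<in>{\<tau> i<..\<tau> (Suc i)}. msq (\<lambda>\<omega>. Fc r \<omega> - F_i i \<omega>) \<partial>lborel) \<le> ennreal (cint i)"
    and int_\<sigma>_le: "(\<integral>\<^sup>+r\<in>{\<tau> i<..\<tau> (Suc i)}. msq (\<lambda>\<omega>. \<sigma>c r \<omega> - \<sigma>_i i \<omega>) \<partial>lborel) \<le> ennreal (cint i)"
proof -
  have s: "0 \<le> step i" using step_pos[OF i] by simp
  have eq: "ennreal (4 * L\<^sup>2) * (ennreal ((step i + near i) * step i) + ennreal (zint i)) = ennreal (cint i)"
    unfolding cint_def using s near_nonneg[OF i] zint_nonneg[of i] by (simp add: ennreal_plus[symmetric] ennreal_mult[symmetric] del: ennreal_plus)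
  note lem = int_msq_le_near[OF i L0(1) joint_Z_dev[OF i], unfolded zint_eq[OF i] eq]
  have sq: "L * (sqrt \<bar>r - \<tau> i\<bar> + A) \<le> L * (sqrt (step i) + A)" if "r \<in> {\<tau> i<..\<tau> (Suc i)}" for r A
    using grid_sub[OF i that] by (intro mult_left_mono) auto
  have ti: "\<tau> i \<in> {0..T}" using grid_mem[of i] i by simp
  show "(\<integral>\<^sup>+r\<in>{\<tau> i<..\<tau> (Suc i)}. msq (\<lambda>\<omega>. bc r \<omega> - b_i i \<omega>) \<partial>lborel) \<le> ennreal (cint i)"
  proof (rule lem)
    fix r \<omega> assume r: "r \<in> {\<tau> i<..\<tau> (Suc i)}"
    then have rT: "r \<in> {0..T}" using grid_sub[OF i] by blast
    show "norm (bc r \<omega> - b_i i \<omega>) \<le> L * (sqrt (step i) + norm (Xc r \<omega> - xs i \<omega>) + norm (Yc r \<omega> - ys i \<omega>) + norm (Zc r \<omega> - zs i \<omega>))"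
      unfolding bc_def b_i_def clip_eq[OF rT] real_norm_def add.assoc using order_trans[OF b_le[OF rT ti, unfolded add.assoc] sq[OF r]] .
  qed
  show "(\<integral>\<^sup>+r\<in>{\<tau> i<..\<tau> (Suc i)}. msq (\<lambda>\<omega>. Fc r \<omega> - F_i i \<omega>) \<partial>lborel) \<le> ennreal (cint i)"
  proof (rule lem)
    fix r \<omega> assume r: "r \<in> {\<tau> i<..\<tau> (Suc i)}"
    then have rT: "r \<in> {0..T}" using grid_sub[OF i] by blast
    show "norm (Fc r \<omega> - F_i i \<omega>) \<le> L * (sqrt (step i) + norm (Xc r \<omega> - xs i \<omega>) + norm (Yc r \<omega> - ys i \<omega>) + norm (Zc r \<omega> - zs i \<omega>))"
      unfolding Fc_def F_i_def clip_eq[OF rT] real_norm_def add.assoc using order_trans[OF F_le[OF rT ti, unfolded add.assoc] sq[OF r]] .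
  qed
  show "(\<integral>\<^sup>+r\<in>{\<tau> i<..\<tau> (Suc i)}. msq (\<lambda>\<omega>. \<sigma>c r \<omega> - \<sigma>_i i \<omega>) \<partial>lborel) \<le> ennreal (cint i)"
  proof (rule lem)
    fix r \<omega> assume r: "r \<in> {\<tau> i<..\<tau> (Suc i)}"
    then have rT: "r \<in> {0..T}" using grid_sub[OF i] by blast
    have "norm (\<sigma>c r \<omega> - \<sigma>_i i \<omega>) \<le> L * (sqrt (step i) + (norm (Xc r \<omega> - xs i \<omega>) + norm (Yc r \<omega> - ys i \<omega>)))"
      unfolding \<sigma>c_def \<sigma>_i_def clip_eq[OF rT] real_norm_def using order_trans[OF \<sigma>_le[OF rT ti, unfolded add.assoc] sq[OF r]] .
    also have "\<dots> \<le> L * (sqrt (step i) + norm (Xc r \<omega> - xs i \<omega>) + norm (Yc r \<omega> - ys i \<omega>) + norm (Zc r \<omega> - zs i \<omega>))"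
      by (intro mult_left_mono) auto
    finally show "norm (\<sigma>c r \<omega> - \<sigma>_i i \<omega>) \<le> \<dots>" .
  qed
qed

text \<open>The new error is \<open>(?p + n) + \<beta>\<close>. The old error \<open>?p\<close> is
  known at \<open>\<tau> i\<close> and the martingale part \<open>n\<close> is orthogonal to it, so
  their squares simply add. The drift part \<beta> gets the weight \<open>1 + 1 / \<Delta>\<close>,
  which the factor \<open>\<Delta>\<close> of \<open>msq_lint_le\<close> pays for.\<close>

lemma msq_X_step:
  assumes i: "i < N"
  shows "msq (\<lambda>\<omega>. X (\<tau> (Suc i)) \<omega> - xs (Suc i) \<omega>) \<le> ennreal (1 + step i) * msq (\<lambda>\<omega>. X (\<tau> i) \<omega> - xs i \<omega>) + 10 * ennreal (cint i)"
proof -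
  let ?s = "\<tau> i" and ?t = "\<tau> (Suc i)" and ?\<Delta> = "step i"
  have st: "0 \<le> ?s" "?s \<le> ?t" "?t \<le> T" and ti: "?s \<in> {0..T}" using grid_mem[of i] grid_mem[of "Suc i"] grid_less[OF i] i by auto
  have \<Delta>: "0 < ?\<Delta>" "?\<Delta> \<le> 1" "?t - ?s = ?\<Delta>" using step_pos[OF i] step_le_1[OF i] unfolding step_def by auto
  have iN: "i \<le> N" using i by simp
  note xsm = sq_integrable_measurable[OF xs_sq[OF iN]] and ysm = sq_integrable_measurable[OF ys_sq[OF iN]] and zsm = sq_integrable_measurable[OF zs(2)[OF i]]
  obtain m where "(\<forall>k. ito_increment ?s ?t (\<lambda>r \<omega>. \<sigma>c r \<omega> $ k) (\<lambda>\<omega>. m \<omega> $ k)) \<and>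
    (AE \<omega> in M. X ?t \<omega> = X ?s \<omega> + (LINT r:{?s..?t}|lborel. bc r \<omega>) + m \<omega>)" using X_increment[OF st] ..
  note m = this[THEN conjunct1, rule_format] this[THEN conjunct2]
  have \<sigma>m: "\<sigma>_i i \<in> borel_measurable (\<F> ?s)" unfolding \<sigma>_i_def[abs_def] by (intro measurable_\<sigma> ti xs_adapted ys_adapted iN)
  have \<sigma>s: "sq_integrable M (\<sigma>_i i)"
    by (rule sq_integrable_bounded[OF measurable_filtration[OF \<sigma>m], of L]) (simp add: \<sigma>_i_def \<sigma>_bound[OF ti])
  define n where "n \<omega> = m \<omega> - \<sigma>_i i \<omega> *v (W ?t \<omega> - W ?s \<omega>)" for \<omega>
  note im = ito_increment_matrix[OF m(1) joint_\<sigma> st(1,2) \<sigma>m \<sigma>s, folded n_def]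
  have bm: "b_i i \<in> borel_measurable M" unfolding b_i_def[abs_def] by (intro measurable_b ti xsm ysm zsm)
  have jb: "jointly_measurable (\<lambda>r \<omega>. bc r \<omega> - b_i i \<omega>)" by (intro jointly_measurable_diff joint_b jointly_measurable_const_time bm)
  define \<beta> where "\<beta> \<omega> = (LINT r:{?s..?t}|lborel. bc r \<omega> - b_i i \<omega>)" for \<omega>
  have \<beta>m: "\<beta> \<in> borel_measurable M" unfolding \<beta>_def[abs_def] by (rule measurable_lint[OF jb])
  have \<beta>: "msq \<beta> \<le> ennreal ?\<Delta> * ennreal (cint i)"
    unfolding \<beta>_def using order_trans[OF msq_lint_le[OF jb st(2)] mult_left_mono[OF int_b_le[OF i]]] by (simp add: \<Delta>(3))
  have n: "msq n \<le> 4 * ennreal (cint i)" using order_trans[OF im(2) mult_left_mono[OF int_\<sigma>_le[OF i]]] by simp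
  let ?p = "\<lambda>\<omega>. X ?s \<omega> - xs i \<omega>"
  have ps: "sq_integrable M ?p" by (rule sq_X_dev[OF iN])
  have pm: "?p \<in> borel_measurable (\<F> ?s)" by (intro borel_measurable_diff adapted_X ti xs_adapted iN)
  have "AE \<omega> in M. X ?t \<omega> - xs (Suc i) \<omega> = (?p \<omega> + n \<omega>) + \<beta> \<omega>"
    using m(2) b_paths
  proof eventually_elim
    case (elim \<omega>)
    have I: "set_integrable lborel {?s..?t} (\<lambda>r. bc r \<omega>)" using st by (intro set_integrable_subset[OF elim(2)]) auto
    have c: "set_integrable lborel {?s..?t} (\<lambda>r. b_i i \<omega>)" "(LINT r:{?s..?t}|lborel. b_i i \<omega>) = ?\<Delta> *\<^sub>R b_i i \<omega>"
      using st \<Delta>(3) by (auto simp: set_integrable_def set_integral_const)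
    have "\<beta> \<omega> = (LINT r:{?s..?t}|lborel. bc r \<omega>) - ?\<Delta> *\<^sub>R b_i i \<omega>"
      unfolding \<beta>_def set_integral_diff(2)[OF I c(1)] c(2) ..
    then show ?case unfolding elim(1) xs_Suc[OF i] n_def b_i_def[symmetric] \<sigma>_i_def[symmetric] \<Delta>(3) by simp
  qed
  then have "msq (\<lambda>\<omega>. X ?t \<omega> - xs (Suc i) \<omega>) = msq (\<lambda>\<omega>. (?p \<omega> + n \<omega>) + \<beta> \<omega>)" by (rule msq_cong_AE)
  also have "\<dots> \<le> ennreal (1 + ?\<Delta>) * msq (\<lambda>\<omega>. ?p \<omega> + n \<omega>) + ennreal (1 + 1 / ?\<Delta>) * msq \<beta>"
    by (intro msq_add_weighted borel_measurable_add sq_integrable_measurable[OF ps] sq_integrable_measurable[OF im(1)] \<beta>m \<Delta>)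
  also have "msq (\<lambda>\<omega>. ?p \<omega> + n \<omega>) = msq ?p + msq n"
    by (intro msq_add_orthogonal ps im measurable_vec_nth[OF pm] sq_integrable_nth)
  also have "ennreal (1 + ?\<Delta>) * (msq ?p + msq n) + ennreal (1 + 1 / ?\<Delta>) * msq \<beta> \<le>
     ennreal (1 + ?\<Delta>) * (msq ?p + 4 * ennreal (cint i)) + ennreal (1 + 1 / ?\<Delta>) * (ennreal ?\<Delta> * ennreal (cint i))"
    by (intro add_mono mult_left_mono n \<beta>) simp_all
  also have "\<dots> = ennreal (1 + ?\<Delta>) * msq ?p + (ennreal (1 + ?\<Delta>) * (4 * ennreal (cint i)) + ennreal (1 + 1 / ?\<Delta>) * (ennreal ?\<Delta> * ennreal (cint i)))"
    by (simp only: distrib_left add.assoc)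
  also have "\<dots> = ennreal (1 + ?\<Delta>) * msq ?p + ennreal (5 * (1 + ?\<Delta>) * cint i)"
  proof -
    have "ennreal (1 + ?\<Delta>) * (4 * ennreal (cint i)) + ennreal (1 + 1 / ?\<Delta>) * (ennreal ?\<Delta> * ennreal (cint i))
      = ennreal ((1 + ?\<Delta>) * (4 * cint i) + (1 + 1 / ?\<Delta>) * (?\<Delta> * cint i))"
      using \<Delta> cint_nonneg[OF i] by (simp add: numeral_ennreal_mult ennreal_plus[symmetric] ennreal_mult[symmetric] del: ennreal_plus)
    also have "(1 + ?\<Delta>) * (4 * cint i) + (1 + 1 / ?\<Delta>) * (?\<Delta> * cint i) = 5 * (1 + ?\<Delta>) * cint i"
      using \<Delta> by (simp add: field_simps)
    finally show ?thesis by simp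
  qed
  also have "\<dots> \<le> ennreal (1 + ?\<Delta>) * msq ?p + 10 * ennreal (cint i)"
    unfolding numeral_ennreal_mult[OF cint_nonneg[OF i]] using \<Delta> cint_nonneg[OF i]
    by (intro add_left_mono ennreal_leI mult_right_mono) auto
  finally show ?thesis .
qed

text \<open>As for \<open>X\<close>, but the martingale part compares \<open>Zc\<close> with the
  control and therefore costs \<open>zint\<close> instead of \<open>cint\<close>.\<close>

lemma msq_Y_step:
  assumes i: "i < N"
  shows "msq (\<lambda>\<omega>. Y (\<tau> (Suc i)) \<omega> - ys (Suc i) \<omega>) \<le>
    ennreal (1 + step i) * msq (\<lambda>\<omega>. Y (\<tau> i) \<omega> - ys i \<omega>) + (2 * ennreal (cint i) + 8 * ennreal (zint i))"
proof -
  let ?s = "\<tau> i" and ?t = "\<tau> (Suc i)" and ?\<Delta> = "step i"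
  have st: "0 \<le> ?s" "?s \<le> ?t" "?t \<le> T" and ti: "?s \<in> {0..T}" using grid_mem[of i] grid_mem[of "Suc i"] grid_less[OF i] i by auto
  have \<Delta>: "0 < ?\<Delta>" "?\<Delta> \<le> 1" "?t - ?s = ?\<Delta>" using step_pos[OF i] step_le_1[OF i] unfolding step_def by auto
  have iN: "i \<le> N" using i by simp
  note xsm = sq_integrable_measurable[OF xs_sq[OF iN]] and ysm = sq_integrable_measurable[OF ys_sq[OF iN]] and zsm = sq_integrable_measurable[OF zs(2)[OF i]]
  obtain m where "ito_increment ?s ?t Zc m \<and>
    (AE \<omega> in M. Y ?t \<omega> = Y ?s \<omega> + (LINT r:{?s..?t}|lborel. Fc r \<omega>) + m \<omega>)" using Y_increment[OF st] ..
  note m = this[THEN conjunct1] this[THEN conjunct2]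
  define n where "n \<omega> = m \<omega> - zs i \<omega> \<bullet> (W ?t \<omega> - W ?s \<omega>)" for \<omega>
  have n: "msq n \<le> 4 * ennreal (zint i)"
    unfolding n_def zint_eq[OF i, symmetric] by (rule ito_increment_msq_le[OF m(1) joint_Z st(1,2) zs[OF i]])
  have ms: "sq_integrable M m" by (rule ito_increment_sq_integrable[OF m(1)])
  have ws: "sq_integrable M (\<lambda>\<omega>. zs i \<omega> \<bullet> (W ?t \<omega> - W ?s \<omega>))" by (rule sq_integrable_inner_increment[OF st(1,2) zs[OF i]])
  have ns: "sq_integrable M n" unfolding n_def[abs_def] by (intro sq_integrable_diff ms ws)
  have Fm: "F_i i \<in> borel_measurable M" unfolding F_i_def[abs_def] by (intro measurable_F ti xsm ysm zsm)
  have jF: "jointly_measurable (\<lambda>r \<omega>. Fc r \<omega> - F_i i \<omega>)" by (intro jointly_measurable_diff joint_F jointly_measurable_const_time Fm)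
  define \<beta> where "\<beta> \<omega> = (LINT r:{?s..?t}|lborel. Fc r \<omega> - F_i i \<omega>)" for \<omega>
  have \<beta>m: "\<beta> \<in> borel_measurable M" unfolding \<beta>_def[abs_def] by (rule measurable_lint[OF jF])
  have \<beta>: "msq \<beta> \<le> ennreal ?\<Delta> * ennreal (cint i)"
    unfolding \<beta>_def using order_trans[OF msq_lint_le[OF jF st(2)] mult_left_mono[OF int_F_le[OF i]]] by (simp add: \<Delta>(3))
  let ?p = "\<lambda>\<omega>. Y ?s \<omega> - ys i \<omega>"
  have ps: "sq_integrable M ?p" by (rule sq_Y_dev[OF iN])
  have pm: "?p \<in> borel_measurable (\<F> ?s)" by (intro borel_measurable_diff adapted_Y ti ys_adapted iN)
  have on: "expectation (\<lambda>\<omega>. ?p \<omega> * n \<omega>) = 0"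
  proof -
    have "expectation (\<lambda>\<omega>. ?p \<omega> * n \<omega>) = expectation (\<lambda>\<omega>. ?p \<omega> * m \<omega>) - expectation (\<lambda>\<omega>. ?p \<omega> * (zs i \<omega> \<bullet> (W ?t \<omega> - W ?s \<omega>)))"
      unfolding n_def right_diff_distrib[of "?p _"] by (intro Bochner_Integration.integral_diff sq_integrable_times ps ms ws)
    then show ?thesis
      using ito_increment_orthogonal[OF m(1) st(1) pm ps] expectation_mult_inner_increment[OF st(1,2) zs[OF i] pm ps] by simp
  qed
  have "AE \<omega> in M. Y ?t \<omega> - ys (Suc i) \<omega> = (?p \<omega> + n \<omega>) + \<beta> \<omega>"
    using m(2) F_paths
  proof eventually_elim
    case (elim \<omega>)
    have I: "set_integrable lborel {?s..?t} (\<lambda>r. Fc r \<omega>)" using st by (intro set_integrable_subset[OF elim(2)]) auto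
    have c: "set_integrable lborel {?s..?t} (\<lambda>r. F_i i \<omega>)" "(LINT r:{?s..?t}|lborel. F_i i \<omega>) = ?\<Delta> *\<^sub>R F_i i \<omega>"
      using st \<Delta>(3) by (auto simp: set_integrable_def set_integral_const)
    have "\<beta> \<omega> = (LINT r:{?s..?t}|lborel. Fc r \<omega>) - ?\<Delta> *\<^sub>R F_i i \<omega>"
      unfolding \<beta>_def set_integral_diff(2)[OF I c(1)] c(2) ..
    then show ?case unfolding elim(1) ys_Suc[OF i] n_def F_i_def[symmetric] \<Delta>(3) by simp
  qed
  then have "msq (\<lambda>\<omega>. Y ?t \<omega> - ys (Suc i) \<omega>) = msq (\<lambda>\<omega>. (?p \<omega> + n \<omega>) + \<beta> \<omega>)" by (rule msq_cong_AE)
  also have "\<dots> \<le> ennreal (1 + ?\<Delta>) * msq (\<lambda>\<omega>. ?p \<omega> + n \<omega>) + ennreal (1 + 1 / ?\<Delta>) * msq \<beta>"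
    by (intro msq_add_weighted borel_measurable_add sq_integrable_measurable[OF ps] sq_integrable_measurable[OF ns] \<beta>m \<Delta>)
  also have "msq (\<lambda>\<omega>. ?p \<omega> + n \<omega>) = msq ?p + msq n"
    by (rule msq_add_orthogonal_real[OF ps ns on])
  also have "ennreal (1 + ?\<Delta>) * (msq ?p + msq n) + ennreal (1 + 1 / ?\<Delta>) * msq \<beta> \<le>
     ennreal (1 + ?\<Delta>) * (msq ?p + 4 * ennreal (zint i)) + ennreal (1 + 1 / ?\<Delta>) * (ennreal ?\<Delta> * ennreal (cint i))"
    by (intro add_mono mult_left_mono n \<beta>) simp_all
  also have "\<dots> = ennreal (1 + ?\<Delta>) * msq ?p + (ennreal (1 + ?\<Delta>) * (4 * ennreal (zint i)) + ennreal (1 + 1 / ?\<Delta>) * (ennreal ?\<Delta> * ennreal (cint i)))"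
    by (simp only: distrib_left add.assoc)
  also have "\<dots> = ennreal (1 + ?\<Delta>) * msq ?p + ennreal ((1 + ?\<Delta>) * cint i + 4 * (1 + ?\<Delta>) * zint i)"
  proof -
    have "ennreal (1 + ?\<Delta>) * (4 * ennreal (zint i)) + ennreal (1 + 1 / ?\<Delta>) * (ennreal ?\<Delta> * ennreal (cint i))
      = ennreal ((1 + ?\<Delta>) * (4 * zint i) + (1 + 1 / ?\<Delta>) * (?\<Delta> * cint i))"
      using \<Delta> cint_nonneg[OF i] zint_nonneg[of i] by (simp add: numeral_ennreal_mult ennreal_plus[symmetric] ennreal_mult[symmetric] del: ennreal_plus)
    also have "(1 + ?\<Delta>) * (4 * zint i) + (1 + 1 / ?\<Delta>) * (?\<Delta> * cint i) = (1 + ?\<Delta>) * cint i + 4 * (1 + ?\<Delta>) * zint i"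
      using \<Delta> by (simp add: field_simps)
    finally show ?thesis by simp
  qed
  also have "\<dots> \<le> ennreal (1 + ?\<Delta>) * msq ?p + ennreal (2 * cint i + 8 * zint i)"
    using \<Delta> cint_nonneg[OF i] zint_nonneg[of i] by (intro add_left_mono ennreal_leI add_mono mult_right_mono) auto
  also have "\<dots> = ennreal (1 + ?\<Delta>) * msq ?p + (2 * ennreal (cint i) + 8 * ennreal (zint i))"
    using cint_nonneg[OF i] zint_nonneg[of i] by (simp add: numeral_ennreal_mult ennreal_plus)
  finally show ?thesis .
qed

text \<open>The sum of the bounds for \<open>X\<close> and \<open>Y\<close>. Through
  \<open>near\<close>, the coefficient term \<open>cint\<close> contains \<open>err i\<close> again,
  weighted by the step, and this goes into the growth factor; the control enters through
  \<open>zint\<close>.\<close>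

lemma forward_step:
  assumes i: "i < N"
  shows "err (Suc i) \<le> (1 + CF * step i) * err i + (CF * (step i * q i) + CF * zint i)"
proof -
  have \<Delta>: "0 < step i" "step i \<le> q i" using step_pos[OF i] step_le_q[OF i] by auto
  have iN: "i \<le> N" "Suc i \<le> N" using i by auto
  have "ennreal (err (Suc i)) \<le> (ennreal (1 + step i) * msq (\<lambda>\<omega>. X (\<tau> i) \<omega> - xs i \<omega>) + 10 * ennreal (cint i)) +
    (ennreal (1 + step i) * msq (\<lambda>\<omega>. Y (\<tau> i) \<omega> - ys i \<omega>) + (2 * ennreal (cint i) + 8 * ennreal (zint i)))"
    unfolding err_eq[OF iN(2), symmetric] by (rule add_mono[OF msq_X_step[OF i] msq_Y_step[OF i]])
  also have "\<dots> = ennreal (1 + step i) * ennreal (err i) + (10 * ennreal (cint i) + (2 * ennreal (cint i) + 8 * ennreal (zint i)))"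
    unfolding err_eq[OF iN(1), symmetric] distrib_left by (simp only: ac_simps)
  also have "\<dots> = ennreal ((1 + step i) * err i + (10 * cint i + (2 * cint i + 8 * zint i)))"
    using \<Delta> err_nonneg[of i] cint_nonneg[OF i] zint_nonneg[of i]
    by (simp add: numeral_ennreal_mult ennreal_plus[symmetric] ennreal_mult[symmetric] del: ennreal_plus)
  finally have "err (Suc i) \<le> (1 + step i) * err i + (10 * cint i + (2 * cint i + 8 * zint i))"
    using \<Delta> err_nonneg[of i] cint_nonneg[OF i] zint_nonneg[of i] by (subst (asm) ennreal_le_iff) auto
  also have "\<dots> = (1 + step i) * err i + (12 * cint i + 8 * zint i)" by simp
  also have "12 * cint i = 48 * L\<^sup>2 * (step i * (step i + 20 * L\<^sup>2 * step i)) + 48 * L\<^sup>2 * (2 * CY) * (step i * q i) + 96 * L\<^sup>2 * (step i * err i) + 48 * L\<^sup>2 * zint i"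
    unfolding cint_def near_def by (simp add: algebra_simps power2_eq_square)
  also have "(1 + step i) * err i + (48 * L\<^sup>2 * (step i * (step i + 20 * L\<^sup>2 * step i)) + 48 * L\<^sup>2 * (2 * CY) * (step i * q i) + 96 * L\<^sup>2 * (step i * err i) + 48 * L\<^sup>2 * zint i + 8 * zint i)
    \<le> (1 + step i) * err i + (48 * L\<^sup>2 * (1 + 20 * L\<^sup>2) * (step i * q i) + 48 * L\<^sup>2 * (2 * CY) * (step i * q i) + 96 * L\<^sup>2 * (step i * err i) + 48 * L\<^sup>2 * zint i + 8 * zint i)"
  proof -
    \<comment> \<open>\<open>step i \<le> q i\<close> merges the terms quadratic in the step into
      those with \<open>q i\<close>.\<close>
    have "step i * (step i + 20 * L\<^sup>2 * step i) = (1 + 20 * L\<^sup>2) * (step i * step i)" by (simp add: algebra_simps)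
    also have "\<dots> \<le> (1 + 20 * L\<^sup>2) * (step i * q i)" using \<Delta> by (intro mult_left_mono) auto
    finally have "48 * L\<^sup>2 * (step i * (step i + 20 * L\<^sup>2 * step i)) \<le> 48 * L\<^sup>2 * ((1 + 20 * L\<^sup>2) * (step i * q i))"
      by (intro mult_left_mono) auto
    then show ?thesis by (simp add: mult.assoc)
  qed
  also have "\<dots> = err i + (1 + 96 * L\<^sup>2) * (step i * err i) + (48 * L\<^sup>2 * (1 + 20 * L\<^sup>2 + 2 * CY) * (step i * q i) + (48 * L\<^sup>2 + 8) * zint i)"
    by (simp add: algebra_simps)
  also have "\<dots> \<le> err i + CF * (step i * err i) + (CF * (step i * q i) + CF * zint i)"
  proof (intro add_mono mult_right_mono order_refl)
    have Lc: "0 \<le> L\<^sup>2 * L\<^sup>2" "0 \<le> L\<^sup>2 * CY" "0 \<le> L\<^sup>2" using CY_pos by auto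
    have CF: "CF = 144 * L\<^sup>2 + 960 * (L\<^sup>2 * L\<^sup>2) + 96 * (L\<^sup>2 * CY) + 9" unfolding CF_def by (simp add: algebra_simps)
    show "1 + 96 * L\<^sup>2 \<le> CF" "48 * L\<^sup>2 + 8 \<le> CF" using Lc unfolding CF by linarith+
    have "48 * L\<^sup>2 * (1 + 20 * L\<^sup>2 + 2 * CY) = 48 * L\<^sup>2 + 960 * (L\<^sup>2 * L\<^sup>2) + 96 * (L\<^sup>2 * CY)" by (simp add: algebra_simps)
    then show "48 * L\<^sup>2 * (1 + 20 * L\<^sup>2 + 2 * CY) \<le> CF" using Lc unfolding CF by linarith
  qed (use \<Delta> err_nonneg[of i] zint_nonneg[of i] q_nonneg[of i] in auto)
  finally show ?thesis by (simp add: algebra_simps)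
qed

lemma sum_int_grid:
  assumes [measurable]: "f \<in> borel_measurable lborel" and n: "n \<le> N"
  shows "(\<Sum>i<n. \<integral>\<^sup>+r\<in>{\<tau> i<..\<tau> (Suc i)}. f r \<partial>lborel) = (\<integral>\<^sup>+r\<in>{0<..\<tau> n}. f r \<partial>lborel)"
  using n
proof (induction n)
  case 0
  then show ?case by (simp add: grid_0)
next
  case (Suc n)
  have "0 \<le> \<tau> n" "\<tau> n \<le> \<tau> (Suc n)" using grid_mem[of n] grid_less[of n] Suc.prems by auto
  then have "{0<..\<tau> (Suc n)} = {0<..\<tau> n} \<union> {\<tau> n<..\<tau> (Suc n)}" by auto
  then show ?case using Suc nn_integral_disjoint_pair[of f lborel "{0<..\<tau> n}" "{\<tau> n<..\<tau> (Suc n)}"] by simp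
qed

lemma sum_q: "(\<Sum>i<N. q i) = Qtot"
proof -
  have "ennreal (\<Sum>i<N. q i) = (\<Sum>i<N. ennreal (q i))" by (rule sum_ennreal[symmetric]) (rule q_nonneg)
  also have "\<dots> = (\<Sum>i<N. Q (\<tau> i) (\<tau> (Suc i)))" by (intro sum.cong) (auto simp: q_eq)
  also have "\<dots> = Q 0 T" unfolding Q_def using sum_int_grid[of dens N] grid_N by simp
  finally have "ennreal (\<Sum>i<N. q i) = Q 0 T" .
  then show ?thesis unfolding Qtot_def using q_nonneg by (metis enn2real_ennreal sum_nonneg)
qed

text \<open>\<open>Vc\<close> and \<open>zs i\<close> are both compared with
  \<open>ux v* \<sigma>\<close> frozen along the scheme, and the second difference is
  \<open>Zdev i\<close>. In this way the backward estimate, which bounds \<open>Zdev\<close>, yields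
  the distance of the control to the candidate for \<open>Z\<close>. The factor
  \<open>16 * L^4\<close> is \<open>4 * (2 * L\<^sup>2)\<^sup>2\<close>.\<close>

lemma int_V_le:
  assumes i: "i < N"
  shows "(\<integral>\<^sup>+r\<in>{\<tau> i<..\<tau> (Suc i)}. msq (\<lambda>\<omega>. Vc r \<omega> - zs i \<omega>) \<partial>lborel) \<le>
    ennreal (16 * L^4 * ((step i + near i + expectation (\<lambda>\<omega>. (norm (Zdev i \<omega>))\<^sup>2)) * step i))"
proof -
  have s: "0 \<le> step i" using step_pos[OF i] by simp
  have L2: "1 \<le> 2 * L\<^sup>2" using L_power_mono[of 0 2] by simp
  have ti: "\<tau> i \<in> {0..T}" using grid_mem[of i] i by simp
  have jz: "jointly_measurable (\<lambda>r. Zdev i)" by (intro jointly_measurable_const_time sq_integrable_measurable Zdev_sq i)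
  have "(\<integral>\<^sup>+r\<in>{\<tau> i<..\<tau> (Suc i)}. msq (\<lambda>\<omega>. Vc r \<omega> - zs i \<omega>) \<partial>lborel) \<le>
    ennreal (4 * (2 * L\<^sup>2)\<^sup>2) * (ennreal ((step i + near i) * step i) + (\<integral>\<^sup>+r\<in>{\<tau> i<..\<tau> (Suc i)}. msq (Zdev i) \<partial>lborel))"
  proof (rule int_msq_le_near[OF i _ jz])
    fix r \<omega> assume r: "r \<in> {\<tau> i<..\<tau> (Suc i)}"
    then have rT: "r \<in> {0..T}" and rs: "sqrt \<bar>r - \<tau> i\<bar> \<le> sqrt (step i)" using grid_sub[OF i] by auto
    let ?v = "ux (\<tau> i) (xs i \<omega>) v* \<sigma> (\<tau> i) (xs i \<omega>) (ys i \<omega>)"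
    let ?a = "sqrt (step i) + norm (Xc r \<omega> - xs i \<omega>) + norm (Yc r \<omega> - ys i \<omega>)"
    have "Vc r \<omega> - zs i \<omega> = (Vc r \<omega> - ?v) - Zdev i \<omega>" unfolding Zdev_def by simp
    then have "norm (Vc r \<omega> - zs i \<omega>) \<le> norm (Vc r \<omega> - ?v) + norm (Zdev i \<omega>)" by (metis norm_triangle_ineq4)
    also have "norm (Vc r \<omega> - ?v) \<le> 2 * L\<^sup>2 * (sqrt \<bar>r - \<tau> i\<bar> + norm (Xc r \<omega> - xs i \<omega>) + \<bar>Yc r \<omega> - ys i \<omega>\<bar>)"
      unfolding Vc_def \<sigma>c_def clip_eq[OF rT] by (rule ux\<sigma>_le[OF rT ti])
    also have "\<dots> \<le> 2 * L\<^sup>2 * ?a" using rs by (intro mult_left_mono) auto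
    also have "norm (Zdev i \<omega>) \<le> 2 * L\<^sup>2 * norm (Zdev i \<omega>)" using mult_right_mono[OF L2, of "norm (Zdev i \<omega>)"] by simp
    finally show "norm (Vc r \<omega> - zs i \<omega>) \<le> 2 * L\<^sup>2 * (?a + norm (Zdev i \<omega>))" by (simp add: distrib_left)
  qed simp
  also have "(\<integral>\<^sup>+r\<in>{\<tau> i<..\<tau> (Suc i)}. msq (Zdev i) \<partial>lborel) = ennreal (expectation (\<lambda>\<omega>. (norm (Zdev i \<omega>))\<^sup>2) * step i)"
    unfolding nn_integral_sq_integrable[OF Zdev_sq[OF i]] using s unfolding step_def
    by (simp add: nn_integral_cmult ennreal_mult)
  also have "ennreal (4 * (2 * L\<^sup>2)\<^sup>2) * (ennreal ((step i + near i) * step i) + \<dots>) =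
     ennreal (4 * (2 * L\<^sup>2)\<^sup>2 * ((step i + near i) * step i + expectation (\<lambda>\<omega>. (norm (Zdev i \<omega>))\<^sup>2) * step i))"
    using s near_nonneg[OF i] by (simp add: ennreal_plus[symmetric] ennreal_mult[symmetric] del: ennreal_plus)
  also have "4 * (2 * L\<^sup>2)\<^sup>2 * ((step i + near i) * step i + expectation (\<lambda>\<omega>. (norm (Zdev i \<omega>))\<^sup>2) * step i) =
     16 * L^4 * ((step i + near i + expectation (\<lambda>\<omega>. (norm (Zdev i \<omega>))\<^sup>2)) * step i)"
    by (simp add: power_mult_distrib distrib_right)
  finally show ?thesis .
qed

end

section \<open>Estimates summed over the grid\<close>

context fbsde begin

text \<open>\<open>kB\<close> and \<open>cB\<close> are the constants of
  \<open>backward_estimate\<close>; the 4 in \<open>KB\<close> undoes the 1/4 in front of the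
  \<open>Zdev\<close> terms.\<close>

definition kB :: real where "kB = 2 * (7 * L^4) + 4 * (7 * L^4)\<^sup>2"
definition cB :: real where "cB = (L^6 + 128 * (66 * L^6)\<^sup>2) * (1 + 105 * real CARD('d)^4)"
definition KB :: real where "KB = 4 * exp ((2 * kB + 1) * T) * (1 + cB * T)"

lemma kB_nonneg: "0 \<le> kB" and cB_nonneg: "0 \<le> cB" and KB_nonneg: "0 \<le> KB" and CF_nonneg: "0 \<le> CF" and Qtot_nonneg: "0 \<le> Qtot"
  unfolding kB_def cB_def KB_def CF_def Qtot_def using CY_pos T by (auto intro!: add_nonneg_nonneg mult_nonneg_nonneg)

end

context fbsde_scheme begin

text \<open>As \<open>u T = g\<close>, this is the mean square of \<open>ys N - g (xs N)\<close>,
  the terminal term of the claim.\<close>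

definition cost :: real where "cost = expectation (\<lambda>\<omega>. (Dev N \<omega>)\<^sup>2)"
definition ez :: "nat \<Rightarrow> real" where "ez i = expectation (\<lambda>\<omega>. (norm (Zdev i \<omega>))\<^sup>2)"

lemma cost_nonneg: "0 \<le> cost" and ez_nonneg: "0 \<le> ez i" unfolding cost_def ez_def by simp_all

lemma sum_step: "(\<Sum>i<N. step i) = T"
  unfolding step_def using sum_lessThan_telescope[of \<tau> N] grid_0 grid_N by simp

lemma backward_bound:
  assumes h: "\<And>i. i < N \<Longrightarrow> step i \<le> h" "h \<le> 1" "kB * h \<le> 1 / 2" and h0: "0 \<le> h"
  shows "expectation (\<lambda>\<omega>. (Dev 0 \<omega>)\<^sup>2) \<le> KB * (cost + h powr \<alpha>)"
    and "(\<Sum>i<N. step i * ez i) \<le> KB * (cost + h powr \<alpha>)"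
proof -
  let ?e = "exp ((2 * kB + 1) * T)"
  define D where "D = expectation (\<lambda>\<omega>. (Dev 0 \<omega>)\<^sup>2)"
  define S where "S = (\<Sum>i<N. step i * ez i)"
  have D0: "0 \<le> D" unfolding D_def by simp
  have S0: "0 \<le> S" unfolding S_def by (intro sum_nonneg mult_nonneg_nonneg ez_nonneg) (use step_pos in \<open>auto intro: less_imp_le\<close>)
  have cT: "0 \<le> cB * T" using cB_nonneg T by simp
  have "D + (\<Sum>i=0..<N. (\<tau> (Suc i) - \<tau> i) / 4 * expectation (\<lambda>\<omega>. (norm (Zdev i \<omega>))\<^sup>2)) \<le> ?e * (cost + cB * T * h powr \<alpha>)"
    using backward_estimate[of h 0] h unfolding D_def cost_def kB_def cB_def step_def by simp
  also have "(\<Sum>i=0..<N. (\<tau> (Suc i) - \<tau> i) / 4 * expectation (\<lambda>\<omega>. (norm (Zdev i \<omega>))\<^sup>2)) = S / 4"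
    unfolding S_def step_def ez_def by (simp add: atLeast0LessThan sum_divide_distrib)
  also have "?e * (cost + cB * T * h powr \<alpha>) \<le> ?e * ((1 + cB * T) * (cost + h powr \<alpha>))"
  proof (rule mult_left_mono)
    show "cost + cB * T * h powr \<alpha> \<le> (1 + cB * T) * (cost + h powr \<alpha>)"
      using mult_nonneg_nonneg[OF cT cost_nonneg] powr_ge_zero[of h \<alpha>] by (simp add: algebra_simps)
  qed simp
  also have "\<dots> = KB * (cost + h powr \<alpha>) / 4" unfolding KB_def by simp
  finally have "D + S / 4 \<le> KB * (cost + h powr \<alpha>) / 4" .
  then show "D \<le> KB * (cost + h powr \<alpha>)" "S \<le> KB * (cost + h powr \<alpha>)" using D0 S0 by linarith+
qed

lemma sum_step_q:
  assumes "\<And>i. i < N \<Longrightarrow> step i \<le> h" shows "(\<Sum>i<N. step i * q i) \<le> h * Qtot"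
proof -
  have "(\<Sum>i<N. step i * q i) \<le> (\<Sum>i<N. h * q i)" by (intro sum_mono mult_right_mono assms q_nonneg) simp
  then show ?thesis by (simp add: sum_distrib_left[symmetric] sum_q)
qed

lemma sum_step_sq:
  assumes "\<And>i. i < N \<Longrightarrow> step i \<le> h" shows "(\<Sum>i<N. step i * step i) \<le> h * T"
proof -
  have "(\<Sum>i<N. step i * step i) \<le> (\<Sum>i<N. h * step i)" using assms step_pos by (intro sum_mono mult_right_mono) (auto intro: less_imp_le)
  then show ?thesis by (simp add: sum_distrib_left[symmetric] sum_step)
qed

lemma sum_near:
  assumes h: "\<And>i. i < N \<Longrightarrow> step i \<le> h" and e: "\<And>i. i \<le> N \<Longrightarrow> err i \<le> e"
  shows "(\<Sum>i<N. near i * step i) \<le> 20 * L\<^sup>2 * (h * T) + 2 * CY * (h * Qtot) + 2 * (e * T)"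
proof -
  have "(\<Sum>i<N. near i * step i) = 20 * L\<^sup>2 * (\<Sum>i<N. step i * step i) + 2 * CY * (\<Sum>i<N. step i * q i) + 2 * (\<Sum>i<N. err i * step i)"
    unfolding near_def sum_distrib_left sum.distrib[symmetric] by (simp add: algebra_simps)
  moreover have "(\<Sum>i<N. err i * step i) \<le> (\<Sum>i<N. e * step i)" using e step_pos by (intro sum_mono mult_right_mono) (auto intro: less_imp_le)
  then have "(\<Sum>i<N. err i * step i) \<le> e * T" by (simp add: sum_distrib_left[symmetric] sum_step)
  moreover have "20 * L\<^sup>2 * (\<Sum>i<N. step i * step i) \<le> 20 * L\<^sup>2 * (h * T)" using sum_step_sq[of h] h by (intro mult_left_mono) auto
  moreover have "2 * CY * (\<Sum>i<N. step i * q i) \<le> 2 * CY * (h * Qtot)" using sum_step_q[of h] h CY_pos by (intro mult_left_mono) auto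
  ultimately show ?thesis by linarith
qed

lemma int_V_sum_le:
  assumes h: "\<And>i. i < N \<Longrightarrow> step i \<le> h" and e: "\<And>i. i \<le> N \<Longrightarrow> err i \<le> e"
  shows "(\<Sum>i<N. \<integral>\<^sup>+r\<in>{\<tau> i<..\<tau> (Suc i)}. msq (\<lambda>\<omega>. Vc r \<omega> - zs i \<omega>) \<partial>lborel) \<le>
    ennreal (16 * L^4 * (h * T + (20 * L\<^sup>2 * (h * T) + 2 * CY * (h * Qtot) + 2 * (e * T)) + (\<Sum>i<N. step i * ez i)))"
proof -
  let ?f = "\<lambda>i. 16 * L^4 * ((step i + near i + ez i) * step i)"
  have nn: "0 \<le> ?f i" if "i < N" for i
    using step_pos[OF that] near_nonneg[OF that] ez_nonneg[of i] by (intro mult_nonneg_nonneg add_nonneg_nonneg) auto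
  have "(\<Sum>i<N. \<integral>\<^sup>+r\<in>{\<tau> i<..\<tau> (Suc i)}. msq (\<lambda>\<omega>. Vc r \<omega> - zs i \<omega>) \<partial>lborel) \<le> (\<Sum>i<N. ennreal (?f i))"
    unfolding ez_def by (intro sum_mono int_V_le) auto
  also have "\<dots> = ennreal (\<Sum>i<N. ?f i)" using nn by (intro sum_ennreal) auto
  also have "(\<Sum>i<N. ?f i) = 16 * L^4 * ((\<Sum>i<N. step i * step i) + (\<Sum>i<N. near i * step i) + (\<Sum>i<N. step i * ez i))"
    unfolding sum_distrib_left sum.distrib[symmetric] by (simp add: algebra_simps)
  also have "ennreal \<dots> \<le> ennreal (16 * L^4 * (h * T + (20 * L\<^sup>2 * (h * T) + 2 * CY * (h * Qtot) + 2 * (e * T)) + (\<Sum>i<N. step i * ez i)))"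
    using sum_near[OF h e] sum_step_sq[OF h] by (intro ennreal_leI mult_left_mono add_mono) auto
  finally show ?thesis .
qed

lemma int_split_grid:
  assumes H: "jointly_measurable H"
  shows "(\<integral>\<^sup>+r\<in>{0<..T}. msq (H r) \<partial>lborel) = (\<Sum>i<N. \<integral>\<^sup>+r\<in>{\<tau> i<..\<tau> (Suc i)}. msq (H r) \<partial>lborel)"
  using sum_int_grid[OF measurable_msq[OF H], of N] grid_N by simp

text \<open>Since \<open>Y T = g (X T)\<close> almost surely and \<open>u T = g\<close>,
  \<open>Dev N\<close> consists of the terminal errors of \<open>g (X)\<close> and of
  \<open>Y\<close>. So a scheme close to the solution has a small cost, which makes the backward
  estimate effective in the identification.\<close>

lemma cost_le_err:
  shows "cost \<le> 2 * L\<^sup>2 * err N"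
proof -
  have T': "T \<in> {0..T}" by simp
  have A: "AE \<omega> in M. (Dev N \<omega>)\<^sup>2 \<le> 2 * L\<^sup>2 * ((norm (X (\<tau> N) \<omega> - xs N \<omega>))\<^sup>2 + (Y (\<tau> N) \<omega> - ys N \<omega>)\<^sup>2)"
    using Y_T
  proof eventually_elim
    case (elim \<omega>)
    have eq: "Dev N \<omega> = (g (X T \<omega>) - g (xs N \<omega>)) + (ys N \<omega> - Y T \<omega>)"
      unfolding Dev_def grid_N uT_eq elim by simp
    have "(Dev N \<omega>)\<^sup>2 \<le> 2 * (g (X T \<omega>) - g (xs N \<omega>))\<^sup>2 + 2 * (ys N \<omega> - Y T \<omega>)\<^sup>2"
      using norm_add_sq_le[of "g (X T \<omega>) - g (xs N \<omega>)" "ys N \<omega> - Y T \<omega>"] unfolding eq by simp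
    also have "(g (X T \<omega>) - g (xs N \<omega>))\<^sup>2 \<le> (L * norm (X T \<omega> - xs N \<omega>))\<^sup>2"
      using g_lip[of "X T \<omega>" "xs N \<omega>"] by (intro power2_le_iff_abs_le[THEN iffD2]) auto
    also have "(ys N \<omega> - Y T \<omega>)\<^sup>2 \<le> L\<^sup>2 * (Y T \<omega> - ys N \<omega>)\<^sup>2"
      using mult_right_mono[OF L_power_mono[of 0 2], of "(Y T \<omega> - ys N \<omega>)\<^sup>2"] by (simp add: power2_commute)
    finally show ?case unfolding grid_N by (simp add: power_mult_distrib algebra_simps)
  qed
  have i1: "integrable M (\<lambda>\<omega>. (Dev N \<omega>)\<^sup>2)" using Dev_sq[of N] by (simp add: sq_integrable_def)
  have i2: "integrable M (\<lambda>\<omega>. (norm (X (\<tau> N) \<omega> - xs N \<omega>))\<^sup>2)" "integrable M (\<lambda>\<omega>. (Y (\<tau> N) \<omega> - ys N \<omega>)\<^sup>2)"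
    using sq_X_dev[of N] sq_Y_dev[of N] by (simp_all add: sq_integrable_def)
  have "cost \<le> expectation (\<lambda>\<omega>. 2 * L\<^sup>2 * ((norm (X (\<tau> N) \<omega> - xs N \<omega>))\<^sup>2 + (Y (\<tau> N) \<omega> - ys N \<omega>)\<^sup>2))"
    unfolding cost_def using i1 i2 A by (intro integral_mono_AE) auto
  also have "\<dots> = 2 * L\<^sup>2 * err N" unfolding err_def using i2 by simp
  finally show ?thesis .
qed

lemma err_bound:
  assumes h: "\<And>i. i < N \<Longrightarrow> step i \<le> h" and i: "i \<le> N"
  shows "err i \<le> exp (CF * T) * (err 0 + (CF * (h * Qtot) + CF * (\<Sum>j<N. zint j)))"
proof -
  have k0: "0 \<le> CF * (step j * q j) + CF * zint j" if "j < N" for j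
    using step_pos[OF that] q_nonneg[of j] zint_nonneg[of j] CF_nonneg by auto
  have S: "0 \<le> (\<Sum>j<i. CF * (step j * q j) + CF * zint j)" using k0 i by (intro sum_nonneg) auto
  have "err i \<le> exp (CF * \<tau> i) * (err 0 + (\<Sum>j<i. CF * (step j * q j) + CF * zint j))"
    using forward_step by (intro forward_gronwall[OF grid CF_nonneg err_nonneg k0 _ i]) (auto simp: step_def)
  also have "\<dots> \<le> exp (CF * T) * (err 0 + (\<Sum>j<N. CF * (step j * q j) + CF * zint j))"
    using grid_mem[OF i] CF_nonneg err_nonneg[of 0] S i k0
    by (intro mult_mono add_left_mono sum_mono2) (auto intro!: mult_left_mono)
  also have "(\<Sum>j<N. CF * (step j * q j) + CF * zint j) = CF * (\<Sum>j<N. step j * q j) + CF * (\<Sum>j<N. zint j)"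
    by (simp add: sum.distrib sum_distrib_left)
  also have "exp (CF * T) * (err 0 + (CF * (\<Sum>j<N. step j * q j) + CF * (\<Sum>j<N. zint j))) \<le>
      exp (CF * T) * (err 0 + (CF * (h * Qtot) + CF * (\<Sum>j<N. zint j)))"
    using sum_step_q[OF h] CF_nonneg by (intro mult_left_mono add_left_mono add_right_mono) auto
  finally show ?thesis .
qed

end

subsection \<open>Identification of the solution\<close>

text \<open>A uniform grid is merged with \<open>P\<close> and sorted. No point of \<open>P\<close>
  then lies inside a cell, so a step process with its endpoints in \<open>P\<close> is constant on
  every left-open cell.\<close>

lemma time_grid_refining:
  assumes T: "0 < T" and m: "0 < m" and P: "finite P" "P \<subseteq> {0..T}"
  shows "\<exists>N \<tau>. time_grid T N \<tau> \<and> (\<forall>i<N. \<tau> (Suc i) - \<tau> i \<le> T / real m) \<and>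
    (\<forall>i<N. \<forall>x\<in>P. x \<le> \<tau> i \<or> \<tau> (Suc i) \<le> x)"
proof -
  define R where "R = P \<union> (\<lambda>j. real j * T / real m) ` {..m}"
  have R: "finite R" "R \<subseteq> {0..T}" "0 \<in> R" "T \<in> R"
  proof -
    show "finite R" unfolding R_def using P by simp
    have "real j * T / real m \<in> {0..T}" if "j \<le> m" for j
      using that T m mult_right_mono[of "real j" "real m" T] by (simp add: field_simps)
    then show "R \<subseteq> {0..T}" unfolding R_def using P by auto
    show "0 \<in> R" unfolding R_def by (rule UnI2, rule image_eqI[of _ _ 0]) simp_all
    show "T \<in> R" unfolding R_def using m by (intro UnI2 image_eqI[of _ _ m]) simp_all
  qed
  define xs where "xs = sorted_list_of_set R"
  have xs: "set xs = R" "sorted_wrt (<) xs" unfolding xs_def using R(1) by simp_all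
  have ne: "xs \<noteq> []" using xs(1) R(3) by auto
  define N where "N = length xs - 1"
  have len: "length xs = Suc N" using ne unfolding N_def by (cases xs) auto
  have le: "xs ! i \<le> xs ! j" if "i \<le> j" "j \<le> N" for i j
    using that len xs(2) sorted_wrt_nth_less[of "(<)" xs i j] by (cases "i = j") auto
  have idx: "\<exists>j\<le>N. x = xs ! j" if "x \<in> R" for x
    using that unfolding xs(1)[symmetric] in_set_conv_nth len by (auto simp: less_Suc_eq_le)
  have mem: "xs ! i \<in> {0..T}" if "i \<le> N" for i using that R(2) len nth_mem[of i xs] xs(1) by auto
  have gap: "x \<le> xs ! i \<or> xs ! Suc i \<le> x" if i: "i < N" and x: "x \<in> R" for i x
  proof -
    obtain j where "j \<le> N \<and> x = xs ! j" using idx[OF x] ..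
    then show ?thesis using le[of j i] le[of "Suc i" j] i by (cases "j \<le> i") auto
  qed
  have less: "xs ! i < xs ! Suc i" if "i < N" for i using that len xs(2) sorted_wrt_nth_less[of "(<)" xs i "Suc i"] by simp
  show ?thesis
  proof (intro exI[of _ N] exI[of _ "\<lambda>i. xs ! i"] conjI allI impI ballI)
    obtain j where "j \<le> N \<and> 0 = xs ! j" using idx[OF R(3)] ..
    then have "xs ! 0 = 0" using le[of 0 j] mem[of 0] by simp
    moreover obtain k where "k \<le> N \<and> T = xs ! k" using idx[OF R(4)] ..
    then have "xs ! N = T" using le[of k N] mem[of N] by simp
    ultimately show "time_grid T N (\<lambda>i. xs ! i)" unfolding time_grid_def using less by simp
    show "x \<le> xs ! i \<or> xs ! Suc i \<le> x" if "i < N" "x \<in> P" for i x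
      using gap[OF that(1), of x] that(2) unfolding R_def by simp
    show "xs ! Suc i - xs ! i \<le> T / real m" if i: "i < N" for i
    proof -
      define s where "s = xs ! i"
      have s: "0 \<le> s" "s < T" using less[OF i] mem[of i] mem[of "Suc i"] i unfolding s_def by auto
      \<comment> \<open>\<open>j\<close> numbers the uniform cell that contains \<open>s\<close>.
        Its right end belongs to \<open>R\<close> and lies after \<open>s\<close>, so the next grid
        point is no further away.\<close>
      define j where "j = nat \<lfloor>s * real m / T\<rfloor>"
      have "0 \<le> s * real m / T" using s T by simp
      then have j: "real j \<le> s * real m / T" "s * real m / T < real j + 1" unfolding j_def by linarith+
      have "s * real m / T < real m" using s T m by (simp add: field_simps)
      then have "Suc j \<le> m" using j(1) by linarith
      then have "real (Suc j) * T / real m \<in> R" unfolding R_def by blast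
      from gap[OF i this] have "real (Suc j) * T / real m \<le> s \<or> xs ! Suc i \<le> real (Suc j) * T / real m" unfolding s_def .
      moreover have "s < real (Suc j) * T / real m" using j(2) T m by (simp add: field_simps)
      ultimately have "xs ! Suc i \<le> real (Suc j) * T / real m" by simp
      moreover have "real (Suc j) * T / real m = real j * T / real m + T / real m" by (simp add: add_divide_distrib distrib_right)
      moreover have "real j * T / real m \<le> s" using j(1) T m by (simp add: field_simps)
      ultimately show ?thesis unfolding s_def by simp
    qed
  qed
qed

context fbsde begin

text \<open>An Euler scheme started in the solution itself: its initial error is 0 although
  \<open>Y 0\<close> has not been identified yet.\<close>

primrec controlled :: "(nat \<Rightarrow> real) \<Rightarrow> (nat \<Rightarrow> 'a \<Rightarrow> real ^ 'd) \<Rightarrow> nat \<Rightarrow> 'a \<Rightarrow> (real ^ 'd) \<times> real" where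
  "controlled \<tau> zs 0 \<omega> = (x0, Y 0 \<omega>)"
| "controlled \<tau> zs (Suc i) \<omega> =
    (let x = fst (controlled \<tau> zs i \<omega>); y = snd (controlled \<tau> zs i \<omega>); z = zs i \<omega>;
       \<Delta>t = \<tau> (Suc i) - \<tau> i; \<Delta>W = W (\<tau> (Suc i)) \<omega> - W (\<tau> i) \<omega>
     in (x + \<Delta>t *\<^sub>R b (\<tau> i) x y z + \<sigma> (\<tau> i) x y *v \<Delta>W, y + F (\<tau> i) x y z * \<Delta>t + z \<bullet> \<Delta>W))"

lemma fbsde_scheme_controlled:
  assumes "time_grid T N \<tau>" and "\<And>i. i < N \<Longrightarrow> \<tau> (Suc i) - \<tau> i \<le> 1"
    and "\<And>i. i < N \<Longrightarrow> zs i \<in> borel_measurable (\<F> (\<tau> i))" "\<And>i. i < N \<Longrightarrow> sq_integrable M (zs i)"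
  shows "fbsde_scheme M W T L \<alpha> b \<sigma> F g u ut ux uxx x0 X Y Z N \<tau>
    (\<lambda>i \<omega>. fst (controlled \<tau> zs i \<omega>)) (\<lambda>i \<omega>. snd (controlled \<tau> zs i \<omega>)) zs"
proof unfold_locales
  show "(\<lambda>\<omega>. snd (controlled \<tau> zs 0 \<omega>)) \<in> borel_measurable (\<F> 0)" "sq_integrable M (\<lambda>\<omega>. snd (controlled \<tau> zs 0 \<omega>))"
    using adapted_Y[of 0] sq_Y[of 0] T0 by simp_all
qed (use assms in \<open>simp_all add: Let_def\<close>)

text \<open>For mesh \<open>h\<close> and integrated squared control error \<epsilon>,
  \<open>e\<close> bounds the forward error and \<open>B\<close> is the backward bound that results
  from it. What counts is that the whole tends to 0 with \<open>h\<close> and \<epsilon>.\<close>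

definition small_bound :: "real \<Rightarrow> real \<Rightarrow> real" where
  "small_bound h \<epsilon> = (let e = exp (CF * T) * (CF * (h * Qtot) + CF * \<epsilon>); B = KB * (2 * L\<^sup>2 * e + h powr \<alpha>) in
     B + (2 * \<epsilon> + 2 * (16 * L^4 * (h * T + (20 * L\<^sup>2 * (h * T) + 2 * CY * (h * Qtot) + 2 * (e * T)) + B))))"

lemma small_bound_tendsto: "(\<lambda>m. small_bound (T / real m) (1 / real m)) \<longlonglongrightarrow> 0"
proof -
  have h: "(\<lambda>m. T / real m) \<longlonglongrightarrow> 0" and e: "(\<lambda>m. 1 / real m) \<longlonglongrightarrow> 0"
    by (rule lim_const_over_n)+
  have p: "(\<lambda>m. (T / real m) powr \<alpha>) \<longlonglongrightarrow> 0"
    using tendsto_powr'[OF h tendsto_const[of \<alpha>]] \<alpha>(1) T by simp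
  show ?thesis
    unfolding small_bound_def Let_def by (rule tendsto_eq_intros h e p refl | simp)+
qed

end

context fbsde_scheme begin

text \<open>A chain of implications: zero initial error and good controls make the forward error
  small, hence the cost through the terminal condition, hence \<open>Dev 0\<close> and
  \<open>Zdev\<close> by the backward estimate, hence the distance of \<open>zs\<close> to
  \<open>Vc\<close>. As \<open>zs\<close> is close to \<open>Zc\<close> too, the triangle inequality
  compares \<open>Zc\<close> with \<open>Vc\<close>.\<close>

lemma identification_bound:
  assumes h: "\<And>i. i < N \<Longrightarrow> step i \<le> h" "h \<le> 1" "kB * h \<le> 1 / 2" "0 \<le> h"
    and \<epsilon>: "(\<Sum>i<N. zint i) \<le> \<epsilon>" and e0: "err 0 = 0"
  shows "expectation (\<lambda>\<omega>. (Dev 0 \<omega>)\<^sup>2) \<le> small_bound h \<epsilon>"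
    and "(\<integral>\<^sup>+r\<in>{0<..T}. msq (\<lambda>\<omega>. Zc r \<omega> - Vc r \<omega>) \<partial>lborel) \<le> ennreal (small_bound h \<epsilon>)"
proof -
  define e where "e = exp (CF * T) * (CF * (h * Qtot) + CF * \<epsilon>)"
  define B where "B = KB * (2 * L\<^sup>2 * e + h powr \<alpha>)"
  define R where "R = 16 * L^4 * (h * T + (20 * L\<^sup>2 * (h * T) + 2 * CY * (h * Qtot) + 2 * (e * T)) + B)"
  have sb: "small_bound h \<epsilon> = B + (2 * \<epsilon> + 2 * R)" unfolding small_bound_def Let_def e_def B_def R_def ..
  have \<epsilon>0: "0 \<le> \<epsilon>" using \<epsilon> sum_nonneg[of "{..<N}" zint] zint_nonneg by force
  have e: "err i \<le> e" if "i \<le> N" for i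
  proof -
    have "err i \<le> exp (CF * T) * (err 0 + (CF * (h * Qtot) + CF * (\<Sum>j<N. zint j)))" by (rule err_bound[OF h(1) that])
    also have "\<dots> \<le> e" unfolding e_def e0 using \<epsilon> CF_nonneg by (intro mult_left_mono) (auto intro: mult_left_mono)
    finally show ?thesis .
  qed
  have e_nonneg: "0 \<le> e" using e[of 0] err_nonneg[of 0] by simp
  have "cost \<le> 2 * L\<^sup>2 * e" using cost_le_err mult_left_mono[OF e[of N], of "2 * L\<^sup>2"] by simp
  then have "KB * (cost + h powr \<alpha>) \<le> B" unfolding B_def using KB_nonneg by (intro mult_left_mono add_right_mono)
  then have B: "expectation (\<lambda>\<omega>. (Dev 0 \<omega>)\<^sup>2) \<le> B" "(\<Sum>i<N. step i * ez i) \<le> B"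
    using backward_bound[OF h] by simp_all
  have B0: "0 \<le> B" unfolding B_def using e_nonneg KB_nonneg by simp
  have R0: "0 \<le> R" unfolding R_def using h(4) T e_nonneg B0 CY_pos Qtot_nonneg by simp
  show "expectation (\<lambda>\<omega>. (Dev 0 \<omega>)\<^sup>2) \<le> small_bound h \<epsilon>" unfolding sb using B(1) \<epsilon>0 R0 by simp
  let ?I = "\<lambda>H i. \<integral>\<^sup>+r\<in>{\<tau> i<..\<tau> (Suc i)}. msq (H i r) \<partial>lborel"
  have "(\<Sum>i<N. ?I (\<lambda>i r \<omega>. Vc r \<omega> - zs i \<omega>) i) \<le>
      ennreal (16 * L^4 * (h * T + (20 * L\<^sup>2 * (h * T) + 2 * CY * (h * Qtot) + 2 * (e * T)) + (\<Sum>i<N. step i * ez i)))"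
    by (rule int_V_sum_le[OF h(1) e])
  also have "\<dots> \<le> ennreal R" unfolding R_def using B(2) by (intro ennreal_leI mult_left_mono add_left_mono) auto
  finally have V: "(\<Sum>i<N. ?I (\<lambda>i r \<omega>. Vc r \<omega> - zs i \<omega>) i) \<le> ennreal R" .
  have Z: "(\<Sum>i<N. ?I (\<lambda>i r \<omega>. Zc r \<omega> - zs i \<omega>) i) \<le> ennreal \<epsilon>"
    using \<epsilon> zint_nonneg by (simp add: zint_eq sum_ennreal ennreal_leI)
  have "(\<integral>\<^sup>+r\<in>{0<..T}. msq (\<lambda>\<omega>. Zc r \<omega> - Vc r \<omega>) \<partial>lborel) = (\<Sum>i<N. ?I (\<lambda>i r \<omega>. Zc r \<omega> - Vc r \<omega>) i)"
    by (intro int_split_grid jointly_measurable_diff joint_Z joint_V)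
  also have "\<dots> \<le> (\<Sum>i<N. 2 * ?I (\<lambda>i r \<omega>. Zc r \<omega> - zs i \<omega>) i + 2 * ?I (\<lambda>i r \<omega>. Vc r \<omega> - zs i \<omega>) i)"
  proof (rule sum_mono)
    fix i assume "i \<in> {..<N}"
    then have i: "i < N" by simp
    have j: "jointly_measurable (\<lambda>r \<omega>. Vc r \<omega> - zs i \<omega>)"
      by (intro jointly_measurable_diff joint_V jointly_measurable_const_time sq_integrable_measurable zs i)
    have eq: "Zc r \<omega> - Vc r \<omega> = (Zc r \<omega> - zs i \<omega>) - (Vc r \<omega> - zs i \<omega>)" for r \<omega> by simp
    show "?I (\<lambda>i r \<omega>. Zc r \<omega> - Vc r \<omega>) i \<le> 2 * ?I (\<lambda>i r \<omega>. Zc r \<omega> - zs i \<omega>) i + 2 * ?I (\<lambda>i r \<omega>. Vc r \<omega> - zs i \<omega>) i"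
      unfolding eq by (rule int_msq_diff_le[OF joint_Z_dev[OF i] j]) simp
  qed
  also have "\<dots> = 2 * (\<Sum>i<N. ?I (\<lambda>i r \<omega>. Zc r \<omega> - zs i \<omega>) i) + 2 * (\<Sum>i<N. ?I (\<lambda>i r \<omega>. Vc r \<omega> - zs i \<omega>) i)"
    by (simp add: sum.distrib sum_distrib_left)
  also have "\<dots> \<le> 2 * ennreal \<epsilon> + 2 * ennreal R" by (intro add_mono mult_left_mono V Z) simp_all
  also have "\<dots> = ennreal (2 * \<epsilon> + 2 * R)" using \<epsilon>0 R0 by (simp add: numeral_ennreal_mult ennreal_plus)
  also have "\<dots> \<le> ennreal (small_bound h \<epsilon>)" unfolding sb using B0 by (intro ennreal_leI) simp
  finally show "(\<integral>\<^sup>+r\<in>{0<..T}. msq (\<lambda>\<omega>. Zc r \<omega> - Vc r \<omega>) \<partial>lborel) \<le> ennreal (small_bound h \<epsilon>)" .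
qed

end

context fbsde begin

lemma identification_approx:
  assumes m: "0 < m" "T / real m \<le> 1" "kB * (T / real m) \<le> 1 / 2"
  shows "msq (\<lambda>\<omega>. Y 0 \<omega> - u 0 x0) \<le> ennreal (small_bound (T / real m) (1 / real m))"
    and "(\<integral>\<^sup>+r\<in>{0<..T}. msq (\<lambda>\<omega>. Zc r \<omega> - Vc r \<omega>) \<partial>lborel) \<le> ennreal (small_bound (T / real m) (1 / real m))"
proof -
  \<comment> \<open>The integral of \<open>Zc\<close> over the whole interval provides the step
    processes that approximate \<open>Zc\<close> in mean square.\<close>
  obtain J where J: "ito_increment 0 T Zc J" using Y_increment[of 0 T] T by auto
  obtain n p q \<xi> where A: "step_approx 0 T Zc J n p q \<xi>" using J unfolding ito_increment_def by blast
  have "\<exists>k. (\<integral>\<^sup>+r\<in>{0<..T}. msq (\<lambda>\<omega>. Zc r \<omega> - step_process {..<n k} (p k) (q k) (\<xi> k) r \<omega>) \<partial>lborel) < ennreal (1 / real m)"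
  proof -
    have "\<forall>\<^sub>F k in sequentially. (\<integral>\<^sup>+r\<in>{0<..T}. msq (\<lambda>\<omega>. Zc r \<omega> - step_process {..<n k} (p k) (q k) (\<xi> k) r \<omega>) \<partial>lborel) < ennreal (1 / real m)"
      using m(1) by (intro order_tendstoD(2)[OF step_approxD(5)[OF A]]) simp
    then show ?thesis using eventually_happens'[OF sequentially_bot] by blast
  qed
  then obtain k where k: "(\<integral>\<^sup>+r\<in>{0<..T}. msq (\<lambda>\<omega>. Zc r \<omega> - step_process {..<n k} (p k) (q k) (\<xi> k) r \<omega>) \<partial>lborel) < ennreal (1 / real m)" ..
  let ?A = "{..<n k}"
  let ?S = "step_process ?A (p k) (q k) (\<xi> k)"
  have F: "step_family ?A (p k) (q k) (\<xi> k)" by (rule step_approxD(2)[OF A])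
  define P where "P = p k ` {i\<in>?A. p k i \<in> {0..T}} \<union> q k ` {i\<in>?A. q k i \<in> {0..T}}"
  have P: "finite P" "P \<subseteq> {0..T}" unfolding P_def by auto
  obtain N \<tau> where G: "time_grid T N \<tau>" "\<forall>i<N. \<tau> (Suc i) - \<tau> i \<le> T / real m" "\<forall>i<N. \<forall>x\<in>P. x \<le> \<tau> i \<or> \<tau> (Suc i) \<le> x"
    using time_grid_refining[OF T m(1) P] by blast
  have less: "\<tau> i < \<tau> (Suc i)" if "i < N" for i using G(1) that unfolding time_grid_def by blast
  have mem: "\<tau> i \<in> {0..T}" if "i \<le> N" for i by (rule time_grid_mem[OF G(1) that])
  \<comment> \<open>The value at the right end of the cell, since the intervals are left-open and
    right-closed. It is nevertheless known at \<open>\<tau> i\<close>: no left endpoint lies inside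
    the cell, so an interval containing \<open>\<tau> (Suc i)\<close> starts at
    \<open>\<tau> i\<close> or earlier.\<close>
  define zs where "zs i = ?S (\<tau> (Suc i))" for i
  have sep: "indicator {p k j<..q k j} r = (indicator {p k j<..q k j} (\<tau> (Suc i)) :: real)"
      "p k j \<le> \<tau> i \<or> indicator {p k j<..q k j} (\<tau> (Suc i)) = (0 :: real)"
    if i: "i < N" and r: "r \<in> {\<tau> i<..\<tau> (Suc i)}" and j: "j \<in> ?A" for i j r
  proof -
    have pq: "0 \<le> p k j" "p k j \<le> q k j" "q k j \<le> T" using F j step_approxD(4)[OF A, of j k] by (auto simp: step_family_def)
    then have "p k j \<in> P" "q k j \<in> P" unfolding P_def using j by auto
    then have "p k j \<le> \<tau> i \<or> \<tau> (Suc i) \<le> p k j" "q k j \<le> \<tau> i \<or> \<tau> (Suc i) \<le> q k j" using G(3) i by auto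
    then show "indicator {p k j<..q k j} r = (indicator {p k j<..q k j} (\<tau> (Suc i)) :: real)"
      "p k j \<le> \<tau> i \<or> indicator {p k j<..q k j} (\<tau> (Suc i)) = (0 :: real)"
      using r less[OF i] by (auto simp: indicator_def)
  qed
  have zs: "zs i \<in> borel_measurable (\<F> (\<tau> i))" "sq_integrable M (zs i)" if i: "i < N" for i
  proof -
    have "(\<lambda>\<omega>. indicator {p k j<..q k j} (\<tau> (Suc i)) *\<^sub>R \<xi> k j \<omega>) \<in> borel_measurable (\<F> (\<tau> i))" if j: "j \<in> ?A" for j
    proof (cases "p k j \<le> \<tau> i")
      case True
      have "\<xi> k j \<in> borel_measurable (\<F> (p k j))" using F j by (simp add: step_family_def)
      then have "\<xi> k j \<in> borel_measurable (\<F> (\<tau> i))" using True by (rule measurable_aug_filtration_mono)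
      then show ?thesis by simp
    next
      case False
      then show ?thesis using sep(2)[OF i _ j, of "\<tau> (Suc i)"] less[OF i] by simp
    qed
    then show "zs i \<in> borel_measurable (\<F> (\<tau> i))"
      unfolding zs_def step_process_def[abs_def] by (intro borel_measurable_sum)
    show "sq_integrable M (zs i)" unfolding zs_def by (rule sq_integrable_step_process[OF F])
  qed
  have zs_eq: "?S r = zs i" if "i < N" "r \<in> {\<tau> i<..\<tau> (Suc i)}" for i r
    unfolding zs_def step_process_def[abs_def] using sep(1)[OF that] by simp
  have h1: "\<tau> (Suc i) - \<tau> i \<le> 1" if "i < N" for i using G(2) m(2) that by force
  interpret S: fbsde_scheme M W T L \<alpha> b \<sigma> F g u ut ux uxx x0 X Y Z N \<tau>
    "\<lambda>i \<omega>. fst (controlled \<tau> zs i \<omega>)" "\<lambda>i \<omega>. snd (controlled \<tau> zs i \<omega>)" zs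
    by (rule fbsde_scheme_controlled[OF G(1) h1 zs])
  have e0: "S.err 0 = 0"
  proof -
    have "msq (\<lambda>\<omega>. X (\<tau> 0) \<omega> - fst (controlled \<tau> zs 0 \<omega>)) = msq (\<lambda>\<omega>. 0 :: real)"
      using X_0 by (intro nn_integral_cong_AE) (auto simp: S.grid_0)
    then have "ennreal (S.err 0) = 0" using S.err_eq[of 0] by (simp add: S.grid_0)
    then show ?thesis using S.err_nonneg[of 0] by (simp add: ennreal_eq_0_iff)
  qed
  have eps: "(\<Sum>i<N. S.zint i) \<le> 1 / real m"
  proof -
    have "ennreal (\<Sum>i<N. S.zint i) = (\<Sum>i<N. ennreal (S.zint i))" by (rule sum_ennreal[symmetric]) (rule S.zint_nonneg)
    also have "\<dots> = (\<Sum>i<N. \<integral>\<^sup>+r\<in>{\<tau> i<..\<tau> (Suc i)}. msq (\<lambda>\<omega>. Zc r \<omega> - zs i \<omega>) \<partial>lborel)"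
      by (intro sum.cong) (auto simp: S.zint_eq)
    also have "\<dots> = (\<Sum>i<N. \<integral>\<^sup>+r\<in>{\<tau> i<..\<tau> (Suc i)}. msq (\<lambda>\<omega>. Zc r \<omega> - ?S r \<omega>) \<partial>lborel)"
      by (intro sum.cong nn_integral_cong refl) (auto simp: zs_eq indicator_def)
    also have "\<dots> = (\<integral>\<^sup>+r\<in>{0<..T}. msq (\<lambda>\<omega>. Zc r \<omega> - ?S r \<omega>) \<partial>lborel)"
      by (intro S.int_split_grid[symmetric] jointly_measurable_diff joint_Z jointly_measurable_step_process F)
    finally have "ennreal (\<Sum>i<N. S.zint i) \<le> ennreal (1 / real m)" using k by simp
    then show ?thesis by (simp add: ennreal_le_iff)
  qed
  have st: "S.step i \<le> T / real m" if "i < N" for i using G(2) that unfolding S.step_def by blast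
  have hm: "0 \<le> T / real m" using T by simp
  note id = S.identification_bound[OF st m(2,3) hm eps e0]
  show "(\<integral>\<^sup>+r\<in>{0<..T}. msq (\<lambda>\<omega>. Zc r \<omega> - Vc r \<omega>) \<partial>lborel) \<le> ennreal (small_bound (T / real m) (1 / real m))"
    by (rule id(2))
  have "msq (\<lambda>\<omega>. Y 0 \<omega> - u 0 x0) = msq (S.Dev 0)" unfolding S.Dev_def[abs_def] S.grid_0 by simp
  also have "\<dots> = ennreal (expectation (\<lambda>\<omega>. (S.Dev 0 \<omega>)\<^sup>2))"
    using nn_integral_sq_integrable[OF S.Dev_sq[of 0]] by simp
  also have "\<dots> \<le> ennreal (small_bound (T / real m) (1 / real m))" by (rule ennreal_leI[OF id(1)])
  finally show "msq (\<lambda>\<omega>. Y 0 \<omega> - u 0 x0) \<le> ennreal (small_bound (T / real m) (1 / real m))" .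
qed

text \<open>The bounded quantities do not depend on \<open>m\<close>, the bound tends to 0, and the
  conditions on the step hold for all large \<open>m\<close>.\<close>

lemma
  shows Y_0: "AE \<omega> in M. Y 0 \<omega> = u 0 x0"
    and Z_eq_V: "(\<integral>\<^sup>+r\<in>{0<..T}. msq (\<lambda>\<omega>. Zc r \<omega> - Vc r \<omega>) \<partial>lborel) = 0"
proof -
  have "(\<lambda>m. kB * (T / real m)) \<longlonglongrightarrow> kB * 0" by (intro tendsto_intros lim_const_over_n)
  then have "\<forall>\<^sub>F m in sequentially. kB * (T / real m) < 1 / 2" by (intro order_tendstoD(2)) auto
  moreover have "\<forall>\<^sub>F m in sequentially. T / real m < 1" by (intro order_tendstoD(2)[OF lim_const_over_n]) simp
  moreover have "\<forall>\<^sub>F m in sequentially. 0 < m" by (rule eventually_gt_at_top)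
  ultimately have ev: "\<forall>\<^sub>F m in sequentially. 0 < m \<and> T / real m \<le> 1 \<and> kB * (T / real m) \<le> 1 / 2"
    by eventually_elim auto
  have lim: "(\<lambda>m. ennreal (small_bound (T / real m) (1 / real m))) \<longlonglongrightarrow> ennreal 0"
    by (rule tendsto_ennrealI[OF small_bound_tendsto])
  have "msq (\<lambda>\<omega>. Y 0 \<omega> - u 0 x0) \<le> ennreal 0"
    by (rule tendsto_le[OF sequentially_bot lim tendsto_const])
      (rule eventually_mono[OF ev], elim conjE, rule identification_approx)
  then have "msq (\<lambda>\<omega>. Y 0 \<omega> - u 0 x0) = 0" by simp
  moreover have "(\<lambda>\<omega>. Y 0 \<omega> - u 0 x0) \<in> borel_measurable M"
    using sq_integrable_measurable[OF sq_Y[of 0]] T0 by simp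
  ultimately have "AE \<omega> in M. Y 0 \<omega> - u 0 x0 = 0" using msq_eq_0D by blast
  then show "AE \<omega> in M. Y 0 \<omega> = u 0 x0" by simp
  have "(\<integral>\<^sup>+r\<in>{0<..T}. msq (\<lambda>\<omega>. Zc r \<omega> - Vc r \<omega>) \<partial>lborel) \<le> ennreal 0"
    by (rule tendsto_le[OF sequentially_bot lim tendsto_const])
      (rule eventually_mono[OF ev], elim conjE, rule identification_approx)
  then show "(\<integral>\<^sup>+r\<in>{0<..T}. msq (\<lambda>\<omega>. Zc r \<omega> - Vc r \<omega>) \<partial>lborel) = 0" by simp
qed

end

subsection \<open>The error of the scheme\<close>

context
  fixes T N \<tau> assumes grid: "time_grid T N \<tau>"
begin

lemma grid_index_eq:
  assumes i: "i < N" and t: "\<tau> i \<le> t" "t < \<tau> (Suc i)" shows "grid_index N \<tau> t = i"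
  unfolding grid_index_def
proof (rule Max_eqI)
  fix j assume "j \<in> {j. j \<le> N \<and> \<tau> j \<le> t}"
  then have j: "j \<le> N" "\<tau> j \<le> t" by auto
  show "j \<le> i"
  proof (rule ccontr)
    assume "\<not> j \<le> i"
    then have "\<tau> (Suc i) \<le> \<tau> j" using time_grid_mono[OF grid, of "Suc i" j] j(1) by simp
    then show False using t(2) j(2) by simp
  qed
qed (use i t in auto)

lemma grid_index_T: "grid_index N \<tau> T = N"
  unfolding grid_index_def using grid by (intro Max_eqI) (auto simp: time_grid_def)

lemma grid_interval:
  assumes t: "0 \<le> t" "t < T" shows "\<exists>i<N. \<tau> i \<le> t \<and> t < \<tau> (Suc i)"
proof -
  let ?A = "{i. i \<le> N \<and> \<tau> i \<le> t}"
  have A: "finite ?A" "0 \<in> ?A" using t grid by (auto simp: time_grid_def)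
  define i where "i = Max ?A"
  have "i \<in> ?A" unfolding i_def using A by (intro Max_in) auto
  then have i: "i \<le> N" "\<tau> i \<le> t" by auto
  have "i \<noteq> N" using i(2) t grid by (auto simp: time_grid_def)
  then have iN: "i < N" using i(1) by simp
  have "Suc i \<notin> ?A" using Max_ge[OF A(1), of "Suc i", folded i_def] by linarith
  then show ?thesis using iN i by (intro exI[of _ i]) auto
qed

end

context fbsde begin

text \<open>With \<open>Z\<close> identified, \<open>zint\<close> is bounded by the step length,
  \<open>near\<close> and \<open>ez\<close>. Inserted into \<open>forward_step\<close>, the part of
  \<open>near\<close> with \<open>err i\<close> goes into \<open>CG\<close>, the parts with the step
  and \<open>q\<close> into \<open>CA\<close>. \<open>KE\<close>, \<open>KS\<close> and
  \<open>KK\<close> are the factors of \<open>rate\<close> for \<open>err\<close>, for the weighted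
  sum of \<open>near\<close>, and for the whole error.\<close>

definition CG :: real where "CG = CF * (1 + 64 * L^4)"
definition CA :: real where "CA = CF * (1 + 32 * L^4 * (1 + 20 * L\<^sup>2 + 2 * CY))"
definition KE :: real where "KE = exp (CG * T) * (KB + CA * Qtot + CF * (32 * L^4) * KB)"
definition KS :: real where "KS = 20 * L\<^sup>2 * T + 2 * CY * Qtot + 2 * (KE * T)"
definition KK :: real where "KK = 20 * L\<^sup>2 + 2 * KE + KE + (KS + 32 * L^4 * (T + KS + KB))"

lemma CG_nonneg: "0 \<le> CG" and CA_nonneg: "0 \<le> CA" unfolding CG_def CA_def using CF_nonneg CY_pos by simp_all
lemma KE_nonneg: "0 \<le> KE" unfolding KE_def using CA_nonneg CF_nonneg KB_nonneg Qtot_nonneg by simp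
lemma KS_nonneg: "0 \<le> KS" unfolding KS_def using KE_nonneg CY_pos Qtot_nonneg T by simp
lemma KK_nonneg: "0 \<le> KK" unfolding KK_def using KE_nonneg KS_nonneg KB_nonneg T by simp

end

context fbsde_scheme begin

text \<open>Because \<open>Zc\<close> and \<open>Vc\<close> have distance 0, the control is as far
  from \<open>Z\<close> as from \<open>Vc\<close>, which \<open>int_V_le\<close> bounds; the
  triangle inequality for squares doubles its constant.\<close>

lemma zint_le:
  assumes i: "i < N" shows "zint i \<le> 32 * L^4 * ((step i + near i + ez i) * step i)"
proof -
  let ?A = "{\<tau> i<..\<tau> (Suc i)}"
  have nn: "0 \<le> 16 * L^4 * ((step i + near i + ez i) * step i)"
    using step_pos[OF i] near_nonneg[OF i] ez_nonneg[of i] by (intro mult_nonneg_nonneg add_nonneg_nonneg) auto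
  have jv: "jointly_measurable (\<lambda>r \<omega>. Vc r \<omega> - zs i \<omega>)"
    by (intro jointly_measurable_diff joint_V jointly_measurable_const_time sq_integrable_measurable zs i)
  have jz: "jointly_measurable (\<lambda>r \<omega>. Zc r \<omega> - Vc r \<omega>)" by (intro jointly_measurable_diff joint_Z joint_V)
  have "?A \<subseteq> {0<..T}" using grid_mem[of i] grid_mem[of "Suc i"] i by auto
  then have "(\<integral>\<^sup>+r\<in>?A. msq (\<lambda>\<omega>. Zc r \<omega> - Vc r \<omega>) \<partial>lborel) \<le> (\<integral>\<^sup>+r\<in>{0<..T}. msq (\<lambda>\<omega>. Zc r \<omega> - Vc r \<omega>) \<partial>lborel)"
    by (rule nn_set_integral_set_mono)
  then have Z0: "(\<integral>\<^sup>+r\<in>?A. msq (\<lambda>\<omega>. Zc r \<omega> - Vc r \<omega>) \<partial>lborel) = 0" unfolding Z_eq_V by simp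
  have eq: "Zc r \<omega> - zs i \<omega> = (Zc r \<omega> - Vc r \<omega>) + (Vc r \<omega> - zs i \<omega>)" for r \<omega> by simp
  have "ennreal (zint i) = (\<integral>\<^sup>+r\<in>?A. msq (\<lambda>\<omega>. (Zc r \<omega> - Vc r \<omega>) + (Vc r \<omega> - zs i \<omega>)) \<partial>lborel)"
    unfolding zint_eq[OF i, symmetric] eq[symmetric] ..
  also have "\<dots> \<le> 2 * (\<integral>\<^sup>+r\<in>?A. msq (\<lambda>\<omega>. Zc r \<omega> - Vc r \<omega>) \<partial>lborel) + 2 * (\<integral>\<^sup>+r\<in>?A. msq (\<lambda>\<omega>. Vc r \<omega> - zs i \<omega>) \<partial>lborel)"
    by (rule int_msq_add_le[OF jz jv]) simp
  also have "\<dots> \<le> 2 * ennreal (16 * L^4 * ((step i + near i + ez i) * step i))"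
    unfolding Z0 ez_def using int_V_le[OF i] by (simp add: mult_left_mono)
  also have "\<dots> = ennreal (32 * L^4 * ((step i + near i + ez i) * step i))"
    using nn by (simp add: numeral_ennreal_mult)
  finally show ?thesis using nn by (subst (asm) ennreal_le_iff) simp_all
qed

text \<open>\<open>zint\<close> contains \<open>err i\<close> through \<open>near\<close>. Moving
  this part into the growth factor closes the recursion, with only \<open>q\<close> and
  \<open>ez\<close> left as sources, and the backward estimate sums up \<open>ez\<close>.\<close>

lemma forward_step_PDE:
  assumes i: "i < N"
  shows "err (Suc i) \<le> (1 + CG * step i) * err i + (CA * (step i * q i) + CF * (32 * L^4) * (step i * ez i))"
proof -
  have s: "0 < step i" "step i \<le> q i" using step_pos[OF i] step_le_q[OF i] by auto
  have "CF * zint i \<le> CF * (32 * L^4 * ((step i + near i + ez i) * step i))"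
    by (intro mult_left_mono zint_le[OF i] CF_nonneg)
  also have "(step i + near i + ez i) * step i = (1 + 20 * L\<^sup>2) * (step i * step i) + 2 * CY * (step i * q i) + 2 * (step i * err i) + step i * ez i"
    unfolding near_def by (simp add: algebra_simps)
  also have "CF * (32 * L^4 * \<dots>) \<le> CF * (32 * L^4 * ((1 + 20 * L\<^sup>2) * (step i * q i) + 2 * CY * (step i * q i) + 2 * (step i * err i) + step i * ez i))"
    using s CF_nonneg by (intro mult_left_mono add_right_mono) auto
  finally have "err (Suc i) \<le> (1 + CF * step i) * err i + (CF * (step i * q i) +
      CF * (32 * L^4 * ((1 + 20 * L\<^sup>2) * (step i * q i) + 2 * CY * (step i * q i) + 2 * (step i * err i) + step i * ez i)))"
    using forward_step[OF i] by linarith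
  also have "\<dots> = (1 + CG * step i) * err i + (CA * (step i * q i) + CF * (32 * L^4) * (step i * ez i))"
    unfolding CG_def CA_def by (simp add: algebra_simps)
  finally show ?thesis .
qed

context
  fixes h :: real
  assumes h: "\<And>i. i < N \<Longrightarrow> step i \<le> h" "h \<le> 1" "kB * h \<le> 1 / 2" "0 \<le> h"
    and xs_start: "xs 0 = (\<lambda>_. x0)"
begin

definition rate :: real where "rate = cost + h + h powr \<alpha>"

lemma rate_ge: "0 \<le> rate" "h \<le> rate" "cost + h powr \<alpha> \<le> rate"
  unfolding rate_def using cost_nonneg h(4) by auto

text \<open>The identification of \<open>Y 0\<close> turns the initial error into
  \<open>Dev 0\<close>, which the backward estimate bounds.\<close>

lemma err_start: "err 0 = expectation (\<lambda>\<omega>. (Dev 0 \<omega>)\<^sup>2)"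
proof -
  have "msq (\<lambda>\<omega>. X (\<tau> 0) \<omega> - xs 0 \<omega>) = msq (\<lambda>_. 0 :: real)"
    unfolding grid_0 xs_start using X_0 by (intro nn_integral_cong_AE) auto
  moreover have "msq (\<lambda>\<omega>. Y (\<tau> 0) \<omega> - ys 0 \<omega>) = msq (Dev 0)"
    unfolding grid_0 Dev_def xs_start using Y_0 by (intro nn_integral_cong_AE) (auto simp: abs_minus_commute)
  ultimately have "ennreal (err 0) = ennreal (expectation (\<lambda>\<omega>. (Dev 0 \<omega>)\<^sup>2))"
    using err_eq[of 0] nn_integral_sq_integrable[OF Dev_sq[of 0]] by simp
  then show ?thesis using err_nonneg[of 0] by (simp add: ennreal_inj)
qed

lemma err_le:
  assumes i: "i \<le> N" shows "err i \<le> KE * rate"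
proof -
  let ?k = "\<lambda>j. CA * (step j * q j) + CF * (32 * L^4) * (step j * ez j)"
  have k0: "0 \<le> ?k j" if "j < N" for j
    using step_pos[OF that] q_nonneg[of j] ez_nonneg[of j] CF_nonneg CA_nonneg by auto
  have S: "0 \<le> (\<Sum>j<i. ?k j)" using k0 i by (intro sum_nonneg) auto
  note bb = backward_bound[OF h]
  have rB: "KB * (cost + h powr \<alpha>) \<le> KB * rate" by (intro mult_left_mono rate_ge KB_nonneg)
  have "err i \<le> exp (CG * \<tau> i) * (err 0 + (\<Sum>j<i. ?k j))"
    using forward_step_PDE by (intro forward_gronwall[OF grid CG_nonneg err_nonneg k0 _ i]) (auto simp: step_def)
  also have "\<dots> \<le> exp (CG * T) * (err 0 + (\<Sum>j<N. ?k j))"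
    using grid_mem[OF i] CG_nonneg err_nonneg[of 0] S i k0
    by (intro mult_mono add_left_mono sum_mono2) (auto intro!: mult_left_mono)
  also have "(\<Sum>j<N. ?k j) = CA * (\<Sum>j<N. step j * q j) + CF * (32 * L^4) * (\<Sum>j<N. step j * ez j)"
    by (simp add: sum.distrib sum_distrib_left)
  also have "exp (CG * T) * (err 0 + (CA * (\<Sum>j<N. step j * q j) + CF * (32 * L^4) * (\<Sum>j<N. step j * ez j))) \<le>
      exp (CG * T) * (KB * rate + (CA * (rate * Qtot) + CF * (32 * L^4) * (KB * rate)))"
  proof (intro mult_left_mono add_mono)
    show "err 0 \<le> KB * rate" unfolding err_start using bb(1) rB by linarith
    have "(\<Sum>j<N. step j * q j) \<le> h * Qtot" by (rule sum_step_q[OF h(1)])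
    also have "\<dots> \<le> rate * Qtot" by (intro mult_right_mono rate_ge Qtot_nonneg)
    finally show "(\<Sum>j<N. step j * q j) \<le> rate * Qtot" .
    show "(\<Sum>j<N. step j * ez j) \<le> KB * rate" using bb(2) rB by linarith
  qed (use CF_nonneg CA_nonneg in auto)
  also have "\<dots> = KE * rate" unfolding KE_def by (simp add: algebra_simps)
  finally show ?thesis .
qed

lemma sum_near_le: "(\<Sum>i<N. near i * step i) \<le> KS * rate"
proof -
  have "(\<Sum>i<N. near i * step i) \<le> 20 * L\<^sup>2 * (h * T) + 2 * CY * (h * Qtot) + 2 * ((KE * rate) * T)"
    by (rule sum_near[OF h(1) err_le])
  also have "\<dots> \<le> 20 * L\<^sup>2 * (rate * T) + 2 * CY * (rate * Qtot) + 2 * ((KE * rate) * T)"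
    using rate_ge T Qtot_nonneg CY_pos by (intro add_mono mult_left_mono mult_right_mono) auto
  also have "\<dots> = KS * rate" unfolding KS_def by (simp add: algebra_simps)
  finally show ?thesis .
qed

lemma sum_zint_le: "(\<Sum>i<N. zint i) \<le> 32 * L^4 * (T + KS + KB) * rate"
proof -
  have "(\<Sum>i<N. zint i) \<le> (\<Sum>i<N. 32 * L^4 * ((step i + near i + ez i) * step i))"
    by (intro sum_mono zint_le) simp
  also have "\<dots> = 32 * L^4 * ((\<Sum>i<N. step i * step i) + (\<Sum>i<N. near i * step i) + (\<Sum>i<N. step i * ez i))"
    unfolding sum_distrib_left sum.distrib[symmetric] by (simp add: algebra_simps)
  also have "\<dots> \<le> 32 * L^4 * (rate * T + KS * rate + KB * rate)"
  proof (intro mult_left_mono add_mono sum_near_le)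
    have "(\<Sum>i<N. step i * step i) \<le> h * T" by (rule sum_step_sq[OF h(1)])
    also have "\<dots> \<le> rate * T" using rate_ge T by (intro mult_right_mono) auto
    finally show "(\<Sum>i<N. step i * step i) \<le> rate * T" .
    have "KB * (cost + h powr \<alpha>) \<le> KB * rate" by (intro mult_left_mono rate_ge KB_nonneg)
    then show "(\<Sum>i<N. step i * ez i) \<le> KB * rate" using backward_bound(2)[OF h] by linarith
  qed simp
  also have "\<dots> = 32 * L^4 * (T + KS + KB) * rate" by (simp add: algebra_simps)
  finally show ?thesis .
qed

lemma sup_error:
  assumes t: "t \<in> {0..T}"
  shows "msq (\<lambda>\<omega>. X t \<omega> - xs (grid_index N \<tau> t) \<omega>) \<le> ennreal ((20 * L\<^sup>2 + 2 * KE) * rate)"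
proof (cases "t < T")
  case True
  then obtain i where i: "i < N" "\<tau> i \<le> t" "t < \<tau> (Suc i)" using grid_interval[OF grid, of t] t by auto
  have "msq (\<lambda>\<omega>. X t \<omega> - xs (grid_index N \<tau> t) \<omega>) = msq (\<lambda>\<omega>. Xc t \<omega> - xs i \<omega>)"
    unfolding grid_index_eq[OF grid i] Xc_eq[OF t] ..
  also have "\<dots> \<le> ennreal (20 * L\<^sup>2 * step i + 2 * err i)" using i by (intro near_bound_X) auto
  also have "\<dots> \<le> ennreal (20 * L\<^sup>2 * rate + 2 * (KE * rate))"
    using h(1)[OF i(1)] rate_ge(2) err_le[of i] i(1) by (intro ennreal_leI add_mono mult_left_mono) auto
  finally show ?thesis by (simp add: algebra_simps)
next
  case False
  then have tT: "t = T" using t by simp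
  have "msq (\<lambda>\<omega>. X t \<omega> - xs (grid_index N \<tau> t) \<omega>) \<le> ennreal (err N)"
    unfolding tT grid_index_T[OF grid] err_eq[OF order_refl, symmetric] grid_N by simp
  also have "\<dots> \<le> ennreal ((20 * L\<^sup>2 + 2 * KE) * rate)"
  proof (rule ennreal_leI)
    have "KE * rate \<le> (20 * L\<^sup>2 + 2 * KE) * rate" using rate_ge KE_nonneg by (intro mult_right_mono) auto
    then show "err N \<le> (20 * L\<^sup>2 + 2 * KE) * rate" using err_le[of N] by simp
  qed
  finally show ?thesis .
qed

lemma max_error:
  assumes "i \<le> N" shows "msq (\<lambda>\<omega>. Y (\<tau> i) \<omega> - ys i \<omega>) \<le> ennreal (KE * rate)"
proof -
  have "msq (\<lambda>\<omega>. Y (\<tau> i) \<omega> - ys i \<omega>) \<le> ennreal (err i)"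
    unfolding err_eq[OF assms, symmetric] by simp
  then show ?thesis using ennreal_leI[OF err_le[OF assms]] by simp
qed

lemma int_error:
  "(\<integral>\<^sup>+\<omega>. (\<integral>\<^sup>+t\<in>{0..T}. ennreal (\<bar>Y t \<omega> - ys (grid_index N \<tau> t) \<omega>\<bar>\<^sup>2 + (norm (Z t \<omega> - zs (grid_index N \<tau> t) \<omega>))\<^sup>2) \<partial>lborel) \<partial>M)
    \<le> ennreal ((KS + 32 * L^4 * (T + KS + KB)) * rate)"
proof -
  let ?A = "\<lambda>i. {\<tau> i<..\<tau> (Suc i)}"
  have jy: "jointly_measurable (\<lambda>r \<omega>. Yc r \<omega> - ys i \<omega>)" if "i < N" for i
    using that by (intro jointly_measurable_diff joint_Y jointly_measurable_const_time sq_integrable_measurable ys_sq) simp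
  have ns: "0 \<le> near i * step i" if "i < N" for i
    using near_nonneg[OF that] step_pos[OF that] by simp
  let ?fY = "\<lambda>i \<omega> r. ennreal ((norm (Yc r \<omega> - ys i \<omega>))\<^sup>2)" and ?fZ = "\<lambda>i \<omega> r. ennreal ((norm (Zc r \<omega> - zs i \<omega>))\<^sup>2)"
  \<comment> \<open>\<open>grid_index\<close> is constant on left-closed cells whereas the estimates
    use left-open ones; the two differ at grid points only, which form a null set.\<close>
  have ae: "AE t in lborel. t \<notin> \<tau> ` {..N}"
    by (intro AE_not_in finite_imp_null_set_lborel) simp
  have m: "?fY i \<omega> \<in> borel_measurable lborel" "?fZ i \<omega> \<in> borel_measurable lborel" if "\<omega> \<in> space M" "i < N" for i \<omega>
  proof -
    have "(\<lambda>r. Yc r \<omega> - ys i \<omega>) \<in> borel_measurable lborel" "(\<lambda>r. Zc r \<omega> - zs i \<omega>) \<in> borel_measurable lborel"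
      using measurable_Pair1[OF jy[OF that(2), unfolded jointly_measurable_def] that(1)]
        measurable_Pair1[OF joint_Z_dev[OF that(2), unfolded jointly_measurable_def] that(1)] by simp_all
    then show "?fY i \<omega> \<in> borel_measurable lborel" "?fZ i \<omega> \<in> borel_measurable lborel" by measurable
  qed
  have mm: "(\<lambda>\<omega>. \<integral>\<^sup>+r\<in>?A i. ?fY i \<omega> r \<partial>lborel) \<in> borel_measurable M" "(\<lambda>\<omega>. \<integral>\<^sup>+r\<in>?A i. ?fZ i \<omega> r \<partial>lborel) \<in> borel_measurable M" if "i < N" for i
  proof -
    have [measurable]: "(\<lambda>p. Yc (fst p) (snd p) - ys i (snd p)) \<in> borel_measurable (lborel \<Otimes>\<^sub>M M)"
      "(\<lambda>p. Zc (fst p) (snd p) - zs i (snd p)) \<in> borel_measurable (lborel \<Otimes>\<^sub>M M)"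
      using jy[OF that] joint_Z_dev[OF that] unfolding jointly_measurable_def case_prod_beta' by simp_all
    have "(\<lambda>p. ennreal ((norm (Yc (fst p) (snd p) - ys i (snd p)))\<^sup>2) * indicator (?A i) (fst p)) \<in> borel_measurable (lborel \<Otimes>\<^sub>M M)"
      "(\<lambda>p. ennreal ((norm (Zc (fst p) (snd p) - zs i (snd p)))\<^sup>2) * indicator (?A i) (fst p)) \<in> borel_measurable (lborel \<Otimes>\<^sub>M M)"
      by measurable
    note this[THEN measurable_compose[OF measurable_pair_swap']]
    then have "(\<lambda>(\<omega>, r). ?fY i \<omega> r * indicator (?A i) r) \<in> borel_measurable (M \<Otimes>\<^sub>M lborel)"
      "(\<lambda>(\<omega>, r). ?fZ i \<omega> r * indicator (?A i) r) \<in> borel_measurable (M \<Otimes>\<^sub>M lborel)"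
      by (simp_all add: case_prod_beta')
    from this[THEN lborel.borel_measurable_nn_integral] show
     "(\<lambda>\<omega>. \<integral>\<^sup>+r\<in>?A i. ?fY i \<omega> r \<partial>lborel) \<in> borel_measurable M" "(\<lambda>\<omega>. \<integral>\<^sup>+r\<in>?A i. ?fZ i \<omega> r \<partial>lborel) \<in> borel_measurable M"
      by simp_all
  qed
  have inner: "(\<integral>\<^sup>+t\<in>{0..T}. ennreal (\<bar>Y t \<omega> - ys (grid_index N \<tau> t) \<omega>\<bar>\<^sup>2 + (norm (Z t \<omega> - zs (grid_index N \<tau> t) \<omega>))\<^sup>2) \<partial>lborel)
     \<le> (\<Sum>i<N. (\<integral>\<^sup>+r\<in>?A i. ?fY i \<omega> r \<partial>lborel) + (\<integral>\<^sup>+r\<in>?A i. ?fZ i \<omega> r \<partial>lborel))" if \<omega>: "\<omega> \<in> space M" for \<omega>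
  proof -
    have "(\<integral>\<^sup>+t\<in>{0..T}. ennreal (\<bar>Y t \<omega> - ys (grid_index N \<tau> t) \<omega>\<bar>\<^sup>2 + (norm (Z t \<omega> - zs (grid_index N \<tau> t) \<omega>))\<^sup>2) \<partial>lborel)
      \<le> (\<integral>\<^sup>+t. (\<Sum>i<N. ?fY i \<omega> t * indicator (?A i) t + ?fZ i \<omega> t * indicator (?A i) t) \<partial>lborel)"
    proof (rule nn_integral_mono_AE)
      show "AE t in lborel. ennreal (\<bar>Y t \<omega> - ys (grid_index N \<tau> t) \<omega>\<bar>\<^sup>2 + (norm (Z t \<omega> - zs (grid_index N \<tau> t) \<omega>))\<^sup>2) * indicator {0..T} t
        \<le> (\<Sum>i<N. ?fY i \<omega> t * indicator (?A i) t + ?fZ i \<omega> t * indicator (?A i) t)"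
        using ae
      proof eventually_elim
        case (elim t)
        show ?case
        proof (cases "t \<in> {0..T}")
          case True
          have "t \<noteq> T" using elim grid_N by auto
          then obtain i where i: "i < N" "\<tau> i \<le> t" "t < \<tau> (Suc i)" using grid_interval[OF grid, of t] True by auto
          have "\<tau> i \<noteq> t" using elim i(1) by auto
          then have ti: "t \<in> ?A i" using i by simp
          have "ennreal (\<bar>Y t \<omega> - ys (grid_index N \<tau> t) \<omega>\<bar>\<^sup>2 + (norm (Z t \<omega> - zs (grid_index N \<tau> t) \<omega>))\<^sup>2) * indicator {0..T} t
            = ?fY i \<omega> t * indicator (?A i) t + ?fZ i \<omega> t * indicator (?A i) t"
            unfolding grid_index_eq[OF grid i] using ti True by (simp add: Yc_eq Zc_eq ennreal_plus)
          also have "\<dots> \<le> (\<Sum>i<N. ?fY i \<omega> t * indicator (?A i) t + ?fZ i \<omega> t * indicator (?A i) t)"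
            using i(1) by (intro member_le_sum) auto
          finally show ?thesis .
        qed simp
      qed
    qed
    also have "\<dots> = (\<Sum>i<N. (\<integral>\<^sup>+r\<in>?A i. ?fY i \<omega> r \<partial>lborel) + (\<integral>\<^sup>+r\<in>?A i. ?fZ i \<omega> r \<partial>lborel))"
      using m[OF \<omega>] by (subst nn_integral_sum) (auto intro!: sum.cong nn_integral_add)
    finally show ?thesis .
  qed
  have "(\<integral>\<^sup>+\<omega>. (\<integral>\<^sup>+t\<in>{0..T}. ennreal (\<bar>Y t \<omega> - ys (grid_index N \<tau> t) \<omega>\<bar>\<^sup>2 + (norm (Z t \<omega> - zs (grid_index N \<tau> t) \<omega>))\<^sup>2) \<partial>lborel) \<partial>M)
    \<le> (\<integral>\<^sup>+\<omega>. (\<Sum>i<N. (\<integral>\<^sup>+r\<in>?A i. ?fY i \<omega> r \<partial>lborel) + (\<integral>\<^sup>+r\<in>?A i. ?fZ i \<omega> r \<partial>lborel)) \<partial>M)"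
    by (rule nn_integral_mono) (rule inner)
  also have "\<dots> = (\<Sum>i<N. (\<integral>\<^sup>+\<omega>. (\<integral>\<^sup>+r\<in>?A i. ?fY i \<omega> r \<partial>lborel) \<partial>M) + (\<integral>\<^sup>+\<omega>. (\<integral>\<^sup>+r\<in>?A i. ?fZ i \<omega> r \<partial>lborel) \<partial>M))"
    using mm by (subst nn_integral_sum) (auto intro!: sum.cong nn_integral_add)
  also have "\<dots> \<le> (\<Sum>i<N. ennreal (near i * step i) + ennreal (zint i))"
  proof (intro sum_mono add_mono)
    fix i assume "i \<in> {..<N}"
    then have i: "i < N" by simp
    have "(\<integral>\<^sup>+\<omega>. (\<integral>\<^sup>+r\<in>?A i. ?fY i \<omega> r \<partial>lborel) \<partial>M) = (\<integral>\<^sup>+r\<in>?A i. msq (\<lambda>\<omega>. Yc r \<omega> - ys i \<omega>) \<partial>lborel)"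
      by (rule Fubini_msq[OF jy[OF i]]) simp
    also have "\<dots> \<le> (\<integral>\<^sup>+r\<in>?A i. ennreal (near i) \<partial>lborel)"
    proof (rule nn_integral_mono)
      fix r
      show "msq (\<lambda>\<omega>. Yc r \<omega> - ys i \<omega>) * indicator (?A i) r \<le> ennreal (near i) * indicator (?A i) r"
      proof (cases "r \<in> ?A i")
        case True
        have "msq (\<lambda>\<omega>. Yc r \<omega> - ys i \<omega>) \<le> msq (\<lambda>\<omega>. Xc r \<omega> - xs i \<omega>) + msq (\<lambda>\<omega>. Yc r \<omega> - ys i \<omega>)" by simp
        also have "\<dots> \<le> ennreal (near i)" using True by (intro near_bound[OF i]) simp
        finally show ?thesis using True by simp
      qed simp
    qed
    also have "\<dots> = ennreal (near i * step i)"
      using near_nonneg[OF i] grid_less[OF i] unfolding step_def by (simp add: nn_integral_cmult ennreal_mult)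
    finally show "(\<integral>\<^sup>+\<omega>. (\<integral>\<^sup>+r\<in>?A i. ?fY i \<omega> r \<partial>lborel) \<partial>M) \<le> ennreal (near i * step i)" .
    have "(\<integral>\<^sup>+\<omega>. (\<integral>\<^sup>+r\<in>?A i. ?fZ i \<omega> r \<partial>lborel) \<partial>M) = (\<integral>\<^sup>+r\<in>?A i. msq (\<lambda>\<omega>. Zc r \<omega> - zs i \<omega>) \<partial>lborel)"
      by (rule Fubini_msq[OF joint_Z_dev[OF i]]) simp
    then show "(\<integral>\<^sup>+\<omega>. (\<integral>\<^sup>+r\<in>?A i. ?fZ i \<omega> r \<partial>lborel) \<partial>M) \<le> ennreal (zint i)" unfolding zint_eq[OF i] by simp
  qed
  also have "\<dots> = (\<Sum>i<N. ennreal (near i * step i + zint i))"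
    using ns zint_nonneg by (intro sum.cong refl ennreal_plus[symmetric]) auto
  also have "\<dots> = ennreal (\<Sum>i<N. near i * step i + zint i)"
    using ns zint_nonneg by (intro sum_ennreal add_nonneg_nonneg) auto
  also have "\<dots> \<le> ennreal ((KS + 32 * L^4 * (T + KS + KB)) * rate)"
    using sum_near_le sum_zint_le unfolding sum.distrib distrib_right by (intro ennreal_leI add_mono)
  finally show ?thesis .
qed

lemma total_error:
  "(SUP t\<in>{0..T}. \<integral>\<^sup>+\<omega>. ennreal ((norm (X t \<omega> - xs (grid_index N \<tau> t) \<omega>))\<^sup>2) \<partial>M)
     + (MAX i\<in>{..N}. \<integral>\<^sup>+\<omega>. ennreal (\<bar>Y (\<tau> i) \<omega> - ys i \<omega>\<bar>\<^sup>2) \<partial>M)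
     + (\<integral>\<^sup>+\<omega>. (\<integral>\<^sup>+t\<in>{0..T}. ennreal (\<bar>Y t \<omega> - ys (grid_index N \<tau> t) \<omega>\<bar>\<^sup>2 + (norm (Z t \<omega> - zs (grid_index N \<tau> t) \<omega>))\<^sup>2) \<partial>lborel) \<partial>M)
   \<le> ennreal (KK * rate)"
proof -
  have "(SUP t\<in>{0..T}. msq (\<lambda>\<omega>. X t \<omega> - xs (grid_index N \<tau> t) \<omega>)) \<le> ennreal ((20 * L\<^sup>2 + 2 * KE) * rate)"
    by (intro SUP_least sup_error)
  moreover have "(MAX i\<in>{..N}. \<integral>\<^sup>+\<omega>. ennreal (\<bar>Y (\<tau> i) \<omega> - ys i \<omega>\<bar>\<^sup>2) \<partial>M) \<le> ennreal (KE * rate)"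
    using max_error by (subst Max_le_iff) auto
  ultimately have "(SUP t\<in>{0..T}. msq (\<lambda>\<omega>. X t \<omega> - xs (grid_index N \<tau> t) \<omega>))
     + (MAX i\<in>{..N}. \<integral>\<^sup>+\<omega>. ennreal (\<bar>Y (\<tau> i) \<omega> - ys i \<omega>\<bar>\<^sup>2) \<partial>M)
     + (\<integral>\<^sup>+\<omega>. (\<integral>\<^sup>+t\<in>{0..T}. ennreal (\<bar>Y t \<omega> - ys (grid_index N \<tau> t) \<omega>\<bar>\<^sup>2 + (norm (Z t \<omega> - zs (grid_index N \<tau> t) \<omega>))\<^sup>2) \<partial>lborel) \<partial>M)
     \<le> ennreal ((20 * L\<^sup>2 + 2 * KE) * rate) + ennreal (KE * rate) + ennreal ((KS + 32 * L^4 * (T + KS + KB)) * rate)"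
    by (intro add_mono int_error)
  also have "\<dots> = ennreal (KK * rate)"
    unfolding KK_def using rate_ge(1) KE_nonneg KS_nonneg KB_nonneg T
    by (subst ennreal_plus[symmetric] | simp add: algebra_simps)+
  finally show ?thesis .
qed

end

end

section \<open>The claim from the general estimates\<close>

lemma lipschitz_mono:
  assumes "K \<le> L"
  shows "lipschitz_tx T K f \<Longrightarrow> lipschitz_tx T L f"
    and "lipschitz_txy T K f' \<Longrightarrow> lipschitz_txy T L f'"
    and "lipschitz_txyz T K f'' \<Longrightarrow> lipschitz_txyz T L f''"
  unfolding lipschitz_tx_def lipschitz_txy_def lipschitz_txyz_def using assms
  by (blast intro: order_trans[OF _ mult_right_mono] add_nonneg_nonneg norm_ge_zero abs_ge_zero real_sqrt_ge_zero)+

lemma fbsde_of_constants: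
  fixes W :: "real \<Rightarrow> 'a \<Rightarrow> real ^ 'd"
  assumes "T > 0" and "prob_space M" and "brownian_motion M W"
    and "lipschitz_txyz T H\<^sub>b b" and "lipschitz_txyz T H\<^sub>F F" and "lipschitz_txy T H\<^sub>\<sigma> \<sigma>"
    and "lipschitz_txy T H\<^sub>\<sigma>\<^sub>\<sigma> (\<lambda>t x y. \<sigma> t x y ** transpose (\<sigma> t x y))"
    and "\<forall>x x'. \<bar>g x - g x'\<bar> \<le> H\<^sub>g * norm (x - x')"
    and "\<forall>t\<in>{0..T}. \<forall>x y z. norm (b t x y z) \<le> K\<^sub>b"
    and "\<forall>t\<in>{0..T}. \<forall>x y. norm (\<sigma> t x y) \<le> K\<^sub>\<sigma>"
    and "\<forall>t\<in>{0..T}. \<forall>x y. norm (\<sigma> t x y ** transpose (\<sigma> t x y)) \<le> K\<^sub>\<sigma>\<^sub>\<sigma>"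
    and "classical_pde_solution T b \<sigma> F g u ut ux uxx"
    and "\<forall>t\<in>{0..T}. \<forall>x. norm (ux t x) \<le> K\<^sub>u\<^sub>x"
    and "\<forall>t\<in>{0..T}. \<forall>x. norm (uxx t x) \<le> K\<^sub>u\<^sub>x\<^sub>x"
    and "lipschitz_tx T H\<^sub>u u" and "lipschitz_tx T H\<^sub>u\<^sub>x ux"
    and "0 < \<alpha>" and "\<alpha> \<le> 1"
    and "\<forall>t\<in>{0..T}. \<forall>t'\<in>{0..T}. \<forall>x x'.
           norm (uxx t x - uxx t' x') \<le> H\<^sub>u\<^sub>x\<^sub>x * (\<bar>t - t'\<bar> powr (\<alpha> / 2) + norm (x - x') powr \<alpha>)"
    and "fbsde_solution M W T x0 b \<sigma> F g X Y Z"
  shows "\<exists>L. fbsde M W T L \<alpha> b \<sigma> F g u ut ux uxx x0 X Y Z"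
proof -
  define S where "S = {1, H\<^sub>b, H\<^sub>F, H\<^sub>\<sigma>, H\<^sub>\<sigma>\<^sub>\<sigma>, H\<^sub>g, K\<^sub>b, K\<^sub>\<sigma>, K\<^sub>\<sigma>\<^sub>\<sigma>, K\<^sub>u\<^sub>x, K\<^sub>u\<^sub>x\<^sub>x, H\<^sub>u, H\<^sub>u\<^sub>x, H\<^sub>u\<^sub>x\<^sub>x}"
  define L where "L = Max S"
  have S: "x \<le> L" if "x \<in> S" for x unfolding L_def using that by (intro Max_ge) (simp_all add: S_def)
  have c: "1 \<le> L" "H\<^sub>b \<le> L" "H\<^sub>F \<le> L" "H\<^sub>\<sigma> \<le> L" "H\<^sub>\<sigma>\<^sub>\<sigma> \<le> L" "H\<^sub>g \<le> L" "K\<^sub>b \<le> L" "K\<^sub>\<sigma> \<le> L" "K\<^sub>\<sigma>\<^sub>\<sigma> \<le> L"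
     "K\<^sub>u\<^sub>x \<le> L" "K\<^sub>u\<^sub>x\<^sub>x \<le> L" "H\<^sub>u \<le> L" "H\<^sub>u\<^sub>x \<le> L" "H\<^sub>u\<^sub>x\<^sub>x \<le> L"
    by (rule S, simp add: S_def)+
  have "fbsde M W T L \<alpha> b \<sigma> F g u ut ux uxx x0 X Y Z"
  proof (intro fbsde.intro brownian.intro brownian_axioms.intro pde_data.intro fbsde_axioms.intro assms
      lipschitz_mono(1)[OF c(12) assms(15)] lipschitz_mono(1)[OF c(13) assms(16)] lipschitz_mono(2)[OF c(4) assms(6)]
      lipschitz_mono(2)[OF c(5) assms(7)] lipschitz_mono(3)[OF c(2) assms(4)] lipschitz_mono(3)[OF c(3) assms(5)] c(1))
    show "\<bar>g x - g x'\<bar> \<le> L * norm (x - x')" for x x'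
      by (rule order_trans[OF assms(8)[rule_format] mult_right_mono[OF c(6)]]) simp
    show "norm (uxx t x - uxx t' x') \<le> L * (\<bar>t - t'\<bar> powr (\<alpha> / 2) + norm (x - x') powr \<alpha>)" if "t \<in> {0..T}" "t' \<in> {0..T}" for t t' x x'
      by (rule order_trans[OF assms(19)[rule_format, OF that] mult_right_mono[OF c(14)]]) simp
    show "norm (b t x y z) \<le> L" if "t \<in> {0..T}" for t x y z using assms(9)[rule_format, OF that, of x y z] c by linarith
    show "norm (\<sigma> t x y) \<le> L" if "t \<in> {0..T}" for t x y using assms(10)[rule_format, OF that, of x y] c by linarith
    show "norm (\<sigma> t x y ** transpose (\<sigma> t x y)) \<le> L" if "t \<in> {0..T}" for t x y using assms(11)[rule_format, OF that, of x y] c by linarith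
    show "norm (ux t x) \<le> L" if "t \<in> {0..T}" for t x using assms(13)[rule_format, OF that, of x] c by linarith
    show "norm (uxx t x) \<le> L" if "t \<in> {0..T}" for t x using assms(14)[rule_format, OF that, of x] c by linarith
  qed
  then show ?thesis ..
qed

text \<open>A Lipschitz function of the adapted \<open>xs i\<close> is adapted, and a bounded one is
  square integrable; this is the conditional form in which \<open>euler_scheme\<close> asks for the
  control.\<close>

lemma (in fbsde) fbsde_scheme_rho:
  assumes \<rho>: "\<rho> \<in> bounded_lipschitz_class T K H" and H: "0 \<le> H" and \<tau>: "time_grid T N \<tau>"
    and m1: "\<And>i. i < N \<Longrightarrow> \<tau> (Suc i) - \<tau> i \<le> 1"
  shows "fbsde_scheme M W T L \<alpha> b \<sigma> F g u ut ux uxx x0 X Y Z N \<tau>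
    (scheme_X W x0 b \<sigma> F y0 \<rho> \<tau>) (scheme_Y W x0 b \<sigma> F y0 \<rho> \<tau>) (scheme_Z W x0 b \<sigma> F y0 \<rho> \<tau>)"
proof unfold_locales
  let ?x = "scheme_X W x0 b \<sigma> F y0 \<rho> \<tau>" and ?y = "scheme_Y W x0 b \<sigma> F y0 \<rho> \<tau>" and ?z = "scheme_Z W x0 b \<sigma> F y0 \<rho> \<tau>"
  have \<rho>': "norm (\<rho> t x) \<le> K" if "t \<in> {0..T}" for t x using \<rho> that unfolding bounded_lipschitz_class_def by blast
  have lip: "lipschitz_tx T H \<rho>" using \<rho> unfolding bounded_lipschitz_class_def by blast
  show m: "?z i \<in> borel_measurable (\<F> (\<tau> i))" if i: "i < N" and x: "?x i \<in> borel_measurable (\<F> (\<tau> i))" for i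
    using measurable_of_lipschitz_tx[OF lip T0 H measurable_const x, of "\<tau> i"] clip_eq[OF time_grid_mem[OF \<tau>, of i]] i
    by (simp add: scheme_Z_def[abs_def])
  show "sq_integrable M (?z i)" if i: "i < N" and x: "?x i \<in> borel_measurable (\<F> (\<tau> i))" for i
    by (rule sq_integrable_bounded[of _ K])
      (use m[OF i x] \<rho>' time_grid_mem[OF \<tau>, of i] i in \<open>auto simp: scheme_Z_def intro: measurable_filtration\<close>)
qed (use \<tau> m1 in \<open>simp_all add: scheme_X_def[abs_def] scheme_Y_def[abs_def] scheme_Z_def[abs_def] Let_def\<close>)

lemma grid_pos:
  assumes "time_grid T N \<tau>" "0 < T" shows "0 < N"
  using assms by (cases N) (auto simp: time_grid_def)

lemma step_le_mesh: "i < N \<Longrightarrow> \<tau> (Suc i) - \<tau> i \<le> mesh N \<tau>"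
  unfolding mesh_def by (intro Max_ge) auto

lemma (in fbsde) scheme_error_le:
  assumes \<rho>: "\<rho> \<in> bounded_lipschitz_class T K H" and H: "0 \<le> H" and \<tau>: "time_grid T N \<tau>"
    and h: "mesh N \<tau> \<le> 1" "kB * mesh N \<tau> \<le> 1 / 2"
  shows "scheme_error W x0 b \<sigma> F y0 \<rho> \<tau> M T X Y Z N \<le> ennreal KK *
    ((\<integral>\<^sup>+\<omega>. ennreal (\<bar>scheme_Y W x0 b \<sigma> F y0 \<rho> \<tau> N \<omega> - g (scheme_X W x0 b \<sigma> F y0 \<rho> \<tau> N \<omega>)\<bar>\<^sup>2) \<partial>M)
      + ennreal (mesh N \<tau> + mesh N \<tau> powr \<alpha>))"
proof -
  let ?x = "scheme_X W x0 b \<sigma> F y0 \<rho> \<tau>" and ?y = "scheme_Y W x0 b \<sigma> F y0 \<rho> \<tau>"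
  interpret S: fbsde_scheme M W T L \<alpha> b \<sigma> F g u ut ux uxx x0 X Y Z N \<tau> ?x ?y "scheme_Z W x0 b \<sigma> F y0 \<rho> \<tau>"
    using step_le_mesh[of _ N \<tau>] h(1) by (intro fbsde_scheme_rho[OF \<rho> H \<tau>]) (rule order_trans)
  have st: "S.step i \<le> mesh N \<tau>" if "i < N" for i using step_le_mesh[OF that] unfolding S.step_def .
  have N: "0 < N" by (rule grid_pos[OF \<tau> T])
  have h0: "0 \<le> mesh N \<tau>" using st[OF N] S.step_pos[OF N] by simp
  have x: "?x 0 = (\<lambda>_. x0)" by (simp add: scheme_X_def[abs_def])
  have "S.Dev N = (\<lambda>\<omega>. ?y N \<omega> - g (?x N \<omega>))" unfolding S.Dev_def[abs_def] S.grid_N uT_eq ..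
  then have c: "(\<integral>\<^sup>+\<omega>. ennreal (\<bar>?y N \<omega> - g (?x N \<omega>)\<bar>\<^sup>2) \<partial>M) = ennreal S.cost"
    using nn_integral_sq_integrable[OF S.Dev_sq[OF order_refl]] unfolding S.cost_def by simp
  have "scheme_error W x0 b \<sigma> F y0 \<rho> \<tau> M T X Y Z N \<le> ennreal (KK * S.rate (mesh N \<tau>))"
    unfolding scheme_error_def by (rule S.total_error[OF st h h0 x])
  also have "S.rate (mesh N \<tau>) = S.cost + (mesh N \<tau> + mesh N \<tau> powr \<alpha>)" using S.rate_def[OF st h h0 x] by simp
  also have "ennreal (KK * (S.cost + (mesh N \<tau> + mesh N \<tau> powr \<alpha>))) = ennreal KK * (ennreal S.cost + ennreal (mesh N \<tau> + mesh N \<tau> powr \<alpha>))"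
    using S.cost_nonneg h0 KK_nonneg by (simp add: ennreal_mult ennreal_plus[symmetric] del: ennreal_plus)
  finally show ?thesis unfolding c .
qed

theorem theorem3p1:
  fixes M :: "'a measure"
    and W :: "real \<Rightarrow> 'a \<Rightarrow> real ^ 'd"
    and T :: real
    and x0 :: "real ^ 'd"
    and b :: "real \<Rightarrow> real ^ 'd \<Rightarrow> real \<Rightarrow> real ^ 'd \<Rightarrow> real ^ 'd"
    and \<sigma> :: "real \<Rightarrow> real ^ 'd \<Rightarrow> real \<Rightarrow> real ^ 'd ^ 'd"
    and F :: "real \<Rightarrow> real ^ 'd \<Rightarrow> real \<Rightarrow> real ^ 'd \<Rightarrow> real"
    and g :: "real ^ 'd \<Rightarrow> real"
    and u ut :: "real \<Rightarrow> real ^ 'd \<Rightarrow> real"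
    and ux :: "real \<Rightarrow> real ^ 'd \<Rightarrow> real ^ 'd"
    and uxx :: "real \<Rightarrow> real ^ 'd \<Rightarrow> real ^ 'd ^ 'd"
    and X :: "real \<Rightarrow> 'a \<Rightarrow> real ^ 'd"
    and Y :: "real \<Rightarrow> 'a \<Rightarrow> real"
    and Z :: "real \<Rightarrow> 'a \<Rightarrow> real ^ 'd"
    and H\<^sub>b H\<^sub>\<sigma> H\<^sub>\<sigma>\<^sub>i\<^sub>n\<^sub>v H\<^sub>\<sigma>\<^sub>\<sigma> H\<^sub>F H\<^sub>g K\<^sub>b K\<^sub>\<sigma> K\<^sub>\<sigma>\<^sub>i\<^sub>n\<^sub>v K\<^sub>\<sigma>\<^sub>\<sigma> :: real
    and K\<^sub>u\<^sub>x K\<^sub>u\<^sub>x\<^sub>x H\<^sub>u H\<^sub>u\<^sub>x H\<^sub>u\<^sub>x\<^sub>x \<alpha> K\<^sub>\<rho> H\<^sub>\<rho> :: real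
  assumes "T > 0"
    and "prob_space M" and "complete_measure M" and "brownian_motion M W"
    \<comment> \<open>coefficients\<close>
    and "\<forall>t\<in>{0..T}. \<forall>x y. invertible (\<sigma> t x y)"
    and "H\<^sub>b > 0" and "lipschitz_txyz T H\<^sub>b b"
    and "H\<^sub>F > 0" and "lipschitz_txyz T H\<^sub>F F"
    and "H\<^sub>\<sigma> > 0" and "lipschitz_txy T H\<^sub>\<sigma> \<sigma>"
    and "H\<^sub>\<sigma>\<^sub>i\<^sub>n\<^sub>v > 0" and "lipschitz_txy T H\<^sub>\<sigma>\<^sub>i\<^sub>n\<^sub>v (\<lambda>t x y. matrix_inv (\<sigma> t x y))"
    and "H\<^sub>\<sigma>\<^sub>\<sigma> > 0" and "lipschitz_txy T H\<^sub>\<sigma>\<^sub>\<sigma> (\<lambda>t x y. \<sigma> t x y ** transpose (\<sigma> t x y))"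
    and "H\<^sub>g > 0" and "\<forall>x x'. \<bar>g x - g x'\<bar> \<le> H\<^sub>g * norm (x - x')"
    and "K\<^sub>b > 0" and "\<forall>t\<in>{0..T}. \<forall>x y z. norm (b t x y z) \<le> K\<^sub>b"
    and "K\<^sub>\<sigma> > 0" and "\<forall>t\<in>{0..T}. \<forall>x y. norm (\<sigma> t x y) \<le> K\<^sub>\<sigma>"
    and "K\<^sub>\<sigma>\<^sub>i\<^sub>n\<^sub>v > 0" and "\<forall>t\<in>{0..T}. \<forall>x y. norm (matrix_inv (\<sigma> t x y)) \<le> K\<^sub>\<sigma>\<^sub>i\<^sub>n\<^sub>v"
    and "K\<^sub>\<sigma>\<^sub>\<sigma> > 0" and "\<forall>t\<in>{0..T}. \<forall>x y. norm (\<sigma> t x y ** transpose (\<sigma> t x y)) \<le> K\<^sub>\<sigma>\<^sub>\<sigma>"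
    \<comment> \<open>PDE\<close>
    and "classical_pde_solution T b \<sigma> F g u ut ux uxx"
    and "K\<^sub>u\<^sub>x > 0" and "\<forall>t\<in>{0..T}. \<forall>x. norm (ux t x) \<le> K\<^sub>u\<^sub>x"
    and "K\<^sub>u\<^sub>x\<^sub>x > 0" and "\<forall>t\<in>{0..T}. \<forall>x. norm (uxx t x) \<le> K\<^sub>u\<^sub>x\<^sub>x"
    and "H\<^sub>u > 0" and "lipschitz_tx T H\<^sub>u u"
    and "H\<^sub>u\<^sub>x > 0" and "lipschitz_tx T H\<^sub>u\<^sub>x ux"
    and "0 < \<alpha>" and "\<alpha> \<le> 1"
    and "H\<^sub>u\<^sub>x\<^sub>x > 0"
    and "\<forall>t\<in>{0..T}. \<forall>t'\<in>{0..T}. \<forall>x x'.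
           norm (uxx t x - uxx t' x')
             \<le> H\<^sub>u\<^sub>x\<^sub>x * (\<bar>t - t'\<bar> powr (\<alpha> / 2) + norm (x - x') powr \<alpha>)"
    \<comment> \<open>FBSDE\<close>
    and "fbsde_solution M W T x0 b \<sigma> F g X Y Z"
    and "K\<^sub>\<rho> > 0" and "H\<^sub>\<rho> > 0"
  shows "\<exists>C\<ge>1. \<forall>\<rho>\<in>bounded_lipschitz_class T K\<^sub>\<rho> H\<^sub>\<rho>. \<forall>y0 N \<tau>.
    time_grid T N \<tau> \<and> mesh N \<tau> \<le> 1 / (C * (1 + K\<^sub>\<rho> ^ 4)) \<longrightarrow>
    scheme_error W x0 b \<sigma> F y0 \<rho> \<tau> M T X Y Z N
      \<le> ennreal C *
         (ennreal (exp (C * K\<^sub>\<rho> ^ 4)) *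
            (\<integral>\<^sup>+\<omega>. ennreal (\<bar>scheme_Y W x0 b \<sigma> F y0 \<rho> \<tau> N \<omega>
                 - g (scheme_X W x0 b \<sigma> F y0 \<rho> \<tau> N \<omega>)\<bar>\<^sup>2) \<partial>M)
          + ennreal (exp (C * (K\<^sub>\<rho>\<^sup>2 + H\<^sub>\<rho>\<^sup>2)) * (mesh N \<tau> + mesh N \<tau> powr \<alpha>)))"
proof -
  obtain L where "fbsde M W T L \<alpha> b \<sigma> F g u ut ux uxx x0 X Y Z"
    using fbsde_of_constants[OF assms(1,2,4,7,9,11,15,17,19,21,25,26,28,30,32,34,35,36,38,39)] ..
  then interpret fbsde M W T L \<alpha> b \<sigma> F g u ut ux uxx x0 X Y Z .
  \<comment> \<open>\<open>2 * kB\<close> turns \<open>mesh N \<tau> \<le> 1 / C\<close> into the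
    condition \<open>kB * mesh N \<tau> \<le> 1 / 2\<close> of the backward estimate, 1 keeps the
    mesh below 1, and \<open>KK\<close> is the factor of the error bound.\<close>
  define C where "C = max 1 (max KK (2 * kB))"
  have C: "1 \<le> C" "KK \<le> C" "2 * kB \<le> C" unfolding C_def by auto
  show ?thesis
  proof (intro exI[of _ C] conjI ballI allI impI C(1))
    fix \<rho> :: "real \<Rightarrow> real ^ 'd \<Rightarrow> real ^ 'd" and y0 N \<tau>
    assume \<rho>: "\<rho> \<in> bounded_lipschitz_class T K\<^sub>\<rho> H\<^sub>\<rho>" and "time_grid T N \<tau> \<and> mesh N \<tau> \<le> 1 / (C * (1 + K\<^sub>\<rho> ^ 4))"
    then have \<tau>: "time_grid T N \<tau>" and "mesh N \<tau> \<le> 1 / (C * (1 + K\<^sub>\<rho> ^ 4))" by auto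
    note this(2)
    also have "1 / (C * (1 + K\<^sub>\<rho> ^ 4)) \<le> 1 / (C * 1)"
      using C(1) by (intro divide_left_mono mult_left_mono mult_pos_pos add_pos_nonneg) auto
    finally have h: "mesh N \<tau> \<le> 1 / C" by simp
    have h1: "mesh N \<tau> \<le> 1" using h C(1) by (simp add: order_trans[OF h])
    have "kB * mesh N \<tau> \<le> C / 2 * (1 / C)" using h C(1,3) kB_nonneg
      by (intro order_trans[OF mult_left_mono[OF h] mult_right_mono]) auto
    then have h2: "kB * mesh N \<tau> \<le> 1 / 2" using C(1) by simp
    have h0: "0 \<le> mesh N \<tau>"
      using step_le_mesh[of 0 N \<tau>] grid_pos[OF \<tau> T] \<tau> unfolding time_grid_def by fastforce
    let ?J = "\<integral>\<^sup>+\<omega>. ennreal (\<bar>scheme_Y W x0 b \<sigma> F y0 \<rho> \<tau> N \<omega> - g (scheme_X W x0 b \<sigma> F y0 \<rho> \<tau> N \<omega>)\<bar>\<^sup>2) \<partial>M"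
    have "scheme_error W x0 b \<sigma> F y0 \<rho> \<tau> M T X Y Z N \<le> ennreal KK * (?J + ennreal (mesh N \<tau> + mesh N \<tau> powr \<alpha>))"
      by (rule scheme_error_le[OF \<rho> less_imp_le[OF assms(41)] \<tau> h1 h2])
    \<comment> \<open>Both exponents are nonnegative, so inserting the exponential factors only
      enlarges the bound.\<close>
    also have "\<dots> \<le> ennreal C * (ennreal (exp (C * K\<^sub>\<rho> ^ 4)) * ?J + ennreal (exp (C * (K\<^sub>\<rho>\<^sup>2 + H\<^sub>\<rho>\<^sup>2)) * (mesh N \<tau> + mesh N \<tau> powr \<alpha>)))"
    proof (intro mult_mono add_mono ennreal_leI C(2))
      have "1 * ?J \<le> ennreal (exp (C * K\<^sub>\<rho> ^ 4)) * ?J" using C(1) by (intro mult_right_mono) auto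
      then show "?J \<le> ennreal (exp (C * K\<^sub>\<rho> ^ 4)) * ?J" by simp
      have "1 * (mesh N \<tau> + mesh N \<tau> powr \<alpha>) \<le> exp (C * (K\<^sub>\<rho>\<^sup>2 + H\<^sub>\<rho>\<^sup>2)) * (mesh N \<tau> + mesh N \<tau> powr \<alpha>)"
        using C(1) h0 by (intro mult_right_mono) auto
      then show "mesh N \<tau> + mesh N \<tau> powr \<alpha> \<le> exp (C * (K\<^sub>\<rho>\<^sup>2 + H\<^sub>\<rho>\<^sup>2)) * (mesh N \<tau> + mesh N \<tau> powr \<alpha>)" by simp
    qed simp_all
    finally show "scheme_error W x0 b \<sigma> F y0 \<rho> \<tau> M T X Y Z N \<le> ennreal C * (ennreal (exp (C * K\<^sub>\<rho> ^ 4)) * ?J + ennreal (exp (C * (K\<^sub>\<rho>\<^sup>2 + H\<^sub>\<rho>\<^sup>2)) * (mesh N \<tau> + mesh N \<tau> powr \<alpha>)))" .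
  qed
qed

end
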